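(* Let $N\ge 5$ be an integer, $q>2$, $\lambda<\gamma_N^2$ where $\gamma_N=\frac{N(N-4)}{4}$, and put $\beta=N-q\,\frac{N-4}{2}$. Then the problem $$\Delta^2u=\lambda|x|^{-4}u+|x|^{-\beta}|u|^{q-2}u\ \text{ in }\mathbb{R}^N,\qquad u\in\mathcal D^{2,2}(\mathbb{R}^N),\quad u\neq 0,$$ has at least one radially symmetric (weak) solution $u$ that achieves the infimum $S_q^{\rm rad}(\lambda)$.
   Context: $\mathcal D^{2,2}(\mathbb{R}^N)$ ($N\ge5$) is the completion of $C^\infty_c(\mathbb{R}^N)$ with respect to the norm $\|u\|=\left(\int_{\mathbb{R}^N}|\Delta u|^2dx\right)^{1/2}$; it embeds continuously into $L^{2N/(N-4)}(\mathbb{R}^N)$ and, by the Rellich inequality (whose best constant is $\gamma_N^2$), into $L^2(\mathbb{R}^N;|x|^{-4}dx)$. Solutions are weak solutions, i.e. $\int\Delta u\,\Delta\varphi\,dx=\lambda\int|x|^{-4}u\varphi\,dx+\int|x|^{-\beta}|u|^{q-2}u\varphi\,dx$ for all $\varphi\in C_c^\infty(\mathbb{R}^N)$. Define $$S_q^{\rm rad}(\lambda)=\inf_{u\in\mathcal D^{2,2}(\mathbb{R}^N),\ u=u(|x|),\ u\neq0}\frac{\int_{\mathbb{R}^N}|\Delta u|^2dx-\lambda\int_{\mathbb{R}^N}|x|^{-4}|u|^2dx}{\left(\int_{\mathbb{R}^N}|x|^{-\beta}|u|^qdx\right)^{2/q}},$$ which is a positive number under the stated hypotheses. "Achieves" means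 that the infimum is attained at $u$. *)

theory Defs
  imports "HOL-Analysis.Analysis"
begin

section \<open>Smooth compactly supported functions and the classical Laplacian\<close>

text \<open>Since \<open>frechet_derivative f (at x) v\<close> is the directional derivative along \<open>v\<close>, \<open>C_k k f\<close> says
  that \<open>f\<close> is \<open>k\<close> times continuously differentiable.\<close>

primrec C_k :: "nat \<Rightarrow> ('a::euclidean_space \<Rightarrow> real) \<Rightarrow> bool" where
  "C_k 0 f \<longleftrightarrow> continuous_on UNIV f"
| "C_k (Suc k) f \<longleftrightarrow> (\<forall>x. f differentiable (at x)) \<and>
     (\<forall>v. C_k k (\<lambda>x. frechet_derivative f (at x) v))"

definition Cc_infty :: "('a::euclidean_space \<Rightarrow> real) set" where
  "Cc_infty = {\<phi>. (\<forall>k. C_k k \<phi>) \<and> compact (closure {x. \<phi> x \<noteq> 0})}"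

definition laplacian :: "('a::euclidean_space \<Rightarrow> real) \<Rightarrow> 'a \<Rightarrow> real" where
  "laplacian f x =
     (\<Sum>b\<in>Basis. frechet_derivative (\<lambda>y. frechet_derivative f (at y) b) (at x) b)"

section \<open>The space \<open>D\<^sup>2\<^sup>,\<^sup>2\<close>\<close>

text \<open>For \<open>N = DIM('a) \<ge> 5\<close> the completion of \<open>Cc_infty\<close> under \<open>\<phi> \<mapsto> \<parallel>laplacian \<phi>\<parallel>\<close> (norm of \<open>L\<^sup>2\<close>)
  is realised inside \<open>L\<close> with exponent \<open>2N/(N-4)\<close>, into which it embeds continuously: its elements are
  the limits \<open>u\<close> there of sequences \<open>\<phi>\<^sub>n\<close> for which \<open>laplacian \<phi>\<^sub>n\<close> is Cauchy, i.e. convergent, in \<open>L\<^sup>2\<close>.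
  \<open>D22_rel u w\<close> says that \<open>u\<close> is such a limit and that \<open>w\<close> is the corresponding limit of the
  Laplacians; \<open>w\<close> is then the distributional Laplacian of \<open>u\<close>, hence unique almost everywhere,
  and integrals of \<open>D22_lap u\<close> do not depend on the choice made by \<open>SOME\<close>.
  Finiteness of the norms of \<open>u\<close> and \<open>w\<close> is implied by the two limits.\<close>

definition D22_rel :: "('a::euclidean_space \<Rightarrow> real) \<Rightarrow> ('a \<Rightarrow> real) \<Rightarrow> bool" where
  "D22_rel u w \<longleftrightarrow>
     u \<in> borel_measurable lebesgue \<and> w \<in> borel_measurable lebesgue \<and>
     (\<exists>\<phi> :: nat \<Rightarrow> 'a \<Rightarrow> real. (\<forall>n. \<phi> n \<in> Cc_infty) \<and>
        (\<lambda>n. \<integral>\<^sup>+x. ennreal (\<bar>\<phi> n x - u x\<bar> powr (2 * real DIM('a) / (real DIM('a) - 4))) \<partial>lebesgue)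
          \<longlonglongrightarrow> 0 \<and>
        (\<lambda>n. \<integral>\<^sup>+x. ennreal ((laplacian (\<phi> n) x - w x)\<^sup>2) \<partial>lebesgue) \<longlonglongrightarrow> 0)"

definition D22 :: "('a::euclidean_space \<Rightarrow> real) set" where
  "D22 = {u. \<exists>w. D22_rel u w}"

definition D22_lap :: "('a::euclidean_space \<Rightarrow> real) \<Rightarrow> 'a \<Rightarrow> real" where
  "D22_lap u = (SOME w. D22_rel u w)"

text \<open>Elements of \<open>D22\<close> are functions rather than classes modulo null sets, so being nonzero in the
  space means not vanishing almost everywhere, whereas \<open>radial\<close> asks \<open>u\<close> to be a genuinely radial representative.\<close>

definition nonzero_ae :: "('a::euclidean_space \<Rightarrow> real) \<Rightarrow> bool" where
  "nonzero_ae u \<longleftrightarrow> \<not> (AE x in lebesgue. u x = 0)"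

definition radial :: "('a::euclidean_space \<Rightarrow> real) \<Rightarrow> bool" where
  "radial u \<longleftrightarrow> (\<exists>f :: real \<Rightarrow> real. \<forall>x. u x = f (norm x))"

section \<open>The minimisation problem and the equation\<close>

text \<open>For \<open>u\<close> nonzero and radial in \<open>D22\<close>, with \<open>\<beta> = N - q (N - 4) / 2\<close> and \<open>q > 2\<close>, all three integrals
  are finite (Rellich inequality and the radial bound \<open>\<bar>u x\<bar> \<le> C \<bar>x\<bar> powr (-(N - 4) / 2)\<close>) and the
  denominator is positive, so the totalised integral and division are never used on junk
  arguments in \<open>S_rad\<close>. If moreover \<open>lam < (N (N - 4) / 4)\<^sup>2\<close>, the quotients are positive, so the real-valued
  infimum is over a set that is bounded below.\<close>

definition rayleigh_quotient ::
  "real \<Rightarrow> real \<Rightarrow> real \<Rightarrow> ('a::euclidean_space \<Rightarrow> real) \<Rightarrow> real" where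
  "rayleigh_quotient q \<beta> lam u =
     ((\<integral>x. (D22_lap u x)\<^sup>2 \<partial>lebesgue) - lam * (\<integral>x. norm x powr (-4) * \<bar>u x\<bar>\<^sup>2 \<partial>lebesgue)) /
     (\<integral>x. norm x powr (-\<beta>) * \<bar>u x\<bar> powr q \<partial>lebesgue) powr (2 / q)"

definition S_rad :: "'a::euclidean_space itself \<Rightarrow> real \<Rightarrow> real \<Rightarrow> real \<Rightarrow> real" where
  "S_rad (T :: 'a itself) q \<beta> lam =
     (INF u \<in> {u :: 'a \<Rightarrow> real. u \<in> D22 \<and> radial u \<and> nonzero_ae u}. rayleigh_quotient q \<beta> lam u)"

text \<open>Integrability is required explicitly, since the integral of a non-integrable function is \<open>0\<close>
  by convention.\<close>

definition weak_solution ::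
  "real \<Rightarrow> real \<Rightarrow> real \<Rightarrow> ('a::euclidean_space \<Rightarrow> real) \<Rightarrow> bool" where
  "weak_solution q \<beta> lam u \<longleftrightarrow> (\<forall>\<phi> \<in> Cc_infty.
     integrable lebesgue (\<lambda>x. D22_lap u x * laplacian \<phi> x) \<and>
     integrable lebesgue (\<lambda>x. norm x powr (-4) * u x * \<phi> x) \<and>
     integrable lebesgue (\<lambda>x. norm x powr (-\<beta>) * \<bar>u x\<bar> powr (q - 2) * u x * \<phi> x) \<and>
     (\<integral>x. D22_lap u x * laplacian \<phi> x \<partial>lebesgue) =
       lam * (\<integral>x. norm x powr (-4) * u x * \<phi> x \<partial>lebesgue) +
       (\<integral>x. norm x powr (-\<beta>) * \<bar>u x\<bar> powr (q - 2) * u x * \<phi> x \<partial>lebesgue))"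

end

theory Submission
  imports Defs "HOL-Complex_Analysis.Great_Picard" "HOL-Real_Asymp.Real_Asymp"
begin

text \<open>
  Write \<open>N = DIM('a)\<close>, \<open>a = (N - 4) / 2\<close>, \<open>t = - ln \<bar>x\<bar>\<close> and \<open>u x = \<bar>x\<bar> powr (- a) * v t\<close>. In these
  coordinates all the integrals of the problem become integrals over the line, up to the area of
  the unit sphere: the weight \<open>\<bar>x\<bar> powr (- \<beta>)\<close> turns into the constant weight in
  \<open>\<integral>\<bar>v\<bar> powr q\<close>, the Hardy term becomes \<open>\<integral>v\<^sup>2\<close>, and the equation becomes the translation invariant
  ordinary differential equation \<open>L v = \<bar>v\<bar> powr (q - 2) * v\<close> with
  \<open>L = D\<^sup>4 - (2 * gam + 4) * D\<^sup>2 + (gam\<^sup>2 - lam)\<close> and \<open>gam = a * (a + 2)\<close>, the constant whose square is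
  optimal in the Rellich inequality. Since \<open>lam < gam\<^sup>2\<close>, the operator factors as
  \<open>(D\<^sup>2 - p * D + s) * (D\<^sup>2 + p * D + s)\<close> with \<open>p, s > 0\<close>, a damped oscillator times its adjoint. Its
  inverse \<open>G\<close> is therefore the composition of two convolutions with explicit exponentially
  decaying kernels, and \<open>J h = \<integral>h * G h\<close> is the square of a norm.

  The minimiser is found by duality. With \<open>r = q / (q - 1)\<close> let \<open>M\<close> be the supremum of \<open>J\<close> over the
  unit ball of \<open>L\<close> with exponent \<open>r\<close> (\<open>maximizer_exists\<close>). For a maximising sequence \<open>h\<^sub>n\<close> the functions
  \<open>v\<^sub>n = G h\<^sub>n\<close> are uniformly bounded and uniformly Lipschitz, and after a translation
  \<open>\<bar>v\<^sub>n 0\<bar>\<close> stays away from \<open>0\<close>. One step of the power method, which replaces \<open>h\<^sub>n\<close> by the normalised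
  \<open>\<bar>v\<^sub>n\<bar> powr (q - 2) * v\<^sub>n\<close>, changes \<open>h\<^sub>n\<close> by a quantity that tends to \<open>0\<close> in the norm given by \<open>J\<close>. So
  pointwise convergence of a subsequence of \<open>v\<^sub>n\<close> is enough to pass to the limit in the equation,
  and a solution \<open>w \<noteq> 0\<close> results. No mass escapes to infinity: if the limit had mass \<open>n < 1\<close>, then
  the equation and the homogeneity of \<open>J\<close> would give \<open>M * n \<le> M * n powr (2 / r)\<close>, where \<open>2 / r > 1\<close>.

  The lower bound on \<open>D22\<close> comes from the same operator. Let \<open>u\<close> be any radial element
  with profile \<open>v\<close>, and let \<open>\<psi>\<close> have the profile \<open>G h\<close>. The Rellich inequality
  (\<open>D22_Rellich\<close>) for \<open>u - \<psi>\<close> says that its energy is nonnegative, so that the energy of \<open>u\<close>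
  is at least \<open>2 * \<integral>v * h - J h\<close> times the area of the sphere; here one integrates by parts against
  the regular function \<open>\<psi>\<close>. Taking for \<open>h\<close> the best multiple of a truncation of
  \<open>\<bar>v\<bar> powr (q - 2) * v\<close> yields the sharp lower bound \<open>energy_lower_bound\<close>, and with it the
  integrability of \<open>\<bar>v\<bar> powr q\<close>. For \<open>v = G (\<bar>v\<bar> powr (q - 2) * v)\<close> it is an equality. That this
  profile gives an element of \<open>D22\<close> and a weak solution is shown by truncating it to profiles with compact
  support (\<open>profile_pairing\<close>).
\<close>

section \<open>Convolution on the line\<close>

text \<open>Boundedness at every point, and not only almost everywhere, makes the convolution with an integrable
  kernel meaningful at every point.\<close>

definition bounded_borel :: "(real \<Rightarrow> real) \<Rightarrow> bool" where
  "bounded_borel w \<longleftrightarrow> w \<in> borel_measurable borel \<and> (\<exists>B. \<forall>t. \<bar>w t\<bar> \<le> B)"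

definition conv :: "(real \<Rightarrow> real) \<Rightarrow> (real \<Rightarrow> real) \<Rightarrow> real \<Rightarrow> real" where
  "conv k w t = (\<integral>y. k y * w (t - y) \<partial>lborel)"

lemma quadratic_nonneg_imp_discriminant:
  fixes A E D :: real
  assumes "\<And>c. 0 \<le> D - 2 * c * E + c\<^sup>2 * A"
  shows "E\<^sup>2 \<le> A * D"
proof (cases "A = 0")
  case True
  have "E = 0"
  proof (rule ccontr)
    assume "E \<noteq> 0"
    then have "D - 2 * ((D + 1) / (2 * E)) * E = - 1" by (simp add: field_simps)
    then show False using assms[of "(D + 1) / (2 * E)"] True by simp
  qed
  then show ?thesis using True by simp
next
  case False
  have "A > 0"
  proof (rule ccontr)
    assume "\<not> A > 0"
    with False have A: "A < 0" by simp
    define c where "c = (\<bar>D\<bar> + 2 * \<bar>E\<bar> + 1) / (- A) + 1"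
    have c1: "c \<ge> 1" using A by (simp add: c_def divide_nonneg_neg divide_nonneg_pos)
    have c2: "c * (-A) > \<bar>D\<bar> + 2 * \<bar>E\<bar>" using A by (simp add: c_def field_simps)
    have "c\<^sup>2 * (-A) > c * (\<bar>D\<bar> + 2 * \<bar>E\<bar>)"
      using mult_strict_left_mono[OF c2, of c] c1 by (simp add: power2_eq_square mult.assoc)
    moreover have "c * \<bar>D\<bar> \<ge> D" using c1
      by (smt (verit) mult_left_le_one_le mult_le_cancel_right1)
    moreover have "2 * c * E \<ge> - (c * (2 * \<bar>E\<bar>))"
    proof -
      have "c * E \<ge> c * (- \<bar>E\<bar>)" using c1 by (intro mult_left_mono) auto
      then show ?thesis by (simp add: algebra_simps)
    qed
    ultimately have "D - 2 * c * E + c\<^sup>2 * A < 0" by (simp add: algebra_simps)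
    with assms[of c] show False by simp
  qed
  have "D - 2 * (E / A) * E + (E / A)\<^sup>2 * A = D - E\<^sup>2 / A"
    using \<open>A > 0\<close> by (simp add: field_simps power2_eq_square)
  then have "E\<^sup>2 / A \<le> D" using assms[of "E / A"] by simp
  then show ?thesis using \<open>A > 0\<close> by (simp add: field_simps)
qed

text \<open>The weight will be the absolute value of a convolution kernel.\<close>

lemma weighted_Cauchy_Schwarz:
  fixes k w :: "'a \<Rightarrow> real"
  assumes "integrable M k" "\<And>x. 0 \<le> k x" "integrable M (\<lambda>x. k x * w x)" "integrable M (\<lambda>x. k x * (w x)\<^sup>2)"
  shows "(\<integral>x. k x * w x \<partial>M)\<^sup>2 \<le> (\<integral>x. k x \<partial>M) * (\<integral>x. k x * (w x)\<^sup>2 \<partial>M)"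
proof (rule quadratic_nonneg_imp_discriminant)
  fix c :: real
  have "0 \<le> (\<integral>x. k x * (w x - c)\<^sup>2 \<partial>M)" using assms(2) by (intro integral_nonneg_AE) auto
  also have "\<dots> = (\<integral>x. k x * (w x)\<^sup>2 - 2 * c * (k x * w x) + c\<^sup>2 * k x \<partial>M)"
    by (intro Bochner_Integration.integral_cong) (auto simp: power2_eq_square algebra_simps)
  also have "\<dots> = (\<integral>x. k x * (w x)\<^sup>2 \<partial>M) - 2 * c * (\<integral>x. k x * w x \<partial>M) + c\<^sup>2 * (\<integral>x. k x \<partial>M)"
    using assms by simp
  finally show "0 \<le> \<dots>" .
qed

lemma L2_product_integrable:
  fixes f g :: "'a \<Rightarrow> real"
  assumes [measurable]: "f \<in> borel_measurable M" "g \<in> borel_measurable M"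
    and "integrable M (\<lambda>x. (f x)\<^sup>2)" "integrable M (\<lambda>x. (g x)\<^sup>2)"
  shows "integrable M (\<lambda>x. f x * g x)"
proof (rule Bochner_Integration.integrable_bound[of M "\<lambda>x. (f x)\<^sup>2 + (g x)\<^sup>2"])
  show "AE x in M. norm (f x * g x) \<le> norm ((f x)\<^sup>2 + (g x)\<^sup>2)"
  proof (rule AE_I2)
    fix x
    have "2 * (\<bar>f x\<bar> * \<bar>g x\<bar>) \<le> (f x)\<^sup>2 + (g x)\<^sup>2"
      using sum_squares_bound[of "\<bar>f x\<bar>" "\<bar>g x\<bar>"] by (simp add: mult.assoc)
    then show "norm (f x * g x) \<le> norm ((f x)\<^sup>2 + (g x)\<^sup>2)"
      by (simp add: abs_mult) (smt (verit) abs_ge_zero mult_nonneg_nonneg)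
  qed
qed (use assms in auto)

lemma Cauchy_Schwarz_integral:
  fixes f g :: "'a \<Rightarrow> real"
  assumes [measurable]: "f \<in> borel_measurable M" "g \<in> borel_measurable M"
    and i: "integrable M (\<lambda>x. (f x)\<^sup>2)" "integrable M (\<lambda>x. (g x)\<^sup>2)"
  shows "(\<integral>x. f x * g x \<partial>M)\<^sup>2 \<le> (\<integral>x. (f x)\<^sup>2 \<partial>M) * (\<integral>x. (g x)\<^sup>2 \<partial>M)"
proof (rule quadratic_nonneg_imp_discriminant)
  fix c :: real
  have p: "integrable M (\<lambda>x. f x * g x)" by (rule L2_product_integrable) (use assms in auto)
  have "0 \<le> (\<integral>x. (g x - c * f x)\<^sup>2 \<partial>M)" by (intro integral_nonneg_AE) auto
  also have "\<dots> = (\<integral>x. (g x)\<^sup>2 - 2 * c * (f x * g x) + c\<^sup>2 * (f x)\<^sup>2 \<partial>M)"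
    by (intro Bochner_Integration.integral_cong) (auto simp: power2_eq_square algebra_simps)
  also have "\<dots> = (\<integral>x. (g x)\<^sup>2 \<partial>M) - 2 * c * (\<integral>x. f x * g x \<partial>M) + c\<^sup>2 * (\<integral>x. (f x)\<^sup>2 \<partial>M)"
    using i p by simp
  finally show "0 \<le> \<dots>" .
qed

lemma lborel_reflect_integral:
  fixes f :: "real \<Rightarrow> real"
  shows "(\<integral>y. f (t - y) \<partial>lborel) = (\<integral>y. f y \<partial>lborel)"
  using lborel_integral_real_affine[of "-1" f t] by simp

lemma lborel_reflect_integrable:
  fixes f :: "real \<Rightarrow> real"
  assumes "integrable lborel f"
  shows "integrable lborel (\<lambda>y. f (t - y))"
  using lborel_integrable_real_affine[of f "-1" t] assms by simp

lemma lborel_shift_integral: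
  fixes f :: "real \<Rightarrow> real"
  shows "(\<integral>y. f (y + t) \<partial>lborel) = (\<integral>y. f y \<partial>lborel)"
  using lborel_integral_real_affine[of 1 f t] by (simp add: add.commute)

lemma lborel_shift_integrable:
  fixes f :: "real \<Rightarrow> real"
  assumes "integrable lborel f"
  shows "integrable lborel (\<lambda>y. f (y + t))"
  using lborel_integrable_real_affine[of f 1 t] assms by (simp add: add.commute)

lemma bounded_borelE:
  assumes "bounded_borel w"
  obtains B where "0 \<le> B" "\<And>t. \<bar>w t\<bar> \<le> B" "w \<in> borel_measurable borel"
  using assms unfolding bounded_borel_def by (metis abs_ge_zero order_trans)

lemma bounded_borel_indicator_integrable:
  assumes "bounded_borel w" "A \<in> sets borel" "emeasure lborel A < \<infinity>"
  shows "integrable lborel (\<lambda>r. indicator A r * w r)"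
proof -
  obtain B where B: "\<And>t. \<bar>w t\<bar> \<le> B" and [measurable]: "w \<in> borel_measurable borel"
    using bounded_borelE[OF assms(1)] by metis
  show ?thesis
    using integrableI_bounded_set_indicator[of A lborel w B] B assms by simp
qed

lemma conv_integrable:
  assumes "integrable lborel k" "bounded_borel w"
  shows "integrable lborel (\<lambda>y. k y * w (t - y))"
proof -
  obtain B where B: "\<And>t. \<bar>w t\<bar> \<le> B" and [measurable]: "w \<in> borel_measurable borel"
    using bounded_borelE[OF assms(2)] by metis
  note [measurable] = borel_measurable_integrable[OF assms(1)]
  show ?thesis
  proof (rule Bochner_Integration.integrable_bound[of _ "\<lambda>y. B * \<bar>k y\<bar>"])
    have "\<bar>k y * w (t - y)\<bar> \<le> \<bar>B * \<bar>k y\<bar>\<bar>" for y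
      using mult_right_mono[OF order_trans[OF B abs_ge_self], of "\<bar>k y\<bar>" "t - y"]
      by (simp add: abs_mult mult.commute)
    then show "AE y in lborel. norm (k y * w (t - y)) \<le> norm (B * \<bar>k y\<bar>)" by simp
  qed (use assms in auto)
qed

lemma conv_alt:
  "conv k w t = (\<integral>y. k (t - y) * w y \<partial>lborel)"
  unfolding conv_def using lborel_reflect_integral[of "\<lambda>y. k y * w (t - y)" t] by simp

lemma conv_integrable_alt:
  assumes "integrable lborel k" "bounded_borel w"
  shows "integrable lborel (\<lambda>y. k (t - y) * w y)"
  using lborel_reflect_integrable[OF conv_integrable[OF assms, of t], of t] by simp

lemma conv_bound:
  assumes "integrable lborel k" "bounded_borel w" "\<And>t. \<bar>w t\<bar> \<le> B"
  shows "\<bar>conv k w t\<bar> \<le> B * (\<integral>y. \<bar>k y\<bar> \<partial>lborel)"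
proof -
  have "\<bar>conv k w t\<bar> \<le> (\<integral>y. \<bar>k y * w (t - y)\<bar> \<partial>lborel)"
    unfolding conv_def by (rule integral_abs_bound)
  also have "\<dots> \<le> (\<integral>y. B * \<bar>k y\<bar> \<partial>lborel)"
  proof (rule integral_mono)
    show "integrable lborel (\<lambda>y. \<bar>k y * w (t - y)\<bar>)" by (rule integrable_abs[OF conv_integrable[OF assms(1,2)]])
    show "\<bar>k y * w (t - y)\<bar> \<le> B * \<bar>k y\<bar>" for y
      using mult_right_mono[OF assms(3)[of "t - y"], of "\<bar>k y\<bar>"] by (simp add: abs_mult mult.commute)
  qed (use assms in auto)
  finally show ?thesis by simp
qed

lemma conv_measurable [measurable]:
  assumes [measurable]: "k \<in> borel_measurable borel" "w \<in> borel_measurable borel"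
  shows "conv k w \<in> borel_measurable borel"
  unfolding conv_def by measurable

lemma bounded_borel_conv:
  assumes "integrable lborel k" "bounded_borel w"
  shows "bounded_borel (conv k w)"
proof -
  obtain B where B: "\<And>t. \<bar>w t\<bar> \<le> B" and [measurable]: "w \<in> borel_measurable borel"
    using bounded_borelE[OF assms(2)] by metis
  have [measurable]: "k \<in> borel_measurable borel" using borel_measurable_integrable[OF assms(1)] by simp
  show ?thesis unfolding bounded_borel_def using conv_bound[OF assms B] by auto
qed

lemma conv_dominated_convergence:
  assumes k: "integrable lborel k" and m: "\<And>n. W n \<in> borel_measurable borel" "\<And>n t. \<bar>W n t\<bar> \<le> B"
    and lim: "\<And>t. (\<lambda>n. W n t) \<longlonglongrightarrow> w t"
  shows "(\<lambda>n. conv k (W n) t) \<longlonglongrightarrow> conv k w t"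
proof -
  note [measurable] = m(1) borel_measurable_integrable[OF k]
  have [measurable]: "w \<in> borel_measurable borel" by (rule borel_measurable_LIMSEQ_metric[OF m(1) lim])
  show ?thesis unfolding conv_def
    by (rule integral_dominated_convergence[where w = "\<lambda>y. B * \<bar>k y\<bar>"])
       (use k m(2) in \<open>auto simp: abs_mult mult.commute[of "\<bar>k _\<bar>"]
         intro!: tendsto_intros lim mult_right_mono\<close>)
qed

lemma conv_continuous:
  assumes k: "integrable lborel k" and w: "continuous_on UNIV w" "bounded_borel w"
  shows "continuous_on UNIV (conv k w)"
proof -
  obtain B where B: "\<And>t. \<bar>w t\<bar> \<le> B" and [measurable]: "w \<in> borel_measurable borel"
    using bounded_borelE[OF w(2)] by metis
  have "(\<lambda>n. conv k w (x n)) \<longlonglongrightarrow> conv k w a" if x: "x \<longlonglongrightarrow> a" for x a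
  proof -
    have "(\<lambda>n. conv k (\<lambda>t. w (t + x n - a)) a) \<longlonglongrightarrow> conv k w a"
    proof (rule conv_dominated_convergence[OF k, where B = B])
      fix t
      have "(\<lambda>n. t + x n - a) \<longlonglongrightarrow> t + a - a" by (intro tendsto_intros x)
      then have "(\<lambda>n. t + x n - a) \<longlonglongrightarrow> t" by simp
      then show "(\<lambda>n. w (t + x n - a)) \<longlonglongrightarrow> w t"
        using w(1) by (intro continuous_on_tendsto_compose[OF w(1)]) auto
    qed (use B in auto)
    moreover have "conv k (\<lambda>t. w (t + x n - a)) a = conv k w (x n)" for n
      unfolding conv_def by (simp add: algebra_simps)
    ultimately show ?thesis by simp
  qed
  then show ?thesis by (auto simp: continuous_on_sequentially o_def)
qed

lemma conv_integrable_L1: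
  assumes k: "integrable lborel k" and w: "bounded_borel w" "integrable lborel w"
  shows "integrable lborel (conv k w)"
    and "(\<integral>t. \<bar>conv k w t\<bar> \<partial>lborel) \<le> (\<integral>y. \<bar>k y\<bar> \<partial>lborel) * (\<integral>y. \<bar>w y\<bar> \<partial>lborel)"
proof -
  have [measurable]: "k \<in> borel_measurable borel" using borel_measurable_integrable[OF k] by simp
  have [measurable]: "w \<in> borel_measurable borel" using w by (simp add: bounded_borel_def)
  let ?F = "\<lambda>(y, t). k y * w (t - y)"
  have inner: "(\<integral>t. norm (?F (y, t)) \<partial>lborel) = \<bar>k y\<bar> * (\<integral>t. \<bar>w t\<bar> \<partial>lborel)" for y
    using lborel_shift_integral[of "\<lambda>t. \<bar>w t\<bar>" "-y"] by (simp add: abs_mult)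
  have F: "integrable (lborel \<Otimes>\<^sub>M lborel) ?F"
  proof (rule lborel_pair.Fubini_integrable)
    show "integrable lborel (\<lambda>y. \<integral>t. norm (?F (y, t)) \<partial>lborel)"
      unfolding inner using k by (intro integrable_mult_left) auto
    show "AE y in lborel. integrable lborel (\<lambda>t. ?F (y, t))"
      using lborel_shift_integrable[OF w(2), of "- _"] by (auto intro!: AE_I2)
  qed measurable
  then have F': "integrable (lborel \<Otimes>\<^sub>M lborel) (\<lambda>(t, y). k y * w (t - y))"
    using lborel_pair.integrable_product_swap[OF F] by (simp add: split_beta')
  have "integrable lborel (\<lambda>t. \<integral>y. k y * w (t - y) \<partial>lborel)"
    using lborel_pair.integrable_fst'[OF F'] by simp
  then show I: "integrable lborel (conv k w)" by (simp add: conv_def[abs_def])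
  have aF: "integrable (lborel \<Otimes>\<^sub>M lborel) (\<lambda>(y, t). \<bar>k y * w (t - y)\<bar>)"
    using integrable_abs[OF F] by (simp add: split_beta')
  have aF': "integrable (lborel \<Otimes>\<^sub>M lborel) (\<lambda>(t, y). \<bar>k y * w (t - y)\<bar>)"
    using integrable_abs[OF F'] by (simp add: split_beta')
  have "(\<integral>t. \<bar>conv k w t\<bar> \<partial>lborel) \<le> (\<integral>t. (\<integral>y. \<bar>k y * w (t - y)\<bar> \<partial>lborel) \<partial>lborel)"
    using integrable_abs[OF I] lborel_pair.integrable_fst'[OF aF']
    by (intro integral_mono) (auto simp: conv_def intro: integral_abs_bound)
  also have "\<dots> = (\<integral>y. (\<integral>t. \<bar>k y * w (t - y)\<bar> \<partial>lborel) \<partial>lborel)"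
    using lborel_pair.Fubini_integral[OF aF] by simp
  also have "\<dots> = (\<integral>y. \<bar>k y\<bar> \<partial>lborel) * (\<integral>y. \<bar>w y\<bar> \<partial>lborel)"
    using inner by simp
  finally show "(\<integral>t. \<bar>conv k w t\<bar> \<partial>lborel) \<le> (\<integral>y. \<bar>k y\<bar> \<partial>lborel) * (\<integral>y. \<bar>w y\<bar> \<partial>lborel)" .
qed

lemma bounded_borel_power2: "bounded_borel w \<Longrightarrow> bounded_borel (\<lambda>t. (w t)\<^sup>2)"
proof -
  assume a: "bounded_borel w"
  obtain B where B: "0 \<le> B" "\<And>t. \<bar>w t\<bar> \<le> B" and [measurable]: "w \<in> borel_measurable borel"
    using bounded_borelE[OF a] by metis
  have "\<bar>(w t)\<^sup>2\<bar> \<le> B\<^sup>2" for t using power_mono[OF B(2)[of t], of 2] by simp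
  then show ?thesis unfolding bounded_borel_def by auto
qed

lemma bounded_borel_abs: "bounded_borel w \<Longrightarrow> bounded_borel (\<lambda>t. \<bar>w t\<bar>)"
  unfolding bounded_borel_def by auto

lemma conv_square_le:
  assumes k: "integrable lborel k" and w: "bounded_borel w"
  shows "(conv k w t)\<^sup>2 \<le> (\<integral>y. \<bar>k y\<bar> \<partial>lborel) * conv (\<lambda>y. \<bar>k y\<bar>) (\<lambda>y. (w y)\<^sup>2) t"
proof -
  have [measurable]: "w \<in> borel_measurable borel" using w by (simp add: bounded_borel_def)
  note [measurable] = borel_measurable_integrable[OF k]
  have ka: "integrable lborel (\<lambda>y. \<bar>k y\<bar>)" using k by simp
  have "\<bar>conv k w t\<bar> \<le> (\<integral>y. \<bar>k y * w (t - y)\<bar> \<partial>lborel)"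
    unfolding conv_def by (rule integral_abs_bound)
  then have "(conv k w t)\<^sup>2 \<le> (\<integral>y. \<bar>k y\<bar> * \<bar>w (t - y)\<bar> \<partial>lborel)\<^sup>2"
    using power_mono[of "\<bar>conv k w t\<bar>" _ 2] by (simp add: abs_mult)
  also have "\<dots> \<le> (\<integral>y. \<bar>k y\<bar> \<partial>lborel) * (\<integral>y. \<bar>k y\<bar> * (\<bar>w (t - y)\<bar>)\<^sup>2 \<partial>lborel)"
    by (rule weighted_Cauchy_Schwarz)
       (use ka conv_integrable[OF ka bounded_borel_abs[OF w]]
          conv_integrable[OF ka bounded_borel_power2[OF w]] in auto)
  finally show ?thesis by (simp add: conv_def)
qed

text \<open>Young's inequality for a kernel in \<open>L\<^sup>1\<close>: by the weighted Cauchy--Schwarz inequality the square of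
  the convolution is dominated by the convolution of two integrable functions.\<close>

lemma conv_L2:
  assumes k: "integrable lborel k" and w: "bounded_borel w" "integrable lborel (\<lambda>y. (w y)\<^sup>2)"
  shows "integrable lborel (\<lambda>t. (conv k w t)\<^sup>2)"
    and "(\<integral>t. (conv k w t)\<^sup>2 \<partial>lborel) \<le> (\<integral>y. \<bar>k y\<bar> \<partial>lborel)\<^sup>2 * (\<integral>y. (w y)\<^sup>2 \<partial>lborel)"
proof -
  have [measurable]: "w \<in> borel_measurable borel" using w by (simp add: bounded_borel_def)
  have [measurable]: "k \<in> borel_measurable borel" using borel_measurable_integrable[OF k] by simp
  let ?A = "\<integral>y. \<bar>k y\<bar> \<partial>lborel"
  have ka: "integrable lborel (\<lambda>y. \<bar>k y\<bar>)" using k by simp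
  note L1 = conv_integrable_L1[OF ka bounded_borel_power2[OF w(1)] w(2)]
  show I: "integrable lborel (\<lambda>t. (conv k w t)\<^sup>2)"
    by (rule Bochner_Integration.integrable_bound[OF integrable_mult_right[OF L1(1), of ?A]])
       (use conv_square_le[OF k w(1)] in \<open>auto intro!: order_trans[OF _ abs_ge_self]\<close>)
  have "(\<integral>t. (conv k w t)\<^sup>2 \<partial>lborel) \<le> (\<integral>t. ?A * conv (\<lambda>y. \<bar>k y\<bar>) (\<lambda>y. (w y)\<^sup>2) t \<partial>lborel)"
    by (rule integral_mono[OF I]) (use L1 conv_square_le[OF k w(1)] in auto)
  also have "\<dots> = ?A * (\<integral>t. conv (\<lambda>y. \<bar>k y\<bar>) (\<lambda>y. (w y)\<^sup>2) t \<partial>lborel)" by simp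
  also have "\<dots> \<le> ?A * (?A * (\<integral>y. (w y)\<^sup>2 \<partial>lborel))"
    using L1 by (intro mult_left_mono order_trans[OF integral_mono L1(2)[simplified]]) auto
  finally show "(\<integral>t. (conv k w t)\<^sup>2 \<partial>lborel) \<le> ?A\<^sup>2 * (\<integral>y. (w y)\<^sup>2 \<partial>lborel)"
    by (simp add: power2_eq_square mult.assoc)
qed

lemma conv_adjoint:
  assumes k: "integrable lborel k" and w: "bounded_borel w" "integrable lborel (\<lambda>y. (w y)\<^sup>2)"
    and f: "bounded_borel f" "integrable lborel (\<lambda>y. (f y)\<^sup>2)"
  shows "(\<integral>t. f t * conv k w t \<partial>lborel) = (\<integral>t. conv (\<lambda>y. k (- y)) f t * w t \<partial>lborel)"
proof -
  have [measurable]: "w \<in> borel_measurable borel" "f \<in> borel_measurable borel"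
    using w f by (simp_all add: bounded_borel_def)
  have [measurable]: "k \<in> borel_measurable borel" using borel_measurable_integrable[OF k] by simp
  let ?F = "\<lambda>(t, y). f t * (k (t - y) * w y)"
  have ka: "integrable lborel (\<lambda>y. \<bar>k y\<bar>)" using k by simp
  have wa: "bounded_borel (\<lambda>t. \<bar>w t\<bar>)" by (rule bounded_borel_abs[OF w(1)])
  have F: "integrable (lborel \<Otimes>\<^sub>M lborel) ?F"
  proof (rule lborel_pair.Fubini_integrable)
    have "(\<integral>y. norm (?F (t, y)) \<partial>lborel) = \<bar>f t\<bar> * conv (\<lambda>y. \<bar>k y\<bar>) (\<lambda>y. \<bar>w y\<bar>) t" for t
      by (simp add: conv_alt abs_mult)
    then show "integrable lborel (\<lambda>t. \<integral>y. norm (?F (t, y)) \<partial>lborel)"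
      using conv_L2(1)[OF ka wa] f w by (simp add: L2_product_integrable)
    show "AE t in lborel. integrable lborel (\<lambda>y. ?F (t, y))"
      using conv_integrable_alt[OF k w(1)] by (auto intro!: AE_I2)
  qed measurable
  have "(\<integral>t. f t * conv k w t \<partial>lborel) = (\<integral>t. (\<integral>y. ?F (t, y) \<partial>lborel) \<partial>lborel)"
    by (simp add: conv_alt)
  also have "\<dots> = (\<integral>y. (\<integral>t. f t * (k (t - y) * w y) \<partial>lborel) \<partial>lborel)"
    using lborel_pair.Fubini_integral[of "\<lambda>t y. f t * (k (t - y) * w y)"] F by simp
  also have "\<dots> = (\<integral>y. conv (\<lambda>y. k (- y)) f y * w y \<partial>lborel)"
  proof (intro Bochner_Integration.integral_cong refl)
    fix y
    have "(\<integral>t. f t * (k (t - y) * w y) \<partial>lborel) = (\<integral>t. (k (- (y - t)) * f t) * w y \<partial>lborel)"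
      by (simp add: mult_ac)
    also have "\<dots> = conv (\<lambda>y. k (- y)) f y * w y"
      unfolding conv_alt by (rule integral_mult_left_zero)
    finally show "(\<integral>t. f t * (k (t - y) * w y) \<partial>lborel) = conv (\<lambda>y. k (- y)) f y * w y" .
  qed
  finally show ?thesis .
qed

text \<open>The distributional derivative of \<open>k\<close> is \<open>k'\<close> plus \<open>j\<close> times the Dirac measure at \<open>0\<close>; at the
  jump \<open>k\<close> takes the value from the right. This is the regularity of fundamental solutions, which are
  not differentiable at \<open>0\<close>.\<close>

definition jump_primitive :: "real \<Rightarrow> (real \<Rightarrow> real) \<Rightarrow> (real \<Rightarrow> real) \<Rightarrow> bool" where
  "jump_primitive j k' k \<longleftrightarrow> (\<forall>a b. a \<le> b \<longrightarrow>
     k b - k a = (if a < 0 \<and> 0 \<le> b then j else 0) + (\<integral>r. indicator {a..b} r * k' r \<partial>lborel))"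

text \<open>The integrated form of \<open>(k * w)' = j w + k' * w\<close>, obtained from Fubini's theorem. It holds for
  discontinuous \<open>w\<close> as well, which is what makes Lipschitz bounds for such \<open>w\<close> possible.\<close>

lemma conv_increment:
  assumes k: "integrable lborel k" "integrable lborel k'" and jp: "jump_primitive j k' k"
    and w: "bounded_borel w" and ab: "a \<le> b"
  shows "conv k w b - conv k w a = (\<integral>r. indicator {a..b} r * (j * w r + conv k' w r) \<partial>lborel)"
proof -
  have [measurable]: "w \<in> borel_measurable borel" using w by (simp_all add: bounded_borel_def)
  have [measurable]: "k \<in> borel_measurable borel" "k' \<in> borel_measurable borel"
    using borel_measurable_integrable[OF k(1)] borel_measurable_integrable[OF k(2)] by simp_all
  obtain B where B: "0 \<le> B" "\<And>t. \<bar>w t\<bar> \<le> B" using bounded_borelE[OF w] by metis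
  let ?F = "\<lambda>(r, y). indicator {a..b} r * (k' (r - y) * w y)"
  have F: "integrable (lborel \<Otimes>\<^sub>M lborel) ?F"
  proof (rule lborel_pair.Fubini_integrable)
    have *: "(\<integral>y. norm (?F (r, y)) \<partial>lborel) = indicator {a..b} r * conv (\<lambda>y. \<bar>k' y\<bar>) (\<lambda>y. \<bar>w y\<bar>) r" for r
      by (simp add: conv_alt abs_mult)
    have ka: "integrable lborel (\<lambda>y. \<bar>k' y\<bar>)" using k by simp
    show "integrable lborel (\<lambda>r. \<integral>y. norm (?F (r, y)) \<partial>lborel)"
      unfolding * using ab by (intro bounded_borel_indicator_integrable[OF bounded_borel_conv[OF ka bounded_borel_abs[OF w]]]) auto
    show "AE r in lborel. integrable lborel (\<lambda>y. ?F (r, y))"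
      using conv_integrable_alt[OF k(2) w(1)] by (auto intro!: AE_I2)
  qed measurable
  have Fs: "integrable lborel (\<lambda>y. \<integral>r. indicator {a..b} r * (k' (r - y) * w y) \<partial>lborel)"
    using lborel_pair.integrable_snd[of "\<lambda>r y. indicator {a..b} r * (k' (r - y) * w y)"] F by simp
  have iw: "integrable lborel (\<lambda>y. indicator {a..b} y * w y)"
    using ab by (intro bounded_borel_indicator_integrable[OF w]) auto
  have iw': "integrable lborel (\<lambda>y. indicator {a<..b} y * w y)"
    using ab by (intro bounded_borel_indicator_integrable[OF w]) auto
  have ic: "integrable lborel (\<lambda>r. indicator {a..b} r * conv k' w r)"
    using ab by (intro bounded_borel_indicator_integrable[OF bounded_borel_conv[OF k(2) w]]) auto
  have d: "k (b - y) - k (a - y) = j * indicator {a<..b} y + (\<integral>r. indicator {a..b} r * k' (r - y) \<partial>lborel)" for y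
  proof -
    have "(\<integral>r. indicator {a - y..b - y} r * k' r \<partial>lborel) = (\<integral>r. indicator {a..b} r * k' (r - y) \<partial>lborel)"
      using lborel_shift_integral[of "\<lambda>r. indicator {a - y..b - y} r * k' r" "- y", symmetric]
      by (auto intro!: Bochner_Integration.integral_cong simp: indicator_def)
    then show ?thesis using jp[unfolded jump_primitive_def, rule_format, of "a - y" "b - y"] ab
      by (auto simp: indicator_def)
  qed
  have "conv k w b - conv k w a = (\<integral>y. (k (b - y) - k (a - y)) * w y \<partial>lborel)"
    unfolding conv_alt left_diff_distrib
    by (rule Bochner_Integration.integral_diff[symmetric]) (use conv_integrable_alt[OF k(1) w] in auto)
  also have "\<dots> = (\<integral>y. j * (indicator {a<..b} y * w y) + (\<integral>r. indicator {a..b} r * (k' (r - y) * w y) \<partial>lborel) \<partial>lborel)"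
  proof (intro Bochner_Integration.integral_cong refl)
    fix y
    show "(k (b - y) - k (a - y)) * w y = j * (indicator {a<..b} y * w y) + (\<integral>r. indicator {a..b} r * (k' (r - y) * w y) \<partial>lborel)"
      unfolding d by (simp add: distrib_right mult.assoc[symmetric])
  qed
  also have "\<dots> = j * (\<integral>y. indicator {a<..b} y * w y \<partial>lborel) + (\<integral>y. (\<integral>r. indicator {a..b} r * (k' (r - y) * w y) \<partial>lborel) \<partial>lborel)"
    using iw' Fs by simp
  also have "(\<integral>y. (\<integral>r. indicator {a..b} r * (k' (r - y) * w y) \<partial>lborel) \<partial>lborel) = (\<integral>r. indicator {a..b} r * conv k' w r \<partial>lborel)"
    using lborel_pair.Fubini_integral[of "\<lambda>r y. indicator {a..b} r * (k' (r - y) * w y)"] F by (simp add: conv_alt)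
  also have "(\<integral>y. indicator {a<..b} y * w y \<partial>lborel) = (\<integral>y. indicator {a..b} y * w y \<partial>lborel)"
  proof (rule integral_cong_AE)
    show "AE x in lborel. indicator {a<..b} x * w x = indicator {a..b} x * w x"
      using AE_lborel_singleton[of a] by eventually_elim (auto simp: indicator_def)
  qed auto
  also have "j * (\<integral>y. indicator {a..b} y * w y \<partial>lborel) + (\<integral>r. indicator {a..b} r * conv k' w r \<partial>lborel)
     = (\<integral>r. indicator {a..b} r * (j * w r + conv k' w r) \<partial>lborel)"
    using iw ic by (simp add: distrib_left mult.left_commute[of _ j])
  finally show ?thesis .
qed

lemma conv_Lipschitz:
  assumes k: "integrable lborel k" "integrable lborel k'" and jp: "jump_primitive 0 k' k"
    and w: "bounded_borel w" and C: "\<And>t. \<bar>conv k' w t\<bar> \<le> C"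
  shows "\<bar>conv k w b - conv k w a\<bar> \<le> C * \<bar>b - a\<bar>"
proof -
  have *: "\<bar>conv k w b - conv k w a\<bar> \<le> C * \<bar>b - a\<bar>" if ab: "a \<le> b" for a b
  proof -
    have [measurable]: "conv k' w \<in> borel_measurable borel"
      using bounded_borel_conv[OF k(2) w] by (simp add: bounded_borel_def)
    have i: "integrable lborel (\<lambda>r. indicator {a..b} r * conv k' w r)"
      using ab by (intro bounded_borel_indicator_integrable[OF bounded_borel_conv[OF k(2) w]]) auto
    have "\<bar>conv k w b - conv k w a\<bar> \<le> (\<integral>r. \<bar>indicator {a..b} r * conv k' w r\<bar> \<partial>lborel)"
      using conv_increment[OF k jp w ab] by (simp add: integral_abs_bound)
    also have "\<dots> \<le> (\<integral>r. indicator {a..b} r * C \<partial>lborel)"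
      using i C ab by (intro integral_mono integrable_abs integrable_mult_left)
        (auto simp: abs_mult integrable_indicator_iff intro!: mult_left_mono)
    also have "\<dots> = C * (b - a)" using ab by simp
    finally show ?thesis using ab by simp
  qed
  show ?thesis using *[of a b] *[of b a] by (cases "a \<le> b") (auto simp: abs_minus_commute)
qed

lemma conv_has_derivative:
  assumes k: "integrable lborel k" "integrable lborel k'" and jp: "jump_primitive j k' k"
    and w: "bounded_borel w" "continuous_on UNIV w"
  shows "(conv k w has_real_derivative j * w t + conv k' w t) (at t)"
proof -
  let ?f = "\<lambda>r. j * w r + conv k' w r"
  have cf: "continuous_on S ?f" for S
    using conv_continuous[OF k(2) w(2,1)] w(2)
    by (intro continuous_intros) (auto intro: continuous_on_subset)
  have bf: "bounded_borel ?f"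
  proof -
    obtain B where B: "\<And>t. \<bar>w t\<bar> \<le> B" using bounded_borelE[OF w(1)] by metis
    obtain C where C: "\<And>t. \<bar>conv k' w t\<bar> \<le> C" using bounded_borelE[OF bounded_borel_conv[OF k(2) w(1)]] by metis
    have "\<bar>?f r\<bar> \<le> \<bar>j\<bar> * B + C" for r
      using mult_left_mono[OF B[of r], of "\<bar>j\<bar>"] C[of r] abs_triangle_ineq[of "j * w r" "conv k' w r"]
      by (simp add: abs_mult)
    then show ?thesis unfolding bounded_borel_def
      using borel_measurable_continuous_onI[OF cf] by blast
  qed
  have eq: "conv k w x = conv k w (t - 1) + integral {t - 1..x} ?f" if "x \<in> {t - 1..t + 1}" for x
  proof -
    have "set_integrable lborel {t - 1..x} ?f"
      unfolding set_integrable_def using bounded_borel_indicator_integrable[OF bf, of "{t - 1..x}"] that by simp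
    then have "(LINT r:{t - 1..x}|lborel. ?f r) = integral {t - 1..x} ?f"
      by (rule set_borel_integral_eq_integral(2))
    then show ?thesis using conv_increment[OF k jp w(1), of "t - 1" x] that
      by (simp add: set_lebesgue_integral_def)
  qed
  have "((\<lambda>x. integral {t - 1..x} ?f) has_vector_derivative ?f t) (at t within {t - 1..t + 1})"
    by (rule integral_has_vector_derivative) (use cf in auto)
  moreover have "at t within {t - 1..t + 1} = at t" by (rule at_within_interior) auto
  ultimately have "((\<lambda>x. integral {t - 1..x} ?f) has_real_derivative ?f t) (at t)"
    unfolding has_real_derivative_iff_has_vector_derivative by simp
  then have "((\<lambda>x. conv k w (t - 1) + integral {t - 1..x} ?f) has_real_derivative ?f t) (at t)"
    by (auto intro!: derivative_eq_intros)
  then show ?thesis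
  proof (rule has_field_derivative_transform_within_open[where S = "{t - 1<..<t + 1}"])
    fix x assume "x \<in> {t - 1<..<t + 1}"
    then show "conv k w (t - 1) + integral {t - 1..x} ?f = conv k w x" by (intro eq[symmetric]) auto
  qed auto
qed

section \<open>A factored fourth order operator\<close>

text \<open>Square integrability gives the energy estimates and boundedness the pointwise meaning of
  convolutions; the class is preserved by convolution with integrable kernels.\<close>

definition L2_bounded :: "(real \<Rightarrow> real) \<Rightarrow> bool" where
  "L2_bounded f \<longleftrightarrow> bounded_borel f \<and> integrable lborel (\<lambda>t. (f t)\<^sup>2)"

lemma L2_bounded_measurable: "L2_bounded f \<Longrightarrow> f \<in> borel_measurable borel"
  by (simp add: L2_bounded_def bounded_borel_def)

lemma bounded_borel_cmult: "bounded_borel f \<Longrightarrow> bounded_borel (\<lambda>t. c * f t)"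
proof -
  assume a: "bounded_borel f"
  obtain B where B: "\<And>t. \<bar>f t\<bar> \<le> B" and [measurable]: "f \<in> borel_measurable borel"
    using bounded_borelE[OF a] by metis
  have "\<bar>c * f t\<bar> \<le> \<bar>c\<bar> * B" for t using mult_left_mono[OF B[of t], of "\<bar>c\<bar>"] by (simp add: abs_mult)
  then show ?thesis unfolding bounded_borel_def by auto
qed

lemma bounded_borel_add: "bounded_borel f \<Longrightarrow> bounded_borel g \<Longrightarrow> bounded_borel (\<lambda>t. f t + g t)"
proof -
  assume a: "bounded_borel f" "bounded_borel g"
  obtain B where B: "\<And>t. \<bar>f t\<bar> \<le> B" and [measurable]: "f \<in> borel_measurable borel"
    using bounded_borelE[OF a(1)] by metis
  obtain C where C: "\<And>t. \<bar>g t\<bar> \<le> C" and [measurable]: "g \<in> borel_measurable borel"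
    using bounded_borelE[OF a(2)] by metis
  have "\<bar>f t + g t\<bar> \<le> B + C" for t using B[of t] C[of t] by linarith
  then show ?thesis unfolding bounded_borel_def by auto
qed

lemma L2_bounded_cmult: "L2_bounded f \<Longrightarrow> L2_bounded (\<lambda>t. c * f t)"
  unfolding L2_bounded_def by (simp add: bounded_borel_cmult power_mult_distrib)

lemma L2_bounded_add:
  assumes "L2_bounded f" "L2_bounded g"
  shows "L2_bounded (\<lambda>t. f t + g t)"
proof -
  have [measurable]: "f \<in> borel_measurable borel" "g \<in> borel_measurable borel"
    using assms by (auto intro: L2_bounded_measurable)
  have "integrable lborel (\<lambda>t. f t * g t)"
    using assms by (intro L2_product_integrable) (auto simp: L2_bounded_def)
  then have "integrable lborel (\<lambda>t. (f t)\<^sup>2 + 2 * (f t * g t) + (g t)\<^sup>2)"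
    using assms by (simp add: L2_bounded_def)
  then have "integrable lborel (\<lambda>t. (f t + g t)\<^sup>2)"
    by (simp add: power2_sum algebra_simps)
  then show ?thesis using assms by (auto simp: L2_bounded_def intro: bounded_borel_add)
qed

lemma L2_bounded_diff:
  assumes "L2_bounded f" "L2_bounded g"
  shows "L2_bounded (\<lambda>t. f t - g t)"
  using L2_bounded_add[OF assms(1) L2_bounded_cmult[OF assms(2), of "-1"]] by simp

lemma L2_bounded_reflect: "L2_bounded f \<Longrightarrow> L2_bounded (\<lambda>t. f (- t))"
proof -
  assume a: "L2_bounded f"
  have [measurable]: "f \<in> borel_measurable borel" using a by (rule L2_bounded_measurable)
  show ?thesis using a lborel_reflect_integrable[of "\<lambda>t. (f t)\<^sup>2" 0]
    unfolding L2_bounded_def bounded_borel_def by auto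
qed

lemma L2_bounded_conv: "integrable lborel k \<Longrightarrow> L2_bounded f \<Longrightarrow> L2_bounded (conv k f)"
  unfolding L2_bounded_def using conv_L2(1) bounded_borel_conv by auto

lemma conv_commute: "conv k w = conv w k"
  by (rule ext) (metis (no_types, lifting) conv_alt conv_def mult.commute Bochner_Integration.integral_cong)

lemma conv_diff:
  assumes "integrable lborel k" "bounded_borel f" "bounded_borel g"
  shows "conv k (\<lambda>t. f t - g t) t = conv k f t - conv k g t"
  unfolding conv_def right_diff_distrib
  by (rule Bochner_Integration.integral_diff) (use assms conv_integrable in auto)

lemma conv_add:
  assumes "integrable lborel k" "bounded_borel f" "bounded_borel g"
  shows "conv k (\<lambda>t. f t + g t) t = conv k f t + conv k g t"
  unfolding conv_def distrib_left
  by (rule Bochner_Integration.integral_add) (use assms conv_integrable in auto)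

lemma conv_cmult: "conv k (\<lambda>t. c * f t) t = c * conv k f t"
  unfolding conv_def mult.left_commute[of _ c] by (rule integral_mult_right_zero)

lemma conv_shift: "conv k (\<lambda>t. f (t + c)) t = conv k f (t + c)"
  unfolding conv_def by (simp add: algebra_simps)

lemma bounded_integrable_imp_L2:
  assumes "integrable lborel k" "\<And>t. \<bar>k t\<bar> \<le> (B :: real)"
  shows "integrable lborel (\<lambda>t. (k t)\<^sup>2)"
proof (rule Bochner_Integration.integrable_bound[OF integrable_mult_right[OF assms(1), of B]])
  show "AE t in lborel. norm ((k t)\<^sup>2) \<le> norm (B * k t)"
  proof (rule AE_I2)
    fix t
    have "(k t)\<^sup>2 \<le> \<bar>B\<bar> * \<bar>k t\<bar>"
      using mult_right_mono[OF order_trans[OF assms(2) abs_ge_self], of "\<bar>k t\<bar>" t]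
      by (simp add: power2_eq_square)
    then show "norm ((k t)\<^sup>2) \<le> norm (B * k t)" by (simp add: abs_mult)
  qed
qed (use borel_measurable_integrable[OF assms(1)] in auto)

lemma conv_bound_L2:
  assumes k: "integrable lborel k" "integrable lborel (\<lambda>t. (k t)\<^sup>2)" and w: "L2_bounded w"
  shows "(conv k w t)\<^sup>2 \<le> (\<integral>y. (k y)\<^sup>2 \<partial>lborel) * (\<integral>y. (w y)\<^sup>2 \<partial>lborel)"
proof -
  have [measurable]: "w \<in> borel_measurable borel" using L2_bounded_measurable[OF w] .
  have [measurable]: "k \<in> borel_measurable borel" using borel_measurable_integrable[OF k(1)] by simp
  have "integrable lborel (\<lambda>y. (w (t - y))\<^sup>2)"
    using lborel_reflect_integrable[of "\<lambda>y. (w y)\<^sup>2" t] w by (simp add: L2_bounded_def)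
  from Cauchy_Schwarz_integral[OF _ _ k(2) this]
  show ?thesis using lborel_reflect_integral[of "\<lambda>y. (w y)\<^sup>2" t] by (simp add: conv_def)
qed

text \<open>The function \<open>g\<close> is the fundamental solution of \<open>D\<^sup>2 + p * D + s\<close> and \<open>g1\<close> is its derivative, which has
  the jump \<open>1\<close> at the origin.\<close>

locale damped_kernel =
  fixes p s :: real and g g1 :: "real \<Rightarrow> real"
  assumes g_integrable: "integrable lborel g" and g1_integrable: "integrable lborel g1"
    and g_bounded: "\<exists>B. \<forall>t. \<bar>g t\<bar> \<le> B" and g1_bounded: "\<exists>B. \<forall>t. \<bar>g1 t\<bar> \<le> B"
    and g_primitive: "jump_primitive 0 g1 g"
    and g1_primitive: "jump_primitive 1 (\<lambda>t. - p * g1 t - s * g t) g1"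
    and s_nonzero: "s \<noteq> 0"
begin

text \<open>Convolution with \<open>g\<close> inverts \<open>D\<^sup>2 + p * D + s\<close>, and convolution with the reflection of \<open>g\<close> inverts
  the adjoint \<open>D\<^sup>2 - p * D + s\<close>. Hence \<open>G\<close> is the inverse of
  \<open>(D\<^sup>2 - p * D + s) * (D\<^sup>2 + p * D + s) = D\<^sup>4 - (p\<^sup>2 - 2 * s) * D\<^sup>2 + s\<^sup>2\<close>, and \<open>J\<close> is its quadratic form.\<close>

definition K :: "(real \<Rightarrow> real) \<Rightarrow> real \<Rightarrow> real" where "K h = conv (\<lambda>y. g (- y)) h"
definition G :: "(real \<Rightarrow> real) \<Rightarrow> real \<Rightarrow> real" where "G h = conv g (K h)"
definition J :: "(real \<Rightarrow> real) \<Rightarrow> real" where "J h = (\<integral>t. (K h t)\<^sup>2 \<partial>lborel)"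

lemma gr_integrable: "integrable lborel (\<lambda>y. g (- y))"
  using lborel_reflect_integrable[OF g_integrable, of 0] by simp

lemma g_measurable [measurable]: "g \<in> borel_measurable borel" "g1 \<in> borel_measurable borel"
  using borel_measurable_integrable[OF g_integrable] borel_measurable_integrable[OF g1_integrable] by auto

lemma g_L2: "integrable lborel (\<lambda>t. (g t)\<^sup>2)" "integrable lborel (\<lambda>t. (g1 t)\<^sup>2)"
  "integrable lborel (\<lambda>t. (g (- t))\<^sup>2)"
proof -
  show "integrable lborel (\<lambda>t. (g t)\<^sup>2)" 
    using g_bounded bounded_integrable_imp_L2[OF g_integrable] by auto
  from lborel_reflect_integrable[OF this, of 0] show "integrable lborel (\<lambda>t. (g (- t))\<^sup>2)" by simp
  show "integrable lborel (\<lambda>t. (g1 t)\<^sup>2)" 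
    using g1_bounded bounded_integrable_imp_L2[OF g1_integrable] by auto
qed

lemma gr_L2_bounded: "L2_bounded (\<lambda>y. g (- y))"
  using g_L2(3) g_bounded unfolding L2_bounded_def bounded_borel_def by auto

lemma K_reflect: "K h t = conv g (\<lambda>y. h (- y)) (- t)"
  unfolding K_def conv_def
  using lborel_reflect_integral[of "\<lambda>y. g y * h (t + y)" 0] by (simp add: add.commute)

lemma L2_bounded_K: "L2_bounded h \<Longrightarrow> L2_bounded (K h)"
  unfolding K_def by (rule L2_bounded_conv[OF gr_integrable])

lemma L2_bounded_G: "L2_bounded h \<Longrightarrow> L2_bounded (G h)"
  unfolding G_def by (intro L2_bounded_conv g_integrable L2_bounded_K)

lemma bounded_borel_K: "bounded_borel h \<Longrightarrow> bounded_borel (K h)"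
  unfolding K_def by (rule bounded_borel_conv[OF gr_integrable])

text \<open>The two factors of \<open>G\<close> are adjoint to each other; symmetry and positivity of the form follow.\<close>

lemma form_eq:
  assumes "L2_bounded k" "L2_bounded h"
  shows "(\<integral>t. k t * G h t \<partial>lborel) = (\<integral>t. K k t * K h t \<partial>lborel)"
  unfolding G_def K_def[of k]
  using conv_adjoint[OF g_integrable, of "K h" k] L2_bounded_K[OF assms(2)] assms
  by (simp add: L2_bounded_def)

lemma J_eq: "L2_bounded h \<Longrightarrow> J h = (\<integral>t. h t * G h t \<partial>lborel)"
  by (simp add: form_eq J_def power2_eq_square)

lemma J_nonneg: "0 \<le> J h" by (simp add: J_def)

lemma K_cmult: "K (\<lambda>t. c * h t) = (\<lambda>t. c * K h t)"
  unfolding K_def by (rule ext) (rule conv_cmult)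

lemma G_cmult: "G (\<lambda>t. c * h t) = (\<lambda>t. c * G h t)"
  unfolding G_def K_cmult by (rule ext) (rule conv_cmult)

lemma J_cmult: "J (\<lambda>t. c * h t) = c\<^sup>2 * J h"
  by (simp add: J_def K_cmult power_mult_distrib)

lemma K_diff: "L2_bounded k \<Longrightarrow> L2_bounded h \<Longrightarrow> K (\<lambda>t. k t - h t) = (\<lambda>t. K k t - K h t)"
  unfolding K_def by (rule ext, rule conv_diff) (auto simp: gr_integrable L2_bounded_def)

text \<open>Two functions of almost maximal \<open>J\<close> whose mixed term is also almost maximal are close to each
  other; this identity measures how close.\<close>

lemma J_diff:
  assumes k: "L2_bounded k" and h: "L2_bounded h"
  shows "J (\<lambda>t. k t - h t) = J k + J h - 2 * (\<integral>t. k t * G h t \<partial>lborel)"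
proof -
  note L = L2_bounded_K[OF k] L2_bounded_K[OF h]
  have i: "integrable lborel (\<lambda>t. K k t * K h t)"
    using L by (intro L2_product_integrable) (auto intro: L2_bounded_measurable simp: L2_bounded_def)
  have "J (\<lambda>t. k t - h t) = (\<integral>t. (K k t)\<^sup>2 + (K h t)\<^sup>2 - 2 * (K k t * K h t) \<partial>lborel)"
    unfolding J_def K_diff[OF k h] by (simp add: power2_diff algebra_simps)
  also have "\<dots> = J k + J h - 2 * (\<integral>t. K k t * K h t \<partial>lborel)"
    using i L by (simp add: J_def L2_bounded_def)
  finally show ?thesis by (simp add: form_eq k h)
qed

lemma G_diff: "L2_bounded k \<Longrightarrow> L2_bounded h \<Longrightarrow> G (\<lambda>t. k t - h t) t = G k t - G h t"
  unfolding G_def K_diff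
  by (rule conv_diff) (auto simp: g_integrable intro: bounded_borel_K simp: L2_bounded_def)

lemma form_Cauchy_Schwarz:
  assumes "L2_bounded k" "L2_bounded h"
  shows "(\<integral>t. k t * G h t \<partial>lborel)\<^sup>2 \<le> J k * J h"
  unfolding form_eq[OF assms] J_def
  using L2_bounded_K[OF assms(1)] L2_bounded_K[OF assms(2)]
  by (intro Cauchy_Schwarz_integral) (auto intro: L2_bounded_measurable simp: L2_bounded_def)

text \<open>This bound and \<open>G_Lipschitz\<close> depend on \<open>h\<close> only through \<open>J h\<close>. They provide all the compactness
  that the maximisation needs.\<close>

lemma G_bound: "L2_bounded h \<Longrightarrow> (G h t)\<^sup>2 \<le> (\<integral>t. (g t)\<^sup>2 \<partial>lborel) * J h"
  unfolding G_def J_def by (intro conv_bound_L2 g_integrable g_L2 L2_bounded_K)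

lemma G_L2_bound:
  assumes "L2_bounded h"
  shows "(\<integral>t. (G h t)\<^sup>2 \<partial>lborel) \<le> (\<integral>t. \<bar>g t\<bar> \<partial>lborel)\<^sup>2 * J h"
  unfolding G_def J_def using L2_bounded_K[OF assms] by (intro conv_L2 g_integrable) (auto simp: L2_bounded_def)

lemma G_Lipschitz:
  assumes h: "L2_bounded h"
  shows "\<bar>G h b - G h a\<bar> \<le> sqrt ((\<integral>t. (g1 t)\<^sup>2 \<partial>lborel) * J h) * \<bar>b - a\<bar>"
  unfolding G_def
proof (rule conv_Lipschitz[OF g_integrable g1_integrable g_primitive])
  show "bounded_borel (K h)" using L2_bounded_K[OF h] by (simp add: L2_bounded_def)
  show "\<bar>conv g1 (K h) t\<bar> \<le> sqrt ((\<integral>t. (g1 t)\<^sup>2 \<partial>lborel) * J h)" for t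
    unfolding J_def by (intro real_le_rsqrt) (simp add: conv_bound_L2 g1_integrable g_L2 L2_bounded_K[OF h])
qed

lemma G_shift: "G (\<lambda>t. h (t + c)) = (\<lambda>t. G h (t + c))"
proof -
  have "K (\<lambda>t. h (t + c)) = (\<lambda>t. K h (t + c))" unfolding K_def by (rule ext) (rule conv_shift)
  then show ?thesis unfolding G_def using conv_shift[of g "K h" c] by auto
qed

lemma J_shift: "J (\<lambda>t. h (t + c)) = J h"
proof -
  have "K (\<lambda>t. h (t + c)) = (\<lambda>t. K h (t + c))" unfolding K_def by (rule ext) (rule conv_shift)
  then show ?thesis unfolding J_def using lborel_shift_integral[of "\<lambda>t. (K h t)\<^sup>2" c] by simp
qed

lemma G_pointwise_limit:
  assumes m: "\<And>n. W n \<in> borel_measurable borel" and b: "\<And>n t. \<bar>W n t\<bar> \<le> B" and lim: "\<And>t. (\<lambda>n. W n t) \<longlonglongrightarrow> w t"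
  shows "(\<lambda>n. G (W n) t) \<longlonglongrightarrow> G w t"
  unfolding G_def
proof (rule conv_dominated_convergence[OF g_integrable])
  have bb: "bounded_borel (W n)" for n using m b unfolding bounded_borel_def by blast
  show "K (W n) \<in> borel_measurable borel" for n using bounded_borel_K[OF bb] by (simp add: bounded_borel_def)
  show "\<bar>K (W n) t\<bar> \<le> B * (\<integral>y. \<bar>g (- y)\<bar> \<partial>lborel)" for n t
    unfolding K_def by (rule conv_bound[OF gr_integrable bb b])
  show "(\<lambda>n. K (W n) t) \<longlonglongrightarrow> K w t" for t
    unfolding K_def by (rule conv_dominated_convergence[OF gr_integrable m b lim])
qed

text \<open>Each of the two factors gains two derivatives, and the derivatives remain square integrable since
  \<open>g1\<close> is integrable and the higher ones are read off from the equation.\<close>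

lemma G_solves:
  assumes h: "L2_bounded h" "continuous_on UNIV h"
  shows "\<exists>V :: nat \<Rightarrow> real \<Rightarrow> real. V 0 = G h \<and> (\<forall>i<4. \<forall>t. (V i has_real_derivative V (Suc i) t) (at t)) \<and>
    (\<forall>i\<le>4. L2_bounded (V i) \<and> continuous_on UNIV (V i)) \<and>
    (\<forall>t. V 4 t - (p\<^sup>2 - 2 * s) * V 2 t + s\<^sup>2 * V 0 t = h t)"
proof -
  \<comment> \<open>\<open>K h\<close> is the reflection of the convolution of \<open>g\<close> with \<open>w\<close>; the functions \<open>z1\<close> and \<open>z2\<close> are the first
    two derivatives of \<open>z = K h\<close>.\<close>
  define w where "w = (\<lambda>y. h (- y))"
  have w: "L2_bounded w" "continuous_on UNIV w" unfolding w_def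
    using h by (auto intro: L2_bounded_reflect intro!: continuous_on_compose2[OF h(2)] continuous_intros)
  have bw: "bounded_borel w" using w by (simp add: L2_bounded_def)
  define z where "z = K h"
  define z1 where "z1 = (\<lambda>t. - conv g1 w (- t))"
  define z2 where "z2 = (\<lambda>t. h t + p * z1 t - s * z t)"
  have zalt: "z = (\<lambda>t. conv g w (- t))" unfolding z_def w_def by (rule ext) (rule K_reflect)
  have g2: "integrable lborel (\<lambda>t. - p * g1 t - s * g t)" using g_integrable g1_integrable by auto
  have c2: "conv (\<lambda>t. - p * g1 t - s * g t) f t = - p * conv g1 f t - s * conv g f t" if "bounded_borel f" for f t
    using conv_integrable[OF g_integrable that, of t] conv_integrable[OF g1_integrable that, of t]
    by (simp add: conv_def left_diff_distrib mult.assoc)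
  have dg: "(conv g f has_real_derivative conv g1 f t) (at t)"
    "(conv g1 f has_real_derivative f t - p * conv g1 f t - s * conv g f t) (at t)"
    if "bounded_borel f" "continuous_on UNIV f" for f t
  proof -
    show "(conv g f has_real_derivative conv g1 f t) (at t)"
      using conv_has_derivative[OF g_integrable g1_integrable g_primitive that, of t] by simp
    have "1 * f t + conv (\<lambda>t. - p * g1 t - s * g t) f t = f t - p * conv g1 f t - s * conv g f t"
      using c2[OF that(1), of t] by linarith
    then show "(conv g1 f has_real_derivative f t - p * conv g1 f t - s * conv g f t) (at t)"
      using conv_has_derivative[OF g1_integrable g2 g1_primitive that, of t] by (simp only:)
  qed
  have dz: "(z has_real_derivative z1 t) (at t)" for t
    unfolding zalt z1_def
    by (rule DERIV_cong, rule DERIV_chain2[OF dg(1)[OF bw w(2)]]) (auto intro!: derivative_eq_intros)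
  have dz1: "(z1 has_real_derivative z2 t) (at t)" for t
    unfolding zalt z1_def z2_def
    by (rule DERIV_cong, rule DERIV_minus, rule DERIV_chain2[OF dg(2)[OF bw w(2)]])
       (auto intro!: derivative_eq_intros simp: w_def)
  have Lz: "L2_bounded z" unfolding z_def by (rule L2_bounded_K[OF h(1)])
  have Lz1: "L2_bounded z1" unfolding z1_def
    using L2_bounded_cmult[OF L2_bounded_reflect[OF L2_bounded_conv[OF g1_integrable w(1)]], of "-1"] by simp
  have Lz2: "L2_bounded z2" unfolding z2_def
    by (intro L2_bounded_diff L2_bounded_add L2_bounded_cmult h Lz Lz1)
  have cz: "continuous_on UNIV z" "continuous_on UNIV z1"
    using dz dz1 by (auto intro: DERIV_continuous_on)
  have cz2: "continuous_on UNIV z2" unfolding z2_def by (intro continuous_intros h cz)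
  have bz: "bounded_borel z" using Lz by (simp add: L2_bounded_def)
  define v where "v = conv g z"
  define v1 where "v1 = conv g1 z"
  define v2 where "v2 = (\<lambda>t. z t - p * v1 t - s * v t)"
  define v3 where "v3 = (\<lambda>t. z1 t - p * v2 t - s * v1 t)"
  define v4 where "v4 = (\<lambda>t. z2 t - p * v3 t - s * v2 t)"
  have d0: "(v has_real_derivative v1 t) (at t)" for t unfolding v_def v1_def by (rule dg(1)[OF bz cz(1)])
  have d1: "(v1 has_real_derivative v2 t) (at t)" for t unfolding v_def v1_def v2_def by (rule dg(2)[OF bz cz(1)])
  have d2: "(v2 has_real_derivative v3 t) (at t)" for t
    unfolding v2_def v3_def by (rule DERIV_cong) (auto intro!: derivative_eq_intros dz d1 d0 simp: v2_def)
  have d3: "(v3 has_real_derivative v4 t) (at t)" for t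
    unfolding v3_def v4_def by (rule DERIV_cong) (auto intro!: derivative_eq_intros dz1 d2 d1 simp: v3_def)
  have L: "L2_bounded v" "L2_bounded v1" unfolding v_def v1_def
    by (intro L2_bounded_conv g_integrable g1_integrable Lz)+
  have L2: "L2_bounded v2" unfolding v2_def by (intro L2_bounded_diff L2_bounded_cmult L Lz)
  have L3: "L2_bounded v3" unfolding v3_def by (intro L2_bounded_diff L2_bounded_cmult L L2 Lz1)
  have L4: "L2_bounded v4" unfolding v4_def by (intro L2_bounded_diff L2_bounded_cmult L2 L3 Lz2)
  have c: "continuous_on UNIV v" "continuous_on UNIV v1" "continuous_on UNIV v2" "continuous_on UNIV v3"
    by (rule DERIV_continuous_on, rule d0) (rule DERIV_continuous_on, rule d1 d2 d3)+
  have c4: "continuous_on UNIV v4" unfolding v4_def by (intro continuous_intros c cz2)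
  have eq: "v4 t - (p\<^sup>2 - 2 * s) * v2 t + s\<^sup>2 * v t = h t" for t
    unfolding v4_def v3_def v2_def z2_def by (simp add: algebra_simps power2_eq_square)
  define V where "V = (\<lambda>i. [v, v1, v2, v3, v4] ! i)"
  have i4: "i < 4 \<longleftrightarrow> i = 0 \<or> i = 1 \<or> i = 2 \<or> i = (3::nat)" for i by auto
  have i5: "i \<le> 4 \<longleftrightarrow> i = 0 \<or> i = 1 \<or> i = 2 \<or> i = 3 \<or> i = (4::nat)" for i by auto
  have V: "V 0 = v" "V 1 = v1" "V 2 = v2" "V 3 = v3" "V 4 = v4" "V (Suc 0) = v1"
    "V (Suc 1) = v2" "V (Suc 2) = v3" "V (Suc 3) = v4" by (simp_all add: V_def eval_nat_numeral)
  have "V 0 = G h" by (simp add: V v_def G_def z_def)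
  moreover have "\<forall>i<4. \<forall>t. (V i has_real_derivative V (Suc i) t) (at t)"
    unfolding i4 using d0 d1 d2 d3 V by auto
  moreover have "\<forall>i\<le>4. L2_bounded (V i) \<and> continuous_on UNIV (V i)"
    unfolding i5 using L L2 L3 L4 c c4 V by auto
  ultimately show ?thesis using eq V by (intro exI[of _ V]) simp
qed

end

section \<open>The dual variational problem\<close>

text \<open>The dual problem is posed on bounded functions, for which \<open>G\<close> is defined pointwise; the maximiser
  turns out to belong to this class.\<close>

definition admissible :: "real \<Rightarrow> (real \<Rightarrow> real) \<Rightarrow> bool" where
  "admissible r h \<longleftrightarrow> bounded_borel h \<and> integrable lborel (\<lambda>t. \<bar>h t\<bar> powr r)"

definition power_mass :: "real \<Rightarrow> (real \<Rightarrow> real) \<Rightarrow> real" where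
  "power_mass r h = (\<integral>t. \<bar>h t\<bar> powr r \<partial>lborel)"

text \<open>The nonlinearity of the equation, which is also the duality map between the exponents \<open>q\<close> and \<open>q / (q - 1)\<close>.\<close>

definition signed_power :: "real \<Rightarrow> real \<Rightarrow> real" where
  "signed_power q x = \<bar>x\<bar> powr (q - 2) * x"

lemma powr_integrable_mono:
  assumes h: "bounded_borel h" "integrable lborel (\<lambda>t. \<bar>h t\<bar> powr r)" and "r \<le> q" "0 < r"
  shows "integrable lborel (\<lambda>t. \<bar>h t\<bar> powr q)"
proof -
  obtain B where B: "0 \<le> B" "\<And>t. \<bar>h t\<bar> \<le> B" and [measurable]: "h \<in> borel_measurable borel"
    using bounded_borelE[OF h(1)] by metis
  show ?thesis
  proof (rule Bochner_Integration.integrable_bound[OF integrable_mult_right[OF h(2), of "B powr (q - r)"]])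
    have "\<bar>h t\<bar> powr q \<le> B powr (q - r) * \<bar>h t\<bar> powr r" for t
    proof -
      have "\<bar>h t\<bar> powr q = \<bar>h t\<bar> powr (q - r) * \<bar>h t\<bar> powr r"
        by (simp flip: powr_add)
      also have "\<dots> \<le> B powr (q - r) * \<bar>h t\<bar> powr r"
        using B assms by (intro mult_right_mono powr_mono2) auto
      finally show ?thesis .
    qed
    then show "AE t in lborel. norm (\<bar>h t\<bar> powr q) \<le> norm (B powr (q - r) * \<bar>h t\<bar> powr r)" by auto
  qed measurable
qed

lemma admissible_L2_bounded:
  assumes "admissible r h" "0 < r" "r \<le> 2"
  shows "L2_bounded h"
  using powr_integrable_mono[of h r 2] assms unfolding admissible_def L2_bounded_def by simp

lemma signed_power_abs: "2 < q \<Longrightarrow> \<bar>signed_power q x\<bar> = \<bar>x\<bar> powr (q - 1)"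
proof -
  assume "2 < q"
  show ?thesis using powr_add[of "\<bar>x\<bar>" "q - 2" 1] by (simp add: signed_power_def abs_mult)
qed

lemma signed_power_mult: "2 < q \<Longrightarrow> signed_power q x * x = \<bar>x\<bar> powr q"
proof -
  assume "2 < q"
  have "\<bar>x\<bar> powr 2 = x * x" by (simp add: power2_eq_square)
  then show ?thesis using powr_add[of "\<bar>x\<bar>" "q - 2" 2] by (simp add: signed_power_def)
qed

lemma signed_power_scale: "0 < c \<Longrightarrow> 2 < q \<Longrightarrow> signed_power q (c * x) = c powr (q - 1) * signed_power q x"
proof -
  assume c: "0 < c" "2 < q"
  have "c powr (q - 1) = c powr (q - 2) * c" using powr_add[of c "q - 2" 1] c by simp
  then show ?thesis using c by (simp add: signed_power_def abs_mult powr_mult)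
qed

lemma signed_power_continuous:
  assumes "2 < q" "continuous_on S f"
  shows "continuous_on S (\<lambda>x. signed_power q (f x))"
  unfolding signed_power_def
  using assms by (intro continuous_intros continuous_on_powr') auto

lemma signed_power_measurable [measurable]: "signed_power q \<in> borel_measurable borel"
  unfolding signed_power_def by measurable

lemma admissible_signed_power:
  assumes q: "2 < q" and v: "L2_bounded v"
  shows "admissible (q / (q - 1)) (\<lambda>t. signed_power q (v t))" "integrable lborel (\<lambda>t. \<bar>v t\<bar> powr q)"
    "power_mass (q / (q - 1)) (\<lambda>t. signed_power q (v t)) = (\<integral>t. \<bar>v t\<bar> powr q \<partial>lborel)"
proof -
  have bv: "bounded_borel v" using v by (simp add: L2_bounded_def)
  obtain B where B: "0 \<le> B" "\<And>t. \<bar>v t\<bar> \<le> B" and [measurable]: "v \<in> borel_measurable borel"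
    using bounded_borelE[OF bv] by metis
  show i: "integrable lborel (\<lambda>t. \<bar>v t\<bar> powr q)"
    using powr_integrable_mono[of v 2 q] v q unfolding L2_bounded_def by simp
  have e: "\<bar>signed_power q x\<bar> powr (q / (q - 1)) = \<bar>x\<bar> powr q" for x
    using q by (simp add: signed_power_abs powr_powr)
  have "\<bar>signed_power q (v t)\<bar> \<le> B powr (q - 1)" for t
    using B q by (auto simp: signed_power_abs intro!: powr_mono2)
  then show "admissible (q / (q - 1)) (\<lambda>t. signed_power q (v t))"
    unfolding admissible_def bounded_borel_def using i by (auto simp: e)
  show "power_mass (q / (q - 1)) (\<lambda>t. signed_power q (v t)) = (\<integral>t. \<bar>v t\<bar> powr q \<partial>lborel)"
    by (simp add: power_mass_def e)
qed

text \<open>Hoelder's inequality from Young's, after scaling by \<open>P powr (1 / q)\<close>, where \<open>P = \<integral>\<bar>v\<bar> powr q\<close>.\<close>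

lemma Hoelder_unit_ball:
  fixes h v :: "real \<Rightarrow> real"
  assumes q: "1 < q" and r: "r = q / (q - 1)"
    and [measurable]: "h \<in> borel_measurable borel" "v \<in> borel_measurable borel"
    and h: "integrable lborel (\<lambda>t. \<bar>h t\<bar> powr r)" "(\<integral>t. \<bar>h t\<bar> powr r \<partial>lborel) \<le> 1"
    and v: "integrable lborel (\<lambda>t. \<bar>v t\<bar> powr q)"
  shows "(\<integral>t. h t * v t \<partial>lborel) \<le> (\<integral>t. \<bar>v t\<bar> powr q \<partial>lborel) powr (1 / q)"
proof -
  define P where "P = (\<integral>t. \<bar>v t\<bar> powr q \<partial>lborel)"
  have P0: "P \<ge> 0" by (simp add: P_def)
  show ?thesis
  proof (cases "P = 0")
    case True
    then have "AE t in lborel. \<bar>v t\<bar> powr q = 0"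
      using integral_nonneg_eq_0_iff_AE[OF v] by (simp add: P_def)
    then have "AE t in lborel. h t * v t = 0" by eventually_elim simp
    then have "(\<integral>t. h t * v t \<partial>lborel) = (\<integral>t. 0 \<partial>(lborel::real measure))" by (intro integral_cong_AE) auto
    then show ?thesis using True by (simp add: P_def)
  next
    case False
    with P0 have P: "P > 0" by simp
    define c where "c = P powr (1 / q)"
    have c: "c > 0" "c powr q = P" using P q by (auto simp: c_def powr_powr)
    have r1: "r > 1" "1 / r + 1 / q = 1" using q by (auto simp: r field_simps)
    have "(\<integral>t. h t * v t \<partial>lborel) \<le> (\<integral>t. c * (\<bar>h t\<bar> powr r / r + (\<bar>v t\<bar> powr q) / P / q) \<partial>lborel)"
    proof (rule integral_mono_AE')
      have "h t * v t \<le> c * (\<bar>h t\<bar> powr r / r + (\<bar>v t\<bar> powr q) / P / q)" for t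
      proof -
        have "h t * v t \<le> c * (\<bar>h t\<bar> * (\<bar>v t\<bar> / c))"
          using c by (simp add: field_simps) (metis abs_ge_self abs_mult mult.commute)
        also have "\<dots> \<le> c * (\<bar>h t\<bar> powr r / r + (\<bar>v t\<bar> / c) powr q / q)"
          using c r1 q by (intro mult_left_mono Youngs_inequality) auto
        also have "(\<bar>v t\<bar> / c) powr q = (\<bar>v t\<bar> powr q) / P"
          using c by (simp add: powr_divide)
        finally show ?thesis .
      qed
      then show "AE t in lborel. h t * v t \<le> c * (\<bar>h t\<bar> powr r / r + (\<bar>v t\<bar> powr q) / P / q)" by simp
      show "AE t in lborel. 0 \<le> c * (\<bar>h t\<bar> powr r / r + (\<bar>v t\<bar> powr q) / P / q)"
        using c r1 q P by (intro AE_I2 mult_nonneg_nonneg add_nonneg_nonneg divide_nonneg_nonneg) auto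
    qed (use h v in auto)
    also have "\<dots> = c * ((\<integral>t. \<bar>h t\<bar> powr r \<partial>lborel) / r + P / P / q)"
      using h v by (simp add: P_def)
    also have "\<dots> \<le> c * (1 / r + 1 / q)"
      using c h r1 P q by (intro mult_left_mono add_mono divide_right_mono) auto
    also have "\<dots> = c" using r1 by simp
    finally show ?thesis by (simp add: c_def P_def)
  qed
qed

lemma admissible_cmult:
  "admissible r h \<Longrightarrow> admissible r (\<lambda>t. c * h t)" "power_mass r (\<lambda>t. c * h t) = \<bar>c\<bar> powr r * power_mass r h"
  unfolding admissible_def power_mass_def by (auto simp: abs_mult powr_mult bounded_borel_cmult)

lemma admissible_shift:
  assumes "admissible r h"
  shows "admissible r (\<lambda>t. h (t + c))" "power_mass r (\<lambda>t. h (t + c)) = power_mass r h"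
proof -
  have [measurable]: "h \<in> borel_measurable borel" using assms by (simp add: admissible_def bounded_borel_def)
  show "admissible r (\<lambda>t. h (t + c))"
    using assms lborel_shift_integrable[of "\<lambda>t. \<bar>h t\<bar> powr r" c] unfolding admissible_def bounded_borel_def by auto
  show "power_mass r (\<lambda>t. h (t + c)) = power_mass r h"
    unfolding power_mass_def using lborel_shift_integral[of "\<lambda>t. \<bar>h t\<bar> powr r" c] by simp
qed

lemma power_mass_nonneg: "0 \<le> power_mass r h"
  by (simp add: power_mass_def)

context damped_kernel
begin

text \<open>Since \<open>1 < r \<le> 2\<close>, the part of \<open>h\<close> where \<open>\<bar>h\<bar> \<le> 1\<close> is controlled in \<open>L\<^sup>2\<close> and the remaining part in
  \<open>L\<^sup>1\<close>. The kernel lies in both spaces, so Young's inequality bounds \<open>K\<close> on each part in \<open>L\<^sup>2\<close>.\<close>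

lemma J_bounded_on_unit_ball:
  assumes r: "1 < r" "r \<le> 2" and h: "admissible r h" "power_mass r h \<le> 1"
  shows "J h \<le> 2 * (\<integral>t. \<bar>g t\<bar> \<partial>lborel)\<^sup>2 + 2 * (\<integral>t. (g t)\<^sup>2 \<partial>lborel)"
proof -
  have bh: "bounded_borel h" and ih: "integrable lborel (\<lambda>t. \<bar>h t\<bar> powr r)"
    using h by (auto simp: admissible_def)
  obtain B where B: "0 \<le> B" "\<And>t. \<bar>h t\<bar> \<le> B" and [measurable]: "h \<in> borel_measurable borel"
    using bounded_borelE[OF bh] by metis
  define h1 where "h1 = (\<lambda>t. if \<bar>h t\<bar> \<le> 1 then h t else 0)"
  define h2 where "h2 = (\<lambda>t. if \<bar>h t\<bar> \<le> 1 then 0 else h t)"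
  have [measurable]: "h1 \<in> borel_measurable borel" "h2 \<in> borel_measurable borel"
    unfolding h1_def h2_def by measurable
  have bb: "bounded_borel h1" "bounded_borel h2"
    using B unfolding bounded_borel_def by (auto simp: h1_def h2_def)
  have p1: "(h1 t)\<^sup>2 \<le> \<bar>h t\<bar> powr r" for t
  proof (cases "\<bar>h t\<bar> \<le> 1 \<and> h t \<noteq> 0")
    case True
    have "\<bar>h t\<bar> powr 2 \<le> \<bar>h t\<bar> powr r" using True r by (intro powr_mono') auto
    then show ?thesis using True by (simp add: h1_def)
  qed (auto simp: h1_def)
  have p2: "\<bar>h2 t\<bar> \<le> \<bar>h t\<bar> powr r" for t
  proof (cases "\<bar>h t\<bar> \<le> 1")
    case False
    have "\<bar>h t\<bar> powr 1 \<le> \<bar>h t\<bar> powr r" using False r by (intro powr_mono) auto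
    then show ?thesis using False by (simp add: h2_def)
  qed (auto simp: h2_def)
  have i1: "integrable lborel (\<lambda>t. (h1 t)\<^sup>2)"
    by (rule Bochner_Integration.integrable_bound[OF ih]) (use p1 in auto)
  have i2: "integrable lborel h2"
    by (rule Bochner_Integration.integrable_bound[OF ih]) (use p2 in auto)
  have n1: "(\<integral>t. (h1 t)\<^sup>2 \<partial>lborel) \<le> 1"
    using integral_mono[OF i1 ih p1] h(2) by (simp add: power_mass_def)
  have n2: "(\<integral>t. \<bar>h2 t\<bar> \<partial>lborel) \<le> 1"
    using integral_mono[OF integrable_abs[OF i2] ih p2] h(2) by (simp add: power_mass_def)
  have L1: "L2_bounded h1" using bb i1 by (simp add: L2_bounded_def)
  have L2: "L2_bounded h2"
  proof -
    obtain C where "\<And>t. \<bar>h2 t\<bar> \<le> C" using bounded_borelE[OF bb(2)] by metis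
    from bounded_integrable_imp_L2[OF i2 this] show ?thesis using bb by (simp add: L2_bounded_def)
  qed
  have gr: "(\<integral>t. \<bar>g (- t)\<bar> \<partial>lborel) = (\<integral>t. \<bar>g t\<bar> \<partial>lborel)" "(\<integral>t. (g (- t))\<^sup>2 \<partial>lborel) = (\<integral>t. (g t)\<^sup>2 \<partial>lborel)"
    using lborel_reflect_integral[of "\<lambda>t. \<bar>g t\<bar>" 0] lborel_reflect_integral[of "\<lambda>t. (g t)\<^sup>2" 0] by simp_all
  have "J h1 \<le> (\<integral>t. \<bar>g t\<bar> \<partial>lborel)\<^sup>2 * (\<integral>t. (h1 t)\<^sup>2 \<partial>lborel)"
    unfolding J_def K_def using conv_L2(2)[OF gr_integrable bb(1) i1] by (simp add: gr)
  also have "\<dots> \<le> (\<integral>t. \<bar>g t\<bar> \<partial>lborel)\<^sup>2" using n1 by (intro mult_right_le_one_le) auto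
  finally have J1: "J h1 \<le> (\<integral>t. \<bar>g t\<bar> \<partial>lborel)\<^sup>2" .
  have "J h2 = (\<integral>t. (conv h2 (\<lambda>y. g (- y)) t)\<^sup>2 \<partial>lborel)"
    unfolding J_def K_def by (subst conv_commute) simp
  also have "\<dots> \<le> (\<integral>t. \<bar>h2 t\<bar> \<partial>lborel)\<^sup>2 * (\<integral>t. (g (- t))\<^sup>2 \<partial>lborel)"
    using conv_L2(2)[OF i2] gr_L2_bounded by (simp add: L2_bounded_def)
  also have "\<dots> \<le> 1 * (\<integral>t. (g t)\<^sup>2 \<partial>lborel)"
    unfolding gr using n2 by (intro mult_right_mono) (auto simp: power_le_one_iff abs_square_le_1)
  finally have J2: "J h2 \<le> (\<integral>t. (g t)\<^sup>2 \<partial>lborel)" by simp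
  have hh: "h = (\<lambda>t. h1 t + h2 t)" by (auto simp: h1_def h2_def)
  have Kh: "K h t = K h1 t + K h2 t" for t
    by (subst hh, unfold K_def, rule conv_add) (auto simp: gr_integrable bb)
  have iK: "integrable lborel (\<lambda>t. (K h1 t)\<^sup>2)" "integrable lborel (\<lambda>t. (K h2 t)\<^sup>2)"
    using L2_bounded_K[OF L1] L2_bounded_K[OF L2] by (auto simp: L2_bounded_def)
  have "J h \<le> (\<integral>t. 2 * (K h1 t)\<^sup>2 + 2 * (K h2 t)\<^sup>2 \<partial>lborel)"
    unfolding J_def
  proof (rule integral_mono)
    show "integrable lborel (\<lambda>t. (K h t)\<^sup>2)"
      using L2_bounded_K[OF L2_bounded_add[OF L1 L2]] by (simp add: hh[symmetric] L2_bounded_def)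
    show "(K h t)\<^sup>2 \<le> 2 * (K h1 t)\<^sup>2 + 2 * (K h2 t)\<^sup>2" for t
      unfolding Kh using sum_squares_bound[of "K h1 t" "K h2 t"] by (simp add: power2_sum)
  qed (use iK in auto)
  also have "\<dots> = 2 * J h1 + 2 * J h2" using iK by (simp add: J_def)
  finally show ?thesis using J1 J2 by simp
qed

text \<open>\<open>J\<close> has degree \<open>2\<close> and the mass has degree \<open>r\<close>, whence the exponent \<open>2 / r\<close>.\<close>

lemma J_homogeneous_bound:
  assumes r: "1 < r" "r \<le> 2" and M: "\<And>h. admissible r h \<Longrightarrow> power_mass r h \<le> 1 \<Longrightarrow> J h \<le> M"
    and h: "admissible r h"
  shows "J h \<le> M * power_mass r h powr (2 / r)"
proof (cases "power_mass r h = 0")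
  case True
  have bh: "bounded_borel h" and ih: "integrable lborel (\<lambda>t. \<bar>h t\<bar> powr r)"
    using h by (auto simp: admissible_def)
  have "AE t in lborel. \<bar>h t\<bar> powr r = 0"
    using integral_nonneg_eq_0_iff_AE[OF ih] True by (simp add: power_mass_def)
  then have h0: "AE t in lborel. h t = 0" by eventually_elim simp
  have "L2_bounded h" using admissible_L2_bounded[OF h] r by simp
  then have "J h = (\<integral>t. h t * G h t \<partial>lborel)" by (rule J_eq)
  also have "\<dots> = (\<integral>t. 0 \<partial>(lborel :: real measure))"
    using h0 bh L2_bounded_measurable[OF L2_bounded_G[OF \<open>L2_bounded h\<close>]]
    by (intro integral_cong_AE) (auto simp: bounded_borel_def)
  finally show ?thesis using True by simp
next
  case False
  define n where "n = power_mass r h"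
  have n: "n > 0" using False power_mass_nonneg[of r h] by (simp add: n_def)
  define c where "c = n powr (- 1 / r)"
  have c: "c > 0" using n by (simp add: c_def)
  have "c powr r = n powr (- 1)" unfolding c_def powr_powr using r by simp
  then have "\<bar>c\<bar> powr r * n = 1" using n c by (simp add: powr_neg_one)
  then have "J (\<lambda>t. c * h t) \<le> M"
    using M[OF admissible_cmult(1)[OF h, of c]] by (simp add: admissible_cmult(2) n_def)
  then have "c\<^sup>2 * J h \<le> M" by (simp add: J_cmult)
  moreover have "c\<^sup>2 = 1 / n powr (2 / r)"
    using n by (simp add: c_def power2_eq_square powr_minus divide_inverse flip: powr_add)
       (simp add: powr_add[symmetric] powr_minus[symmetric])
  ultimately have "J h / n powr (2 / r) \<le> M" by simp
  then show ?thesis using n by (simp add: pos_divide_le_eq n_def)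
qed

end

section \<open>Existence of a maximiser\<close>

text \<open>A diagonal subsequence converges at the rational points, and the Lipschitz bound carries the Cauchy
  property to all points.\<close>

lemma equi_Lipschitz_pointwise_subsequence:
  fixes v :: "nat \<Rightarrow> real \<Rightarrow> real"
  assumes b: "\<And>n t. \<bar>v n t\<bar> \<le> B" and L: "\<And>n a b. \<bar>v n b - v n a\<bar> \<le> L * \<bar>b - a\<bar>"
  obtains k w where "strict_mono (k :: nat \<Rightarrow> nat)" "\<And>t. (\<lambda>n. v (k n) t) \<longlonglongrightarrow> w t"
proof -
  obtain k where k: "strict_mono (k :: nat \<Rightarrow> nat)" "\<And>x. x \<in> \<rat> \<Longrightarrow> \<exists>l. (\<lambda>n. v (k n) x) \<longlonglongrightarrow> l"
    using function_convergent_subsequence[OF countable_rat, of v B] b by (metis real_norm_def)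
  have L0: "L \<ge> 0" using L[of 0 1 0] by (auto intro: order_trans[OF abs_ge_zero])
  have "Cauchy (\<lambda>n. v (k n) t)" for t
  proof (rule metric_CauchyI)
    fix e :: real assume e: "0 < e"
    obtain x where x: "x \<in> \<rat>" "t < x" "x < t + e / (3 * (L + 1))"
      using Rats_dense_in_real[of t "t + e / (3 * (L + 1))"] e L0 by (auto simp: field_simps)
    have small: "\<bar>v (k n) t - v (k n) x\<bar> < e / 3" for n
    proof -
      have "\<bar>v (k n) t - v (k n) x\<bar> \<le> L * \<bar>t - x\<bar>" by (rule L)
      also have "\<dots> \<le> (L + 1) * \<bar>t - x\<bar>" by (intro mult_right_mono) auto
      also have "\<dots> < (L + 1) * (e / (3 * (L + 1)))" using x L0 by (intro mult_strict_left_mono) auto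
      also have "\<dots> = e / 3" using L0 by (simp add: field_simps)
      finally show ?thesis .
    qed
    have "Cauchy (\<lambda>n. v (k n) x)" using k(2)[OF x(1)] LIMSEQ_imp_Cauchy by blast
    then obtain N where N: "\<And>m n. m \<ge> N \<Longrightarrow> n \<ge> N \<Longrightarrow> dist (v (k m) x) (v (k n) x) < e / 3"
      using metric_CauchyD[of _ "e / 3"] e by (metis divide_pos_pos zero_less_numeral)
    have "dist (v (k m) t) (v (k n) t) < e" if "m \<ge> N" "n \<ge> N" for m n
      using N[OF that] small[of m] small[of n] unfolding dist_real_def by linarith
    then show "\<exists>N. \<forall>m\<ge>N. \<forall>n\<ge>N. dist (v (k m) t) (v (k n) t) < e" by blast
  qed
  then have "\<exists>w. \<forall>t. (\<lambda>n. v (k n) t) \<longlonglongrightarrow> w t"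
    by (intro choice allI) (simp add: Cauchy_convergent_iff convergent_def)
  then show ?thesis using k(1) that by blast
qed

lemma integral_positive_continuous:
  fixes f :: "real \<Rightarrow> real"
  assumes c: "continuous_on UNIV f" and nn: "\<And>t. 0 \<le> f t" and i: "integrable lborel f" and p: "f a \<noteq> 0"
  shows "0 < (\<integral>t. f t \<partial>lborel)"
proof (rule ccontr)
  assume "\<not> ?thesis"
  then have "(\<integral>t. f t \<partial>lborel) = 0"
    using integral_nonneg_AE[OF AE_I2[of lborel "\<lambda>t. 0 \<le> f t"]] nn by (simp add: order_antisym)
  then have "AE t in lborel. f t = 0" using integral_nonneg_eq_0_iff_AE[OF i] nn by simp
  then have "AE t in lebesgue. t \<in> {t. f t = 0}" by (simp add: AE_completion)
  moreover have "closed {t. f t = 0}" by (rule closed_Collect_eq) (use c in auto)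
  ultimately have "{t. f t = 0} = UNIV"
    using mem_closed_if_AE_lebesgue[of "{t. f t = 0}"] by auto
  then show False using p by blast
qed

context damped_kernel
begin

text \<open>If \<open>G h\<close> vanished, so would its derivatives, and the equation would give \<open>h = 0\<close>.\<close>

lemma G_not_zero:
  assumes h: "L2_bounded h" "continuous_on UNIV h" and a: "h a \<noteq> 0"
  shows "\<exists>t. G h t \<noteq> 0"
proof (rule ccontr)
  assume n: "\<nexists>t. G h t \<noteq> 0"
  obtain V where V: "V 0 = G h" "\<And>i t. i < 4 \<Longrightarrow> (V i has_real_derivative V (Suc i) t) (at t)"
     "\<And>t. V 4 t - (p\<^sup>2 - 2 * s) * V 2 t + s\<^sup>2 * V 0 t = h t"
    using G_solves[OF h] by metis
  have "i \<le> 4 \<Longrightarrow> V i = (\<lambda>_. 0)" for i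
  proof (induction i)
    case 0
    then show ?case using V(1) n by auto
  next
    case (Suc i)
    then have "V i = (\<lambda>_. 0)" by simp
    then have "((\<lambda>_. 0) has_real_derivative V (Suc i) t) (at t)" for t
      using V(2)[of i t] Suc.prems by simp
    then show ?case using DERIV_unique[OF _ DERIV_const] by fastforce
  qed
  from this[of 4] this[of 2] this[of 0] V(3)[of a] a show False by simp
qed

text \<open>Let \<open>h\<^sub>n\<close> be a maximising sequence and \<open>v\<^sub>n = G h\<^sub>n\<close>. The steps are: \<open>\<integral>\<bar>v\<^sub>n\<bar> powr q\<close> converges, since Hoelder's
  inequality and the Cauchy--Schwarz inequality for the form bound it from both sides; \<open>v\<^sub>n\<close> does not tend to
  \<open>0\<close> uniformly, because \<open>q > 2\<close>, so that translations bring a point where it is large to the origin; the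
  normalised duals \<open>k\<^sub>n\<close> of \<open>v\<^sub>n\<close> satisfy \<open>J (k\<^sub>n - h\<^sub>n) \<rightarrow> 0\<close>, so that \<open>G k\<^sub>n\<close> and \<open>v\<^sub>n\<close> have the same
  pointwise limit \<open>w\<close>, and \<open>w\<close> solves \<open>w = G (M powr (1 - q) * \<bar>w\<bar> powr (q - 2) * w)\<close>. Finally the
  dual of \<open>w\<close> has mass exactly \<open>1\<close>, and a multiple of \<open>w\<close> is the required solution. The integral in the
  conclusion is the value that makes the lower bound for the energy sharp.\<close>

theorem maximizer_exists:
  assumes q: "2 < q" and r: "r = q / (q - 1)"
  obtains M v where "0 < M" "\<And>h. admissible r h \<Longrightarrow> J h \<le> M * power_mass r h powr (2 / r)"
    "L2_bounded v" "continuous_on UNIV v"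
    "v = G (\<lambda>t. signed_power q (v t))" "(\<integral>t. \<bar>v t\<bar> powr q \<partial>lborel) powr (1 - 2 / q) = 1 / M"
proof -
  have r12: "1 < r" "r < 2" "1 / r + 1 / q = 1" "(q - 1) * r = q" "1 / r = 1 - 1 / q" "q / r = q - 1"
    using q by (auto simp: r field_simps)
  define S where "S = {h. admissible r h \<and> power_mass r h \<le> 1}"
  define M where "M = (SUP h\<in>S. J h)"
  have L2: "L2_bounded h" if "admissible r h" for h using admissible_L2_bounded[OF that] r12 by simp
  have bdd: "bdd_above (J ` S)"
    unfolding S_def using J_bounded_on_unit_ball[of r] r12 by (intro bdd_aboveI2) auto
  have JM: "J h \<le> M" if "admissible r h" "power_mass r h \<le> 1" for h
    unfolding M_def using that bdd by (intro cSUP_upper) (auto simp: S_def)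
  have hom: "J h \<le> M * power_mass r h powr (2 / r)" if "admissible r h" for h
    using J_homogeneous_bound[of r M h] r12 JM that by auto
  \<comment> \<open>\<open>J\<close> is positive at the tent function \<open>b\<close>, which makes the supremum positive.\<close>
  define b where "b = (\<lambda>t::real. max 0 (1 - \<bar>t\<bar>))"
  have bc: "continuous_on UNIV b" unfolding b_def by (intro continuous_intros)
  have bL: "L2_bounded b"
  proof -
    have "bounded_borel b" unfolding bounded_borel_def
      using borel_measurable_continuous_onI[OF bc] by (auto simp: b_def intro!: exI[of _ 1])
    moreover have "integrable lborel (\<lambda>t. (b t)\<^sup>2)"
    proof (rule Bochner_Integration.integrable_bound[of _ "indicator {-1..1}"])
      have "(b t)\<^sup>2 \<le> indicator {-1..1} t" for t :: real
        by (auto simp: b_def indicator_def max_def abs_square_le_1)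
      then show "AE t in lborel. norm ((b t)\<^sup>2) \<le> norm (indicat_real {-1..1} t)" by simp
    qed (use borel_measurable_continuous_onI[OF bc] in \<open>auto simp: integrable_indicator_iff\<close>)
    ultimately show ?thesis by (simp add: L2_bounded_def)
  qed
  obtain t0 where t0: "G b t0 \<noteq> 0" using G_not_zero[OF bL bc, of 0] by (auto simp: b_def)
  then have Jb: "J b > 0" using G_bound[OF bL, of t0] J_nonneg[of b]
    by (smt (verit) mult_eq_0_iff not_sum_power2_lt_zero power2_eq_square zero_less_power2)
  have ab: "admissible r b"
  proof -
    have "integrable lborel (\<lambda>t. \<bar>b t\<bar> powr r)"
    proof (rule Bochner_Integration.integrable_bound[of _ "indicator {-1..1}"])
      have "\<bar>b t\<bar> powr r \<le> indicator {-1..1} t" for t :: real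
        using r12 by (auto simp: b_def indicator_def max_def powr_le1)
      then show "AE t in lborel. norm (\<bar>b t\<bar> powr r) \<le> norm (indicat_real {-1..1} t)" by simp
    qed (use borel_measurable_continuous_onI[OF bc] in \<open>auto simp: integrable_indicator_iff\<close>)
    then show ?thesis using bL by (simp add: admissible_def L2_bounded_def)
  qed
  have Mpos: "M > 0"
  proof (rule ccontr)
    assume "\<not> M > 0"
    then have "M * power_mass r b powr (2 / r) \<le> 0" by (simp add: mult_nonpos_nonneg)
    then show False using hom[OF ab] Jb by linarith
  qed
  \<comment> \<open>These two bounds hold for every \<open>h\<close> of mass at most \<open>1\<close>. If \<open>J h\<close> is close to \<open>M\<close>, they force
    \<open>Q (G h)\<close> to be close to \<open>M powr q\<close>.\<close>
  define Q where "Q v = (\<integral>t. \<bar>v t\<bar> powr q \<partial>lborel)" for v :: "real \<Rightarrow> real"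
  have Q_lower: "J h \<le> Q (G h) powr (1 / q)" if "admissible r h" "power_mass r h \<le> 1" for h
  proof -
    have "integrable lborel (\<lambda>t. \<bar>G h t\<bar> powr q)"
      by (rule admissible_signed_power(2)[OF q L2_bounded_G[OF L2[OF that(1)]]])
    then show ?thesis unfolding J_eq[OF L2[OF that(1)]] Q_def
      using Hoelder_unit_ball[of q r h "G h"] that q r L2_bounded_measurable[OF L2_bounded_G[OF L2[OF that(1)]]]
      by (auto simp: admissible_def bounded_borel_def power_mass_def)
  qed
  have Q_upper: "Q (G h) powr (2 / q) \<le> M * J h" if "admissible r h" for h
  proof -
    let ?k = "\<lambda>t. signed_power q (G h t)"
    note LG = L2_bounded_G[OF L2[OF that]]
    note a = admissible_signed_power[OF q LG, folded r]
    have Q0: "Q (G h) \<ge> 0" by (simp add: Q_def)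
    have "(\<integral>t. ?k t * G h t \<partial>lborel) = Q (G h)" using q by (simp add: signed_power_mult Q_def)
    then have "(Q (G h))\<^sup>2 \<le> J ?k * J h" using form_Cauchy_Schwarz[OF L2[OF a(1)] L2[OF that]] by simp
    also have "\<dots> \<le> (M * Q (G h) powr (2 / r)) * J h"
      using hom[OF a(1)] J_nonneg by (intro mult_right_mono) (auto simp: a(3) Q_def)
    finally have le: "(Q (G h))\<^sup>2 \<le> Q (G h) powr (2 / r) * (M * J h)" by (simp add: mult_ac)
    show ?thesis
    proof (cases "Q (G h) = 0")
      case False
      with Q0 have Qp: "Q (G h) > 0" by simp
      have e: "2 / r + 2 / q = 2" using r12(3) by (simp add: field_simps)
      have "Q (G h) powr (2 / r) * Q (G h) powr (2 / q) = (Q (G h))\<^sup>2"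
        using Qp by (simp flip: powr_add add: e)
      then have "Q (G h) powr (2 / r) * Q (G h) powr (2 / q) \<le> Q (G h) powr (2 / r) * (M * J h)" using le by simp
      then show ?thesis by (rule mult_left_le_imp_le) (use Qp in simp)
    qed (use Mpos J_nonneg in auto)
  qed
  \<comment> \<open>The choice \<open>e n \<le> M / 2\<close> keeps \<open>J\<close> above \<open>M / 2\<close> from the first index on.\<close>
  define e where "e n = M / (real n + 2)" for n :: nat
  have "\<exists>h. admissible r h \<and> power_mass r h \<le> 1 \<and> M - e n < J h" for n :: nat
  proof -
    have "M - e n < M" using Mpos by (simp add: e_def)
    moreover have "S \<noteq> {}"
      by (auto simp: S_def admissible_def power_mass_def bounded_borel_def intro!: exI[of _ "\<lambda>_. 0"])
    ultimately have "\<exists>h\<in>S. M - e n < J h"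
      unfolding M_def using less_cSUP_iff[OF _ bdd] by blast
    then show ?thesis by (auto simp: S_def)
  qed
  then obtain h0 where h0: "\<And>n::nat. admissible r (h0 n)" "\<And>n. power_mass r (h0 n) \<le> 1" "\<And>n. M - e n < J (h0 n)"
    by metis
  \<comment> \<open>If \<open>\<bar>G h\<bar>\<close> stayed below \<open>d\<close>, then \<open>Q (G h)\<close> would be at most
    \<open>d powr (q - 2) * \<integral>(G h)\<^sup>2\<close>; the value of \<open>d\<close> makes this at most \<open>(M / 2) powr q\<close>, which is less than \<open>Q (G h)\<close>.\<close>
  define A where "A = (\<integral>t. \<bar>g t\<bar> \<partial>lborel)\<^sup>2"
  have A0: "A \<ge> 0" by (simp add: A_def)
  define d where "d = ((M / 2) powr q / ((A + 1) * M)) powr (1 / (q - 2))"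
  have d0: "d > 0" using Mpos A0 by (simp add: d_def)
  have d_eq: "d powr (q - 2) = (M / 2) powr q / ((A + 1) * M)"
    unfolding d_def powr_powr using q Mpos A0 by simp
  have half: "J (h0 n) > M / 2" for n
  proof -
    have "e n \<le> M / 2" unfolding e_def using Mpos by (intro divide_left_mono) auto
    then show ?thesis using h0(3)[of n] by linarith
  qed
  have "\<exists>t. \<bar>G (h0 n) t\<bar> \<ge> d" for n
  proof (rule ccontr)
    assume "\<nexists>t. \<bar>G (h0 n) t\<bar> \<ge> d"
    then have lt: "\<bar>G (h0 n) t\<bar> \<le> d" for t by (meson linear)
    note LG = L2_bounded_G[OF L2[OF h0(1)[of n]]]
    have "(M / 2) powr q < J (h0 n) powr q" using half[of n] Mpos q by (intro powr_less_mono2) auto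
    also have "\<dots> \<le> (Q (G (h0 n)) powr (1 / q)) powr q"
      using Q_lower[OF h0(1)[of n] h0(2)[of n]] J_nonneg q by (intro powr_mono2) auto
    also have "\<dots> = Q (G (h0 n))" using q by (simp add: powr_powr Q_def)
    also have "\<dots> \<le> (\<integral>t. d powr (q - 2) * (G (h0 n) t)\<^sup>2 \<partial>lborel)"
      unfolding Q_def
    proof (rule integral_mono)
      show "integrable lborel (\<lambda>t. \<bar>G (h0 n) t\<bar> powr q)" by (rule admissible_signed_power(2)[OF q LG])
      show "integrable lborel (\<lambda>t. d powr (q - 2) * (G (h0 n) t)\<^sup>2)" using LG by (simp add: L2_bounded_def)
      fix t
      have "\<bar>G (h0 n) t\<bar> powr q = \<bar>G (h0 n) t\<bar> powr (q - 2) * (G (h0 n) t)\<^sup>2"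
        using signed_power_mult[OF q, of "G (h0 n) t"] by (simp add: signed_power_def power2_eq_square mult.assoc)
      also have "\<dots> \<le> d powr (q - 2) * (G (h0 n) t)\<^sup>2"
        using lt q by (intro mult_right_mono powr_mono2) auto
      finally show "\<bar>G (h0 n) t\<bar> powr q \<le> d powr (q - 2) * (G (h0 n) t)\<^sup>2" .
    qed
    also have "\<dots> = d powr (q - 2) * (\<integral>t. (G (h0 n) t)\<^sup>2 \<partial>lborel)" by simp
    also have "\<dots> \<le> d powr (q - 2) * ((A + 1) * M)"
    proof (intro mult_left_mono)
      have "(\<integral>t. (G (h0 n) t)\<^sup>2 \<partial>lborel) \<le> A * J (h0 n)" unfolding A_def by (rule G_L2_bound[OF L2[OF h0(1)]])
      also have "\<dots> \<le> A * M" using JM[OF h0(1,2)] A0 by (intro mult_left_mono) auto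
      also have "\<dots> \<le> (A + 1) * M" using Mpos by (intro mult_right_mono) auto
      finally show "(\<integral>t. (G (h0 n) t)\<^sup>2 \<partial>lborel) \<le> (A + 1) * M" .
    qed auto
    also have "\<dots> = (M / 2) powr q" using d_eq Mpos A0 by simp
    finally show False by simp
  qed
  then obtain tn where tn: "\<And>n. \<bar>G (h0 n) (tn n)\<bar> \<ge> d" by metis
  define h where "h n = (\<lambda>t. h0 n (t + tn n))" for n
  have h: "admissible r (h n)" "power_mass r (h n) \<le> 1" "M - e n < J (h n)" "d \<le> \<bar>G (h n) 0\<bar>" for n
    unfolding h_def using admissible_shift[OF h0(1)[of n], of "tn n"] h0(2,3)[of n] J_shift[of "h0 n" "tn n"] G_shift[of "h0 n" "tn n"] tn[of n]
    by simp_all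
  note Lh = L2[OF h(1)]
  define v where "v n = G (h n)" for n
  note Lv = L2_bounded_G[OF Lh, folded v_def]
  define B where "B = sqrt ((\<integral>t. (g t)\<^sup>2 \<partial>lborel) * M)"
  define Lc where "Lc = sqrt ((\<integral>t. (g1 t)\<^sup>2 \<partial>lborel) * M)"
  have vB: "\<bar>v n t\<bar> \<le> B" for n t
  proof -
    have "(v n t)\<^sup>2 \<le> (\<integral>t. (g t)\<^sup>2 \<partial>lborel) * J (h n)" unfolding v_def by (rule G_bound[OF Lh])
    also have "\<dots> \<le> (\<integral>t. (g t)\<^sup>2 \<partial>lborel) * M" by (intro mult_left_mono JM h) auto
    finally show ?thesis unfolding B_def by (intro real_le_rsqrt) simp
  qed
  have vL: "\<bar>v n b - v n a\<bar> \<le> Lc * \<bar>b - a\<bar>" for n a b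
  proof -
    have "\<bar>v n b - v n a\<bar> \<le> sqrt ((\<integral>t. (g1 t)\<^sup>2 \<partial>lborel) * J (h n)) * \<bar>b - a\<bar>"
      unfolding v_def by (rule G_Lipschitz[OF Lh])
    also have "\<dots> \<le> Lc * \<bar>b - a\<bar>" unfolding Lc_def
      by (intro mult_right_mono real_sqrt_le_mono mult_left_mono JM h) auto
    finally show ?thesis .
  qed
  obtain k w where k: "strict_mono (k :: nat \<Rightarrow> nat)" and w: "\<And>t. (\<lambda>n. v (k n) t) \<longlonglongrightarrow> w t"
    using equi_Lipschitz_pointwise_subsequence[of v B Lc] vB vL by metis
  have klim: "filterlim k at_top sequentially" by (rule filterlim_subseq[OF k])
  have wB: "\<bar>w t\<bar> \<le> B" for t
    by (rule LIMSEQ_le_const2[OF tendsto_rabs[OF w]]) (use vB in auto)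
  have wL: "\<bar>w b - w a\<bar> \<le> Lc * \<bar>b - a\<bar>" for a b
    by (rule LIMSEQ_le_const2[OF tendsto_rabs[OF tendsto_diff[OF w w]]]) (use vL in auto)
  have Lc0: "Lc \<ge> 0" using Mpos by (simp add: Lc_def)
  have wc: "continuous_on UNIV w"
  proof (rule lipschitz_on_continuous_on)
    show "Lc-lipschitz_on UNIV w"
      by (rule lipschitz_onI) (use wL Lc0 in \<open>auto simp: dist_real_def\<close>)
  qed
  have w0: "w 0 \<noteq> 0"
  proof -
    have "d \<le> \<bar>w 0\<bar>" by (rule LIMSEQ_le_const[OF tendsto_rabs[OF w]]) (use h(4) in \<open>auto simp: v_def\<close>)
    then show ?thesis using d0 by auto
  qed
  have wm [measurable]: "w \<in> borel_measurable borel" using borel_measurable_continuous_onI[OF wc] .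
  \<comment> \<open>With \<open>Q (v n)\<close> converging, so do the constants \<open>c n\<close> that normalise the duals \<open>kn n\<close> of \<open>v n\<close>.\<close>
  have Jlim: "(\<lambda>n. J (h n)) \<longlonglongrightarrow> M"
  proof (rule tendsto_sandwich)
    show "(\<lambda>n. M - e n) \<longlonglongrightarrow> M" unfolding e_def by real_asymp
    show "\<forall>\<^sub>F n in sequentially. M - e n \<le> J (h n)" using less_imp_le[OF h(3)] by (intro always_eventually allI)
    show "\<forall>\<^sub>F n in sequentially. J (h n) \<le> M" using JM h by auto
  qed auto
  have Qle: "Q (v n) powr (1 / q) \<le> M" for n
  proof -
    have "(Q (v n) powr (1 / q))\<^sup>2 = Q (v n) powr (2 / q)"
      by (simp add: power2_eq_square flip: powr_add)
    also have "\<dots> \<le> M * J (h n)" unfolding v_def by (rule Q_upper[OF h(1)])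
    also have "\<dots> \<le> M\<^sup>2" using JM[OF h(1,2)] Mpos by (simp add: power2_eq_square)
    finally show ?thesis using Mpos by (simp add: power2_le_iff_abs_le)
  qed
  have Qlim1: "(\<lambda>n. Q (v n) powr (1 / q)) \<longlonglongrightarrow> M"
    by (rule tendsto_sandwich[OF _ _ Jlim tendsto_const]) (use Q_lower[OF h(1,2)] Qle in \<open>auto simp: v_def\<close>)
  have Qpos: "Q (v n) > 0" for n
  proof -
    have "e n \<le> M / 2" unfolding e_def using Mpos by (intro divide_left_mono) auto
    then have "J (h n) > 0" using h(3)[of n] Mpos by linarith
    then have "Q (v n) \<noteq> 0" using Q_lower[OF h(1)[of n] h(2)[of n]] by (auto simp: v_def)
    then show ?thesis by (smt (verit) Q_def integral_nonneg_AE AE_I2 powr_ge_zero)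
  qed
  define c where "c n = Q (v n) powr (- 1 / r)" for n
  define kn where "kn n = (\<lambda>t. c n * signed_power q (v n t))" for n
  have cM: "c \<longlonglongrightarrow> M powr (1 - q)"
  proof -
    have "(\<lambda>n. (Q (v n) powr (1 / q)) powr (1 - q)) \<longlonglongrightarrow> M powr (1 - q)"
      using Mpos by (intro tendsto_powr Qlim1 tendsto_const) auto
    moreover have "(Q (v n) powr (1 / q)) powr (1 - q) = c n" for n
    proof -
      have "(1 / q) * (1 - q) = - 1 / r" using r12(5) q by (simp add: field_simps)
      then show ?thesis by (simp add: c_def powr_powr)
    qed
    ultimately show ?thesis by simp
  qed
  have c0: "c n > 0" for n using Qpos[of n] by (simp add: c_def)
  note adm_v = admissible_signed_power[OF q Lv, folded r]
  have akn: "admissible r (kn n)" "power_mass r (kn n) = 1" for n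
  proof -
    show "admissible r (kn n)" unfolding kn_def by (rule admissible_cmult(1)[OF adm_v(1)])
    have "power_mass r (kn n) = \<bar>c n\<bar> powr r * Q (v n)"
      unfolding kn_def admissible_cmult(2) adm_v(3) Q_def ..
    also have "\<bar>c n\<bar> powr r = Q (v n) powr (- 1)"
    proof -
      have "- 1 / r * r = - 1" using r12(1) by simp
      then have "c n powr r = Q (v n) powr (- 1)" unfolding c_def powr_powr by (simp only:)
      then show ?thesis using c0[of n] by simp
    qed
    finally show "power_mass r (kn n) = 1" using Qpos[of n] by (simp add: powr_neg_one)
  qed
  note Lkn = L2[OF akn(1)]
  \<comment> \<open>The dual of \<open>v n\<close> makes the mixed term equal to \<open>Q (v n) powr (1 / q)\<close>, the largest value that
    Hoelder's inequality permits, hence at least \<open>J (h n)\<close>.\<close>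
  have Jd: "J (\<lambda>t. kn n t - h n t) \<le> 2 * M - 2 * J (h n)" for n
  proof -
    have "(\<integral>t. kn n t * G (h n) t \<partial>lborel) = c n * (\<integral>t. signed_power q (v n t) * v n t \<partial>lborel)"
      by (simp add: kn_def v_def mult.assoc)
    also have "\<dots> = c n * Q (v n)" using q by (simp add: signed_power_mult Q_def)
    also have "\<dots> = Q (v n) powr (- 1 / r) * Q (v n) powr 1" using Qpos[of n] by (simp add: c_def)
    also have "\<dots> = Q (v n) powr (1 / q)"
    proof -
      have "- 1 / r + 1 = 1 / q" using r12(5) by simp
      then show ?thesis by (simp only: powr_add[symmetric])
    qed
    finally have "(\<integral>t. kn n t * G (h n) t \<partial>lborel) \<ge> J (h n)" using Q_lower[OF h(1)[of n] h(2)[of n]] by (simp add: v_def)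
    then show ?thesis using J_diff[OF Lkn[of n] Lh[of n]] JM[OF akn(1)[of n]] JM[OF h(1)[of n] h(2)[of n]] akn(2)[of n] by simp
  qed
  have Glim: "(\<lambda>n. G (kn n) t - v n t) \<longlonglongrightarrow> 0" for t
  proof -
    have "(\<lambda>n. (G (kn n) t - v n t)\<^sup>2) \<longlonglongrightarrow> 0"
    proof (rule tendsto_sandwich[where f = "\<lambda>_. 0" and h = "\<lambda>n. (\<integral>t. (g t)\<^sup>2 \<partial>lborel) * (2 * M - 2 * J (h n))"])
      have "(G (kn n) t - v n t)\<^sup>2 \<le> (\<integral>t. (g t)\<^sup>2 \<partial>lborel) * (2 * M - 2 * J (h n))" for n
      proof -
        have "(G (kn n) t - v n t)\<^sup>2 \<le> (\<integral>t. (g t)\<^sup>2 \<partial>lborel) * J (\<lambda>t. kn n t - h n t)"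
          using G_bound[OF L2_bounded_diff[OF Lkn[of n] Lh[of n]], of t] by (simp add: G_diff[OF Lkn Lh] v_def)
        also have "\<dots> \<le> (\<integral>t. (g t)\<^sup>2 \<partial>lborel) * (2 * M - 2 * J (h n))"
          by (intro mult_left_mono Jd) auto
        finally show ?thesis .
      qed
      then show "\<forall>\<^sub>F n in sequentially. (G (kn n) t - v n t)\<^sup>2 \<le> (\<integral>t. (g t)\<^sup>2 \<partial>lborel) * (2 * M - 2 * J (h n))" by simp
      have "(\<lambda>n. (\<integral>t. (g t)\<^sup>2 \<partial>lborel) * (2 * M - 2 * J (h n))) \<longlonglongrightarrow> (\<integral>t. (g t)\<^sup>2 \<partial>lborel) * (2 * M - 2 * M)"
        by (intro tendsto_intros Jlim)
      then show "(\<lambda>n. (\<integral>t. (g t)\<^sup>2 \<partial>lborel) * (2 * M - 2 * J (h n))) \<longlonglongrightarrow> 0" by simp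
    qed auto
    from tendsto_real_sqrt[OF this] show ?thesis by (simp add: tendsto_rabs_zero_iff)
  qed
  define kw where "kw t = M powr (1 - q) * signed_power q (w t)" for t
  have kwlim: "(\<lambda>n. kn (k n) t) \<longlonglongrightarrow> kw t" for t
  proof -
    have "(\<lambda>n. signed_power q (v (k n) t)) \<longlonglongrightarrow> signed_power q (w t)"
      using continuous_on_tendsto_compose[OF signed_power_continuous[OF q continuous_on_id, of UNIV] w] by auto
    moreover have "(\<lambda>n. c (k n)) \<longlonglongrightarrow> M powr (1 - q)" by (rule filterlim_compose[OF cM klim])
    ultimately show ?thesis unfolding kn_def kw_def by (intro tendsto_mult)
  qed
  obtain Cb where Cb: "\<And>n. \<bar>c n\<bar> \<le> Cb"
    using convergent_imp_Bseq[of c] cM by (auto simp: convergent_def Bseq_def)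
  have knB: "\<bar>kn n t\<bar> \<le> Cb * B powr (q - 1)" for n t
    unfolding kn_def abs_mult using q vB order_trans[OF abs_ge_zero Cb]
    by (intro mult_mono Cb) (auto simp: signed_power_abs intro!: powr_mono2)
  have knm: "kn n \<in> borel_measurable borel" for n by (rule L2_bounded_measurable[OF Lkn])
  have Gkw: "G kw = w"
  proof
    fix t
    have "(\<lambda>n. G (kn (k n)) t) \<longlonglongrightarrow> G kw t" by (rule G_pointwise_limit[OF knm knB kwlim])
    moreover have "(\<lambda>n. (G (kn (k n)) t - v (k n) t) + v (k n) t) \<longlonglongrightarrow> 0 + w t"
      by (rule tendsto_add[OF filterlim_compose[OF Glim klim] w])
    ultimately show "G kw t = w t" using LIMSEQ_unique by fastforce
  qed
  have kwm [measurable]: "kw \<in> borel_measurable borel" unfolding kw_def by measurable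
  have kwb: "bounded_borel kw" unfolding bounded_borel_def
    using kwm LIMSEQ_le_const2[OF tendsto_rabs[OF kwlim]] knB by (metis (no_types, lifting))
  \<comment> \<open>Pointwise convergence gives only an inequality for the mass of the limit.\<close>
  have fat: "(\<integral>\<^sup>+t. ennreal (\<bar>kw t\<bar> powr r) \<partial>lborel) \<le> 1"
  proof -
    have [measurable]: "kn n \<in> borel_measurable borel" for n by (rule knm)
    have "(\<integral>\<^sup>+t. ennreal (\<bar>kw t\<bar> powr r) \<partial>lborel) = (\<integral>\<^sup>+t. liminf (\<lambda>n. ennreal (\<bar>kn (k n) t\<bar> powr r)) \<partial>lborel)"
    proof (intro nn_integral_cong)
      fix t
      have "(\<lambda>n. ennreal (\<bar>kn (k n) t\<bar> powr r)) \<longlonglongrightarrow> ennreal (\<bar>kw t\<bar> powr r)"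
        using r12 by (intro tendsto_ennrealI tendsto_powr2 tendsto_rabs kwlim tendsto_const) auto
      then show "ennreal (\<bar>kw t\<bar> powr r) = liminf (\<lambda>n. ennreal (\<bar>kn (k n) t\<bar> powr r))"
        using lim_imp_Liminf[of sequentially] by (metis sequentially_bot)
    qed
    also have "\<dots> \<le> liminf (\<lambda>n. \<integral>\<^sup>+t. ennreal (\<bar>kn (k n) t\<bar> powr r) \<partial>lborel)"
      by (rule nn_integral_liminf) measurable
    also have "\<dots> = liminf (\<lambda>n. ennreal 1)"
    proof -
      have "(\<integral>\<^sup>+t. ennreal (\<bar>kn n t\<bar> powr r) \<partial>lborel) = ennreal 1" for n
        using akn[of n] by (subst nn_integral_eq_integral) (auto simp: admissible_def power_mass_def)
      then show ?thesis by simp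
    qed
    finally show ?thesis by (simp add: Liminf_const)
  qed
  have ikw: "integrable lborel (\<lambda>t. \<bar>kw t\<bar> powr r)"
    by (rule integrableI_bounded) (use fat in \<open>auto simp: top_unique less_top[symmetric]\<close>)
  have akw: "admissible r kw" using kwb ikw by (simp add: admissible_def)
  define n where "n = power_mass r kw"
  have n1: "n \<le> 1" using fat nn_integral_eq_integral[OF ikw] by (simp add: n_def power_mass_def)
  have kwr: "\<bar>kw t\<bar> powr r = M powr (- q) * \<bar>w t\<bar> powr q" for t
  proof -
    have "(1 - q) * r = - q" using r12(4) by (simp add: algebra_simps)
    then show ?thesis using q r12 Mpos by (simp add: kw_def abs_mult powr_mult signed_power_abs powr_powr)
  qed
  have iw: "integrable lborel (\<lambda>t. \<bar>w t\<bar> powr q)"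
    using ikw Mpos unfolding kwr by simp
  have nQ: "n = M powr (- q) * Q w" unfolding n_def power_mass_def kwr Q_def by simp
  have Qw: "Q w > 0" unfolding Q_def
  proof (rule integral_positive_continuous[OF _ _ iw])
    show "continuous_on UNIV (\<lambda>t. \<bar>w t\<bar> powr q)"
      using q by (intro continuous_on_powr' continuous_intros wc) auto
    show "\<bar>w 0\<bar> powr q \<noteq> 0" using w0 by simp
  qed auto
  have Lkw: "L2_bounded kw" by (rule L2[OF akw])
  have "J kw = (\<integral>t. kw t * w t \<partial>lborel)" using J_eq[OF Lkw] Gkw by simp
  also have "\<dots> = M powr (1 - q) * Q w"
    using q by (simp add: kw_def mult.assoc signed_power_mult Q_def)
  also have "\<dots> = M * n" unfolding nQ using powr_add[of M 1 "- q"] Mpos by simp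
  finally have "M * n \<le> M * n powr (2 / r)" using hom[OF akw] by (simp add: n_def)
  then have nle: "n \<le> n powr (2 / r)" using Mpos by simp
  have n0: "n > 0" using nQ Qw Mpos by simp
  \<comment> \<open>No mass is lost: \<open>2 / r > 1\<close>, so \<open>n < 1\<close> would give \<open>n powr (2 / r) < n\<close>.\<close>
  have neq: "n = 1"
  proof (rule ccontr)
    assume "n \<noteq> 1"
    then have "n < 1" using n1 by simp
    then have "n powr (2 / r) < n powr 1" using n0 r12 by (intro powr_less_mono') auto
    then show False using nle n0 by simp
  qed
  then have QM: "Q w = M powr q" using nQ Mpos by (simp add: powr_minus field_simps)
  \<comment> \<open>The factor for which \<open>al powr (q - 2)\<close> absorbs the multiplier \<open>M powr (1 - q)\<close> in the equation for \<open>w\<close>.\<close>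
  define al where "al = M powr (- (q - 1) / (q - 2))"
  have al0: "al > 0" using Mpos by (simp add: al_def)
  have al1: "al powr (q - 2) = M powr (1 - q)" using q by (simp add: al_def powr_powr)
  define u where "u = (\<lambda>t. al * w t)"
  have Lw: "L2_bounded w" using L2_bounded_G[OF Lkw] Gkw by simp
  have "G (\<lambda>t. signed_power q (u t)) = u"
  proof -
    have "signed_power q (u t) = al * kw t" for t
    proof -
      have "al powr (q - 1) = al powr (q - 2) * al" using powr_add[of al "q - 2" 1] al0 by simp
      then show ?thesis using al0 q al1 by (simp add: u_def signed_power_scale kw_def)
    qed
    then show ?thesis using G_cmult[of al kw] Gkw by (simp add: u_def)
  qed
  moreover have "(\<integral>t. \<bar>u t\<bar> powr q \<partial>lborel) powr (1 - 2 / q) = 1 / M"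
  proof -
    have "(\<integral>t. \<bar>u t\<bar> powr q \<partial>lborel) = al powr q * Q w"
      using al0 by (simp add: u_def abs_mult powr_mult Q_def)
    also have "\<dots> = (al * M) powr q" using al0 Mpos by (simp add: QM powr_mult)
    finally have "(\<integral>t. \<bar>u t\<bar> powr q \<partial>lborel) powr (1 - 2 / q) = (al * M) powr (q * (1 - 2 / q))"
      by (simp add: powr_powr)
    also have "q * (1 - 2 / q) = q - 2" using q by (simp add: field_simps)
    also have "(al * M) powr (q - 2) = M powr (1 - q) * M powr (q - 2)"
      using al0 Mpos by (simp add: powr_mult al1)
    also have "\<dots> = M powr (- 1)" by (simp flip: powr_add)
    finally show ?thesis using Mpos by (simp add: powr_neg_one)
  qed
  moreover have "L2_bounded u" "continuous_on UNIV u"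
    unfolding u_def using L2_bounded_cmult[OF Lw] wc by (auto intro!: continuous_intros)
  ultimately show ?thesis using that[of M u] Mpos hom by simp
qed

end

section \<open>The kernel of the damped oscillator\<close>

text \<open>A smooth function restricted to the half line has its value at the origin as jump.\<close>

lemma half_line_jump_primitive:
  fixes F F' :: "real \<Rightarrow> real"
  assumes d: "\<And>t. (F has_real_derivative F' t) (at t)" and c: "continuous_on UNIV F'"
  shows "jump_primitive (F 0) (\<lambda>t. if 0 \<le> t then F' t else 0) (\<lambda>t. if 0 \<le> t then F t else 0)"
  unfolding jump_primitive_def
proof (intro allI impI)
  fix a b :: real assume ab: "a \<le> b"
  have FTC: "(\<integral>r. F' r * indicator {x..b} r \<partial>lborel) = F b - F x" if "x \<le> b" for x
    by (rule integral_FTC_Icc_real[OF that]) (use d c in \<open>auto simp: continuous_on_eq_continuous_at\<close>)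
  consider "b < 0" | "0 \<le> a" | "a < 0" "0 \<le> b" by linarith
  then show "(if 0 \<le> b then F b else 0) - (if 0 \<le> a then F a else 0) =
      (if a < 0 \<and> 0 \<le> b then F 0 else 0) + (\<integral>r. indicator {a..b} r * (if 0 \<le> r then F' r else 0) \<partial>lborel)"
  proof cases
    case 1
    then have "(\<lambda>r. indicator {a..b} r * (if 0 \<le> r then F' r else 0)) = (\<lambda>_. 0)"
      by (auto simp: indicator_def)
    then show ?thesis using 1 ab by simp
  next
    case 2
    then have "(\<lambda>r. indicator {a..b} r * (if 0 \<le> r then F' r else 0)) = (\<lambda>r. F' r * indicator {a..b} r)"
      by (auto simp: indicator_def)
    then show ?thesis using 2 ab FTC[OF ab] by simp
  next
    case 3
    then have "(\<lambda>r. indicator {a..b} r * (if 0 \<le> r then F' r else 0)) = (\<lambda>r. F' r * indicator {0..b} r)"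
      by (auto simp: indicator_def)
    then show ?thesis using 3 FTC[OF 3(2)] by simp
  qed
qed

lemma exp_decay_integrable:
  fixes f :: "real \<Rightarrow> real"
  assumes c: "0 < c" and f: "f \<in> borel_measurable borel" "\<And>t. 0 \<le> t \<Longrightarrow> \<bar>f t\<bar> \<le> C * exp (- c * t)"
  shows "integrable lborel (\<lambda>t. if 0 \<le> t then f t else 0)" "\<exists>B. \<forall>t. \<bar>if 0 \<le> t then f t else 0\<bar> \<le> B"
proof -
  have C0: "0 \<le> C" using f(2)[of 0] by (simp add: order_trans[OF abs_ge_zero])
  have "(\<integral>\<^sup>+t. ennreal (exp (- c * t)) * indicator {0..} t \<partial>lborel) = ennreal (0 - (- exp (- c * 0) / c))"
  proof (rule nn_integral_FTC_atLeast)
    show "((\<lambda>t. - exp (- c * t) / c) has_real_derivative exp (- c * t)) (at t)" for t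
      using c by (auto intro!: derivative_eq_intros)
    show "((\<lambda>t. - exp (- c * t) / c) \<longlongrightarrow> 0) at_top" using c by real_asymp
  qed auto
  then have e: "integrable lborel (\<lambda>t. exp (- c * t) * indicator {0..} t)"
    by (intro integrableI_nonneg) (auto simp: ennreal_mult' ennreal_indicator less_top[symmetric])
  show "integrable lborel (\<lambda>t. if 0 \<le> t then f t else 0)"
    by (rule Bochner_Integration.integrable_bound[OF integrable_mult_right[OF e, of C]])
       (use f C0 in \<open>auto simp: indicator_def\<close>)
  have "\<bar>if 0 \<le> t then f t else 0\<bar> \<le> C" for t
  proof (cases "0 \<le> t")
    case True
    have "C * exp (- c * t) \<le> C * 1" using C0 c True by (intro mult_left_mono) auto
    then show ?thesis using f(2)[OF True] True by simp
  qed (use C0 in auto)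
  then show "\<exists>B. \<forall>t. \<bar>if 0 \<le> t then f t else 0\<bar> \<le> B" by blast
qed

text \<open>A solution of \<open>D\<^sup>2 + p * D + s\<close> is \<open>exp (- p * t / 2)\<close> times a solution of the undamped
  equation \<open>S'' = (p\<^sup>2 / 4 - s) * S\<close>. According to the sign of the coefficient the latter is a hyperbolic
  sine, the identity, or a sine. In each case it grows more slowly than \<open>exp (p * t / 2)\<close>, because \<open>s > 0\<close>.\<close>

lemma undamped_solution:
  fixes p s :: real
  assumes p: "0 < p" and s: "0 < s"
  obtains S S1 C m where "\<And>t. (S has_real_derivative S1 t) (at t)"
    "\<And>t. (S1 has_real_derivative (p\<^sup>2 / 4 - s) * S t) (at t)" "S 0 = 0" "S1 0 = 1"
    "0 \<le> m" "m < p / 2" "\<And>t. 0 \<le> t \<Longrightarrow> \<bar>S t\<bar> \<le> C * exp (m * t)" "\<And>t. 0 \<le> t \<Longrightarrow> \<bar>S1 t\<bar> \<le> C * exp (m * t)"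
proof -
  consider "p\<^sup>2 / 4 - s > 0" | "p\<^sup>2 / 4 - s = 0" | "p\<^sup>2 / 4 - s < 0" by linarith
  then show ?thesis
  proof cases
    case 1
    define m where "m = sqrt (p\<^sup>2 / 4 - s)"
    have m: "0 < m" "m * m = p\<^sup>2 / 4 - s" using 1 by (auto simp: m_def)
    have "m < sqrt (p\<^sup>2 / 4)" unfolding m_def using s by simp
    then have mp: "m < p / 2" using p by (simp add: real_sqrt_divide)
    have ex: "exp (- (m * t)) \<le> exp (m * t)" if "0 \<le> t" for t using m that by simp
    show ?thesis
    proof (rule that[of "\<lambda>t. (exp (m * t) - exp (- (m * t))) / (2 * m)" "\<lambda>t. (exp (m * t) + exp (- (m * t))) / 2" m "1 / (2 * m) + 1"])
      fix t :: real
      show "((\<lambda>t. (exp (m * t) - exp (- (m * t))) / (2 * m)) has_real_derivative (exp (m * t) + exp (- (m * t))) / 2) (at t)"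
        using m by (auto intro!: derivative_eq_intros simp: field_simps)
      show "((\<lambda>t. (exp (m * t) + exp (- (m * t))) / 2) has_real_derivative (p\<^sup>2 / 4 - s) * ((exp (m * t) - exp (- (m * t))) / (2 * m))) (at t)"
        unfolding m(2)[symmetric] using m(1) by (auto intro!: derivative_eq_intros simp: field_simps)
      assume t: "0 \<le> t"
      have "\<bar>(exp (m * t) - exp (- (m * t))) / (2 * m)\<bar> \<le> exp (m * t) / (2 * m)"
        using ex[OF t] m by (simp add: divide_right_mono)
      also have "\<dots> \<le> (1 / (2 * m) + 1) * exp (m * t)" by (simp add: field_simps)
      finally show "\<bar>(exp (m * t) - exp (- (m * t))) / (2 * m)\<bar> \<le> (1 / (2 * m) + 1) * exp (m * t)" .
      have "\<bar>(exp (m * t) + exp (- (m * t))) / 2\<bar> \<le> exp (m * t)" 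
        using ex[OF t] by (simp add: add_nonneg_nonneg)
      also have "\<dots> \<le> (1 / (2 * m) + 1) * exp (m * t)" using m by (simp add: field_simps)
      finally show "\<bar>(exp (m * t) + exp (- (m * t))) / 2\<bar> \<le> (1 / (2 * m) + 1) * exp (m * t)" .
    qed (use m mp in auto)
  next
    case 2
    show ?thesis
    proof (rule that[of "\<lambda>t. t" "\<lambda>_. 1" "p / 4" "4 / p + 1"])
      fix t :: real
      show "((\<lambda>_. 1) has_real_derivative (p\<^sup>2 / 4 - s) * t) (at t)" unfolding 2 by simp
      assume t: "0 \<le> t"
      have "1 + p / 4 * t \<le> exp (p / 4 * t)" by (rule exp_ge_add_one_self)
      then have "p / 4 * t \<le> exp (p / 4 * t)" by linarith
      then have "4 / p * (p / 4 * t) \<le> 4 / p * exp (p / 4 * t)" using p by (intro mult_left_mono) auto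
      then have "t \<le> 4 / p * exp (p / 4 * t)" using p by simp
      also have "\<dots> \<le> (4 / p + 1) * exp (p / 4 * t)" by (intro mult_right_mono) auto
      finally show "\<bar>t\<bar> \<le> (4 / p + 1) * exp (p / 4 * t)" using t by simp
      have "1 * 1 \<le> (4 / p + 1) * exp (p / 4 * t)" using t p by (intro mult_mono) auto
      then show "\<bar>1\<bar> \<le> (4 / p + 1) * exp (p / 4 * t)" by simp
    qed (use p in auto)
  next
    case 3
    define m where "m = sqrt (- (p\<^sup>2 / 4 - s))"
    have m: "0 < m" "- (m * m) = p\<^sup>2 / 4 - s" using 3 by (auto simp: m_def)
    show ?thesis
    proof (rule that[of "\<lambda>t. sin (m * t) / m" "\<lambda>t. cos (m * t)" 0 "1 / m + 1"])
      fix t :: real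
      show "((\<lambda>t. sin (m * t) / m) has_real_derivative cos (m * t)) (at t)"
        using m by (auto intro!: derivative_eq_intros)
      show "((\<lambda>t. cos (m * t)) has_real_derivative (p\<^sup>2 / 4 - s) * (sin (m * t) / m)) (at t)"
        unfolding m(2)[symmetric] using m(1) by (auto intro!: derivative_eq_intros)
      have "\<bar>sin (m * t) / m\<bar> \<le> 1 / m" using m by (simp add: divide_right_mono)
      then show "\<bar>sin (m * t) / m\<bar> \<le> (1 / m + 1) * exp (0 * t)" by simp
      have "\<bar>cos (m * t)\<bar> \<le> 1" by simp
      also have "1 \<le> 1 / m + 1" using m by simp
      finally show "\<bar>cos (m * t)\<bar> \<le> (1 / m + 1) * exp (0 * t)" by simp
    qed (use m p in auto)
  qed
qed

lemma damped_kernel_exists: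
  fixes p s :: real
  assumes p: "0 < p" and s: "0 < s"
  obtains g g1 where "damped_kernel p s g g1"
proof -
  obtain S S1 C m where S: "\<And>t. (S has_real_derivative S1 t) (at t)"
    "\<And>t. (S1 has_real_derivative (p\<^sup>2 / 4 - s) * S t) (at t)" "S 0 = 0" "S1 0 = 1"
    "0 \<le> m" "m < p / 2" "\<And>t. 0 \<le> t \<Longrightarrow> \<bar>S t\<bar> \<le> C * exp (m * t)" "\<And>t. 0 \<le> t \<Longrightarrow> \<bar>S1 t\<bar> \<le> C * exp (m * t)"
    using undamped_solution[OF assms] by metis
  define F where "F t = exp (- (p / 2) * t) * S t" for t
  define F1 where "F1 t = exp (- (p / 2) * t) * (S1 t - p / 2 * S t)" for t
  define F2 where "F2 t = - p * F1 t - s * F t" for t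
  have d: "(F has_real_derivative F1 t) (at t)" for t
    unfolding F_def[abs_def] F1_def by (auto intro!: derivative_eq_intros S simp: algebra_simps)
  have d1: "(F1 has_real_derivative F2 t) (at t)" for t
    unfolding F_def F1_def[abs_def] F2_def
    by (rule derivative_eq_intros S refl)+ (simp add: field_simps power2_eq_square)
  have c: "continuous_on UNIV F" "continuous_on UNIV F1"
    by (rule DERIV_continuous_on, rule d) (rule DERIV_continuous_on, rule d1)
  have c2: "continuous_on UNIV F2" unfolding F2_def[abs_def] by (intro continuous_intros c)
  note fm = c[THEN borel_measurable_continuous_onI]
  have exps: "exp (- (p / 2) * t) * exp (m * t) = exp (- (p / 2 - m) * t)" for t
    by (simp add: mult_exp_exp algebra_simps)
  have b: "\<bar>F t\<bar> \<le> C * exp (- (p / 2 - m) * t)" "\<bar>F1 t\<bar> \<le> (C + p / 2 * C) * exp (- (p / 2 - m) * t)" if "0 \<le> t" for t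
  proof -
    have "\<bar>F t\<bar> \<le> exp (- (p / 2) * t) * (C * exp (m * t))"
      unfolding F_def abs_mult using S(7)[OF that] by (intro mult_mono) auto
    then show "\<bar>F t\<bar> \<le> C * exp (- (p / 2 - m) * t)" unfolding exps[symmetric] by (simp add: mult_ac)
    have "\<bar>S1 t - p / 2 * S t\<bar> \<le> \<bar>S1 t\<bar> + p / 2 * \<bar>S t\<bar>"
      using abs_triangle_ineq4[of "S1 t" "p / 2 * S t"] p by (simp add: abs_mult)
    also have "\<dots> \<le> C * exp (m * t) + p / 2 * (C * exp (m * t))"
      using p S(7,8)[OF that] by (intro add_mono mult_left_mono) auto
    finally have "\<bar>F1 t\<bar> \<le> exp (- (p / 2) * t) * (C * exp (m * t) + p / 2 * (C * exp (m * t)))"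
      unfolding F1_def abs_mult by (intro mult_mono) auto
    then show "\<bar>F1 t\<bar> \<le> (C + p / 2 * C) * exp (- (p / 2 - m) * t)"
      unfolding exps[symmetric] by (simp add: algebra_simps)
  qed
  define g where "g t = (if 0 \<le> t then F t else 0)" for t
  define g1 where "g1 t = (if 0 \<le> t then F1 t else 0)" for t
  have mp: "p / 2 - m > 0" using S by simp
  have "damped_kernel p s g g1"
  proof
    show "integrable lborel g" "\<exists>B. \<forall>t. \<bar>g t\<bar> \<le> B"
      unfolding g_def[abs_def] using exp_decay_integrable[OF mp fm(1) b(1)] by auto
    show "integrable lborel g1" "\<exists>B. \<forall>t. \<bar>g1 t\<bar> \<le> B"
      unfolding g1_def[abs_def] using exp_decay_integrable[OF mp fm(2) b(2)] by auto
    show "jump_primitive 0 g1 g"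
      using half_line_jump_primitive[OF d c(2)] by (simp add: g_def[abs_def] g1_def[abs_def] F_def S)
    have "(\<lambda>t. if 0 \<le> t then F2 t else 0) = (\<lambda>t. - p * g1 t - s * g t)"
      by (auto simp: g_def g1_def F2_def)
    moreover have "F1 0 = 1" by (simp add: F1_def S)
    ultimately show "jump_primitive 1 (\<lambda>t. - p * g1 t - s * g t) g1"
      using half_line_jump_primitive[OF d1 c2] by (simp add: g1_def[abs_def])
  qed (use s in simp)
  then show ?thesis by (rule that)
qed

section \<open>Integration by parts and the Rellich inequality\<close>

text \<open>Integration by parts in the direction \<open>b\<close> takes place on lines parallel to \<open>b\<close>, where this is an
  ordinary derivative.\<close>

definition has_dirderiv :: "('a::euclidean_space \<Rightarrow> real) \<Rightarrow> 'a \<Rightarrow> ('a \<Rightarrow> real) \<Rightarrow> bool" where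
  "has_dirderiv F b F' \<longleftrightarrow> (\<forall>x. ((\<lambda>t. F (x + t *\<^sub>R b)) has_real_derivative F' x) (at 0))"

lemma has_dirderiv_line:
  assumes "has_dirderiv F b F'"
  shows "((\<lambda>t. F (x + t *\<^sub>R b)) has_real_derivative F' (x + c *\<^sub>R b)) (at c)"
proof -
  have "((\<lambda>t. F (x + c *\<^sub>R b + t *\<^sub>R b)) has_real_derivative F' (x + c *\<^sub>R b)) (at (c - c))"
    using assms unfolding has_dirderiv_def by simp
  then have "((\<lambda>s. F (x + c *\<^sub>R b + (s - c) *\<^sub>R b)) has_real_derivative F' (x + c *\<^sub>R b) * 1) (at c)"
    by (rule DERIV_chain2) (auto intro!: derivative_eq_intros)
  then show ?thesis by (simp add: algebra_simps)
qed

lemma has_dirderiv_mult: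
  assumes "has_dirderiv F b F'" "has_dirderiv H b H'"
  shows "has_dirderiv (\<lambda>x. F x * H x) b (\<lambda>x. F' x * H x + F x * H' x)"
  unfolding has_dirderiv_def
proof
  fix x
  have "((\<lambda>t. F (x + t *\<^sub>R b) * H (x + t *\<^sub>R b)) has_real_derivative
     F' x * H (x + 0 *\<^sub>R b) + H' x * F (x + 0 *\<^sub>R b)) (at 0)"
    using assms by (intro DERIV_mult) (auto simp: has_dirderiv_def)
  then show "((\<lambda>t. F (x + t *\<^sub>R b) * H (x + t *\<^sub>R b)) has_real_derivative F' x * H x + F x * H' x) (at 0)"
    by (simp add: mult.commute)
qed

lemma continuous_compact_support:
  fixes f :: "'a::euclidean_space \<Rightarrow> real"
  assumes c: "continuous_on UNIV f" and z: "\<And>x. R < norm x \<Longrightarrow> f x = 0"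
  shows "integrable lborel f" "\<exists>B. \<forall>x. \<bar>f x\<bar> \<le> B"
proof -
  have "integrable lborel (\<lambda>x. indicator (cball 0 R) x *\<^sub>R f x)"
    by (rule borel_integrable_compact) (use continuous_on_subset[OF c] in auto)
  moreover have "(\<lambda>x. indicator (cball 0 R) x *\<^sub>R f x) = f" using z by (fastforce simp: indicator_def not_le)
  ultimately show "integrable lborel f" by simp
  have "compact (f ` cball 0 R)" by (rule compact_continuous_image) (use c in \<open>auto intro: continuous_on_subset\<close>)
  then obtain B where B: "\<And>x. x \<in> cball 0 R \<Longrightarrow> \<bar>f x\<bar> \<le> B"
    by (metis bounded_iff compact_imp_bounded image_eqI real_norm_def)
  have "\<bar>f x\<bar> \<le> max B 0" for x
    using B[of x] z[of x] by (cases "norm x \<le> R") auto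
  then show "\<exists>B. \<forall>x. \<bar>f x\<bar> \<le> B" by blast
qed

lemma lborel_translate:
  fixes f :: "'a::euclidean_space \<Rightarrow> real"
  assumes [measurable]: "f \<in> borel_measurable borel"
  shows "(\<integral>x. f (x + c) \<partial>lborel) = (\<integral>x. f x \<partial>lborel)" "integrable lborel f \<Longrightarrow> integrable lborel (\<lambda>x. f (x + c))"
proof -
  have "(\<integral>x. f x \<partial>distr lborel borel ((+) c)) = (\<integral>x. f (c + x) \<partial>lborel)"
    by (rule integral_distr) auto
  then show "(\<integral>x. f (x + c) \<partial>lborel) = (\<integral>x. f x \<partial>lborel)"
    by (simp add: lborel_distr_plus add.commute)
  assume "integrable lborel f"
  then have "integrable (distr lborel borel ((+) c)) f" by (simp add: lborel_distr_plus)
  then show "integrable lborel (\<lambda>x. f (x + c))"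
    by (subst (asm) integrable_distr_eq) (auto simp: add.commute)
qed

lemma dirderiv_support:
  assumes d: "has_dirderiv F b F'" and z: "\<And>x. R < norm x \<Longrightarrow> F x = 0" and x: "R < norm x"
  shows "F' x = 0"
proof -
  have "((\<lambda>t. F (x + t *\<^sub>R b)) has_real_derivative 0) (at 0)"
  proof (rule has_field_derivative_transform_within_open[where f = "\<lambda>_. 0"])
    show "open {t. R < norm (x + t *\<^sub>R b)}" by (intro open_Collect_less continuous_intros)
  qed (use x z in auto)
  then show ?thesis using d DERIV_unique unfolding has_dirderiv_def by blast
qed

text \<open>The difference quotients of \<open>F\<close> have integral \<open>0\<close> by translation invariance, and they converge
  boundedly on a fixed ball.\<close>

lemma integral_dirderiv_zero:
  fixes F F' :: "'a::euclidean_space \<Rightarrow> real"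
  assumes d: "has_dirderiv F b F'" and c: "continuous_on UNIV F" "continuous_on UNIV F'"
    and z: "\<And>x. R < norm x \<Longrightarrow> F x = 0"
  shows "(\<integral>x. F' x \<partial>lborel) = 0"
proof -
  have z': "F' x = 0" if "R < norm x" for x by (rule dirderiv_support[OF d z that])
  obtain B where B: "\<And>x. \<bar>F' x\<bar> \<le> B" using continuous_compact_support(2)[OF c(2) z'] by metis
  have B0: "0 \<le> B" using B[of 0] by (auto intro: order_trans[OF abs_ge_zero])
  have [measurable]: "F \<in> borel_measurable borel" "F' \<in> borel_measurable borel"
    using c by (auto intro: borel_measurable_continuous_onI)
  have iF: "integrable lborel F" by (rule continuous_compact_support(1)[OF c(1) z])
  define D where "D n x = real (Suc n) * (F (x + (1 / real (Suc n)) *\<^sub>R b) - F x)" for n x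
  have "(\<integral>x. D n x \<partial>lborel) = 0" for n
    unfolding D_def integral_mult_right_zero using iF lborel_translate[of F "(1 / real (Suc n)) *\<^sub>R b"]
    by simp
  moreover have "(\<lambda>n. \<integral>x. D n x \<partial>lborel) \<longlonglongrightarrow> (\<integral>x. F' x \<partial>lborel)"
  proof (rule integral_dominated_convergence)
    show "integrable lborel (\<lambda>x::'a. indicator (cball 0 (R + norm b)) x * B :: real)"
      using emeasure_lborel_cball_finite[of "0 :: 'a" "R + norm b"]
      by (intro integrable_mult_left integrable_real_indicator) auto
    show "AE x in lborel. norm (D n x) \<le> indicator (cball 0 (R + norm b)) x * B" for n
    proof (rule AE_I2)
      fix x
      let ?t = "1 / real (Suc n)"
      have t: "0 < ?t" "?t \<le> 1" by auto
      show "norm (D n x) \<le> indicator (cball 0 (R + norm b)) x * B"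
      proof (cases "norm x \<le> R + norm b")
        case True
        have "\<exists>w. 0 < w \<and> w < ?t \<and> F (x + ?t *\<^sub>R b) - F (x + 0 *\<^sub>R b) = (?t - 0) * F' (x + w *\<^sub>R b)"
          by (rule MVT2[of 0 ?t "\<lambda>t. F (x + t *\<^sub>R b)"]) (use t has_dirderiv_line[OF d] in auto)
        then obtain w where w: "F (x + ?t *\<^sub>R b) - F x = ?t * F' (x + w *\<^sub>R b)" by auto
        have "D n x = F' (x + w *\<^sub>R b)" unfolding D_def w by simp
        then show ?thesis using B True by simp
      next
        case False
        have "norm x \<le> norm (x + ?t *\<^sub>R b) + norm (?t *\<^sub>R b)" by (metis add_diff_cancel_right' norm_triangle_ineq4)
        moreover have "norm (?t *\<^sub>R b) \<le> 1 * norm b" unfolding norm_scaleR using t by (intro mult_right_mono) auto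
        ultimately have "R < norm (x + ?t *\<^sub>R b)" "R < norm x" using False norm_ge_zero[of b] by linarith+
        then show ?thesis using z False by (simp add: D_def)
      qed
    qed
    show "AE x in lborel. (\<lambda>n. D n x) \<longlonglongrightarrow> F' x"
    proof (rule AE_I2)
      fix x
      have "((\<lambda>h. (F (x + h *\<^sub>R b) - F x) / h) \<longlongrightarrow> F' x) (at 0)"
        using d unfolding has_dirderiv_def DERIV_def by simp
      moreover have "filterlim (\<lambda>n. 1 / real (Suc n)) (at 0) sequentially"
        using LIMSEQ_Suc[OF lim_1_over_n[where 'a = real]] by (intro filterlim_atI) auto
      ultimately have "(\<lambda>n. (F (x + (1 / real (Suc n)) *\<^sub>R b) - F x) / (1 / real (Suc n))) \<longlonglongrightarrow> F' x"
        by (rule filterlim_compose)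
      then show "(\<lambda>n. D n x) \<longlonglongrightarrow> F' x" by (simp add: D_def mult.commute)
    qed
  qed (auto simp: D_def)
  ultimately show ?thesis by (simp add: LIMSEQ_const_iff)
qed

text \<open>Second derivatives occur only in the Laplacian, so the mixed ones are not recorded.\<close>

definition C2_data :: "('a::euclidean_space \<Rightarrow> real) \<Rightarrow> ('a \<Rightarrow> 'a \<Rightarrow> real) \<Rightarrow> ('a \<Rightarrow> 'a \<Rightarrow> real) \<Rightarrow> bool" where
  "C2_data f f1 f2 \<longleftrightarrow> continuous_on UNIV f \<and> (\<forall>b\<in>Basis. has_dirderiv f b (f1 b) \<and> has_dirderiv (f1 b) b (f2 b)
     \<and> continuous_on UNIV (f1 b) \<and> continuous_on UNIV (f2 b))"

lemma Green_identity:
  fixes f g :: "'a::euclidean_space \<Rightarrow> real"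
  assumes f: "C2_data f f1 f2" and g: "C2_data g g1 g2" and z: "\<And>x. R < norm x \<Longrightarrow> f x = 0"
  shows "(\<integral>x. f x * (\<Sum>b\<in>Basis. g2 b x) \<partial>lborel) = (\<integral>x. (\<Sum>b\<in>Basis. f2 b x) * g x \<partial>lborel)"
proof -
  have fc: "continuous_on UNIV f" "continuous_on UNIV g" using f g by (auto simp: C2_data_def)
  have comp: "(\<integral>x. f x * g2 b x \<partial>lborel) = (\<integral>x. f2 b x * g x \<partial>lborel) \<and>
     integrable lborel (\<lambda>x. f x * g2 b x) \<and> integrable lborel (\<lambda>x. f2 b x * g x)" if b: "b \<in> Basis" for b
  proof -
    have f': "has_dirderiv f b (f1 b)" "has_dirderiv (f1 b) b (f2 b)" "continuous_on UNIV (f1 b)" "continuous_on UNIV (f2 b)"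
      using f b by (auto simp: C2_data_def)
    have g': "has_dirderiv g b (g1 b)" "has_dirderiv (g1 b) b (g2 b)" "continuous_on UNIV (g1 b)" "continuous_on UNIV (g2 b)"
      using g b by (auto simp: C2_data_def)
    have z1: "f1 b x = 0" if "R < norm x" for x by (rule dirderiv_support[OF f'(1) z that])
    have z2: "f2 b x = 0" if "R < norm x" for x by (rule dirderiv_support[OF f'(2) z1 that])
    have i: "integrable lborel (\<lambda>x. f x * g2 b x)" "integrable lborel (\<lambda>x. f1 b x * g1 b x)" "integrable lborel (\<lambda>x. f2 b x * g x)"
      using z z1 z2 by (auto intro!: continuous_compact_support(1)[where R = R] continuous_intros fc f' g')
    have "(\<integral>x. f1 b x * g1 b x + f x * g2 b x \<partial>lborel) = 0"
      by (rule integral_dirderiv_zero[OF has_dirderiv_mult[OF f'(1) g'(2)], where R = R])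
         (use z in \<open>auto intro!: continuous_intros fc f' g'\<close>)
    moreover have "(\<integral>x. f2 b x * g x + f1 b x * g1 b x \<partial>lborel) = 0"
      by (rule integral_dirderiv_zero[OF has_dirderiv_mult[OF f'(2) g'(1)], where R = R])
         (use z1 in \<open>auto intro!: continuous_intros fc f' g'\<close>)
    ultimately show ?thesis using i by simp
  qed
  show ?thesis unfolding sum_distrib_left sum_distrib_right using comp
    by (subst (1 2) Bochner_Integration.integral_sum) auto
qed

text \<open>Put \<open>\<rho> x = 1 / (x \<bullet> x + e)\<close>. Expanding \<open>0 \<le> \<integral>(\<Delta>u + gam * \<rho> * u)\<^sup>2\<close> reduces the inequality to
  \<open>\<integral>- \<rho> * u * \<Delta>u \<ge> gam * \<integral>\<rho>\<^sup>2 * u\<^sup>2\<close>. Up to the divergence of a vector field with compact support, the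
  difference of the two integrands is \<open>\<rho> * \<bar>\<nabla>u + a * \<rho> * u * x\<bar>\<^sup>2\<close> plus a positive multiple of
  \<open>\<rho>\<^sup>2 * u\<^sup>2 * (1 - \<rho> * (x \<bullet> x))\<close>, and both are nonnegative. The regularisation by \<open>e\<close> removes the singularity at the origin, so that the functions
  need not vanish there.\<close>

lemma Rellich_regularized:
  fixes u :: "'a::euclidean_space \<Rightarrow> real"
  assumes u: "C2_data u u1 u2" and z: "\<And>x. R < norm x \<Longrightarrow> u x = 0" and e: "0 < e"
    and a: "a = (real DIM('a) - 4) / 2" "0 \<le> a" and gam: "gam = a * (a + 2)"
  shows "gam\<^sup>2 * (\<integral>x. (u x)\<^sup>2 * (1 / (x \<bullet> x + e))\<^sup>2 \<partial>lborel) \<le> (\<integral>x. (\<Sum>b\<in>Basis. u2 b x)\<^sup>2 \<partial>lborel)"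
proof -
  define \<rho> where "\<rho> x = 1 / (x \<bullet> x + e)" for x :: 'a
  define L where "L x = (\<Sum>b\<in>Basis. u2 b x)" for x
  have den: "x \<bullet> x + e > 0" for x :: 'a using e by (simp add: add_nonneg_pos)
  have \<rho>0: "\<rho> x > 0" for x using den by (simp add: \<rho>_def)
  have uc: "continuous_on UNIV u" using u by (simp add: C2_data_def)
  have c1: "continuous_on UNIV (u1 b)" "continuous_on UNIV (u2 b)" if "b \<in> Basis" for b using u that by (auto simp: C2_data_def)
  have \<rho>c: "continuous_on UNIV \<rho>" unfolding \<rho>_def[abs_def] by (intro continuous_intros) (metis den less_irrefl)
  have Lc: "continuous_on UNIV L" unfolding L_def[abs_def] by (intro continuous_intros c1)
  have d\<rho>: "has_dirderiv \<rho> b (\<lambda>x. - 2 * (\<rho> x)\<^sup>2 * (x \<bullet> b))" for b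
    unfolding has_dirderiv_def \<rho>_def
  proof
    fix x :: 'a
    have "(\<lambda>t. 1 / ((x + t *\<^sub>R b) \<bullet> (x + t *\<^sub>R b) + e)) = (\<lambda>t. 1 / (x \<bullet> x + 2 * t * (x \<bullet> b) + t\<^sup>2 * (b \<bullet> b) + e))"
      by (simp add: inner_add_left inner_add_right inner_commute algebra_simps power2_eq_square)
    moreover have "((\<lambda>t. 1 / (x \<bullet> x + 2 * t * (x \<bullet> b) + t\<^sup>2 * (b \<bullet> b) + e)) has_real_derivative - 2 * (1 / (x \<bullet> x + e))\<^sup>2 * (x \<bullet> b)) (at 0)"
      using den[of x] by (auto intro!: derivative_eq_intros simp: power2_eq_square divide_simps)
    ultimately show "((\<lambda>t. 1 / ((x + t *\<^sub>R b) \<bullet> (x + t *\<^sub>R b) + e)) has_real_derivative - 2 * (1 / (x \<bullet> x + e))\<^sup>2 * (x \<bullet> b)) (at 0)"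
      by simp
  qed
  have dx: "has_dirderiv (\<lambda>x. x \<bullet> b) b (\<lambda>x. 1)" if "b \<in> Basis" for b :: 'a
    unfolding has_dirderiv_def using that
    by (auto intro!: derivative_eq_intros simp: inner_add_left inner_same_Basis)
  \<comment> \<open>The components of the vector field \<open>\<rho> * u * \<nabla>u + (a + 1) * \<rho>\<^sup>2 * u\<^sup>2 * x\<close>; the factor \<open>a + 1\<close> makes the terms
    in \<open>u * (x \<bullet> \<nabla>u)\<close> combine to the cross term of the completed square.\<close>
  define V where "V b x = \<rho> x * (u x * u1 b x) + (a + 1) * ((\<rho> x * \<rho> x) * ((u x * u x) * (x \<bullet> b)))" for b x
  define V' where "V' b x = (- 2 * (\<rho> x)\<^sup>2 * (x \<bullet> b)) * (u x * u1 b x) + \<rho> x * (u1 b x * u1 b x + u x * u2 b x) +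
     (a + 1) * (((- 2 * (\<rho> x)\<^sup>2 * (x \<bullet> b)) * \<rho> x + \<rho> x * (- 2 * (\<rho> x)\<^sup>2 * (x \<bullet> b))) * ((u x * u x) * (x \<bullet> b))
       + (\<rho> x * \<rho> x) * ((u1 b x * u x + u x * u1 b x) * (x \<bullet> b) + (u x * u x) * 1))" for b x
  have V: "has_dirderiv (V b) b (V' b)" "continuous_on UNIV (V b)" "continuous_on UNIV (V' b)" 
    "\<And>x. R < norm x \<Longrightarrow> V b x = 0" if b: "b \<in> Basis" for b
  proof -
    have ub: "has_dirderiv u b (u1 b)" "has_dirderiv (u1 b) b (u2 b)" using u b by (auto simp: C2_data_def)
    note m1 = has_dirderiv_mult[OF d\<rho> has_dirderiv_mult[OF ub]]
    note m2 = has_dirderiv_mult[OF has_dirderiv_mult[OF d\<rho> d\<rho>] has_dirderiv_mult[OF has_dirderiv_mult[OF ub(1) ub(1)] dx[OF b]]]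
    show "has_dirderiv (V b) b (V' b)"
      unfolding has_dirderiv_def
    proof
      fix x
      show "((\<lambda>t. V b (x + t *\<^sub>R b)) has_real_derivative V' b x) (at 0)"
        unfolding V_def V'_def
        by (rule DERIV_add[OF m1[unfolded has_dirderiv_def, rule_format] DERIV_cmult[OF m2[unfolded has_dirderiv_def, rule_format]]])
    qed
    show "continuous_on UNIV (V b)" unfolding V_def[abs_def] by (intro continuous_intros \<rho>c uc c1 b)
    show "continuous_on UNIV (V' b)" unfolding V'_def[abs_def] by (intro continuous_intros \<rho>c uc c1 b)
    show "V b x = 0" if "R < norm x" for x using z that by (simp add: V_def)
  qed
  have V'z: "V' b x = 0" if "b \<in> Basis" "R < norm x" for b x by (rule dirderiv_support[OF V(1)[OF that(1)] V(4)[OF that(1)] that(2)])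
  have V'i: "integrable lborel (V' b)" if "b \<in> Basis" for b
    by (rule continuous_compact_support(1)[OF V(3)[OF that] V'z[OF that]])
  have "(\<integral>x. (\<Sum>b\<in>Basis. V' b x) \<partial>lborel) = 0"
  proof -
    have "(\<integral>x. V' b x \<partial>lborel) = 0" if "b \<in> Basis" for b
      by (rule integral_dirderiv_zero[OF V(1-3)[OF that] V(4)[OF that]])
    then show ?thesis using V'i by (subst Bochner_Integration.integral_sum) auto
  qed
  note intV = this
  have iV: "integrable lborel (\<lambda>x. \<Sum>b\<in>Basis. V' b x)" using V'i by simp
  have key: "- (\<rho> x * u x * L x) \<ge> gam * ((u x)\<^sup>2 * (\<rho> x)\<^sup>2) - (\<Sum>b\<in>Basis. V' b x)" for x
  proof -
    define X where "X = (\<Sum>b\<in>Basis. (x \<bullet> b) * u1 b x)"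
    define Y where "Y = (\<Sum>b\<in>Basis. (u1 b x)\<^sup>2)"
    have XX: "(\<Sum>b\<in>Basis. (x \<bullet> b)\<^sup>2) = x \<bullet> x"
      using euclidean_inner[of x x] by (simp add: power2_eq_square)
    have sV: "(\<Sum>b\<in>Basis. V' b x) = - 2 * (\<rho> x)\<^sup>2 * u x * X + \<rho> x * Y + \<rho> x * u x * L x
       + (a + 1) * (- 4 * (\<rho> x)^3 * (u x)\<^sup>2 * (x \<bullet> x) + 2 * (\<rho> x)\<^sup>2 * u x * X + real DIM('a) * (\<rho> x)\<^sup>2 * (u x)\<^sup>2)"
    proof -
      have "V' b x = - 2 * (\<rho> x)\<^sup>2 * u x * ((x \<bullet> b) * u1 b x) + \<rho> x * (u1 b x)\<^sup>2 + \<rho> x * u x * u2 b x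
       + (a + 1) * (- 4 * (\<rho> x)^3 * (u x)\<^sup>2 * (x \<bullet> b)\<^sup>2 + 2 * (\<rho> x)\<^sup>2 * u x * ((x \<bullet> b) * u1 b x) + (\<rho> x)\<^sup>2 * (u x)\<^sup>2)" for b
        unfolding V'_def by (simp add: algebra_simps power2_eq_square power3_eq_cube)
      then show ?thesis
        unfolding X_def Y_def L_def XX[symmetric]
        by (simp add: sum.distrib sum_subtractf sum_distrib_left[symmetric])
    qed
    have sq: "0 \<le> \<rho> x * (\<Sum>b\<in>Basis. (u1 b x + a * \<rho> x * u x * (x \<bullet> b))\<^sup>2)"
      using \<rho>0[of x] by (intro mult_nonneg_nonneg sum_nonneg) auto
    have sq2: "(\<Sum>b\<in>Basis. (u1 b x + a * \<rho> x * u x * (x \<bullet> b))\<^sup>2) = Y + 2 * a * \<rho> x * u x * X + a\<^sup>2 * (\<rho> x)\<^sup>2 * (u x)\<^sup>2 * (x \<bullet> x)"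
    proof -
      have "(u1 b x + a * \<rho> x * u x * (x \<bullet> b))\<^sup>2 = (u1 b x)\<^sup>2 + 2 * a * \<rho> x * u x * ((x \<bullet> b) * u1 b x) + a\<^sup>2 * (\<rho> x)\<^sup>2 * (u x)\<^sup>2 * (x \<bullet> b)\<^sup>2" for b
        by (simp add: power2_eq_square algebra_simps)
      then show ?thesis unfolding X_def Y_def XX[symmetric] by (simp add: sum.distrib sum_distrib_left[symmetric])
    qed
    have rx: "\<rho> x * (x \<bullet> x) \<le> 1" using den[of x] e by (simp add: \<rho>_def divide_le_eq_1)
    have N: "real DIM('a) = 2 * a + 4" using a by simp
    have "\<rho> x * (Y + 2 * a * \<rho> x * u x * X + a\<^sup>2 * (\<rho> x)\<^sup>2 * (u x)\<^sup>2 * (x \<bullet> x)) + (4 * (a + 1) + a\<^sup>2) * ((\<rho> x)\<^sup>2 * (u x)\<^sup>2) * (1 - \<rho> x * (x \<bullet> x))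
       = - (\<rho> x * u x * L x) + (\<Sum>b\<in>Basis. V' b x) - gam * ((u x)\<^sup>2 * (\<rho> x)\<^sup>2)"
      unfolding sV N gam by (simp add: algebra_simps power2_eq_square power3_eq_cube)
    moreover have "0 \<le> (4 * (a + 1) + a\<^sup>2) * ((\<rho> x)\<^sup>2 * (u x)\<^sup>2) * (1 - \<rho> x * (x \<bullet> x))"
      using a rx by (intro mult_nonneg_nonneg) auto
    ultimately show ?thesis using sq unfolding sq2 by linarith
  qed
  have gam0: "gam \<ge> 0" using a gam by simp
  have i1: "integrable lborel (\<lambda>x. (u x)\<^sup>2 * (\<rho> x)\<^sup>2)"
    by (rule continuous_compact_support(1)[where R = R]) (use z in \<open>auto intro!: continuous_intros uc \<rho>c\<close>)
  have Lz: "L x = 0" if "R < norm x" for x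
  proof -
    have "u2 b x = 0" if b: "b \<in> Basis" for b
      using dirderiv_support[of "u1 b" b "u2 b" R x] dirderiv_support[of u b "u1 b" R] z u b \<open>R < norm x\<close>
      unfolding C2_data_def by blast
    then show ?thesis by (simp add: L_def)
  qed
  have i2: "integrable lborel (\<lambda>x. (L x)\<^sup>2)"
    by (rule continuous_compact_support(1)[where R = R]) (use Lz in \<open>auto intro!: continuous_intros Lc\<close>)
  have "0 \<le> (\<integral>x. (L x)\<^sup>2 - gam\<^sup>2 * ((u x)\<^sup>2 * (\<rho> x)\<^sup>2) + 2 * gam * (\<Sum>b\<in>Basis. V' b x) \<partial>lborel)"
  proof (rule Bochner_Integration.integral_nonneg)
    fix x
    have "0 \<le> (L x + gam * (\<rho> x * u x))\<^sup>2" by simp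
    also have "\<dots> = (L x)\<^sup>2 + gam\<^sup>2 * ((u x)\<^sup>2 * (\<rho> x)\<^sup>2) + 2 * gam * (\<rho> x * u x * L x)"
      by (simp add: power2_eq_square algebra_simps)
    also have "\<dots> \<le> (L x)\<^sup>2 + gam\<^sup>2 * ((u x)\<^sup>2 * (\<rho> x)\<^sup>2) + 2 * gam * ((\<Sum>b\<in>Basis. V' b x) - gam * ((u x)\<^sup>2 * (\<rho> x)\<^sup>2))"
      using key[of x] gam0 by (intro add_left_mono mult_left_mono) auto
    finally show "0 \<le> (L x)\<^sup>2 - gam\<^sup>2 * ((u x)\<^sup>2 * (\<rho> x)\<^sup>2) + 2 * gam * (\<Sum>b\<in>Basis. V' b x)"
      by (simp add: algebra_simps power2_eq_square)
  qed
  also have "\<dots> = (\<integral>x. (L x)\<^sup>2 \<partial>lborel) - gam\<^sup>2 * (\<integral>x. (u x)\<^sup>2 * (\<rho> x)\<^sup>2 \<partial>lborel) + 2 * gam * (\<integral>x. (\<Sum>b\<in>Basis. V' b x) \<partial>lborel)"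
    using i1 i2 iV by (simp del: Bochner_Integration.integral_sum)
  finally show ?thesis using intV by (simp add: L_def \<rho>_def)
qed

section \<open>Test functions\<close>

lemma C_k_SucD:
  shows "C_k (Suc k) f \<Longrightarrow> f differentiable (at x)"
    and "C_k (Suc k) f \<Longrightarrow> C_k k (\<lambda>x. frechet_derivative f (at x) v)"
proof -
  show "f differentiable (at x)" if "C_k (Suc k) f"
    using conjunct1[OF iffD1[OF C_k.simps(2) that]] by (rule spec)
  show "C_k k (\<lambda>x. frechet_derivative f (at x) v)" if "C_k (Suc k) f"
    using conjunct2[OF iffD1[OF C_k.simps(2) that]] by (rule spec)
qed

lemma C_k_SucI: "(\<And>x. f differentiable (at x)) \<Longrightarrow> (\<And>v. C_k k (\<lambda>x. frechet_derivative f (at x) v)) \<Longrightarrow> C_k (Suc k) f"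
  by simp

lemma C_k_Suc_imp: "C_k (Suc k) f \<Longrightarrow> C_k k f"
proof (induction k arbitrary: f)
  case 0
  have "continuous_on UNIV f"
    using differentiable_imp_continuous_within[OF C_k_SucD(1)[OF 0]] by (simp add: continuous_on_eq_continuous_within)
  then show ?case by simp
next
  case (Suc k)
  show ?case by (rule C_k_SucI[OF C_k_SucD(1)[OF Suc.prems] Suc.IH[OF C_k_SucD(2)[OF Suc.prems]]])
qed

lemma C_k_const: "C_k k (\<lambda>x. c)"
proof (induction k arbitrary: c)
  case (Suc k)
  show ?case
    by (rule C_k_SucI) (simp_all add: frechet_derivative_const Suc.IH del: C_k.simps)
qed simp

lemma C_k_add: "C_k k f \<Longrightarrow> C_k k g \<Longrightarrow> C_k k (\<lambda>x. f x + g x)"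
proof (induction k arbitrary: f g)
  case 0
  then show ?case by (simp add: continuous_on_add)
next
  case (Suc k)
  note d = C_k_SucD[OF Suc.prems(1)] C_k_SucD[OF Suc.prems(2)]
  have e: "frechet_derivative (\<lambda>x. f x + g x) (at x) v = frechet_derivative f (at x) v + frechet_derivative g (at x) v" for x v
    using fun_cong[OF frechet_derivative_at[OF has_derivative_add[OF d(1)[of x, unfolded frechet_derivative_works] d(3)[of x, unfolded frechet_derivative_works]]], of v]
    by (rule sym)
  show ?case
  proof (rule C_k_SucI)
    show "(\<lambda>x. f x + g x) differentiable (at x)" for x by (rule differentiable_add[OF d(1,3)])
    show "C_k k (\<lambda>x. frechet_derivative (\<lambda>x. f x + g x) (at x) v)" for v
      unfolding e by (rule Suc.IH[OF d(2,4)])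
  qed
qed

lemma C_k_mult: "C_k k f \<Longrightarrow> C_k k g \<Longrightarrow> C_k k (\<lambda>x. f x * g x)"
proof (induction k arbitrary: f g)
  case 0
  then show ?case by (simp add: continuous_on_mult)
next
  case (Suc k)
  note d = C_k_SucD[OF Suc.prems(1)] C_k_SucD[OF Suc.prems(2)]
  have e: "frechet_derivative (\<lambda>x. f x * g x) (at x) v = f x * frechet_derivative g (at x) v + frechet_derivative f (at x) v * g x" for x v
    using fun_cong[OF frechet_derivative_at[OF has_derivative_mult[OF d(1)[of x, unfolded frechet_derivative_works] d(3)[of x, unfolded frechet_derivative_works]]], of v]
    by (rule sym)
  show ?case
  proof (rule C_k_SucI)
    show "(\<lambda>x. f x * g x) differentiable (at x)" for x by (rule differentiable_mult[OF d(1,3)])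
    show "C_k k (\<lambda>x. frechet_derivative (\<lambda>x. f x * g x) (at x) v)" for v
      unfolding e
      by (intro C_k_add Suc.IH d(2,4) C_k_Suc_imp[OF Suc.prems(1)] C_k_Suc_imp[OF Suc.prems(2)])
  qed
qed

lemma C_k_sum: "finite A \<Longrightarrow> (\<And>a. a \<in> A \<Longrightarrow> C_k k (f a)) \<Longrightarrow> C_k k (\<lambda>x. \<Sum>a\<in>A. f a x)"
proof (induction rule: finite_induct)
  case (insert a A)
  have "C_k k (\<lambda>x. f a x + (\<Sum>a\<in>A. f a x))" using insert by (intro C_k_add) auto
  then show ?case using insert(1,2) by simp
qed (simp add: C_k_const)

lemma has_dirderiv_frechet:
  assumes "\<And>x. f differentiable (at x)"
  shows "has_dirderiv f b (\<lambda>x. frechet_derivative f (at x) b)"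
  unfolding has_dirderiv_def
proof
  fix x
  have f: "(f has_derivative frechet_derivative f (at x)) (at (x + 0 *\<^sub>R b))"
    using assms[of x] by (simp add: frechet_derivative_works)
  have l: "((\<lambda>t. x + t *\<^sub>R b) has_derivative (\<lambda>t. t *\<^sub>R b)) (at 0)"
    by (auto intro!: derivative_eq_intros)
  have "((\<lambda>t. f (x + t *\<^sub>R b)) has_derivative (\<lambda>t. frechet_derivative f (at x) (t *\<^sub>R b))) (at 0)"
    using has_derivative_compose[OF l f] by simp
  moreover have "linear (frechet_derivative f (at x))" using assms by (rule linear_frechet_derivative)
  ultimately show "((\<lambda>t. f (x + t *\<^sub>R b)) has_real_derivative frechet_derivative f (at x) b) (at 0)"
    by (simp add: has_field_derivative_def linear_scale mult_commute_abs)
qed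

lemma Cc_inftyI:
  assumes "\<And>k. C_k k \<phi>" and z: "\<And>x. R < norm x \<Longrightarrow> \<phi> x = 0"
  shows "\<phi> \<in> Cc_infty"
proof -
  have "{x. \<phi> x \<noteq> 0} \<subseteq> cball 0 R" using z by (force simp: not_le[symmetric])
  then have "compact (closure {x. \<phi> x \<noteq> 0})" by (meson bounded_cball bounded_subset compact_closure)
  then show ?thesis using assms by (simp add: Cc_infty_def)
qed

lemma Cc_infty_support:
  assumes "\<phi> \<in> Cc_infty"
  obtains R where "\<And>x. R < norm x \<Longrightarrow> \<phi> x = 0"
proof -
  have "bounded (closure {x. \<phi> x \<noteq> 0})" using assms by (simp add: Cc_infty_def compact_imp_bounded)
  then obtain R where R: "\<And>x. x \<in> closure {x. \<phi> x \<noteq> 0} \<Longrightarrow> norm x \<le> R" unfolding bounded_iff by blast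
  have "\<phi> x = 0" if "R < norm x" for x
    using R[of x] that closure_subset[of "{x. \<phi> x \<noteq> 0}"] by (meson in_mono linorder_not_less mem_Collect_eq)
  then show ?thesis by (rule that)
qed

lemma C_k_second_derivative:
  assumes "\<And>k. C_k k \<phi>"
  shows "C_k k (\<lambda>x. frechet_derivative \<phi> (at x) b)" "C_k k (\<lambda>x. frechet_derivative (\<lambda>y. frechet_derivative \<phi> (at y) b) (at x) b)"
  by (rule C_k_SucD(2)[OF assms], rule C_k_SucD(2)[OF C_k_SucD(2)[OF assms]])

lemma C_k_continuous: "C_k k f \<Longrightarrow> continuous_on UNIV f"
proof (induction k)
  case (Suc k)
  from Suc.IH[OF C_k_Suc_imp[OF Suc.prems]] show ?case .
qed simp

lemma C2_data_smooth:
  assumes "\<And>k. C_k k \<phi>"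
  shows "C2_data \<phi> (\<lambda>b x. frechet_derivative \<phi> (at x) b) (\<lambda>b x. frechet_derivative (\<lambda>y. frechet_derivative \<phi> (at y) b) (at x) b)"
  unfolding C2_data_def
proof (intro conjI ballI)
  fix b :: 'a assume "b \<in> Basis"
  show "has_dirderiv \<phi> b (\<lambda>x. frechet_derivative \<phi> (at x) b)"
    by (rule has_dirderiv_frechet[OF C_k_SucD(1)[OF assms]])
  show "has_dirderiv (\<lambda>x. frechet_derivative \<phi> (at x) b) b (\<lambda>x. frechet_derivative (\<lambda>y. frechet_derivative \<phi> (at y) b) (at x) b)"
    by (rule has_dirderiv_frechet[OF C_k_SucD(1)[OF C_k_second_derivative(1)[OF assms]]])
qed (rule C_k_continuous[OF assms] C_k_continuous[OF C_k_second_derivative(1)[OF assms]]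
      C_k_continuous[OF C_k_second_derivative(2)[OF assms]])+

lemma laplacian_smooth:
  assumes "\<And>k. C_k k \<phi>"
  shows "C_k k (laplacian \<phi>)"
  unfolding laplacian_def[abs_def] by (intro C_k_sum C_k_second_derivative(2) assms) auto

lemma has_dirderiv_unique: "has_dirderiv f b u \<Longrightarrow> has_dirderiv f b v \<Longrightarrow> u = v"
  unfolding has_dirderiv_def by (rule ext) (blast intro: DERIV_unique)

text \<open>The Laplacian of a smooth function may be computed from any choice of directional derivatives.\<close>

lemma laplacian_C2_data:
  assumes s: "\<And>k. C_k k \<phi>" and f: "C2_data \<phi> f1 f2"
  shows "laplacian \<phi> x = (\<Sum>b\<in>Basis. f2 b x)"
  unfolding laplacian_def
proof (intro sum.cong refl)
  fix b :: 'a assume b: "b \<in> Basis"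
  note g = C2_data_smooth[OF s, unfolded C2_data_def]
  have f: "has_dirderiv \<phi> b (f1 b)" "has_dirderiv (f1 b) b (f2 b)" using f b by (auto simp: C2_data_def)
  have g': "has_dirderiv \<phi> b (\<lambda>x. frechet_derivative \<phi> (at x) b)"
    "has_dirderiv (\<lambda>x. frechet_derivative \<phi> (at x) b) b (\<lambda>x. frechet_derivative (\<lambda>y. frechet_derivative \<phi> (at y) b) (at x) b)"
    using g b by blast+
  have "f1 b = (\<lambda>x. frechet_derivative \<phi> (at x) b)"
    by (rule has_dirderiv_unique[OF f(1) g'(1)])
  then show "frechet_derivative (\<lambda>y. frechet_derivative \<phi> (at y) b) (at x) b = f2 b x"
    using has_dirderiv_unique[OF g'(2), of "f2 b"] f(2) fun_cong by metis
qed

lemma C2_data_support: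
  assumes f: "C2_data f f1 f2" and z: "\<And>x. R < norm x \<Longrightarrow> f x = 0" and x: "R < norm x"
  shows "(\<Sum>b\<in>Basis. f2 b x) = 0"
proof (intro sum.neutral ballI)
  fix b :: 'a assume "b \<in> Basis"
  then have d: "has_dirderiv f b (f1 b)" "has_dirderiv (f1 b) b (f2 b)" using f by (auto simp: C2_data_def)
  show "f2 b x = 0" by (rule dirderiv_support[OF d(2) dirderiv_support[OF d(1) z] x])
qed

lemma Cc_infty_smooth: "\<phi> \<in> Cc_infty \<Longrightarrow> C_k k \<phi>" by (simp add: Cc_infty_def)

lemma Cc_infty_laplacian:
  assumes "\<phi> \<in> Cc_infty"
  shows "laplacian \<phi> \<in> Cc_infty"
proof -
  obtain R where R: "\<And>x. R < norm x \<Longrightarrow> \<phi> x = 0" using Cc_infty_support[OF assms] by metis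
  note s = Cc_infty_smooth[OF assms]
  have "laplacian \<phi> x = 0" if "R < norm x" for x
    unfolding laplacian_C2_data[OF s C2_data_smooth[OF s]] by (rule C2_data_support[OF C2_data_smooth[OF s] R that])
  then show ?thesis using Cc_inftyI[OF laplacian_smooth[OF s]] by blast
qed

lemma Cc_infty_diff:
  assumes "\<phi> \<in> Cc_infty" "\<psi> \<in> Cc_infty"
  shows "(\<lambda>x. \<phi> x - \<psi> x) \<in> Cc_infty" "laplacian (\<lambda>x. \<phi> x - \<psi> x) x = laplacian \<phi> x - laplacian \<psi> x"
proof -
  note s = Cc_infty_smooth[OF assms(1)] Cc_infty_smooth[OF assms(2)]
  have sm: "C_k k (\<lambda>x. \<phi> x - \<psi> x)" for k
    using C_k_add[OF s(1) C_k_mult[OF C_k_const[of _ "-1"] s(2)], of k] by simp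
  obtain R1 where R1: "\<And>x. R1 < norm x \<Longrightarrow> \<phi> x = 0" using Cc_infty_support[OF assms(1)] by metis
  obtain R2 where R2: "\<And>x. R2 < norm x \<Longrightarrow> \<psi> x = 0" using Cc_infty_support[OF assms(2)] by metis
  show "(\<lambda>x. \<phi> x - \<psi> x) \<in> Cc_infty" by (rule Cc_inftyI[OF sm, of "max R1 R2"]) (simp add: R1 R2)
  note c = C2_data_smooth[OF s(1)] C2_data_smooth[OF s(2)]
  have "C2_data (\<lambda>x. \<phi> x - \<psi> x) (\<lambda>b x. frechet_derivative \<phi> (at x) b - frechet_derivative \<psi> (at x) b)
    (\<lambda>b x. frechet_derivative (\<lambda>y. frechet_derivative \<phi> (at y) b) (at x) b - frechet_derivative (\<lambda>y. frechet_derivative \<psi> (at y) b) (at x) b)"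
    using c unfolding C2_data_def has_dirderiv_def by (auto intro!: continuous_intros DERIV_diff)
  from laplacian_C2_data[OF sm this] show "laplacian (\<lambda>x. \<phi> x - \<psi> x) x = laplacian \<phi> x - laplacian \<psi> x"
    by (simp add: laplacian_def sum_subtractf)
qed

lemma Cc_infty_continuous: "\<phi> \<in> Cc_infty \<Longrightarrow> continuous_on UNIV \<phi>"
  using C_k_continuous Cc_infty_smooth by blast

lemma Cc_infty_borel: "\<phi> \<in> Cc_infty \<Longrightarrow> \<phi> \<in> borel_measurable borel"
  by (rule borel_measurable_continuous_onI[OF Cc_infty_continuous])

lemma borel_imp_lebesgue: "(f :: 'a::euclidean_space \<Rightarrow> real) \<in> borel_measurable borel \<Longrightarrow> f \<in> borel_measurable lebesgue"
  by (simp add: measurable_completion)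

lemma lebesgue_integral_eq:
  fixes f :: "'a::euclidean_space \<Rightarrow> real"
  shows "f \<in> borel_measurable borel \<Longrightarrow> (\<integral>x. f x \<partial>lebesgue) = (\<integral>x. f x \<partial>lborel)"
  by (simp add: integral_completion)

lemma lebesgue_integrable_eq:
  fixes f :: "'a::euclidean_space \<Rightarrow> real"
  shows "f \<in> borel_measurable borel \<Longrightarrow> integrable lebesgue f \<longleftrightarrow> integrable lborel f"
  by (simp add: integrable_completion)

text \<open>The elementary inequality \<open>y \<le> \<epsilon> + \<epsilon> powr (1 - s) * y powr s\<close> controls the integrand: on
  the bounded support of \<open>l\<close> the first term contributes at most a multiple of \<open>\<epsilon>\<close>.\<close>

lemma bounded_support_pairing_limit:
  fixes f :: "'a::euclidean_space \<Rightarrow> real"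
  assumes s: "1 \<le> s" and m: "\<And>n. fn n \<in> borel_measurable lebesgue" "f \<in> borel_measurable lebesgue" "l \<in> borel_measurable lebesgue"
    and i: "\<And>n. integrable lebesgue (\<lambda>x. \<bar>fn n x - f x\<bar> powr s)"
    and lim: "(\<lambda>n. \<integral>x. \<bar>fn n x - f x\<bar> powr s \<partial>lebesgue) \<longlonglongrightarrow> 0"
    and l: "\<And>x. \<bar>l x\<bar> \<le> B" "\<And>x. R < norm x \<Longrightarrow> l x = 0"
    and il: "\<And>n. integrable lebesgue (\<lambda>x. fn n x * l x)"
  shows "integrable lebesgue (\<lambda>x. f x * l x)" "(\<lambda>n. \<integral>x. fn n x * l x \<partial>lebesgue) \<longlonglongrightarrow> (\<integral>x. f x * l x \<partial>lebesgue)"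
proof -
  note [measurable] = m
  have B0: "0 \<le> B" using l(1)[of 0] by (auto intro: order_trans[OF abs_ge_zero])
  define V where "V = measure lebesgue (cball (0::'a) R)"
  have ic: "integrable lebesgue (indicator (cball (0::'a) R) :: 'a \<Rightarrow> real)"
    by (simp add: integrable_indicator_iff emeasure_lborel_cball_finite emeasure_completion less_top[symmetric])
       (metis emeasure_lborel_cball_finite infinity_ennreal_def less_irrefl)
  have pw: "\<bar>(fn n x - f x) * l x\<bar> \<le> B * \<epsilon> * indicator (cball 0 R) x + B * \<epsilon> powr (1 - s) * \<bar>fn n x - f x\<bar> powr s" if e: "0 < \<epsilon>" for n x \<epsilon>
  proof (cases "norm x \<le> R")
    case True
    have "y \<le> \<epsilon> + \<epsilon> powr (1 - s) * y powr s" if y: "0 \<le> y" for y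
    proof (cases "y \<le> \<epsilon>")
      case False
      have "(y / \<epsilon>) powr 1 = y / \<epsilon>" using e y by (intro powr_one) simp
      then have "y = \<epsilon> * (y / \<epsilon>) powr 1" using e by simp
      also have "\<dots> \<le> \<epsilon> * (y / \<epsilon>) powr s" using e False s by (intro mult_left_mono powr_mono) auto
      also have "\<dots> = \<epsilon> powr (1 - s) * y powr s" using e y by (simp add: powr_divide powr_diff)
      finally show ?thesis using e by simp
    qed (simp add: add_increasing2)
    then have "\<bar>fn n x - f x\<bar> * \<bar>l x\<bar> \<le> (\<epsilon> + \<epsilon> powr (1 - s) * \<bar>fn n x - f x\<bar> powr s) * B"
      using l(1)[of x] e by (intro mult_mono) auto
    then show ?thesis using True
      by (simp only: abs_mult distrib_right distrib_left mult.commute[of _ B] mult.assoc) (simp add: distrib_left)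
  qed (use l(2) B0 in \<open>auto simp: not_le\<close>)
  have id: "integrable lebesgue (\<lambda>x. (fn n x - f x) * l x)" for n
    by (rule Bochner_Integration.integrable_bound[where f = "\<lambda>x. B * 1 * indicator (cball 0 R) x + B * 1 powr (1 - s) * \<bar>fn n x - f x\<bar> powr s"])
       (use pw[of 1 n] ic i in \<open>auto intro!: Bochner_Integration.integrable_add integrable_mult_right order_trans[OF _ abs_ge_self]\<close>)
  have "(\<lambda>x. f x * l x) = (\<lambda>x. fn 0 x * l x - (fn 0 x - f x) * l x)" by (auto simp: algebra_simps)
  then show ifl: "integrable lebesgue (\<lambda>x. f x * l x)" using il[of 0] id[of 0] by simp
  have diff: "\<bar>(\<integral>x. fn n x * l x \<partial>lebesgue) - (\<integral>x. f x * l x \<partial>lebesgue)\<bar> \<le> B * \<epsilon> * V + B * \<epsilon> powr (1 - s) * (\<integral>x. \<bar>fn n x - f x\<bar> powr s \<partial>lebesgue)" if e: "0 < \<epsilon>" for n \<epsilon>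
  proof -
    have "(\<integral>x. fn n x * l x \<partial>lebesgue) - (\<integral>x. f x * l x \<partial>lebesgue) = (\<integral>x. (fn n x - f x) * l x \<partial>lebesgue)"
      using il[of n] ifl by (simp add: left_diff_distrib)
    also have "\<bar>\<dots>\<bar> \<le> (\<integral>x. \<bar>(fn n x - f x) * l x\<bar> \<partial>lebesgue)" by (rule integral_abs_bound)
    also have "\<dots> \<le> (\<integral>x. B * \<epsilon> * indicator (cball 0 R) x + B * \<epsilon> powr (1 - s) * \<bar>fn n x - f x\<bar> powr s \<partial>lebesgue)"
      by (intro integral_mono integrable_abs id Bochner_Integration.integrable_add integrable_mult_right ic i pw e)
    also have "\<dots> = B * \<epsilon> * V + B * \<epsilon> powr (1 - s) * (\<integral>x. \<bar>fn n x - f x\<bar> powr s \<partial>lebesgue)"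
      using ic i by (simp add: V_def)
    finally show ?thesis .
  qed
  show "(\<lambda>n. \<integral>x. fn n x * l x \<partial>lebesgue) \<longlonglongrightarrow> (\<integral>x. f x * l x \<partial>lebesgue)"
  proof (rule LIMSEQ_I)
    fix r :: real assume r: "0 < r"
    define D where "D = B * V + 1"
    define \<epsilon> where "\<epsilon> = r / (2 * D)"
    have V0: "0 \<le> V" by (simp add: V_def)
    have BV: "0 < D" unfolding D_def using B0 V0 by (simp add: add_nonneg_pos)
    have e: "0 < \<epsilon>" using r BV by (simp add: \<epsilon>_def)
    have h: "B * \<epsilon> * V < r / 2"
    proof -
      have "B * \<epsilon> * V < \<epsilon> * D" using e by (simp add: D_def algebra_simps)
      also have "\<dots> = r / 2" using BV by (simp add: \<epsilon>_def)
      finally show ?thesis .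
    qed
    have "(\<lambda>n. B * \<epsilon> powr (1 - s) * (\<integral>x. \<bar>fn n x - f x\<bar> powr s \<partial>lebesgue)) \<longlonglongrightarrow> B * \<epsilon> powr (1 - s) * 0"
      by (intro tendsto_mult tendsto_const lim)
    then have "\<forall>\<^sub>F n in sequentially. B * \<epsilon> powr (1 - s) * (\<integral>x. \<bar>fn n x - f x\<bar> powr s \<partial>lebesgue) < r / 2"
      using r by (intro order_tendstoD(2)) auto
    then obtain n0 where "\<And>n. n \<ge> n0 \<Longrightarrow> B * \<epsilon> powr (1 - s) * (\<integral>x. \<bar>fn n x - f x\<bar> powr s \<partial>lebesgue) < r / 2"
      unfolding eventually_sequentially by blast
    then have "\<forall>n\<ge>n0. norm ((\<integral>x. fn n x * l x \<partial>lebesgue) - (\<integral>x. f x * l x \<partial>lebesgue)) < r"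
      using diff[OF e] h by (smt (verit, best) field_sum_of_halves real_norm_def)
    then show "\<exists>n0. \<forall>n\<ge>n0. norm ((\<integral>x. fn n x * l x \<partial>lebesgue) - (\<integral>x. f x * l x \<partial>lebesgue)) < r" by blast
  qed
qed

section \<open>The space \<open>D22\<close> and the weak Laplacian\<close>

text \<open>The critical Sobolev exponent for two derivatives in \<open>L\<^sup>2\<close>.\<close>

definition crit :: "'a::euclidean_space itself \<Rightarrow> real" where
  "crit T = 2 * real DIM('a) / (real DIM('a) - 4)"

text \<open>A quasi-triangle inequality, whose constant is harmless where only smallness matters.\<close>

lemma abs_diff_powr_le:
  assumes "0 \<le> s"
  shows "\<bar>x - y :: real\<bar> powr s \<le> 2 powr s * (\<bar>x - z\<bar> powr s + \<bar>z - y\<bar> powr s)"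
proof -
  define m where "m = max \<bar>x - z\<bar> \<bar>z - y\<bar>"
  have m: "\<bar>x - z\<bar> \<le> m" "\<bar>z - y\<bar> \<le> m" by (auto simp: m_def)
  then have "\<bar>x - y\<bar> \<le> 2 * m" by linarith
  then have "\<bar>x - y\<bar> powr s \<le> (2 * m) powr s" using assms by (intro powr_mono2) auto
  also have "\<dots> = 2 powr s * m powr s" by (subst powr_mult) (auto simp: m_def)
  also have "\<dots> \<le> 2 powr s * (\<bar>x - z\<bar> powr s + \<bar>z - y\<bar> powr s)"
    by (intro mult_left_mono) (auto simp: m_def max_def)
  finally show ?thesis .
qed

lemma nn_integral_abs_diff_powr_le:
  assumes [measurable]: "f \<in> borel_measurable M" "g \<in> borel_measurable M" "h \<in> borel_measurable M" and s: "0 \<le> s"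
  shows "(\<integral>\<^sup>+x. ennreal (\<bar>f x - g x :: real\<bar> powr s) \<partial>M) \<le>
    ennreal (2 powr s) * ((\<integral>\<^sup>+x. ennreal (\<bar>f x - h x\<bar> powr s) \<partial>M) + (\<integral>\<^sup>+x. ennreal (\<bar>h x - g x\<bar> powr s) \<partial>M))"
proof -
  have "(\<integral>\<^sup>+x. ennreal (\<bar>f x - g x\<bar> powr s) \<partial>M) \<le> (\<integral>\<^sup>+x. ennreal (2 powr s) * (ennreal (\<bar>f x - h x\<bar> powr s) + ennreal (\<bar>h x - g x\<bar> powr s)) \<partial>M)"
    using abs_diff_powr_le[OF s] by (intro nn_integral_mono) (simp flip: ennreal_plus ennreal_mult')
  also have "\<dots> = ennreal (2 powr s) * ((\<integral>\<^sup>+x. ennreal (\<bar>f x - h x\<bar> powr s) \<partial>M) + (\<integral>\<^sup>+x. ennreal (\<bar>h x - g x\<bar> powr s) \<partial>M))"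
    by (subst nn_integral_cmult, simp, subst nn_integral_add) auto
  finally show ?thesis .
qed

lemma laplacian_borel: "\<phi> \<in> Cc_infty \<Longrightarrow> laplacian \<phi> \<in> borel_measurable borel"
  by (rule Cc_infty_borel[OF Cc_infty_laplacian])

text \<open>Together with \<open>D22_relE\<close> this replaces the approximating sequence by one test function for each \<open>e\<close>.\<close>

lemma D22_relI:
  fixes u w :: "'a::euclidean_space \<Rightarrow> real"
  assumes m: "u \<in> borel_measurable lebesgue" "w \<in> borel_measurable lebesgue"
    and a: "\<And>e. 0 < e \<Longrightarrow> \<exists>\<phi>\<in>Cc_infty. (\<integral>\<^sup>+x. ennreal (\<bar>\<phi> x - u x\<bar> powr crit TYPE('a)) \<partial>lebesgue) \<le> ennreal e \<and>
       (\<integral>\<^sup>+x. ennreal (\<bar>laplacian \<phi> x - w x\<bar> powr 2) \<partial>lebesgue) \<le> ennreal e"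
  shows "D22_rel u w"
proof -
  have "\<exists>\<phi>\<in>Cc_infty. (\<integral>\<^sup>+x. ennreal (\<bar>\<phi> x - u x\<bar> powr crit TYPE('a)) \<partial>lebesgue) \<le> ennreal (1 / Suc n) \<and>
       (\<integral>\<^sup>+x. ennreal (\<bar>laplacian \<phi> x - w x\<bar> powr 2) \<partial>lebesgue) \<le> ennreal (1 / Suc n)" for n
    by (rule a) simp
  from choice[OF allI[OF this[unfolded Bex_def]]] obtain \<phi> where p: "\<forall>n. \<phi> n \<in> Cc_infty \<and>
     (\<integral>\<^sup>+x. ennreal (\<bar>\<phi> n x - u x\<bar> powr crit TYPE('a)) \<partial>lebesgue) \<le> ennreal (1 / Suc n) \<and>
     (\<integral>\<^sup>+x. ennreal (\<bar>laplacian (\<phi> n) x - w x\<bar> powr 2) \<partial>lebesgue) \<le> ennreal (1 / Suc n)" by (rule exE)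
  note \<phi> = conjunct1[OF spec[OF p]] conjunct1[OF conjunct2[OF spec[OF p]]] conjunct2[OF conjunct2[OF spec[OF p]]]
  have z: "(\<lambda>n. ennreal (1 / Suc n)) \<longlonglongrightarrow> 0"
    using tendsto_ennrealI[OF LIMSEQ_Suc[OF lim_1_over_n]] by simp
  have "(\<lambda>n. \<integral>\<^sup>+x. ennreal (\<bar>\<phi> n x - u x\<bar> powr crit TYPE('a)) \<partial>lebesgue) \<longlonglongrightarrow> 0"
    by (rule tendsto_sandwich[OF _ _ tendsto_const z]) (use \<phi>(2) in auto)
  moreover have "(\<lambda>n. \<integral>\<^sup>+x. ennreal (\<bar>laplacian (\<phi> n) x - w x\<bar> powr 2) \<partial>lebesgue) \<longlonglongrightarrow> 0"
    by (rule tendsto_sandwich[OF _ _ tendsto_const z]) (use \<phi>(3) in auto)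
  ultimately show ?thesis unfolding D22_rel_def using m \<phi>(1) by (auto simp: crit_def)
qed

lemma D22_relE:
  fixes u w :: "'a::euclidean_space \<Rightarrow> real"
  assumes "D22_rel u w" "0 < e"
  obtains \<phi> where "\<phi> \<in> Cc_infty" "(\<integral>\<^sup>+x. ennreal (\<bar>\<phi> x - u x\<bar> powr crit TYPE('a)) \<partial>lebesgue) \<le> ennreal e"
       "(\<integral>\<^sup>+x. ennreal (\<bar>laplacian \<phi> x - w x\<bar> powr 2) \<partial>lebesgue) \<le> ennreal e"
proof -
  obtain \<phi> where \<phi>: "\<And>n. \<phi> n \<in> Cc_infty"
     "(\<lambda>n. \<integral>\<^sup>+x. ennreal (\<bar>\<phi> n x - u x\<bar> powr crit TYPE('a)) \<partial>lebesgue) \<longlonglongrightarrow> 0"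
     "(\<lambda>n. \<integral>\<^sup>+x. ennreal (\<bar>laplacian (\<phi> n) x - w x\<bar> powr 2) \<partial>lebesgue) \<longlonglongrightarrow> 0"
    using assms unfolding D22_rel_def by (auto simp: crit_def)
  have "\<forall>\<^sub>F n in sequentially. (\<integral>\<^sup>+x. ennreal (\<bar>\<phi> n x - u x\<bar> powr crit TYPE('a)) \<partial>lebesgue) < ennreal e \<and>
     (\<integral>\<^sup>+x. ennreal (\<bar>laplacian (\<phi> n) x - w x\<bar> powr 2) \<partial>lebesgue) < ennreal e"
    using order_tendstoD(2)[OF \<phi>(2)] order_tendstoD(2)[OF \<phi>(3)] assms(2) by (intro eventually_conj) auto
  then obtain n where "(\<integral>\<^sup>+x. ennreal (\<bar>\<phi> n x - u x\<bar> powr crit TYPE('a)) \<partial>lebesgue) < ennreal e"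
     "(\<integral>\<^sup>+x. ennreal (\<bar>laplacian (\<phi> n) x - w x\<bar> powr 2) \<partial>lebesgue) < ennreal e"
    unfolding eventually_sequentially by auto
  then show ?thesis using that[OF \<phi>(1)] by (meson less_imp_le)
qed

lemma D22_rel_measurable: "D22_rel u w \<Longrightarrow> u \<in> borel_measurable lebesgue" "D22_rel u w \<Longrightarrow> w \<in> borel_measurable lebesgue"
  by (simp_all add: D22_rel_def)

lemma nn_integral_le_imp_integrable:
  assumes [measurable]: "f \<in> borel_measurable M" and "\<And>x. 0 \<le> f x" "(\<integral>\<^sup>+x. ennreal (f x) \<partial>M) \<le> ennreal e" "0 \<le> e"
  shows "integrable M f" "(\<integral>x. f x \<partial>M) \<le> e"
proof -
  show i: "integrable M f"
    by (rule integrableI_nonneg) (use assms in \<open>auto intro: order.strict_trans1\<close>)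
  show "(\<integral>x. f x \<partial>M) \<le> e" using nn_integral_eq_integral[OF i] assms by simp
qed

lemma D22_rel_sequence:
  fixes u w :: "'a::euclidean_space \<Rightarrow> real"
  assumes "D22_rel u w"
  shows "\<exists>\<phi>. (\<forall>n. \<phi> n \<in> Cc_infty) \<and>
    (\<forall>n. integrable lebesgue (\<lambda>x. \<bar>\<phi> n x - u x\<bar> powr crit TYPE('a))) \<and> (\<lambda>n. \<integral>x. \<bar>\<phi> n x - u x\<bar> powr crit TYPE('a) \<partial>lebesgue) \<longlonglongrightarrow> 0 \<and>
    (\<forall>n. integrable lebesgue (\<lambda>x. \<bar>laplacian (\<phi> n) x - w x\<bar> powr 2)) \<and> (\<lambda>n. \<integral>x. \<bar>laplacian (\<phi> n) x - w x\<bar> powr 2 \<partial>lebesgue) \<longlonglongrightarrow> 0"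
proof -
  have "\<exists>\<phi>\<in>Cc_infty. (\<integral>\<^sup>+x. ennreal (\<bar>\<phi> x - u x\<bar> powr crit TYPE('a)) \<partial>lebesgue) \<le> ennreal (1 / Suc n) \<and>
       (\<integral>\<^sup>+x. ennreal (\<bar>laplacian \<phi> x - w x\<bar> powr 2) \<partial>lebesgue) \<le> ennreal (1 / Suc n)" for n
  proof -
    have e: "0 < 1 / real (Suc n)" by simp
    show ?thesis by (rule D22_relE[OF assms e]) (intro bexI conjI)
  qed
  from choice[OF allI[OF this[unfolded Bex_def]]] obtain \<phi> where p: "\<forall>n. \<phi> n \<in> Cc_infty \<and>
     (\<integral>\<^sup>+x. ennreal (\<bar>\<phi> n x - u x\<bar> powr crit TYPE('a)) \<partial>lebesgue) \<le> ennreal (1 / Suc n) \<and>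
     (\<integral>\<^sup>+x. ennreal (\<bar>laplacian (\<phi> n) x - w x\<bar> powr 2) \<partial>lebesgue) \<le> ennreal (1 / Suc n)" by (rule exE)
  note \<phi> = conjunct1[OF spec[OF p]] conjunct1[OF conjunct2[OF spec[OF p]]] conjunct2[OF conjunct2[OF spec[OF p]]]
  note [measurable] = D22_rel_measurable[OF assms] borel_imp_lebesgue[OF Cc_infty_borel[OF \<phi>(1)]] borel_imp_lebesgue[OF laplacian_borel[OF \<phi>(1)]]
  have z: "(\<lambda>n. 1 / real (Suc n)) \<longlonglongrightarrow> 0" by (rule LIMSEQ_Suc[OF lim_1_over_n])
  have 1: "integrable lebesgue (\<lambda>x. \<bar>\<phi> n x - u x\<bar> powr crit TYPE('a))" "(\<integral>x. \<bar>\<phi> n x - u x\<bar> powr crit TYPE('a) \<partial>lebesgue) \<le> 1 / Suc n" for n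
    using nn_integral_le_imp_integrable[OF _ _ \<phi>(2)[of n]] by auto
  have 2: "integrable lebesgue (\<lambda>x. \<bar>laplacian (\<phi> n) x - w x\<bar> powr 2)" "(\<integral>x. \<bar>laplacian (\<phi> n) x - w x\<bar> powr 2 \<partial>lebesgue) \<le> 1 / Suc n" for n
    using nn_integral_le_imp_integrable[OF _ _ \<phi>(3)[of n]] by auto
  have "(\<lambda>n. \<integral>x. \<bar>\<phi> n x - u x\<bar> powr crit TYPE('a) \<partial>lebesgue) \<longlonglongrightarrow> 0"
    by (rule tendsto_sandwich[OF _ always_eventually tendsto_const z]) (use 1(2) in auto)
  moreover have "(\<lambda>n. \<integral>x. \<bar>laplacian (\<phi> n) x - w x\<bar> powr 2 \<partial>lebesgue) \<longlonglongrightarrow> 0"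
    by (rule tendsto_sandwich[OF _ always_eventually tendsto_const z]) (use 2(2) in auto)
  ultimately show ?thesis using \<phi>(1) 1(1) 2(1) by (intro exI[of _ \<phi>] conjI allI)
qed

lemma crit_gt: "5 \<le> DIM('a::euclidean_space) \<Longrightarrow> 2 < crit TYPE('a)"
  by (simp add: crit_def less_divide_eq)

text \<open>The function \<open>w\<close> is the distributional Laplacian of \<open>u\<close>: Green's identity holds for the approximating
  test functions and passes to the limit.\<close>

theorem D22_rel_pairing:
  fixes u w g :: "'a::euclidean_space \<Rightarrow> real"
  assumes N: "5 \<le> DIM('a)" and u: "D22_rel u w" and g: "C2_data g g1 g2" and z: "\<And>x. R < norm x \<Longrightarrow> g x = 0"
  shows "integrable lebesgue (\<lambda>x. w x * g x)" "integrable lebesgue (\<lambda>x. u x * (\<Sum>b\<in>Basis. g2 b x))"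
    "(\<integral>x. w x * g x \<partial>lebesgue) = (\<integral>x. u x * (\<Sum>b\<in>Basis. g2 b x) \<partial>lebesgue)"
proof -
  define l where "l x = (\<Sum>b\<in>Basis. g2 b x)" for x
  obtain \<phi> where p: "(\<forall>n. \<phi> n \<in> Cc_infty) \<and>
    (\<forall>n. integrable lebesgue (\<lambda>x. \<bar>\<phi> n x - u x\<bar> powr crit TYPE('a))) \<and> (\<lambda>n. \<integral>x. \<bar>\<phi> n x - u x\<bar> powr crit TYPE('a) \<partial>lebesgue) \<longlonglongrightarrow> 0 \<and>
    (\<forall>n. integrable lebesgue (\<lambda>x. \<bar>laplacian (\<phi> n) x - w x\<bar> powr 2)) \<and> (\<lambda>n. \<integral>x. \<bar>laplacian (\<phi> n) x - w x\<bar> powr 2 \<partial>lebesgue) \<longlonglongrightarrow> 0"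
    using D22_rel_sequence[OF u] by (rule exE)
  then have \<phi>: "\<And>n. \<phi> n \<in> Cc_infty"
    "\<And>n. integrable lebesgue (\<lambda>x. \<bar>\<phi> n x - u x\<bar> powr crit TYPE('a))" "(\<lambda>n. \<integral>x. \<bar>\<phi> n x - u x\<bar> powr crit TYPE('a) \<partial>lebesgue) \<longlonglongrightarrow> 0"
    "\<And>n. integrable lebesgue (\<lambda>x. \<bar>laplacian (\<phi> n) x - w x\<bar> powr 2)" "(\<lambda>n. \<integral>x. \<bar>laplacian (\<phi> n) x - w x\<bar> powr 2 \<partial>lebesgue) \<longlonglongrightarrow> 0"
    by blast+
  have gc: "continuous_on UNIV g" using g by (simp add: C2_data_def)
  have lc: "continuous_on UNIV l" unfolding l_def[abs_def] using g by (intro continuous_intros) (auto simp: C2_data_def)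
  have lz: "l x = 0" if "R < norm x" for x unfolding l_def by (rule C2_data_support[OF g z that])
  obtain Bg where Bg: "\<And>x. \<bar>g x\<bar> \<le> Bg" using continuous_compact_support(2)[OF gc z] by metis
  obtain Bl where Bl: "\<And>x. \<bar>l x\<bar> \<le> Bl" using continuous_compact_support(2)[OF lc lz] by metis
  note [measurable] = borel_measurable_continuous_onI[OF gc] borel_measurable_continuous_onI[OF lc] Cc_infty_borel[OF \<phi>(1)] laplacian_borel[OF \<phi>(1)]
  have c: "continuous_on UNIV (\<phi> n)" "continuous_on UNIV (laplacian (\<phi> n))" for n
    using Cc_infty_continuous[OF \<phi>(1)] Cc_infty_continuous[OF Cc_infty_laplacian[OF \<phi>(1)]] by auto
  have i: "integrable lebesgue (\<lambda>x. \<phi> n x * l x)" "integrable lebesgue (\<lambda>x. laplacian (\<phi> n) x * g x)" for n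
    using lz z by (subst lebesgue_integrable_eq; auto intro!: continuous_compact_support(1)[where R = R] continuous_intros c gc lc)+
  have m: "g \<in> borel_measurable lebesgue" "l \<in> borel_measurable lebesgue" "\<phi> n \<in> borel_measurable lebesgue" "laplacian (\<phi> n) \<in> borel_measurable lebesgue" for n
    by (auto intro!: borel_imp_lebesgue)
  have p1: "1 \<le> crit TYPE('a)" using crit_gt[OF N] by simp
  note A = bounded_support_pairing_limit[where R = R, OF p1 m(3) D22_rel_measurable(1)[OF u] m(2) \<phi>(2,3) Bl lz i(1)]
  note B = bounded_support_pairing_limit[where R = R, OF _ m(4) D22_rel_measurable(2)[OF u] m(1) \<phi>(4,5) Bg z i(2)]
  show "integrable lebesgue (\<lambda>x. w x * g x)" using B(1) by simp
  show "integrable lebesgue (\<lambda>x. u x * (\<Sum>b\<in>Basis. g2 b x))" using A(1) by (simp add: l_def)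
  have "(\<integral>x. \<phi> n x * l x \<partial>lebesgue) = (\<integral>x. laplacian (\<phi> n) x * g x \<partial>lebesgue)" for n
  proof -
    obtain R' where R': "\<And>x. R' < norm x \<Longrightarrow> \<phi> n x = 0" by (rule Cc_infty_support[OF \<phi>(1)[of n]]) blast
    note s = Cc_infty_smooth[OF \<phi>(1)]
    have "(\<integral>x. \<phi> n x * l x \<partial>lborel) = (\<integral>x. laplacian (\<phi> n) x * g x \<partial>lborel)"
      unfolding laplacian_C2_data[OF s C2_data_smooth[OF s]] l_def
      by (rule Green_identity[OF C2_data_smooth[OF s] g R'])
    then show ?thesis by (subst (1 2) lebesgue_integral_eq) auto
  qed
  then show "(\<integral>x. w x * g x \<partial>lebesgue) = (\<integral>x. u x * (\<Sum>b\<in>Basis. g2 b x) \<partial>lebesgue)"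
    using LIMSEQ_unique[OF B(2)] A(2) by (simp add: l_def)
qed

lemma abs_powr2: "\<bar>x :: real\<bar> powr 2 = x\<^sup>2" by simp

lemma D22_rel_square_integrable:
  assumes "D22_rel u w"
  shows "integrable lebesgue (\<lambda>x. (w x)\<^sup>2)"
proof -
  obtain \<phi> where \<phi>: "\<phi> \<in> Cc_infty" "(\<integral>\<^sup>+x. ennreal (\<bar>laplacian \<phi> x - w x\<bar> powr 2) \<partial>lebesgue) \<le> ennreal 1"
    using D22_relE[OF assms, of 1] by auto
  note [measurable] = D22_rel_measurable[OF assms] borel_imp_lebesgue[OF laplacian_borel[OF \<phi>(1)]]
  have "integrable lebesgue (\<lambda>x. \<bar>laplacian \<phi> x - w x\<bar> powr 2)"
    by (rule nn_integral_le_imp_integrable(1)[OF _ _ \<phi>(2)]) auto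
  then have 1: "integrable lebesgue (\<lambda>x. (laplacian \<phi> x - w x)\<^sup>2)" by simp
  obtain R where "\<And>x. R < norm x \<Longrightarrow> laplacian \<phi> x = 0" by (rule Cc_infty_support[OF Cc_infty_laplacian[OF \<phi>(1)]]) blast
  then have "integrable lborel (\<lambda>x. (laplacian \<phi> x)\<^sup>2)"
    by (intro continuous_compact_support(1)[where R = R]) (auto intro!: continuous_intros Cc_infty_continuous[OF Cc_infty_laplacian[OF \<phi>(1)]])
  then have 2: "integrable lebesgue (\<lambda>x. (laplacian \<phi> x)\<^sup>2)"
    using laplacian_borel[OF \<phi>(1)] by (subst lebesgue_integrable_eq) auto
  show ?thesis
  proof (rule Bochner_Integration.integrable_bound[OF Bochner_Integration.integrable_add[OF integrable_mult_right[OF 1, of 2] integrable_mult_right[OF 2, of 2]]])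
    have "(w x)\<^sup>2 \<le> 2 * (laplacian \<phi> x - w x)\<^sup>2 + 2 * (laplacian \<phi> x)\<^sup>2" for x
    proof -
      have "0 \<le> (w x - 2 * laplacian \<phi> x)\<^sup>2" by simp
      then show ?thesis by (simp add: power2_eq_square algebra_simps)
    qed
    then show "AE x in lebesgue. norm ((w x)\<^sup>2) \<le> norm (2 * (laplacian \<phi> x - w x)\<^sup>2 + 2 * (laplacian \<phi> x)\<^sup>2)"
      by (auto intro!: order_trans[OF _ abs_ge_self])
  qed auto
qed

lemma D22_rel_Cc: 
  assumes "\<phi> \<in> Cc_infty"
  shows "D22_rel \<phi> (laplacian \<phi>)"
  by (rule D22_relI) (use assms borel_imp_lebesgue[OF Cc_infty_borel[OF assms]] borel_imp_lebesgue[OF laplacian_borel[OF assms]] in \<open>auto intro!: bexI[of _ \<phi>]\<close>)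

lemma D22_rel_diff:
  fixes u w :: "'a::euclidean_space \<Rightarrow> real"
  assumes N: "5 \<le> DIM('a)" and u: "D22_rel u w" and u': "D22_rel u' w'"
  shows "D22_rel (\<lambda>x. u x - u' x) (\<lambda>x. w x - w' x)"
proof (rule D22_relI)
  note [measurable] = D22_rel_measurable[OF u] D22_rel_measurable[OF u']
  show "(\<lambda>x. u x - u' x) \<in> borel_measurable lebesgue" "(\<lambda>x. w x - w' x) \<in> borel_measurable lebesgue" by auto
  fix e :: real assume e: "0 < e"
  let ?p = "crit TYPE('a)"
  have p: "0 \<le> ?p" using crit_gt[OF N] by simp
  define d where "d = min (e / (2 powr ?p * 2)) (e / (2 powr 2 * 2))"
  have d: "0 < d" "2 powr ?p * (d + d) \<le> e" "2 powr 2 * (d + d) \<le> e"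
    using e by (auto simp: d_def min_def field_simps)
  obtain \<phi> where \<phi>: "\<phi> \<in> Cc_infty" "(\<integral>\<^sup>+x. ennreal (\<bar>\<phi> x - u x\<bar> powr ?p) \<partial>lebesgue) \<le> ennreal d"
       "(\<integral>\<^sup>+x. ennreal (\<bar>laplacian \<phi> x - w x\<bar> powr 2) \<partial>lebesgue) \<le> ennreal d" by (rule D22_relE[OF u d(1)])
  obtain \<psi> where \<psi>: "\<psi> \<in> Cc_infty" "(\<integral>\<^sup>+x. ennreal (\<bar>\<psi> x - u' x\<bar> powr ?p) \<partial>lebesgue) \<le> ennreal d"
       "(\<integral>\<^sup>+x. ennreal (\<bar>laplacian \<psi> x - w' x\<bar> powr 2) \<partial>lebesgue) \<le> ennreal d" by (rule D22_relE[OF u' d(1)])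
  note [measurable] = borel_imp_lebesgue[OF Cc_infty_borel[OF \<phi>(1)]] borel_imp_lebesgue[OF laplacian_borel[OF \<phi>(1)]]
     borel_imp_lebesgue[OF Cc_infty_borel[OF \<psi>(1)]] borel_imp_lebesgue[OF laplacian_borel[OF \<psi>(1)]]
  have gen: "(\<integral>\<^sup>+x. ennreal (\<bar>f x - f' x - (h x - h' x)\<bar> powr s) \<partial>lebesgue) \<le> ennreal e"
    if [measurable]: "f \<in> borel_measurable lebesgue" "f' \<in> borel_measurable lebesgue" "h \<in> borel_measurable lebesgue" "h' \<in> borel_measurable lebesgue"
      and "(\<integral>\<^sup>+x. ennreal (\<bar>f x - h x\<bar> powr s) \<partial>lebesgue) \<le> ennreal d" "(\<integral>\<^sup>+x. ennreal (\<bar>f' x - h' x\<bar> powr s) \<partial>lebesgue) \<le> ennreal d"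
      "0 \<le> s" "2 powr s * (d + d) \<le> e" for f f' h h' :: "'a \<Rightarrow> real" and s
  proof -
    have "(\<integral>\<^sup>+x. ennreal (\<bar>(f x - f' x) - (h x - h' x)\<bar> powr s) \<partial>lebesgue) \<le>
       ennreal (2 powr s) * ((\<integral>\<^sup>+x. ennreal (\<bar>(f x - f' x) - (h x - f' x)\<bar> powr s) \<partial>lebesgue) + (\<integral>\<^sup>+x. ennreal (\<bar>(h x - f' x) - (h x - h' x)\<bar> powr s) \<partial>lebesgue))"
      by (rule nn_integral_abs_diff_powr_le) (use that in auto)
    also have "\<dots> = ennreal (2 powr s) * ((\<integral>\<^sup>+x. ennreal (\<bar>f x - h x\<bar> powr s) \<partial>lebesgue) + (\<integral>\<^sup>+x. ennreal (\<bar>f' x - h' x\<bar> powr s) \<partial>lebesgue))"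
      by (simp add: abs_minus_commute)
    also have "\<dots> \<le> ennreal (2 powr s) * (ennreal d + ennreal d)"
      using that by (intro mult_left_mono add_mono) auto
    also have "\<dots> = ennreal (2 powr s * (d + d))" using d(1) by (simp add: ennreal_mult' flip: ennreal_plus)
    also have "\<dots> \<le> ennreal e" using that by (intro ennreal_leI) auto
    finally show ?thesis .
  qed
  show "\<exists>\<phi>\<in>Cc_infty. (\<integral>\<^sup>+x. ennreal (\<bar>\<phi> x - (u x - u' x)\<bar> powr ?p) \<partial>lebesgue) \<le> ennreal e \<and>
       (\<integral>\<^sup>+x. ennreal (\<bar>laplacian \<phi> x - (w x - w' x)\<bar> powr 2) \<partial>lebesgue) \<le> ennreal e"
  proof (rule bexI[of _ "\<lambda>x. \<phi> x - \<psi> x"], intro conjI)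
    show "(\<integral>\<^sup>+x. ennreal (\<bar>\<phi> x - \<psi> x - (u x - u' x)\<bar> powr ?p) \<partial>lebesgue) \<le> ennreal e"
      by (rule gen) (use \<phi> \<psi> p d in auto)
    show "(\<integral>\<^sup>+x. ennreal (\<bar>laplacian (\<lambda>x. \<phi> x - \<psi> x) x - (w x - w' x)\<bar> powr 2) \<partial>lebesgue) \<le> ennreal e"
      unfolding Cc_infty_diff(2)[OF \<phi>(1) \<psi>(1)] by (rule gen) (use \<phi> \<psi> p d in auto)
  qed (rule Cc_infty_diff(1)[OF \<phi>(1) \<psi>(1)])
qed

text \<open>A diagonal argument: limits of limits of test functions are limits of test functions.\<close>

lemma D22_rel_closed:
  fixes u w :: "'a::euclidean_space \<Rightarrow> real"
  assumes N: "5 \<le> DIM('a)" and m [measurable]: "u \<in> borel_measurable lebesgue" "w \<in> borel_measurable lebesgue"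
   and a: "\<And>e. 0 < e \<Longrightarrow> \<exists>u' w'. D22_rel u' w' \<and> (\<integral>\<^sup>+x. ennreal (\<bar>u' x - u x\<bar> powr crit TYPE('a)) \<partial>lebesgue) \<le> ennreal e \<and>
     (\<integral>\<^sup>+x. ennreal (\<bar>w' x - w x\<bar> powr 2) \<partial>lebesgue) \<le> ennreal e"
  shows "D22_rel u w"
proof (rule D22_relI[OF m])
  fix e :: real assume e: "0 < e"
  let ?p = "crit TYPE('a)"
  have p: "0 \<le> ?p" using crit_gt[OF N] by simp
  define d where "d = min (e / (2 powr ?p * 2)) (e / (2 powr 2 * 2))"
  have d: "0 < d" "2 powr ?p * (d + d) \<le> e" "2 powr 2 * (d + d) \<le> e"
    using e by (auto simp: d_def min_def field_simps)
  obtain u' w' where u': "D22_rel u' w'" "(\<integral>\<^sup>+x. ennreal (\<bar>u' x - u x\<bar> powr ?p) \<partial>lebesgue) \<le> ennreal d"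
     "(\<integral>\<^sup>+x. ennreal (\<bar>w' x - w x\<bar> powr 2) \<partial>lebesgue) \<le> ennreal d" using a[OF d(1)] by (elim exE conjE)
  obtain \<phi> where \<phi>: "\<phi> \<in> Cc_infty" "(\<integral>\<^sup>+x. ennreal (\<bar>\<phi> x - u' x\<bar> powr ?p) \<partial>lebesgue) \<le> ennreal d"
       "(\<integral>\<^sup>+x. ennreal (\<bar>laplacian \<phi> x - w' x\<bar> powr 2) \<partial>lebesgue) \<le> ennreal d" by (rule D22_relE[OF u'(1) d(1)])
  note [measurable] = borel_imp_lebesgue[OF Cc_infty_borel[OF \<phi>(1)]] borel_imp_lebesgue[OF laplacian_borel[OF \<phi>(1)]]
     D22_rel_measurable[OF u'(1)]
  have gen: "(\<integral>\<^sup>+x. ennreal (\<bar>f x - h x\<bar> powr s) \<partial>lebesgue) \<le> ennreal e"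
    if [measurable]: "f \<in> borel_measurable lebesgue" "f' \<in> borel_measurable lebesgue" "h \<in> borel_measurable lebesgue"
      and "(\<integral>\<^sup>+x. ennreal (\<bar>f x - f' x\<bar> powr s) \<partial>lebesgue) \<le> ennreal d" "(\<integral>\<^sup>+x. ennreal (\<bar>f' x - h x\<bar> powr s) \<partial>lebesgue) \<le> ennreal d"
      "0 \<le> s" "2 powr s * (d + d) \<le> e" for f f' h :: "'a \<Rightarrow> real" and s
  proof -
    have "(\<integral>\<^sup>+x. ennreal (\<bar>f x - h x\<bar> powr s) \<partial>lebesgue) \<le>
       ennreal (2 powr s) * ((\<integral>\<^sup>+x. ennreal (\<bar>f x - f' x\<bar> powr s) \<partial>lebesgue) + (\<integral>\<^sup>+x. ennreal (\<bar>f' x - h x\<bar> powr s) \<partial>lebesgue))"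
      by (rule nn_integral_abs_diff_powr_le) (use that in auto)
    also have "\<dots> \<le> ennreal (2 powr s) * (ennreal d + ennreal d)"
      using that by (intro mult_left_mono add_mono) auto
    also have "\<dots> = ennreal (2 powr s * (d + d))" using d(1) by (simp add: ennreal_mult' flip: ennreal_plus)
    also have "\<dots> \<le> ennreal e" using that by (intro ennreal_leI) auto
    finally show ?thesis .
  qed
  show "\<exists>\<phi>\<in>Cc_infty. (\<integral>\<^sup>+x. ennreal (\<bar>\<phi> x - u x\<bar> powr ?p) \<partial>lebesgue) \<le> ennreal e \<and>
       (\<integral>\<^sup>+x. ennreal (\<bar>laplacian \<phi> x - w x\<bar> powr 2) \<partial>lebesgue) \<le> ennreal e"
    by (rule bexI[OF _ \<phi>(1)], intro conjI; rule gen[where f' = u'] gen[where f' = w']) (use \<phi> u' p d in auto)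
qed

text \<open>The difference \<open>d\<close> of two Laplacians belongs to the zero function. Pairing it with
  \<open>laplacian \<phi>\<close>, which is again a test function, shows that \<open>d\<close> is orthogonal to \<open>laplacian \<phi>\<close>, although these functions
  approximate \<open>d\<close>. Hence \<open>d = 0\<close>.\<close>

theorem D22_rel_unique:
  fixes u w :: "'a::euclidean_space \<Rightarrow> real"
  assumes N: "5 \<le> DIM('a)" and u: "D22_rel u w" and u': "D22_rel u w'"
  shows "AE x in lebesgue. w x = w' x"
proof -
  define d where "d = (\<lambda>x. w x - w' x)"
  have D: "D22_rel (\<lambda>x. u x - u x) d" unfolding d_def by (rule D22_rel_diff[OF N u u'])
  note di = D22_rel_square_integrable[OF D]
  have "(\<integral>x. (d x)\<^sup>2 \<partial>lebesgue) \<le> e" if e: "0 < e" for e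
  proof -
    obtain \<phi> where \<phi>: "\<phi> \<in> Cc_infty" "(\<integral>\<^sup>+x. ennreal (\<bar>laplacian \<phi> x - d x\<bar> powr 2) \<partial>lebesgue) \<le> ennreal e"
      by (rule D22_relE[OF D e])
    note [measurable] = D22_rel_measurable[OF D] borel_imp_lebesgue[OF laplacian_borel[OF \<phi>(1)]]
    have 1: "integrable lebesgue (\<lambda>x. (laplacian \<phi> x - d x)\<^sup>2)" "(\<integral>x. (laplacian \<phi> x - d x)\<^sup>2 \<partial>lebesgue) \<le> e"
      using nn_integral_le_imp_integrable[OF _ _ \<phi>(2)] e by auto
    obtain R where R: "\<And>x. R < norm x \<Longrightarrow> laplacian \<phi> x = 0" by (rule Cc_infty_support[OF Cc_infty_laplacian[OF \<phi>(1)]]) blast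
    note L = D22_rel_square_integrable[OF D22_rel_Cc[OF \<phi>(1)]]
    note P = D22_rel_pairing[OF N D C2_data_smooth[OF Cc_infty_smooth[OF Cc_infty_laplacian[OF \<phi>(1)]]] R]
    have "(\<integral>x. (laplacian \<phi> x - d x)\<^sup>2 \<partial>lebesgue) = (\<integral>x. (laplacian \<phi> x)\<^sup>2 - 2 * (d x * laplacian \<phi> x) + (d x)\<^sup>2 \<partial>lebesgue)"
      by (intro Bochner_Integration.integral_cong) (auto simp: power2_eq_square algebra_simps)
    also have "\<dots> = (\<integral>x. (laplacian \<phi> x)\<^sup>2 \<partial>lebesgue) + (\<integral>x. (d x)\<^sup>2 \<partial>lebesgue)"
      using L di P by simp
    finally have eq: "(\<integral>x. (laplacian \<phi> x - d x)\<^sup>2 \<partial>lebesgue) = (\<integral>x. (laplacian \<phi> x)\<^sup>2 \<partial>lebesgue) + (\<integral>x. (d x)\<^sup>2 \<partial>lebesgue)" .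
    have "0 \<le> (\<integral>x. (laplacian \<phi> x)\<^sup>2 \<partial>lebesgue)" by (rule Bochner_Integration.integral_nonneg) simp
    then show ?thesis using 1(2) eq by linarith
  qed
  then have "(\<integral>x. (d x)\<^sup>2 \<partial>lebesgue) \<le> 0 + e" if "0 < e" for e using that by simp
  then have "(\<integral>x. (d x)\<^sup>2 \<partial>lebesgue) \<le> 0" by (rule field_le_epsilon)
  then have "(\<integral>x. (d x)\<^sup>2 \<partial>lebesgue) = 0" using Bochner_Integration.integral_nonneg[of lebesgue "\<lambda>x. (d x)\<^sup>2"] by (simp add: order_antisym)
  then have "AE x in lebesgue. (d x)\<^sup>2 = 0" using integral_nonneg_eq_0_iff_AE[OF di] by simp
  then show ?thesis by eventually_elim (simp add: d_def)
qed

lemma L2_norm_limit: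
  fixes f :: "'a \<Rightarrow> real"
  assumes [measurable]: "f \<in> borel_measurable M" "\<And>n. fn n \<in> borel_measurable M"
    and i: "integrable M (\<lambda>x. (f x)\<^sup>2)" "\<And>n. integrable M (\<lambda>x. (fn n x - f x)\<^sup>2)"
    and lim: "(\<lambda>n. \<integral>x. (fn n x - f x)\<^sup>2 \<partial>M) \<longlonglongrightarrow> 0"
  shows "integrable M (\<lambda>x. (fn n x)\<^sup>2)" "(\<lambda>n. \<integral>x. (fn n x)\<^sup>2 \<partial>M) \<longlonglongrightarrow> (\<integral>x. (f x)\<^sup>2 \<partial>M)"
proof -
  define e where "e n = (\<integral>x. (fn n x - f x)\<^sup>2 \<partial>M)" for n
  define c where "c n = (\<integral>x. f x * (fn n x - f x) \<partial>M)" for n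
  have ic: "integrable M (\<lambda>x. f x * (fn n x - f x))" for n
    by (rule L2_product_integrable) (use i in auto)
  have eq: "(fn n x)\<^sup>2 = (f x)\<^sup>2 + 2 * (f x * (fn n x - f x)) + (fn n x - f x)\<^sup>2" for n x
    by (simp add: power2_eq_square algebra_simps)
  show "integrable M (\<lambda>x. (fn n x)\<^sup>2)" unfolding eq using i ic by simp
  have val: "(\<integral>x. (fn n x)\<^sup>2 \<partial>M) = (\<integral>x. (f x)\<^sup>2 \<partial>M) + 2 * c n + e n" for n
    unfolding eq using i ic by (simp add: c_def e_def)
  have "(\<lambda>n. (c n)\<^sup>2) \<longlonglongrightarrow> 0"
  proof (rule tendsto_sandwich[where f = "\<lambda>_. 0" and h = "\<lambda>n. (\<integral>x. (f x)\<^sup>2 \<partial>M) * e n"])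
    show "\<forall>\<^sub>F n in sequentially. (c n)\<^sup>2 \<le> (\<integral>x. (f x)\<^sup>2 \<partial>M) * e n"
      unfolding c_def e_def by (intro always_eventually allI Cauchy_Schwarz_integral) (use i in auto)
    have "(\<lambda>n. (\<integral>x. (f x)\<^sup>2 \<partial>M) * e n) \<longlonglongrightarrow> (\<integral>x. (f x)\<^sup>2 \<partial>M) * 0"
      unfolding e_def by (intro tendsto_intros lim)
    then show "(\<lambda>n. (\<integral>x. (f x)\<^sup>2 \<partial>M) * e n) \<longlonglongrightarrow> 0" by simp
    show "(\<lambda>n. 0) \<longlonglongrightarrow> (0 :: real)" by simp
  qed auto
  from tendsto_real_sqrt[OF this] have c0: "c \<longlonglongrightarrow> 0" by (simp add: tendsto_rabs_zero_iff)
  have "(\<lambda>n. (\<integral>x. (f x)\<^sup>2 \<partial>M) + 2 * c n + e n) \<longlonglongrightarrow> (\<integral>x. (f x)\<^sup>2 \<partial>M) + 2 * 0 + 0"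
    by (intro tendsto_intros c0) (simp add: e_def lim)
  then show "(\<lambda>n. \<integral>x. (fn n x)\<^sup>2 \<partial>M) \<longlonglongrightarrow> (\<integral>x. (f x)\<^sup>2 \<partial>M)" by (simp add: val)
qed

lemma AE_lebesgue_nonzero: "AE x in lebesgue. x \<noteq> (0 :: 'a::euclidean_space)"
  using AE_lborel_singleton[of "0::'a"] by (rule AE_completion)

text \<open>The approximating test functions converge almost everywhere along a subsequence. The inequality with the
  regularising parameter \<open>1 / Suc n\<close> is applied to the \<open>n\<close>-th of them, and Fatou's lemma gives the limit.\<close>

theorem D22_Rellich:
  fixes u w :: "'a::euclidean_space \<Rightarrow> real"
  assumes N: "5 \<le> DIM('a)" and u: "D22_rel u w"
    and a: "a = (real DIM('a) - 4) / 2" and gam: "gam = a * (a + 2)"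
  shows "integrable lebesgue (\<lambda>x. norm x powr (- 4) * \<bar>u x\<bar>\<^sup>2)"
    "gam\<^sup>2 * (\<integral>x. norm x powr (- 4) * \<bar>u x\<bar>\<^sup>2 \<partial>lebesgue) \<le> (\<integral>x. (w x)\<^sup>2 \<partial>lebesgue)"
proof -
  have a0: "0 < a" using N a by simp
  have g0: "0 < gam" using a0 gam by simp
  let ?p = "crit TYPE('a)"
  have p: "2 < ?p" by (rule crit_gt[OF N])
  obtain \<phi> where p0: "(\<forall>n. \<phi> n \<in> Cc_infty) \<and>
    (\<forall>n. integrable lebesgue (\<lambda>x. \<bar>\<phi> n x - u x\<bar> powr ?p)) \<and> (\<lambda>n. \<integral>x. \<bar>\<phi> n x - u x\<bar> powr ?p \<partial>lebesgue) \<longlonglongrightarrow> 0 \<and>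
    (\<forall>n. integrable lebesgue (\<lambda>x. \<bar>laplacian (\<phi> n) x - w x\<bar> powr 2)) \<and> (\<lambda>n. \<integral>x. \<bar>laplacian (\<phi> n) x - w x\<bar> powr 2 \<partial>lebesgue) \<longlonglongrightarrow> 0"
    using D22_rel_sequence[OF u] by (rule exE)
  then have \<phi>: "\<And>n. \<phi> n \<in> Cc_infty"
    "\<And>n. integrable lebesgue (\<lambda>x. \<bar>\<phi> n x - u x\<bar> powr ?p)" "(\<lambda>n. \<integral>x. \<bar>\<phi> n x - u x\<bar> powr ?p \<partial>lebesgue) \<longlonglongrightarrow> 0"
    "\<And>n. integrable lebesgue (\<lambda>x. (laplacian (\<phi> n) x - w x)\<^sup>2)" "(\<lambda>n. \<integral>x. (laplacian (\<phi> n) x - w x)\<^sup>2 \<partial>lebesgue) \<longlonglongrightarrow> 0"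
    by simp_all
  have "(\<lambda>n. \<integral>x. norm (\<bar>\<phi> n x - u x\<bar> powr ?p) \<partial>lebesgue) \<longlonglongrightarrow> 0" using \<phi>(3) by simp
  from tendsto_L1_AE_subseq[OF \<phi>(2) this] obtain r where r: "strict_mono (r :: nat \<Rightarrow> nat)"
    and ae: "AE x in lebesgue. (\<lambda>n. \<bar>\<phi> (r n) x - u x\<bar> powr ?p) \<longlonglongrightarrow> 0" by blast
  have rlim: "filterlim r at_top sequentially" by (rule filterlim_subseq[OF r])
  note [measurable] = D22_rel_measurable[OF u] borel_imp_lebesgue[OF Cc_infty_borel[OF \<phi>(1)]] borel_imp_lebesgue[OF laplacian_borel[OF \<phi>(1)]]
  have [measurable]: "(\<lambda>x::'a. norm x powr (- 4)) \<in> borel_measurable lebesgue"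
    by (rule borel_imp_lebesgue) measurable
  have [measurable]: "(\<lambda>x::'a. 1 / (x \<bullet> x + c)) \<in> borel_measurable lebesgue" for c
    by (rule borel_imp_lebesgue) measurable
  define E where "E n = (\<integral>x. (laplacian (\<phi> n) x)\<^sup>2 \<partial>lebesgue)" for n
  note L2 = L2_norm_limit[OF _ _ D22_rel_square_integrable[OF u] \<phi>(4,5)]
  have Elim: "E \<longlonglongrightarrow> (\<integral>x. (w x)\<^sup>2 \<partial>lebesgue)" unfolding E_def by (rule L2(2)) auto
  have Er: "(\<lambda>n. ennreal (E (r n) / gam\<^sup>2)) \<longlonglongrightarrow> ennreal ((\<integral>x. (w x)\<^sup>2 \<partial>lebesgue) / gam\<^sup>2)"
    using g0 by (intro tendsto_ennrealI tendsto_divide filterlim_compose[OF Elim rlim] tendsto_const) auto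
  define F where "F n x = (\<phi> (r n) x)\<^sup>2 * (1 / (x \<bullet> x + 1 / Suc n))\<^sup>2" for n x
  have [measurable]: "F n \<in> borel_measurable lebesgue" for n unfolding F_def by measurable
  have Fb: "(\<integral>\<^sup>+x. ennreal (F n x) \<partial>lebesgue) \<le> ennreal (E (r n) / gam\<^sup>2)" for n
  proof -
    obtain R where R: "\<And>x. R < norm x \<Longrightarrow> \<phi> (r n) x = 0" by (rule Cc_infty_support[OF \<phi>(1)[of "r n"]]) blast
    note s = Cc_infty_smooth[OF \<phi>(1)]
    have Fc: "continuous_on UNIV (F n)" unfolding F_def[abs_def]
    proof (intro continuous_intros Cc_infty_continuous[OF \<phi>(1)] ballI)
      fix x :: 'a
      have "0 < x \<bullet> x + 1 / Suc n" by (intro add_nonneg_pos) auto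
      then show "x \<bullet> x + 1 / Suc n \<noteq> 0" by simp
    qed
    have iF: "integrable lborel (F n)" by (rule continuous_compact_support(1)[OF Fc, of R]) (simp add: F_def R)
    have Fm: "F n \<in> borel_measurable borel" by (rule borel_measurable_continuous_onI[OF Fc])
    have "gam\<^sup>2 * (\<integral>x. F n x \<partial>lborel) \<le> (\<integral>x. (laplacian (\<phi> (r n)) x)\<^sup>2 \<partial>lborel)"
      unfolding laplacian_C2_data[OF s C2_data_smooth[OF s]] F_def
      by (rule Rellich_regularized[OF C2_data_smooth[OF s] R _ a _ gam]) (use a0 in auto)
    also have "\<dots> = E (r n)" unfolding E_def by (subst lebesgue_integral_eq) (auto intro!: borel_measurable_power laplacian_borel \<phi>)
    finally have "(\<integral>x. F n x \<partial>lborel) \<le> E (r n) / gam\<^sup>2" using g0 by (simp add: field_simps)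
    moreover have "(\<integral>\<^sup>+x. ennreal (F n x) \<partial>lebesgue) = ennreal (\<integral>x. F n x \<partial>lborel)"
    proof -
      have "0 \<le> F n x" for x by (simp add: F_def)
      then show ?thesis using nn_integral_eq_integral[OF iF] Fm by (simp add: nn_integral_completion)
    qed
    ultimately show ?thesis by (simp add: ennreal_leI)
  qed
  have "(\<integral>\<^sup>+x. ennreal (norm x powr (- 4) * \<bar>u x\<bar>\<^sup>2) \<partial>lebesgue) = (\<integral>\<^sup>+x. liminf (\<lambda>n. ennreal (F n x)) \<partial>lebesgue)"
  proof (rule nn_integral_cong_AE)
    show "AE x in lebesgue. ennreal (norm x powr (- 4) * \<bar>u x\<bar>\<^sup>2) = liminf (\<lambda>n. ennreal (F n x))"
      using ae AE_lebesgue_nonzero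
    proof eventually_elim
      case (elim x)
      have "(\<lambda>n. (\<bar>\<phi> (r n) x - u x\<bar> powr ?p) powr (1 / ?p)) \<longlonglongrightarrow> 0"
        by (rule tendsto_zero_powrI[OF elim(1) tendsto_const]) (use p in auto)
      then have "(\<lambda>n. \<bar>\<phi> (r n) x - u x\<bar>) \<longlonglongrightarrow> 0" using p by (simp add: powr_powr)
      then have c: "(\<lambda>n. \<phi> (r n) x) \<longlonglongrightarrow> u x" by (simp add: tendsto_rabs_zero_iff LIM_zero_iff)
      have "(\<lambda>n. F n x) \<longlonglongrightarrow> (u x)\<^sup>2 * (1 / (x \<bullet> x + 0))\<^sup>2"
        unfolding F_def using elim(2) by (intro tendsto_intros c LIMSEQ_Suc[OF lim_1_over_n]) auto
      moreover have "(u x)\<^sup>2 * (1 / (x \<bullet> x + 0))\<^sup>2 = norm x powr (- 4) * \<bar>u x\<bar>\<^sup>2"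
      proof -
        have "norm x powr (- 4) = inverse (norm x ^ 4)" using elim(2) by (simp add: powr_minus powr_numeral)
        moreover have "(x \<bullet> x)\<^sup>2 = norm x ^ 4" by (simp add: power2_norm_eq_inner[symmetric] flip: power_mult)
        ultimately show ?thesis by (simp add: divide_inverse power_inverse mult.commute)
      qed
      ultimately have "(\<lambda>n. F n x) \<longlonglongrightarrow> norm x powr (- 4) * \<bar>u x\<bar>\<^sup>2" by (simp only:)
      then have "(\<lambda>n. ennreal (F n x)) \<longlonglongrightarrow> ennreal (norm x powr (- 4) * \<bar>u x\<bar>\<^sup>2)" by (rule tendsto_ennrealI)
      from lim_imp_Liminf[OF sequentially_bot this] show ?case by (rule sym)
    qed
  qed
  also have "\<dots> \<le> liminf (\<lambda>n. \<integral>\<^sup>+x. ennreal (F n x) \<partial>lebesgue)" by (rule nn_integral_liminf) measurable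
  also have "\<dots> \<le> liminf (\<lambda>n. ennreal (E (r n) / gam\<^sup>2))" by (intro Liminf_mono always_eventually allI Fb)
  also have "\<dots> = ennreal ((\<integral>x. (w x)\<^sup>2 \<partial>lebesgue) / gam\<^sup>2)" by (rule lim_imp_Liminf[OF sequentially_bot Er])
  finally have nn: "(\<integral>\<^sup>+x. ennreal (norm x powr (- 4) * \<bar>u x\<bar>\<^sup>2) \<partial>lebesgue) \<le> ennreal ((\<integral>x. (w x)\<^sup>2 \<partial>lebesgue) / gam\<^sup>2)" .
  have w0: "0 \<le> (\<integral>x. (w x)\<^sup>2 \<partial>lebesgue) / gam\<^sup>2" by simp
  note fin = nn_integral_le_imp_integrable[OF _ _ nn w0]
  show "integrable lebesgue (\<lambda>x. norm x powr (- 4) * \<bar>u x\<bar>\<^sup>2)" by (rule fin(1)) auto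
  have "(\<integral>x. norm x powr (- 4) * \<bar>u x\<bar>\<^sup>2 \<partial>lebesgue) \<le> (\<integral>x. (w x)\<^sup>2 \<partial>lebesgue) / gam\<^sup>2" by (rule fin(2)) auto
  then show "gam\<^sup>2 * (\<integral>x. norm x powr (- 4) * \<bar>u x\<bar>\<^sup>2 \<partial>lebesgue) \<le> (\<integral>x. (w x)\<^sup>2 \<partial>lebesgue)"
    using g0 by (simp add: field_simps)
qed

section \<open>Logarithmic polar coordinates\<close>

text \<open>The Emden--Fowler substitution: \<open>k\<close> is the profile, a function of the logarithmic radius
  \<open>t = - ln \<bar>x\<bar>\<close>. Multiplication by a power of \<open>\<bar>x\<bar>\<close> and the Laplacian only change \<open>m\<close> and \<open>k\<close>.\<close>

definition rad :: "real \<Rightarrow> (real \<Rightarrow> real) \<Rightarrow> 'a::euclidean_space \<Rightarrow> real" where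
  "rad m k x = norm x powr (- m) * k (- ln (norm x))"

text \<open>The area of the unit sphere is the derivative at \<open>1\<close> of the volume of the ball in its radius.\<close>

definition sphere_area :: "'a::euclidean_space itself \<Rightarrow> real" where
  "sphere_area T = real DIM('a) * unit_ball_vol DIM('a)"

lemma sphere_area_pos: "0 < sphere_area TYPE('a::euclidean_space)"
  by (simp add: sphere_area_def)

text \<open>Both measures give the half line \<open>{t<..}\<close> the volume of the ball of radius \<open>exp (- t)\<close>.\<close>

lemma polar_distr:
  "distr (lborel :: 'a::euclidean_space measure) borel (\<lambda>x. - ln (norm x)) =
   density lborel (\<lambda>t. ennreal (sphere_area TYPE('a) * exp (- real DIM('a) * t)))"
proof (rule measure_eqI_lessThan)
  let ?N = "real DIM('a)"
  have N0: "?N > 0" by simp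
  have Nz: "?N \<noteq> 0" by simp
  have l: "emeasure (distr (lborel :: 'a measure) borel (\<lambda>x. - ln (norm x))) {t<..} = ennreal (unit_ball_vol ?N * exp (- ?N * t))" for t
  proof -
    have "emeasure (distr (lborel :: 'a measure) borel (\<lambda>x. - ln (norm x))) {t<..} = emeasure lborel {x :: 'a. t < - ln (norm x)}"
      by (subst emeasure_distr) (auto simp: vimage_def)
    also have "\<dots> = emeasure lborel (ball (0::'a) (exp (- t)))"
    proof (rule emeasure_eq_AE)
      show "AE x in lborel. (x \<in> {x :: 'a. t < - ln (norm x)}) = (x \<in> ball 0 (exp (- t)))"
        using AE_lborel_singleton[of "0::'a"]
      proof eventually_elim
        case (elim x)
        then have "norm x < exp (- t) \<longleftrightarrow> ln (norm x) < - t"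
          by (metis exp_less_cancel_iff exp_ln zero_less_norm_iff)
        then show ?case by auto
      qed
    qed auto
    also have "\<dots> = ennreal (unit_ball_vol ?N * exp (- t) ^ DIM('a))" by (rule emeasure_ball) simp
    also have "exp (- t) ^ DIM('a) = exp (- ?N * t)" by (simp flip: exp_of_nat_mult)
    finally show ?thesis .
  qed
  show "emeasure (distr (lborel :: 'a measure) borel (\<lambda>x. - ln (norm x))) {t<..} < \<infinity>" for t by (simp add: l)
  show "emeasure (distr (lborel :: 'a measure) borel (\<lambda>x. - ln (norm x))) {t<..} =
     emeasure (density lborel (\<lambda>t. ennreal (sphere_area TYPE('a) * exp (- ?N * t)))) {t<..}" for t
  proof -
    have "emeasure (density lborel (\<lambda>t. ennreal (sphere_area TYPE('a) * exp (- ?N * t)))) {t<..} =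
      (\<integral>\<^sup>+s. ennreal (sphere_area TYPE('a) * exp (- ?N * s)) * indicator {t<..} s \<partial>lborel)"
      by (subst emeasure_density) auto
    also have "\<dots> = (\<integral>\<^sup>+s. ennreal (sphere_area TYPE('a) * exp (- ?N * s)) * indicator {t..} s \<partial>lborel)"
    proof (rule nn_integral_cong_AE)
      show "AE s in lborel. ennreal (sphere_area TYPE('a) * exp (- ?N * s)) * indicator {t<..} s =
         ennreal (sphere_area TYPE('a) * exp (- ?N * s)) * indicator {t..} s"
        using AE_lborel_singleton[of t] by eventually_elim (auto simp: indicator_def)
    qed
    also have "\<dots> = ennreal (0 - (- unit_ball_vol ?N * exp (- ?N * t)))"
    proof (rule nn_integral_FTC_atLeast)
      show "((\<lambda>t. - unit_ball_vol ?N * exp (- ?N * t)) has_real_derivative sphere_area TYPE('a) * exp (- ?N * s)) (at s)" for s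
        by (auto intro!: derivative_eq_intros simp: sphere_area_def)
      have "((\<lambda>t. - unit_ball_vol ?N * exp (- ?N * t)) \<longlongrightarrow> - unit_ball_vol ?N * 0) at_top"
        using N0 by (intro tendsto_mult tendsto_const) real_asymp
      then show "((\<lambda>t. - unit_ball_vol ?N * exp (- ?N * t)) \<longlongrightarrow> 0) at_top" by simp
    qed (auto simp: sphere_area_def)
    finally show ?thesis by (simp add: l)
  qed
qed auto

lemma polar_AE:
  assumes "AE t in lborel. P t"
  shows "AE x in (lborel :: 'a::euclidean_space measure). P (- ln (norm x))"
proof -
  obtain Z where Z: "{t. \<not> P t} \<subseteq> Z" "Z \<in> sets borel" "emeasure lborel Z = 0"
    using assms by (auto elim!: AE_E)
  have "AE t in lborel. t \<notin> Z" using Z by (intro AE_not_in) auto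
  then have "AE t in distr (lborel :: 'a measure) borel (\<lambda>x. - ln (norm x)). t \<notin> Z"
    unfolding polar_distr by (subst AE_density) auto
  then have "AE x in (lborel :: 'a measure). - ln (norm x) \<notin> Z"
    by (subst (asm) AE_distr_iff) (use Z in auto)
  then show ?thesis by eventually_elim (use Z in auto)
qed

lemma rad_measurable [measurable]:
  assumes [measurable]: "k \<in> borel_measurable borel"
  shows "rad m k \<in> borel_measurable borel"
  unfolding rad_def[abs_def] by measurable

lemma norm_powr_exp: "x \<noteq> 0 \<Longrightarrow> norm x powr (- m) = exp (m * (- ln (norm x)))"
  by (simp add: powr_def)

text \<open>The exponent \<open>DIM('a)\<close> is the one at which the Jacobian \<open>exp (- DIM('a) * t)\<close> of the
  logarithmic radius cancels.\<close>

lemma rad_integral: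
  fixes k :: "real \<Rightarrow> real"
  assumes k [measurable]: "k \<in> borel_measurable borel"
  shows "integrable lebesgue (rad (real DIM('a)) k :: 'a::euclidean_space \<Rightarrow> real) \<longleftrightarrow> integrable lborel k"
    "(\<integral>x. rad (real DIM('a)) k x \<partial>(lebesgue :: 'a measure)) = sphere_area TYPE('a) * (\<integral>t. k t \<partial>lborel)"
proof -
  let ?N = "real DIM('a)" and ?A = "sphere_area TYPE('a)"
  let ?T = "\<lambda>x::'a. - ln (norm x)"
  define f where "f t = exp (?N * t) * k t" for t
  have [measurable]: "f \<in> borel_measurable borel" unfolding f_def by measurable
  have ae: "AE x in lborel. rad ?N k x = f (?T x)"
    using AE_lborel_singleton[of "0::'a"] by eventually_elim (simp add: rad_def f_def norm_powr_exp)
  have e: "(?A * exp (- ?N * t)) *\<^sub>R f t = ?A * k t" for t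
    by (simp add: f_def mult_exp_exp)
  have "integrable lebesgue (rad ?N k :: 'a \<Rightarrow> real) \<longleftrightarrow> integrable lborel (rad ?N k :: 'a \<Rightarrow> real)"
    by (rule lebesgue_integrable_eq) measurable
  also have "\<dots> \<longleftrightarrow> integrable lborel (\<lambda>x. f (?T x))" by (rule integrable_cong_AE) (use ae in auto)
  also have "\<dots> \<longleftrightarrow> integrable (distr lborel borel ?T) f" by (rule integrable_distr_eq[symmetric]) auto
  also have "\<dots> \<longleftrightarrow> integrable lborel (\<lambda>t. ?A * k t)"
  proof -
    have "integrable (distr lborel borel ?T) f \<longleftrightarrow> integrable lborel (\<lambda>t. (?A * exp (- ?N * t)) *\<^sub>R f t)"
      unfolding polar_distr by (rule integrable_density) (auto simp: sphere_area_pos less_imp_le)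
    then show ?thesis unfolding e .
  qed
  also have "\<dots> \<longleftrightarrow> integrable lborel k" using sphere_area_pos[where 'a = 'a] by (auto simp: integrable_mult_right_iff)
  finally show "integrable lebesgue (rad ?N k :: 'a \<Rightarrow> real) \<longleftrightarrow> integrable lborel k" .
  have "(\<integral>x. rad ?N k x \<partial>(lebesgue :: 'a measure)) = (\<integral>x. rad ?N k x \<partial>(lborel :: 'a measure))"
    by (rule lebesgue_integral_eq) measurable
  also have "\<dots> = (\<integral>x. f (?T x) \<partial>lborel)" by (rule integral_cong_AE) (use ae in auto)
  also have "\<dots> = (\<integral>t. f t \<partial>distr lborel borel ?T)" by (rule integral_distr[symmetric]) auto
  also have "\<dots> = (\<integral>t. ?A * k t \<partial>lborel)"
  proof -
    have "(\<integral>t. f t \<partial>distr lborel borel ?T) = (\<integral>t. (?A * exp (- ?N * t)) *\<^sub>R f t \<partial>lborel)"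
      unfolding polar_distr by (rule integral_density) (auto simp: sphere_area_pos less_imp_le)
    then show ?thesis unfolding e .
  qed
  finally show "(\<integral>x. rad ?N k x \<partial>(lebesgue :: 'a measure)) = ?A * (\<integral>t. k t \<partial>lborel)" by simp
qed

lemma polar_null:
  assumes Z: "Z \<in> sets borel" and n: "AE x in (lborel :: 'a::euclidean_space measure). - ln (norm x) \<notin> Z"
  shows "AE t in lborel. t \<notin> Z"
proof -
  have "AE t in distr (lborel :: 'a measure) borel (\<lambda>x. - ln (norm x)). t \<notin> Z"
    by (subst AE_distr_iff) (use Z n in auto)
  then show ?thesis unfolding polar_distr by (subst (asm) AE_density) (auto simp: sphere_area_pos)
qed

text \<open>A set of radii whose preimage is Lebesgue measurable need not be Borel, so the description of the image
  measure on Borel sets does not apply to it directly. From inside, the preimage is exhausted up to a null set by compact sets; their images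
  are compact, so \<open>S\<close> contains a Borel set of almost full measure. The same holds for the complement of
  \<open>S\<close>, and what remains between the two is null.\<close>

lemma radial_set_measurable:
  fixes S :: "real set"
  assumes S: "{x :: 'a::euclidean_space. x \<noteq> 0 \<and> - ln (norm x) \<in> S} \<in> sets lebesgue"
  shows "S \<in> sets lebesgue"
proof -
  let ?T = "\<lambda>x::'a. - ln (norm x)"
  have key: "\<exists>D. D \<in> sets borel \<and> D \<subseteq> U \<and> (AE x in lebesgue. x \<noteq> 0 \<longrightarrow> ?T x \<in> U \<longrightarrow> ?T x \<in> D)"
    if U: "{x :: 'a. x \<noteq> 0 \<and> ?T x \<in> U} \<in> sets lebesgue" for U
  proof -
    obtain C Nn where C: "fsigma C" "Nn \<in> null_sets lebesgue" "C \<union> Nn = {x :: 'a. x \<noteq> 0 \<and> ?T x \<in> U}"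
      by (rule lebesgue_set_almost_fsigma[OF U])
    obtain F where F: "range F \<subseteq> Collect compact" "C = \<Union>(range (F :: nat \<Rightarrow> 'a set))"
      using iffD1[OF fsigma_Union_compact C(1)] by (elim exE conjE)
    have "?T ` C = (\<Union>n. ?T ` F n)" unfolding F(2) by (rule image_UN)
    moreover have "compact (?T ` F n)" for n
    proof (rule compact_continuous_image)
      have "F n \<subseteq> C" unfolding F(2) by (rule UN_upper) simp
      moreover have "0 \<notin> C" using C(3) by blast
      ultimately have "0 \<notin> F n" by (rule contra_subsetD)
      then show "continuous_on (F n) ?T" by (intro continuous_intros) auto
      show "compact (F n)" using F by auto
    qed
    then have "range (\<lambda>n. ?T ` F n) \<subseteq> sets borel" by (auto intro: borel_compact)
    then have "(\<Union>n. ?T ` F n) \<in> sets borel" by (rule sets.countable_UN)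
    ultimately have "?T ` C \<in> sets borel" by (simp only:)
    moreover have "?T ` C \<subseteq> U" using C(3) by auto
    moreover have "AE x in lebesgue. x \<noteq> 0 \<longrightarrow> ?T x \<in> U \<longrightarrow> ?T x \<in> ?T ` C"
      using AE_not_in[OF C(2)] by eventually_elim (use C(3) in blast)
    ultimately show ?thesis by (intro exI[of _ "?T ` C"] conjI)
  qed
  obtain D where D: "D \<in> sets borel" "D \<subseteq> S" "AE x in lebesgue. x \<noteq> 0 \<longrightarrow> ?T x \<in> S \<longrightarrow> ?T x \<in> D"
    using key[OF S] by (elim exE conjE)
  have eq: "{x :: 'a. x \<noteq> 0 \<and> ?T x \<in> - S} = (space lebesgue - {x. x \<noteq> 0 \<and> ?T x \<in> S}) - {0}" by auto
  have S': "{x :: 'a. x \<noteq> 0 \<and> ?T x \<in> - S} \<in> sets lebesgue"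
    unfolding eq by (rule sets.Diff[OF sets.compl_sets[OF S]]) auto
  obtain D' where D': "D' \<in> sets borel" "D' \<subseteq> - S" "AE x in lebesgue. x \<noteq> 0 \<longrightarrow> ?T x \<in> - S \<longrightarrow> ?T x \<in> D'"
    using key[OF S'] by (elim exE conjE)
  define Z where "Z = - (D \<union> D')"
  have Zb: "Z \<in> sets borel" using D(1) D'(1) by (auto simp: Z_def)
  have "AE x in lebesgue. ?T x \<notin> Z"
    using D(3) D'(3) AE_lebesgue_nonzero by eventually_elim (auto simp: Z_def)
  then have "AE x in lborel. ?T x \<notin> Z"
    by (subst (asm) AE_completion_iff) auto
  then have "AE t in lborel. t \<notin> Z" by (rule polar_null[OF Zb])
  then have Zn: "Z \<in> null_sets lborel" using Zb by (simp add: AE_iff_null_sets)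
  have "S \<inter> Z \<in> null_sets lebesgue"
    by (rule null_sets_completion_subset[OF _ null_sets_completionI[OF Zn]]) auto
  then have "S \<inter> Z \<in> sets lebesgue" by (rule null_setsD2)
  moreover have "S = D \<union> (S \<inter> Z)" using D(2) D'(2) by (auto simp: Z_def)
  moreover have "D \<in> sets lebesgue" using D(1) by auto
  ultimately show ?thesis using sets.Un[of D lebesgue "S \<inter> Z"] by (simp only:)
qed

text \<open>A Borel profile is obtained by changing \<open>f\<close> on a null set of radii; the exponent \<open>a\<close> is arbitrary since
  the factor \<open>\<bar>x\<bar> powr (- a)\<close> can be absorbed in the profile.\<close>

lemma radial_profile:
  fixes u :: "'a::euclidean_space \<Rightarrow> real"
  assumes m: "u \<in> borel_measurable lebesgue" and r: "radial u"
  obtains v where "v \<in> borel_measurable borel" "AE x in lebesgue. u x = rad a v x"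
proof -
  obtain f where f: "\<And>x. u x = f (norm x)" using r unfolding radial_def by blast
  define F where "F t = f (exp (- t))" for t
  have uF: "u x = F (- ln (norm x))" if "x \<noteq> 0" for x using that by (simp add: f F_def)
  have "F \<in> borel_measurable lebesgue"
  proof (rule borel_measurableI_greater)
    fix y
    have "{x :: 'a. x \<noteq> 0 \<and> - ln (norm x) \<in> {t. y < F t}} = {x. y < u x} - {0}" using uF by auto
    moreover have "{x. y < u x} \<in> sets lebesgue"
      using measurable_sets[OF m, of "{y<..}"] by (simp add: vimage_def)
    moreover have "{0 :: 'a} \<in> sets lebesgue" by simp
    ultimately have "{x :: 'a. x \<noteq> 0 \<and> - ln (norm x) \<in> {t. y < F t}} \<in> sets lebesgue"
      by (simp only: sets.Diff)
    from radial_set_measurable[OF this] show "{t \<in> space lebesgue. y < F t} \<in> sets lebesgue" by simp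
  qed
  from completion_ex_borel_measurable_real[OF this]
  obtain g where g: "g \<in> borel_measurable lborel" "AE t in lborel. F t = g t" by (elim bexE)
  have "AE x in (lborel :: 'a measure). F (- ln (norm x)) = g (- ln (norm x))" by (rule polar_AE[OF g(2)])
  then have ae: "AE x in (lebesgue :: 'a measure). F (- ln (norm x)) = g (- ln (norm x))" by (rule AE_completion)
  define v where "v t = exp (- a * t) * g t" for t
  have [measurable]: "g \<in> borel_measurable borel" using g by simp
  have "v \<in> borel_measurable borel" unfolding v_def by measurable
  moreover have "AE x in lebesgue. u x = rad a v x"
    using ae AE_lebesgue_nonzero by eventually_elim (simp add: uF rad_def v_def norm_powr_exp mult_exp_exp flip: mult.assoc)
  ultimately show ?thesis by (rule that)
qed

section \<open>Smooth radial functions and polynomial approximation\<close>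

text \<open>All derivatives are provided at once by the sequence \<open>D\<close>.\<close>

definition smooth_real :: "(real \<Rightarrow> real) \<Rightarrow> bool" where
  "smooth_real F \<longleftrightarrow> (\<exists>D :: nat \<Rightarrow> real \<Rightarrow> real. D 0 = F \<and> (\<forall>k t. (D k has_real_derivative D (Suc k) t) (at t)))"

lemma C_k_inner: "C_k k (\<lambda>x. c * (x \<bullet> v))"
proof (cases k)
  case 0
  show ?thesis unfolding 0 by (simp add: continuous_on_mult_left continuous_on_inner)
next
  case (Suc j)
  have d: "((\<lambda>x. c * (x \<bullet> v)) has_derivative (\<lambda>h. c * (h \<bullet> v))) (at x)" for x
    by (auto intro!: derivative_eq_intros)
  have e: "frechet_derivative (\<lambda>x. c * (x \<bullet> v)) (at x) w = c * (w \<bullet> v)" for x w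
    using fun_cong[OF frechet_derivative_at[OF d[of x]], of w] by (rule sym)
  show ?thesis unfolding Suc
  proof (rule C_k_SucI)
    show "(\<lambda>x. c * (x \<bullet> v)) differentiable (at x)" for x using d[of x] by (rule differentiableI)
    show "C_k j (\<lambda>x. frechet_derivative (\<lambda>x. c * (x \<bullet> v)) (at x) w)" for w
      unfolding e by (rule C_k_const)
  qed
qed

text \<open>Radial functions are written in terms of \<open>x \<bullet> x\<close>, which, unlike \<open>norm x\<close>, is smooth at the origin. Each derivative
  produces a factor linear in \<open>x\<close>.\<close>

lemma smooth_radial_C_k:
  assumes "smooth_real F"
  shows "C_k k (\<lambda>x :: 'a::euclidean_space. F (x \<bullet> x))"
proof -
  obtain D :: "nat \<Rightarrow> real \<Rightarrow> real" where D0: "D 0 = F" and D: "\<And>k t. (D k has_real_derivative D (Suc k) t) (at t)"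
    using assms unfolding smooth_real_def by blast
  have "C_k k (\<lambda>x :: 'a. D j (x \<bullet> x))" for j
  proof (induction k arbitrary: j)
    case 0
    have "continuous_on UNIV (D j)" by (rule DERIV_continuous_on[OF D])
    then have "continuous_on UNIV (\<lambda>x :: 'a. D j (x \<bullet> x))"
      by (rule continuous_on_compose2) (auto intro: continuous_on_inner)
    then show ?case by simp
  next
    case (Suc k)
    have d: "((\<lambda>x :: 'a. D j (x \<bullet> x)) has_derivative (\<lambda>h. D (Suc j) (x \<bullet> x) * (2 * (x \<bullet> h)))) (at x)" for x
    proof -
      have i: "((\<lambda>x :: 'a. x \<bullet> x) has_derivative (\<lambda>h. 2 * (x \<bullet> h))) (at x)"
        by (auto intro!: derivative_eq_intros simp: inner_commute)
      have "(D j has_derivative (\<lambda>h. D (Suc j) (x \<bullet> x) * h)) (at (x \<bullet> x))"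
        using D[of j "x \<bullet> x"] by (simp add: has_field_derivative_def)
      from has_derivative_compose[OF i this] show ?thesis .
    qed
    have e: "frechet_derivative (\<lambda>x :: 'a. D j (x \<bullet> x)) (at x) w = D (Suc j) (x \<bullet> x) * (2 * (x \<bullet> w))" for x w
      using fun_cong[OF frechet_derivative_at[OF d[of x]], of w] by (rule sym)
    show ?case
    proof (rule C_k_SucI)
      show "(\<lambda>x :: 'a. D j (x \<bullet> x)) differentiable (at x)" for x using d[of x] by (rule differentiableI)
      show "C_k k (\<lambda>x :: 'a. frechet_derivative (\<lambda>x. D j (x \<bullet> x)) (at x) w)" for w
        unfolding e by (rule C_k_mult[OF Suc.IH C_k_inner])
    qed
  qed
  from this[of 0] show ?thesis by (simp add: D0)
qed

lemma smooth_real_poly: "smooth_real (poly p)"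
  unfolding smooth_real_def
proof (intro exI conjI allI)
  show "poly ((pderiv ^^ 0) p) = poly p" by simp
  show "(poly ((pderiv ^^ k) p) has_real_derivative poly ((pderiv ^^ Suc k) p) t) (at t)" for k t
    by (simp add: poly_DERIV)
qed

lemma poly_over_exp: "((\<lambda>z. poly p z * exp (- z)) \<longlongrightarrow> (0::real)) at_top"
proof -
  have "((\<lambda>z. \<Sum>i\<le>degree p. coeff p i * (z ^ i / exp z)) \<longlongrightarrow> (\<Sum>i\<le>degree p. coeff p i * 0)) at_top"
    by (intro tendsto_sum tendsto_mult tendsto_const tendsto_power_div_exp_0)
  moreover have "(\<Sum>i\<le>degree p. coeff p i * (z ^ i / exp z)) = poly p z * exp (- z)" for z
    by (simp add: poly_altdef sum_distrib_right exp_minus divide_inverse mult.assoc)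
  ultimately show ?thesis by simp
qed

definition bump :: "real \<Rightarrow> real" where
  "bump y = (if 0 < y then exp (- (1 / y)) else 0)"

text \<open>The \<open>k\<close>-th derivative of \<open>bump\<close> on the positive half line is \<open>poly (bump_poly k) (1 / y) * exp (- (1 / y))\<close>.\<close>

primrec bump_poly :: "nat \<Rightarrow> real poly" where
  "bump_poly 0 = 1"
| "bump_poly (Suc k) = [:0, 0, 1:] * (bump_poly k - pderiv (bump_poly k))"

lemma smooth_real_bump: "smooth_real bump"
  unfolding smooth_real_def
proof (intro exI conjI allI)
  let ?D = "\<lambda>k y. if 0 < y then poly (bump_poly k) (1 / y) * exp (- (1 / y)) else 0"
  show "?D 0 = bump" by (auto simp: bump_def)
  fix k :: nat and t :: real
  consider "t < 0" | "t = 0" | "0 < t" by linarith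
  then show "(?D k has_real_derivative ?D (Suc k) t) (at t)"
  proof cases
    case 1
    have "((\<lambda>_. 0) has_real_derivative 0) (at t)" by simp
    then have "(?D k has_real_derivative 0) (at t)"
      by (rule has_field_derivative_transform_within_open[where S = "{..<0}"]) (use 1 in auto)
    then show ?thesis using 1 by simp
  next
    case 3
    have "((\<lambda>y. poly (bump_poly k) (1 / y) * exp (- (1 / y))) has_real_derivative
        poly (pderiv (bump_poly k)) (1 / t) * (- 1 / t\<^sup>2) * exp (- (1 / t)) + poly (bump_poly k) (1 / t) * (exp (- (1 / t)) * (1 / t\<^sup>2))) (at t)"
    proof -
      have i: "((\<lambda>y. 1 / y) has_real_derivative - 1 / t\<^sup>2) (at t)"
        using 3 by (auto intro!: derivative_eq_intros simp: power2_eq_square)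
      have e: "((\<lambda>y. exp (- (1 / y))) has_real_derivative exp (- (1 / t)) * (1 / t\<^sup>2)) (at t)"
        by (rule DERIV_cong[OF DERIV_fun_exp[OF DERIV_minus[OF i]]]) simp
      show ?thesis
        by (rule DERIV_cong[OF DERIV_mult[OF DERIV_chain2[OF poly_DERIV i] e]]) (simp add: mult_ac)
    qed
    also have "poly (pderiv (bump_poly k)) (1 / t) * (- 1 / t\<^sup>2) * exp (- (1 / t)) + poly (bump_poly k) (1 / t) * (exp (- (1 / t)) * (1 / t\<^sup>2))
       = poly (bump_poly (Suc k)) (1 / t) * exp (- (1 / t))"
      by (simp add: algebra_simps power2_eq_square)
    finally have "((\<lambda>y. poly (bump_poly k) (1 / y) * exp (- (1 / y))) has_real_derivative ?D (Suc k) t) (at t)" using 3 by simp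
    then show ?thesis
      by (rule has_field_derivative_transform_within_open[where S = "{0<..}"]) (use 3 in auto)
  next
    case 2
    have "((\<lambda>h. (?D k (0 + h) - ?D k 0) / h) \<longlongrightarrow> 0) (at 0)"
    proof (rule filterlim_split_at)
      show "((\<lambda>h. (?D k (0 + h) - ?D k 0) / h) \<longlongrightarrow> 0) (at_left 0)"
      proof (rule tendsto_eventually)
        show "\<forall>\<^sub>F h in at_left 0. (?D k (0 + h) - ?D k 0) / h = 0"
          by (rule eventually_at_leftI[of "-1"]) auto
      qed
      have "((\<lambda>h. poly (pCons 0 (bump_poly k)) (inverse h) * exp (- inverse h)) \<longlongrightarrow> 0) (at_right (0::real))"
        by (rule filterlim_compose[OF poly_over_exp filterlim_inverse_at_top_right])
      then show "((\<lambda>h. (?D k (0 + h) - ?D k 0) / h) \<longlongrightarrow> 0) (at_right 0)"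
      proof (rule Lim_transform_eventually)
        show "\<forall>\<^sub>F h in at_right 0. poly (pCons 0 (bump_poly k)) (inverse h) * exp (- inverse h) = (?D k (0 + h) - ?D k 0) / h"
          by (rule eventually_at_rightI[of _ 1]) (auto simp: divide_inverse)
      qed
    qed
    then show ?thesis using 2 by (simp add: DERIV_def)
  qed
qed

lemma smooth_real_reflect:
  assumes "smooth_real F"
  shows "smooth_real (\<lambda>s. F (c - s))"
proof -
  obtain D :: "nat \<Rightarrow> real \<Rightarrow> real" where D0: "D 0 = F" and D: "\<And>k t. (D k has_real_derivative D (Suc k) t) (at t)"
    using assms unfolding smooth_real_def by blast
  show ?thesis unfolding smooth_real_def
  proof (intro exI conjI allI)
    show "(\<lambda>s. (-1) ^ 0 * D 0 (c - s)) = (\<lambda>s. F (c - s))" by (simp add: D0)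
    fix k t
    have "((\<lambda>s. c - s) has_real_derivative - 1) (at t)" by (auto intro!: derivative_eq_intros)
    from DERIV_cmult[OF DERIV_chain2[OF D this], of "(-1) ^ k"]
    show "((\<lambda>s. (-1) ^ k * D k (c - s)) has_real_derivative (-1) ^ Suc k * D (Suc k) (c - t)) (at t)"
      by (rule DERIV_cong) simp
  qed
qed

lemma pderiv_sum_terms: "pderiv (\<Sum>i\<in>A. f i) = (\<Sum>i\<in>A. pderiv (f i :: real poly))"
  by (induction A rule: infinite_finite_induct) (simp_all add: pderiv_add)

lemma poly_antiderivative: "\<exists>Q. pderiv Q = (p :: real poly) \<and> poly Q 0 = c"
proof -
  define Q where "Q = (\<Sum>i\<le>degree p. monom (coeff p i / real (Suc i)) (Suc i)) + [:c:]"
  have "pderiv Q = (\<Sum>i\<le>degree p. monom (coeff p i) i)"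
  proof -
    have "pderiv (monom (coeff p i / real (Suc i)) (Suc i)) = monom (coeff p i) i" for i
      by (subst pderiv_monom) (simp del: of_nat_Suc)
    then show ?thesis unfolding Q_def by (simp add: pderiv_add pderiv_sum_terms pderiv_pCons)
  qed
  also have "\<dots> = p" by (rule poly_as_sum_of_monoms)
  finally have "pderiv Q = p" .
  moreover have "poly Q 0 = c" by (simp add: Q_def poly_sum poly_monom)
  ultimately show ?thesis by blast
qed

lemma derivative_error_bound:
  fixes f g :: "real \<Rightarrow> real"
  assumes "\<And>t. (f has_real_derivative f' t) (at t)" "\<And>t. (g has_real_derivative g' t) (at t)"
    and "\<And>t. t \<in> {0..c} \<Longrightarrow> \<bar>f' t - g' t\<bar> \<le> e" "f 0 = g 0" "s \<in> {0..c}"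
  shows "\<bar>f s - g s\<bar> \<le> e * c"
proof (cases "s = 0")
  case True
  have "0 \<le> e" using assms(3)[OF assms(5)] by (auto intro: order_trans[OF abs_ge_zero])
  then show ?thesis using True assms by simp
next
  case False
  then have s: "0 < s" using assms by auto
  have "((\<lambda>t. f t - g t) has_real_derivative f' t - g' t) (at t)" for t by (intro DERIV_diff assms)
  from MVT2[OF s, of "\<lambda>t. f t - g t" "\<lambda>t. f' t - g' t", OF this]
  obtain z where z: "0 < z" "z < s" "(f s - g s) - (f 0 - g 0) = (s - 0) * (f' z - g' z)" by auto
  have e: "\<bar>f' z - g' z\<bar> \<le> e" using assms z by auto
  have "\<bar>f s - g s\<bar> = s * \<bar>f' z - g' z\<bar>" using z s assms(4) by (simp add: abs_mult)
  also have "\<dots> \<le> c * e" using assms(5) e s by (intro mult_mono) auto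
  finally show ?thesis by (simp add: mult.commute)
qed

text \<open>Weierstrass approximation of the second derivative, integrated twice with the right initial
  values, approximates the function and its first derivative as well.\<close>

lemma C2_Weierstrass:
  fixes G G1 G2 :: "real \<Rightarrow> real"
  assumes G: "\<And>t. (G has_real_derivative G1 t) (at t)" "\<And>t. (G1 has_real_derivative G2 t) (at t)"
    and c: "continuous_on {0..c} G2" "0 < c" and e: "0 < e"
  obtains Q where "\<And>s. s \<in> {0..c} \<Longrightarrow> \<bar>poly Q s - G s\<bar> \<le> e" "\<And>s. s \<in> {0..c} \<Longrightarrow> \<bar>poly (pderiv Q) s - G1 s\<bar> \<le> e"
    "\<And>s. s \<in> {0..c} \<Longrightarrow> \<bar>poly (pderiv (pderiv Q)) s - G2 s\<bar> \<le> e"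
proof -
  define d where "d = e / (1 + c + c * c)"
  have den: "1 + c + c * c > 0" using c by (intro add_pos_pos) auto
  have d: "0 < d" "d * (1 + c + c * c) = e" using e den by (auto simp: d_def)
  have small: "d \<le> e" "d * c \<le> e" "d * c * c \<le> e"
  proof -
    have nn: "0 \<le> d * c" "0 \<le> d * c * c" using d c by auto
    have "d + d * c + d * c * c = e" using d(2) by (simp add: algebra_simps)
    then show "d \<le> e" "d * c \<le> e" "d * c * c \<le> e" using nn d(1) by linarith+
  qed
  obtain P where P: "real_polynomial_function P" "\<And>x. x \<in> {0..c} \<Longrightarrow> \<bar>G2 x - P x\<bar> < d"
    by (rule Stone_Weierstrass_real_polynomial_function[of "{0..c}" G2 d]) (use c d in auto)
  obtain a n where an: "P = (\<lambda>x. \<Sum>i\<le>n. a i * x ^ i)"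
    using P(1) unfolding real_polynomial_function_iff_sum by blast
  define p2 where "p2 = (\<Sum>i\<le>n. monom (a i) i)"
  have p2: "poly p2 x = P x" for x by (simp add: p2_def an poly_sum poly_monom)
  obtain Q1 where Q1: "pderiv Q1 = p2" "poly Q1 0 = G1 0" using poly_antiderivative by blast
  obtain Q where Q: "pderiv Q = Q1" "poly Q 0 = G 0" using poly_antiderivative by blast
  have b2: "\<bar>poly (pderiv (pderiv Q)) s - G2 s\<bar> \<le> d" if "s \<in> {0..c}" for s
    using P(2)[OF that] by (simp add: Q Q1 p2 abs_minus_commute)
  have b1: "\<bar>poly (pderiv Q) s - G1 s\<bar> \<le> d * c" if "s \<in> {0..c}" for s
    by (rule derivative_error_bound[OF poly_DERIV G(2) b2 _ that]) (simp_all add: Q Q1)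
  have b0: "\<bar>poly Q s - G s\<bar> \<le> d * c * c" if "s \<in> {0..c}" for s
    by (rule derivative_error_bound[OF poly_DERIV G(1) b1 _ that]) (simp_all add: Q)
  show ?thesis
    by (rule that[of Q]) (use b0 b1 b2 small in \<open>fastforce intro: order_trans\<close>)+
qed

lemma C2_data_radial:
  fixes F F1 F2 :: "real \<Rightarrow> real"
  assumes d: "\<And>t. (F has_real_derivative F1 t) (at t)" "\<And>t. (F1 has_real_derivative F2 t) (at t)"
    and c: "continuous_on UNIV F2"
  shows "C2_data (\<lambda>x :: 'a::euclidean_space. F (x \<bullet> x)) (\<lambda>b x. 2 * (x \<bullet> b) * F1 (x \<bullet> x))
     (\<lambda>b x. 2 * (b \<bullet> b) * F1 (x \<bullet> x) + 4 * (x \<bullet> b)\<^sup>2 * F2 (x \<bullet> x))"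
    "(\<Sum>b\<in>Basis. 2 * (b \<bullet> b) * F1 (x \<bullet> x) + 4 * (x \<bullet> b)\<^sup>2 * F2 (x \<bullet> x)) =
      4 * (x \<bullet> x) * F2 (x \<bullet> x) + 2 * real DIM('a) * F1 (x \<bullet> (x :: 'a))"
proof -
  have cF: "continuous_on UNIV F" "continuous_on UNIV F1" by (rule DERIV_continuous_on, rule d)+
  have cc: "continuous_on UNIV (\<lambda>x :: 'a. H (x \<bullet> x))" if "continuous_on UNIV H" for H :: "real \<Rightarrow> real"
    by (rule continuous_on_compose2[OF that]) (auto intro: continuous_on_inner)
  have line: "((\<lambda>t. (x + t *\<^sub>R b) \<bullet> (x + t *\<^sub>R b)) has_real_derivative 2 * (x \<bullet> b)) (at 0)" for x b :: 'a
  proof -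
    have "(\<lambda>t. (x + t *\<^sub>R b) \<bullet> (x + t *\<^sub>R b)) = (\<lambda>t. x \<bullet> x + 2 * t * (x \<bullet> b) + t\<^sup>2 * (b \<bullet> b))"
      by (simp add: inner_add_left inner_add_right inner_commute algebra_simps power2_eq_square)
    moreover have "((\<lambda>t. x \<bullet> x + 2 * t * (x \<bullet> b) + t\<^sup>2 * (b \<bullet> b)) has_real_derivative 2 * (x \<bullet> b)) (at 0)"
      by (auto intro!: derivative_eq_intros)
    ultimately show ?thesis by simp
  qed
  have comp: "has_dirderiv (\<lambda>x :: 'a. H (x \<bullet> x)) b (\<lambda>x. 2 * (x \<bullet> b) * H1 (x \<bullet> x))"
    if "\<And>t. (H has_real_derivative H1 t) (at t)" for H H1 b
    unfolding has_dirderiv_def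
  proof
    fix x :: 'a
    have "(H has_real_derivative H1 (x \<bullet> x)) (at ((x + 0 *\<^sub>R b) \<bullet> (x + 0 *\<^sub>R b)))" using that by simp
    from DERIV_chain2[OF this line]
    show "((\<lambda>t. H ((x + t *\<^sub>R b) \<bullet> (x + t *\<^sub>R b))) has_real_derivative 2 * (x \<bullet> b) * H1 (x \<bullet> x)) (at 0)"
      by (rule DERIV_cong) simp
  qed
  have lin: "has_dirderiv (\<lambda>x :: 'a. 2 * (x \<bullet> b)) b (\<lambda>x. 2 * (b \<bullet> b))" for b
    unfolding has_dirderiv_def by (auto intro!: derivative_eq_intros simp: inner_add_left)
  show "C2_data (\<lambda>x :: 'a. F (x \<bullet> x)) (\<lambda>b x. 2 * (x \<bullet> b) * F1 (x \<bullet> x))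
     (\<lambda>b x. 2 * (b \<bullet> b) * F1 (x \<bullet> x) + 4 * (x \<bullet> b)\<^sup>2 * F2 (x \<bullet> x))"
    unfolding C2_data_def
  proof (intro conjI ballI)
    fix b :: 'a
    show "has_dirderiv (\<lambda>x. F (x \<bullet> x)) b (\<lambda>x. 2 * (x \<bullet> b) * F1 (x \<bullet> x))" by (rule comp[OF d(1)])
    have "has_dirderiv (\<lambda>x. 2 * (x \<bullet> b) * F1 (x \<bullet> x)) b (\<lambda>x. 2 * (b \<bullet> b) * F1 (x \<bullet> x) + 2 * (x \<bullet> b) * (2 * (x \<bullet> b) * F2 (x \<bullet> x)))"
      by (rule has_dirderiv_mult[OF lin comp[OF d(2)]])
    then show "has_dirderiv (\<lambda>x. 2 * (x \<bullet> b) * F1 (x \<bullet> x)) b (\<lambda>x. 2 * (b \<bullet> b) * F1 (x \<bullet> x) + 4 * (x \<bullet> b)\<^sup>2 * F2 (x \<bullet> x))"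
      by (simp add: power2_eq_square mult_ac)
    show "continuous_on UNIV (\<lambda>x. 2 * (x \<bullet> b) * F1 (x \<bullet> x))" by (intro continuous_intros cc cF)
    show "continuous_on UNIV (\<lambda>x. 2 * (b \<bullet> b) * F1 (x \<bullet> x) + 4 * (x \<bullet> b)\<^sup>2 * F2 (x \<bullet> x))" by (intro continuous_intros cc cF c)
  qed (rule cc[OF cF(1)])
  have XX: "(\<Sum>b\<in>Basis. (x \<bullet> b)\<^sup>2) = x \<bullet> x" for x :: 'a
    using euclidean_inner[of x x] by (simp add: power2_eq_square)
  have "(\<Sum>b\<in>Basis. 2 * (b \<bullet> b) * F1 (x \<bullet> x) + 4 * (x \<bullet> b)\<^sup>2 * F2 (x \<bullet> x)) =
     (\<Sum>b\<in>Basis. 2 * F1 (x \<bullet> x) + 4 * F2 (x \<bullet> x) * (x \<bullet> b)\<^sup>2)"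
    by (intro sum.cong) (auto simp: inner_same_Basis)
  also have "\<dots> = real DIM('a) * (2 * F1 (x \<bullet> x)) + 4 * F2 (x \<bullet> x) * (x \<bullet> x)"
    by (simp add: sum.distrib XX flip: sum_distrib_left)
  finally show "(\<Sum>b\<in>Basis. 2 * (b \<bullet> b) * F1 (x \<bullet> x) + 4 * (x \<bullet> b)\<^sup>2 * F2 (x \<bullet> x)) =
      4 * (x \<bullet> x) * F2 (x \<bullet> x) + 2 * real DIM('a) * F1 (x \<bullet> (x :: 'a))" by simp
qed

section \<open>Radial functions of class \<open>C\<^sup>2\<close> in \<open>D22\<close>\<close>

lemma deriv_zero_beyond:
  fixes F :: "real \<Rightarrow> real"
  assumes z: "\<And>s. c < s \<Longrightarrow> F s = 0" and d: "(F has_real_derivative y) (at s)" and s: "c < s"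
  shows "y = 0"
proof -
  have "((\<lambda>_. 0) has_real_derivative 0) (at s)" by simp
  then have "(F has_real_derivative 0) (at s)"
    by (rule has_field_derivative_transform_within_open[where S = "{c<..}"]) (use s z in auto)
  then show ?thesis by (rule DERIV_unique[OF d])
qed

text \<open>The function \<open>F\<close> vanishes from \<open>c\<close> on, whereas \<open>bump (c + 1 - s)\<close> becomes zero only at \<open>c + 1\<close>; so the quotient
  is as regular as \<open>F\<close>.\<close>

lemma divide_by_bump:
  fixes F F1 F2 :: "real \<Rightarrow> real"
  assumes d: "\<And>t. (F has_real_derivative F1 t) (at t)" "\<And>t. (F1 has_real_derivative F2 t) (at t)"
    and cont: "continuous_on UNIV F2" and z: "\<And>s. c \<le> s \<Longrightarrow> F s = 0"
  obtains G G1 G2 where "\<And>t. (G has_real_derivative G1 t) (at t)" "\<And>t. (G1 has_real_derivative G2 t) (at t)"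
    "continuous_on UNIV G2" "\<And>s. F s = bump (c + 1 - s) * G s"
proof -
  have z0: "F s = 0" "F1 s = 0" "F2 s = 0" if "c < s" for s
  proof -
    have a: "\<And>s. c < s \<Longrightarrow> F s = 0" using z by simp
    have b: "\<And>s. c < s \<Longrightarrow> F1 s = 0" by (rule deriv_zero_beyond[OF a d(1)])
    have "\<And>s. c < s \<Longrightarrow> F2 s = 0" by (rule deriv_zero_beyond[OF b d(2)])
    then show "F s = 0" "F1 s = 0" "F2 s = 0" using a b that by auto
  qed
  define h where "h s = 1 / (c + 1 - s)" for s
  define E where "E s = exp (h s)" for s
  define G where "G s = (if s < c + 1 then F s * E s else 0)" for s
  define G1 where "G1 s = (if s < c + 1 then (F1 s + F s * (h s)\<^sup>2) * E s else 0)" for s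
  define G2 where "G2 s = (if s < c + 1 then (F2 s + 2 * F1 s * (h s)\<^sup>2 + F s * ((h s)^4 + 2 * (h s)^3)) * E s else 0)" for s
  have dh: "(h has_real_derivative (h s)\<^sup>2) (at s)" if "s < c + 1" for s
    unfolding h_def[abs_def] using that by (auto intro!: derivative_eq_intros simp: power2_eq_square)
  have dE: "(E has_real_derivative (h s)\<^sup>2 * E s) (at s)" if "s < c + 1" for s
    unfolding E_def[abs_def] by (rule DERIV_cong[OF DERIV_fun_exp[OF dh[OF that]]]) simp
  have far: "(f has_real_derivative 0) (at s)" if "\<And>r. c < r \<Longrightarrow> f r = 0" "c < s" for f :: "real \<Rightarrow> real" and s
  proof -
    have "((\<lambda>_. 0) has_real_derivative 0) (at s)" by simp
    then show ?thesis
      by (rule has_field_derivative_transform_within_open[where S = "{c<..}"]) (use that in auto)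
  qed
  have Gz: "G s = 0" "G1 s = 0" "G2 s = 0" if "c < s" for s using z0[OF that] by (auto simp: G_def G1_def G2_def)
  have dG: "(G has_real_derivative G1 s) (at s)" for s
  proof (cases "s < c + 1")
    case True
    have "((\<lambda>s. F s * E s) has_real_derivative G1 s) (at s)"
      by (rule DERIV_cong[OF DERIV_mult[OF d(1) dE[OF True]]]) (use True in \<open>simp add: G1_def algebra_simps\<close>)
    then show ?thesis
      by (rule has_field_derivative_transform_within_open[where S = "{..<c + 1}"]) (use True in \<open>auto simp: G_def\<close>)
  next
    case False
    then have "c < s" by simp
    from far[OF Gz(1) this] show ?thesis using Gz(2)[OF \<open>c < s\<close>] by simp
  qed
  have dG1: "(G1 has_real_derivative G2 s) (at s)" for s
  proof (cases "s < c + 1")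
    case True
    have "((\<lambda>s. (h s)\<^sup>2) has_real_derivative 2 * (h s)^3) (at s)"
      by (rule DERIV_cong[OF DERIV_power[OF dh[OF True]]]) (simp add: power3_eq_cube power2_eq_square)
    from DERIV_mult[OF DERIV_add[OF d(2) DERIV_mult[OF d(1) this]] dE[OF True]]
    have "((\<lambda>s. (F1 s + F s * (h s)\<^sup>2) * E s) has_real_derivative G2 s) (at s)"
      by (rule DERIV_cong) (use True in \<open>simp add: G2_def algebra_simps power2_eq_square power3_eq_cube power4_eq_xxxx\<close>)
    then show ?thesis
      by (rule has_field_derivative_transform_within_open[where S = "{..<c + 1}"]) (use True in \<open>auto simp: G1_def\<close>)
  next
    case False
    then have "c < s" by simp
    from far[OF Gz(2) this] show ?thesis using Gz(3)[OF \<open>c < s\<close>] by simp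
  qed
  have cF: "continuous_on S F" "continuous_on S F1" "continuous_on S F2" for S
    using continuous_on_subset[OF cont] DERIV_continuous_on[of UNIV F F1] DERIV_continuous_on[of UNIV F1 F2] d
    by (auto intro: continuous_on_subset)
  have "continuous_on ({..<c + 1} \<union> {c<..}) G2"
  proof (rule continuous_on_open_Un)
    have "continuous_on {..<c + 1} (\<lambda>s. (F2 s + 2 * F1 s * (h s)\<^sup>2 + F s * ((h s)^4 + 2 * (h s)^3)) * E s)"
      unfolding E_def h_def by (intro continuous_intros cF) auto
    then show "continuous_on {..<c + 1} G2" by (rule continuous_on_eq) (simp add: G2_def)
    show "continuous_on {c<..} G2" by (rule continuous_on_eq[of _ "\<lambda>_. 0"]) (use Gz in auto)
  qed auto
  moreover have "{..<c + 1} \<union> {c<..} = UNIV" by auto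
  ultimately have cG2: "continuous_on UNIV G2" by simp
  have "F s = bump (c + 1 - s) * G s" for s
  proof (cases "s < c + 1")
    case True
    then have "bump (c + 1 - s) * E s = 1" by (simp add: bump_def E_def h_def flip: exp_add)
    then show ?thesis using True by (simp add: G_def mult.left_commute mult.commute)
  qed (use z0 in \<open>simp add: bump_def\<close>)
  then show ?thesis by (rule that[OF dG dG1 cG2])
qed

text \<open>Dividing \<open>F\<close> by the smooth cutoff, approximating the quotient by a polynomial together with
  two derivatives, and multiplying by the cutoff again gives test functions of uniformly bounded support.\<close>

lemma radial_C2_uniform_approximation:
  fixes F F1 F2 :: "real \<Rightarrow> real"
  assumes d: "\<And>t. (F has_real_derivative F1 t) (at t)" "\<And>t. (F1 has_real_derivative F2 t) (at t)"
    and cont: "continuous_on UNIV F2" and z: "\<And>s. c \<le> s \<Longrightarrow> F s = 0" and c: "0 < c" and \<eta>: "0 < \<eta>"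
  shows "\<exists>\<phi>\<in>Cc_infty. \<forall>x :: 'a::euclidean_space.
     \<bar>\<phi> x - F (x \<bullet> x)\<bar> \<le> \<eta> * indicator (cball 0 (c + 2)) x \<and>
     \<bar>laplacian \<phi> x - (4 * (x \<bullet> x) * F2 (x \<bullet> x) + 2 * real DIM('a) * F1 (x \<bullet> x))\<bar> \<le> \<eta> * indicator (cball 0 (c + 2)) x"
proof -
  let ?N = "real DIM('a)"
  obtain G G1 G2 where G: "\<And>t. (G has_real_derivative G1 t) (at t)" "\<And>t. (G1 has_real_derivative G2 t) (at t)"
    "continuous_on UNIV G2" and FBG: "\<And>s. F s = bump (c + 1 - s) * G s"
    by (rule divide_by_bump[OF d cont z]) blast+
  obtain D :: "nat \<Rightarrow> real \<Rightarrow> real" where D0: "D 0 = (\<lambda>s. bump (c + 1 - s))" and D: "\<And>k t. (D k has_real_derivative D (Suc k) t) (at t)"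
    using smooth_real_reflect[OF smooth_real_bump, of "c + 1"] unfolding smooth_real_def by blast
  define B where "B = D 0"
  define B1 where "B1 = D (Suc 0)"
  define B2 where "B2 = D (Suc (Suc 0))"
  have dB: "(B has_real_derivative B1 t) (at t)" "(B1 has_real_derivative B2 t) (at t)" for t
    unfolding B_def B1_def B2_def by (rule D)+
  have cB: "continuous_on UNIV B" "continuous_on UNIV B1" "continuous_on UNIV B2"
    unfolding B_def B1_def B2_def by (rule DERIV_continuous_on, rule D)+
  have Bz: "B s = 0" "B1 s = 0" "B2 s = 0" if "c + 1 < s" for s
  proof -
    have a: "\<And>s. c + 1 < s \<Longrightarrow> B s = 0" by (simp add: B_def D0 bump_def)
    have b: "\<And>s. c + 1 < s \<Longrightarrow> B1 s = 0" by (rule deriv_zero_beyond[OF a dB(1)])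
    have "\<And>s. c + 1 < s \<Longrightarrow> B2 s = 0" by (rule deriv_zero_beyond[OF b dB(2)])
    then show "B s = 0" "B1 s = 0" "B2 s = 0" using a b that by auto
  qed
  have bd: "\<exists>K. \<forall>s\<in>{0..c + 1}. \<bar>f s\<bar> \<le> K" if "continuous_on UNIV f" for f :: "real \<Rightarrow> real"
  proof -
    have "compact (f ` {0..c + 1})" by (rule compact_continuous_image[OF continuous_on_subset[OF that]]) auto
    then show ?thesis using compact_imp_bounded bounded_iff by (metis imageI real_norm_def)
  qed
  obtain K0 K1 K2 where K0: "\<forall>s\<in>{0..c + 1}. \<bar>B s\<bar> \<le> K0" and K1: "\<forall>s\<in>{0..c + 1}. \<bar>B1 s\<bar> \<le> K1"
     and K2: "\<forall>s\<in>{0..c + 1}. \<bar>B2 s\<bar> \<le> K2"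
    using bd[OF cB(1)] bd[OF cB(2)] bd[OF cB(3)] by blast
  define K where "K = max K0 (max K1 K2)"
  have K: "\<bar>B s\<bar> \<le> K" "\<bar>B1 s\<bar> \<le> K" "\<bar>B2 s\<bar> \<le> K" if "s \<in> {0..c + 1}" for s
    using K0 K1 K2 that unfolding K_def by (meson max.coboundedI1 max.coboundedI2)+
  have K00: "0 \<le> K" using K(1)[of 0] c by (auto intro: order_trans[OF abs_ge_zero])
  \<comment> \<open>The errors of \<open>H\<close>, \<open>H1\<close> and \<open>H2\<close> are at most \<open>1\<close>, \<open>2\<close> and \<open>4\<close> times \<open>K * \<delta>\<close>, and the Laplacian has the
    coefficients \<open>4 * s \<le> 4 * (c + 1)\<close> and \<open>2 * DIM('a)\<close>.\<close>
  define M where "M = K + 16 * (c + 1) * K + 4 * ?N * K + 1"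
  have M: "0 < M" "K \<le> M" "16 * (c + 1) * K + 4 * ?N * K \<le> M"
    using K00 c by (auto simp: M_def intro!: add_nonneg_pos add_nonneg_nonneg)
  define \<delta> where "\<delta> = \<eta> / M"
  have \<delta>: "0 < \<delta>" "\<delta> * M = \<eta>" using \<eta> M by (auto simp: \<delta>_def)
  obtain Q where Q: "\<And>s. s \<in> {0..c + 1} \<Longrightarrow> \<bar>poly Q s - G s\<bar> \<le> \<delta>" "\<And>s. s \<in> {0..c + 1} \<Longrightarrow> \<bar>poly (pderiv Q) s - G1 s\<bar> \<le> \<delta>"
    "\<And>s. s \<in> {0..c + 1} \<Longrightarrow> \<bar>poly (pderiv (pderiv Q)) s - G2 s\<bar> \<le> \<delta>"
    by (rule C2_Weierstrass[OF G(1,2) continuous_on_subset[OF G(3)], of "c + 1" \<delta>]) (use c \<delta> in auto)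
  define H where "H s = B s * poly Q s" for s
  define H1 where "H1 s = B1 s * poly Q s + B s * poly (pderiv Q) s" for s
  define H2 where "H2 s = B2 s * poly Q s + 2 * (B1 s * poly (pderiv Q) s) + B s * poly (pderiv (pderiv Q)) s" for s
  have dH: "(H has_real_derivative H1 t) (at t)" for t
    unfolding H_def[abs_def] H1_def by (rule DERIV_cong[OF DERIV_mult[OF dB(1) poly_DERIV]]) simp
  have dH1: "(H1 has_real_derivative H2 t) (at t)" for t
    unfolding H1_def[abs_def] H2_def
    by (rule DERIV_cong[OF DERIV_add[OF DERIV_mult[OF dB(2) poly_DERIV] DERIV_mult[OF dB(1) poly_DERIV]]]) simp
  have cH2: "continuous_on UNIV H2" unfolding H2_def[abs_def] by (intro continuous_intros cB)
  have F0: "F s = B s * G s" for s using FBG by (simp add: B_def D0)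
  have dF: "(F has_real_derivative B1 t * G t + B t * G1 t) (at t)" for t
    unfolding F0[abs_def] by (rule DERIV_cong[OF DERIV_mult[OF dB(1) G(1)]]) simp
  have F1: "F1 s = B1 s * G s + B s * G1 s" for s by (rule DERIV_unique[OF d(1) dF])
  have dF1: "(F1 has_real_derivative B2 t * G t + 2 * (B1 t * G1 t) + B t * G2 t) (at t)" for t
    unfolding F1[abs_def] by (rule DERIV_cong[OF DERIV_add[OF DERIV_mult[OF dB(2) G(1)] DERIV_mult[OF dB(1) G(2)]]]) simp
  have F2: "F2 s = B2 s * G s + 2 * (B1 s * G1 s) + B s * G2 s" for s by (rule DERIV_unique[OF d(2) dF1])
  have prod: "\<bar>a * b\<bar> \<le> K * \<delta>" if "\<bar>a\<bar> \<le> K" "\<bar>b\<bar> \<le> \<delta>" for a b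
    unfolding abs_mult using that K00 by (intro mult_mono) auto
  have e0: "\<bar>H s - F s\<bar> \<le> K * \<delta>" if "s \<in> {0..c + 1}" for s
    using prod[OF K(1)[OF that] Q(1)[OF that]] by (simp add: H_def F0 right_diff_distrib)
  have e1: "\<bar>H1 s - F1 s\<bar> \<le> 2 * (K * \<delta>)" if "s \<in> {0..c + 1}" for s
  proof -
    have "H1 s - F1 s = B1 s * (poly Q s - G s) + B s * (poly (pderiv Q) s - G1 s)"
      by (simp add: H1_def F1 algebra_simps)
    then show ?thesis using prod[OF K(2)[OF that] Q(1)[OF that]] prod[OF K(1)[OF that] Q(2)[OF that]] by linarith
  qed
  have e2: "\<bar>H2 s - F2 s\<bar> \<le> 4 * (K * \<delta>)" if "s \<in> {0..c + 1}" for s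
  proof -
    have "H2 s - F2 s = B2 s * (poly Q s - G s) + 2 * (B1 s * (poly (pderiv Q) s - G1 s)) + B s * (poly (pderiv (pderiv Q)) s - G2 s)"
      by (simp add: H2_def F2 algebra_simps)
    then show ?thesis
      using prod[OF K(3)[OF that] Q(1)[OF that]] prod[OF K(2)[OF that] Q(2)[OF that]] prod[OF K(1)[OF that] Q(3)[OF that]] by linarith
  qed
  define \<phi> where "\<phi> = (\<lambda>x :: 'a. H (x \<bullet> x))"
  have sm: "C_k k \<phi>" for k unfolding \<phi>_def H_def B_def D0
    by (intro C_k_mult smooth_radial_C_k[OF smooth_real_reflect[OF smooth_real_bump]] smooth_radial_C_k[OF smooth_real_poly])
  have big: "c + 1 < x \<bullet> x" if "c + 2 < norm x" for x :: 'a
  proof -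
    have "norm x * 1 \<le> norm x * norm x" using that c by (intro mult_left_mono) auto
    then show ?thesis using that by (simp add: power2_eq_square flip: power2_norm_eq_inner)
  qed
  have Cc: "\<phi> \<in> Cc_infty"
    by (rule Cc_inftyI[OF sm, of "c + 2"]) (use big Bz in \<open>simp add: \<phi>_def H_def\<close>)
  have lap: "laplacian \<phi> x = 4 * (x \<bullet> x) * H2 (x \<bullet> x) + 2 * ?N * H1 (x \<bullet> x)" for x
  proof -
    have cd: "C2_data \<phi> (\<lambda>b x. 2 * (x \<bullet> b) * H1 (x \<bullet> x)) (\<lambda>b x. 2 * (b \<bullet> b) * H1 (x \<bullet> x) + 4 * (x \<bullet> b)\<^sup>2 * H2 (x \<bullet> x))"
      unfolding \<phi>_def by (rule C2_data_radial(1)[OF dH dH1 cH2])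
    show ?thesis unfolding laplacian_C2_data[OF sm cd] by (rule C2_data_radial(2)[OF dH dH1 cH2])
  qed
  show ?thesis
  proof (rule bexI[OF _ Cc], intro allI)
    fix x :: 'a
    let ?s = "x \<bullet> x"
    show "\<bar>\<phi> x - F ?s\<bar> \<le> \<eta> * indicator (cball 0 (c + 2)) x \<and>
     \<bar>laplacian \<phi> x - (4 * ?s * F2 ?s + 2 * ?N * F1 ?s)\<bar> \<le> \<eta> * indicator (cball 0 (c + 2)) x"
    proof (cases "?s \<le> c + 1")
      case False
      then have "H ?s = 0" "H1 ?s = 0" "H2 ?s = 0" "F ?s = 0" "F1 ?s = 0" "F2 ?s = 0"
        using Bz[of ?s] by (simp_all add: H_def H1_def H2_def F0 F1 F2)
      moreover from this have "laplacian \<phi> x = 0" "\<phi> x = 0" using lap[of x] by (simp_all add: \<phi>_def)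
      ultimately show ?thesis using \<eta> by (simp add: indicator_def)
    next
      case True
      then have s: "?s \<in> {0..c + 1}" by simp
      have "norm x \<le> c + 2" using big[of x] True by (meson not_le)
      then have ind: "indicator (cball 0 (c + 2)) x = (1 :: real)" by simp
      have "K * \<delta> \<le> M * \<delta>" using M \<delta> by (intro mult_right_mono) auto
      then have 1: "\<bar>\<phi> x - F ?s\<bar> \<le> \<eta>" using e0[OF s] \<delta>(2) by (simp add: \<phi>_def mult.commute)
      have "\<bar>laplacian \<phi> x - (4 * ?s * F2 ?s + 2 * ?N * F1 ?s)\<bar> = \<bar>4 * ?s * (H2 ?s - F2 ?s) + 2 * ?N * (H1 ?s - F1 ?s)\<bar>"
        by (simp add: lap algebra_simps)
      also have "\<dots> \<le> \<bar>4 * ?s * (H2 ?s - F2 ?s)\<bar> + \<bar>2 * ?N * (H1 ?s - F1 ?s)\<bar>" by (rule abs_triangle_ineq)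
      also have "\<dots> \<le> 4 * (c + 1) * (4 * (K * \<delta>)) + 2 * ?N * (2 * (K * \<delta>))"
        unfolding abs_mult using e1[OF s] e2[OF s] s c by (intro add_mono mult_mono) auto
      also have "\<dots> = (16 * (c + 1) * K + 4 * ?N * K) * \<delta>" by (simp add: algebra_simps)
      also have "\<dots> \<le> M * \<delta>" using M \<delta> by (intro mult_right_mono) auto
      finally have 2: "\<bar>laplacian \<phi> x - (4 * ?s * F2 ?s + 2 * ?N * F1 ?s)\<bar> \<le> \<eta>" using \<delta>(2) by (simp add: mult.commute)
      show ?thesis unfolding ind using 1 2 by simp
    qed
  qed
qed

lemma radial_C2_D22:
  fixes F F1 F2 :: "real \<Rightarrow> real"
  assumes N: "5 \<le> DIM('a::euclidean_space)"
    and d: "\<And>t. (F has_real_derivative F1 t) (at t)" "\<And>t. (F1 has_real_derivative F2 t) (at t)"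
    and cont: "continuous_on UNIV F2" and z: "\<And>s. c \<le> s \<Longrightarrow> F s = 0" and c: "0 < c"
  shows "D22_rel (\<lambda>x :: 'a. F (x \<bullet> x)) (\<lambda>x. 4 * (x \<bullet> x) * F2 (x \<bullet> x) + 2 * real DIM('a) * F1 (x \<bullet> x))"
proof (rule D22_relI)
  have cF: "continuous_on UNIV F" "continuous_on UNIV F1" by (rule DERIV_continuous_on, rule d)+
  have [measurable]: "F \<in> borel_measurable borel" "F1 \<in> borel_measurable borel" "F2 \<in> borel_measurable borel"
    using cF cont by (auto intro: borel_measurable_continuous_onI)
  show "(\<lambda>x :: 'a. F (x \<bullet> x)) \<in> borel_measurable lebesgue" by (rule borel_imp_lebesgue) measurable
  show "(\<lambda>x :: 'a. 4 * (x \<bullet> x) * F2 (x \<bullet> x) + 2 * real DIM('a) * F1 (x \<bullet> x)) \<in> borel_measurable lebesgue"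
    by (rule borel_imp_lebesgue) measurable
  fix e :: real assume e: "0 < e"
  let ?C = "cball (0 :: 'a) (c + 2)"
  define V where "V = measure lborel ?C"
  have V: "0 \<le> V" "emeasure lebesgue ?C = ennreal V"
    using emeasure_lborel_cball_finite[of "0 :: 'a" "c + 2"] by (auto simp: V_def emeasure_eq_ennreal_measure)
  define \<eta> where "\<eta> = min 1 (e / (V + 1))"
  have \<eta>: "0 < \<eta>" "\<eta> \<le> 1" "\<eta> * V \<le> e"
  proof -
    show "0 < \<eta>" "\<eta> \<le> 1" using e V by (auto simp: \<eta>_def add_nonneg_pos)
    have "\<eta> * V \<le> e / (V + 1) * V" using V by (intro mult_right_mono) (auto simp: \<eta>_def)
    also have "\<dots> \<le> e" using e V by (simp add: field_simps)
    finally show "\<eta> * V \<le> e" .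
  qed
  obtain \<phi> where \<phi>: "\<phi> \<in> Cc_infty" "\<And>x :: 'a. \<bar>\<phi> x - F (x \<bullet> x)\<bar> \<le> \<eta> * indicator ?C x"
     "\<And>x. \<bar>laplacian \<phi> x - (4 * (x \<bullet> x) * F2 (x \<bullet> x) + 2 * real DIM('a) * F1 (x \<bullet> x))\<bar> \<le> \<eta> * indicator ?C x"
    using radial_C2_uniform_approximation[OF d cont z c \<eta>(1), where 'a = 'a] by blast
  have gen: "(\<integral>\<^sup>+x. ennreal (\<bar>f x\<bar> powr s) \<partial>lebesgue) \<le> ennreal e"
    if "\<And>x :: 'a. \<bar>f x\<bar> \<le> \<eta> * indicator ?C x" "1 \<le> s" for f s
  proof -
    have b: "\<bar>f x\<bar> powr s \<le> \<eta> * indicator ?C x" for x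
    proof (cases "x \<in> ?C")
      case True
      then have "\<bar>f x\<bar> powr s \<le> \<eta> powr s" using that(1)[of x] that(2) by (intro powr_mono2) auto
      also have "\<dots> \<le> \<eta> powr 1" using \<eta> that(2) by (intro powr_mono') auto
      finally show ?thesis using True \<eta> by simp
    qed (use that(1)[of x] in auto)
    have "(\<integral>\<^sup>+x. ennreal (\<bar>f x\<bar> powr s) \<partial>lebesgue) \<le> (\<integral>\<^sup>+x. ennreal \<eta> * indicator ?C x \<partial>lebesgue)"
    proof (intro nn_integral_mono)
      fix x :: 'a
      show "ennreal (\<bar>f x\<bar> powr s) \<le> ennreal \<eta> * indicator ?C x"
        using ennreal_leI[OF b[of x]] \<eta> by (simp add: ennreal_mult' ennreal_indicator)
    qed
    also have "\<dots> = ennreal \<eta> * ennreal V" by (subst nn_integral_cmult_indicator) (auto simp: V)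
    also have "\<dots> = ennreal (\<eta> * V)" using \<eta> V by (simp add: ennreal_mult)
    also have "\<dots> \<le> ennreal e" using \<eta> by (intro ennreal_leI)
    finally show ?thesis .
  qed
  have p: "1 \<le> crit TYPE('a)" using crit_gt[OF N] by simp
  show "\<exists>\<phi>\<in>(Cc_infty :: ('a \<Rightarrow> real) set). (\<integral>\<^sup>+x. ennreal (\<bar>\<phi> x - F (x \<bullet> x)\<bar> powr crit TYPE('a)) \<partial>lebesgue) \<le> ennreal e \<and>
     (\<integral>\<^sup>+x. ennreal (\<bar>laplacian \<phi> x - (4 * (x \<bullet> x) * F2 (x \<bullet> x) + 2 * real DIM('a) * F1 (x \<bullet> x))\<bar> powr 2) \<partial>lebesgue) \<le> ennreal e"
  proof (rule bexI[of _ \<phi>], rule conjI)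
    show "(\<integral>\<^sup>+x. ennreal (\<bar>\<phi> x - F (x \<bullet> x)\<bar> powr crit TYPE('a)) \<partial>lebesgue) \<le> ennreal e"
      using \<phi>(2) p by (rule gen)
    show "(\<integral>\<^sup>+x. ennreal (\<bar>laplacian \<phi> x - (4 * (x \<bullet> x) * F2 (x \<bullet> x) + 2 * real DIM('a) * F1 (x \<bullet> x))\<bar> powr 2) \<partial>lebesgue) \<le> ennreal e"
      using \<phi>(3) by (rule gen) simp
  qed (rule \<phi>(1))
qed

text \<open>The profile of \<open>rad\<close> in the variable \<open>s = x \<bullet> x\<close>, where \<open>- ln (norm x) = - (ln s / 2)\<close>. The value for
  \<open>s \<le> 0\<close> is a smooth continuation if \<open>k\<close> vanishes for large arguments, that is, near the origin of the space.\<close>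

definition square_profile :: "real \<Rightarrow> (real \<Rightarrow> real) \<Rightarrow> real \<Rightarrow> real" where
  "square_profile m k s = (if 0 < s then s powr (- m / 2) * k (- (ln s / 2)) else 0)"

lemma rad_square_profile: "rad m k x = square_profile m k (x \<bullet> x)"
proof (cases "x = 0")
  case False
  have n: "0 < norm x" using False by simp
  have "(x \<bullet> x) powr (- m / 2) = norm x powr (- m)"
  proof -
    have "x \<bullet> x = norm x powr 2" using n by (simp add: power2_norm_eq_inner)
    then have "(x \<bullet> x) powr (- m / 2) = norm x powr (2 * (- m / 2))" by (simp only: powr_powr)
    then show ?thesis by simp
  qed
  moreover have "ln (x \<bullet> x) / 2 = ln (norm x)"
    using n by (simp add: ln_realpow flip: power2_norm_eq_inner)
  ultimately show ?thesis using False by (simp add: rad_def square_profile_def)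
qed (simp add: rad_def square_profile_def)

lemma square_profile_derivative:
  assumes d: "\<And>t. (k has_real_derivative k' t) (at t)" and z: "\<And>t. T \<le> t \<Longrightarrow> k t = 0"
  shows "(square_profile m k has_real_derivative - square_profile (m + 2) (\<lambda>t. m * k t + k' t) s / 2) (at s)"
proof (cases "0 < s")
  case True
  have l: "((\<lambda>s. - (ln s / 2)) has_real_derivative - (1 / (2 * s))) (at s)"
    using True by (auto intro!: derivative_eq_intros simp: field_simps)
  have p: "((\<lambda>s. s powr (- m / 2)) has_real_derivative (- m / 2) * s powr (- m / 2 - 1)) (at s)"
    using True by (auto intro!: derivative_eq_intros simp: powr_diff)
  have e: "s powr (- (m + 2) / 2) = s powr (- m / 2) / s" "s powr (- m / 2 - 1) = s powr (- m / 2) / s"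
  proof -
    have h: "- (m + 2) / 2 = - m / 2 - 1" by (simp add: field_simps)
    show "s powr (- m / 2 - 1) = s powr (- m / 2) / s" using True by (simp add: powr_diff)
    then show "s powr (- (m + 2) / 2) = s powr (- m / 2) / s" unfolding h .
  qed
  have val: "square_profile (m + 2) (\<lambda>t. m * k t + k' t) s = s powr (- m / 2) / s * (m * k (- (ln s / 2)) + k' (- (ln s / 2)))"
    unfolding square_profile_def e(1) using True by simp
  have "((\<lambda>s. s powr (- m / 2) * k (- (ln s / 2))) has_real_derivative - square_profile (m + 2) (\<lambda>t. m * k t + k' t) s / 2) (at s)"
    by (rule DERIV_cong[OF DERIV_mult[OF p DERIV_chain2[OF d l]]])
       (use True in \<open>simp only: val e(2), simp add: field_simps\<close>)
  then show ?thesis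
    by (rule has_field_derivative_transform_within_open[where S = "{0<..}"]) (use True in \<open>auto simp: square_profile_def\<close>)
next
  case False
  have "square_profile m k r = 0" if "r < exp (- 2 * T)" for r
  proof (cases "0 < r")
    case True
    have "ln r < ln (exp (- 2 * T))" using True that by (subst ln_less_cancel_iff) auto
    then have "T \<le> - (ln r / 2)" by simp
    then show ?thesis using z by (simp add: square_profile_def)
  qed (simp add: square_profile_def)
  note near = this
  have se: "s < exp (- 2 * T)" using False exp_gt_zero[of "- 2 * T"] by linarith
  have "((\<lambda>_. 0) has_real_derivative 0) (at s)" by simp
  then have "(square_profile m k has_real_derivative 0) (at s)"
    by (rule has_field_derivative_transform_within_open[where S = "{..<exp (- 2 * T)}"]) (use near se in auto)
  then show ?thesis using False by (simp add: square_profile_def)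
qed

lemma square_profile_continuous:
  assumes c: "continuous_on UNIV k" and z: "\<And>t. T < t \<Longrightarrow> k t = 0"
  shows "continuous_on UNIV (square_profile m k)"
proof -
  have "continuous_on ({0<..} \<union> {..<exp (- 2 * T)}) (square_profile m k)"
  proof (rule continuous_on_open_Un)
    have "continuous_on {0<..} (\<lambda>s. s powr (- m / 2) * k (- (ln s / 2)))"
      by (intro continuous_intros continuous_on_compose2[OF c]) auto
    then show "continuous_on {0<..} (square_profile m k)"
      by (rule continuous_on_eq) (simp add: square_profile_def)
    have "square_profile m k r = 0" if "r < exp (- 2 * T)" for r
    proof (cases "0 < r")
      case True
      have "ln r < ln (exp (- 2 * T))" using True that by (subst ln_less_cancel_iff) auto
      then have "T < - (ln r / 2)" by simp
      then show ?thesis using z by (simp add: square_profile_def)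
    qed (simp add: square_profile_def)
    then have "\<And>r. r \<in> {..<exp (- 2 * T)} \<Longrightarrow> 0 = square_profile m k r" by simp
    from continuous_on_eq[OF continuous_on_const this]
    show "continuous_on {..<exp (- 2 * T)} (square_profile m k)" .
  qed auto
  moreover have "{0<..} \<union> {..<exp (- 2 * T)} = UNIV" 
  proof -
    have "x \<in> {0<..} \<union> {..<exp (- 2 * T)}" for x
      using exp_gt_zero[of "- 2 * T"] unfolding Un_iff greaterThan_iff lessThan_iff by linarith
    then show ?thesis by blast
  qed
  ultimately show ?thesis by simp
qed

text \<open>The equation for \<open>l\<close> is the Laplacian in the logarithmic radius: \<open>\<Delta>(\<bar>x\<bar> powr (- m) * k t) = \<bar>x\<bar> powr (- m - 2) * l t\<close>.
  It follows from applying \<open>square_profile_derivative\<close> twice.\<close>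

theorem rad_C2:
  fixes k k1 k2 :: "real \<Rightarrow> real"
  assumes N: "5 \<le> DIM('a::euclidean_space)"
    and d: "\<And>t. (k has_real_derivative k1 t) (at t)" "\<And>t. (k1 has_real_derivative k2 t) (at t)"
    and c: "continuous_on UNIV k2" and z: "\<And>t. T \<le> \<bar>t\<bar> \<Longrightarrow> k t = 0"
    and l: "\<And>t. l t = k2 t + (2 * m + 2 - real DIM('a)) * k1 t + m * (m + 2 - real DIM('a)) * k t"
  shows "\<exists>f1 f2. C2_data (rad m k :: 'a \<Rightarrow> real) f1 f2 \<and> (\<forall>x. (\<Sum>b\<in>Basis. f2 b x) = rad (m + 2) l x)"
    "D22_rel (rad m k :: 'a \<Rightarrow> real) (rad (m + 2) l)"
    "\<And>x :: 'a. exp T < norm x \<Longrightarrow> rad m k x = 0"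
proof -
  let ?N = "real DIM('a)"
  have z': "T \<le> t \<Longrightarrow> k t = 0" for t using z[of t] by simp
  have z1: "T < t \<Longrightarrow> k1 t = 0" for t by (rule deriv_zero_beyond[OF _ d(1)]) (use z' in auto)
  have z2: "T < t \<Longrightarrow> k2 t = 0" for t by (rule deriv_zero_beyond[OF z1 d(2)])
  define q1 where "q1 t = m * k t + k1 t" for t
  define q2 where "q2 t = m * k1 t + k2 t" for t
  have dq: "(q1 has_real_derivative q2 t) (at t)" for t
    unfolding q1_def[abs_def] q2_def by (intro DERIV_add DERIV_cmult d)
  have qz: "T + 1 \<le> t \<Longrightarrow> q1 t = 0" for t using z'[of t] z1[of t] by (simp add: q1_def)
  define F where "F = square_profile m k"
  define F1 where "F1 s = - square_profile (m + 2) q1 s / 2" for s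
  define F2 where "F2 s = square_profile (m + 4) (\<lambda>t. (m + 2) * q1 t + q2 t) s / 4" for s
  have dF: "(F has_real_derivative F1 s) (at s)" for s
    unfolding F_def F1_def q1_def[abs_def] by (rule square_profile_derivative[OF d(1) z'])
  have dF1: "(F1 has_real_derivative F2 s) (at s)" for s
    unfolding F1_def[abs_def] F2_def
    by (rule DERIV_cong[OF DERIV_cdivide[OF DERIV_minus[OF square_profile_derivative[OF dq qz]]]]) (simp_all add: add.assoc)
  have ck: "continuous_on UNIV k" "continuous_on UNIV k1" by (rule DERIV_continuous_on, rule d)+
  have cF2: "continuous_on UNIV F2"
    unfolding F2_def[abs_def]
    by (intro continuous_intros square_profile_continuous[where T = T])
       (use z' z1 z2 in \<open>auto simp: q1_def q2_def intro!: continuous_intros ck c\<close>)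
  have Fz: "F s = 0" if "exp (2 * T) \<le> s" for s
  proof -
    have s: "0 < s" using that exp_gt_zero[of "2 * T"] by linarith
    have "ln (exp (2 * T)) \<le> ln s" using s that by (subst ln_le_cancel_iff) auto
    then have "T \<le> \<bar>- (ln s / 2)\<bar>" by simp
    then show ?thesis using z s by (simp add: F_def square_profile_def)
  qed
  have lap: "4 * (x \<bullet> x) * F2 (x \<bullet> x) + 2 * ?N * F1 (x \<bullet> x) = rad (m + 2) l x" for x :: 'a
  proof (cases "x = 0")
    case False
    define s where "s = x \<bullet> x"
    have s: "0 < s" using False by (simp add: s_def)
    have e: "s * s powr (- (m + 4) / 2) = s powr (- (m + 2) / 2)"
    proof -
      have h: "- (m + 2) / 2 = - (m + 4) / 2 + 1" by (simp add: field_simps)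
      show ?thesis unfolding h powr_add using s by simp
    qed
    have "4 * s * F2 s + 2 * ?N * F1 s = s * s powr (- (m + 4) / 2) * ((m + 2) * q1 (- (ln s / 2)) + q2 (- (ln s / 2)))
        - ?N * (s powr (- (m + 2) / 2) * q1 (- (ln s / 2)))"
      using s by (simp add: F1_def F2_def square_profile_def)
    also have "\<dots> = s powr (- (m + 2) / 2) * l (- (ln s / 2))"
      unfolding e by (simp add: l q1_def q2_def algebra_simps)
    also have "\<dots> = rad (m + 2) l x" using s by (simp add: rad_square_profile square_profile_def s_def)
    finally show ?thesis by (simp add: s_def)
  qed (simp add: rad_def F1_def square_profile_def)
  have rF: "(rad m k :: 'a \<Rightarrow> real) = (\<lambda>x. F (x \<bullet> x))" by (rule ext) (simp add: rad_square_profile F_def)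
  show "\<exists>f1 f2. C2_data (rad m k :: 'a \<Rightarrow> real) f1 f2 \<and> (\<forall>x. (\<Sum>b\<in>Basis. f2 b x) = rad (m + 2) l x)"
    unfolding rF using C2_data_radial[OF dF dF1 cF2, where 'a = 'a] lap by (intro exI conjI) auto
  have "D22_rel (\<lambda>x :: 'a. F (x \<bullet> x)) (\<lambda>x. 4 * (x \<bullet> x) * F2 (x \<bullet> x) + 2 * ?N * F1 (x \<bullet> x))"
    by (rule radial_C2_D22[OF N dF dF1 cF2 Fz]) auto
  then show "D22_rel (rad m k :: 'a \<Rightarrow> real) (rad (m + 2) l)" unfolding rF[symmetric] lap .
  show "rad m k x = 0" if x: "exp T < norm x" for x :: 'a
  proof -
    have "0 < norm x" using x exp_gt_zero[of T] by linarith
    then have "ln (exp T) < ln (norm x)" using x by (subst ln_less_cancel_iff) auto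
    then have "T \<le> \<bar>- ln (norm x)\<bar>" by simp
    then show ?thesis using z by (simp add: rad_def)
  qed
qed

section \<open>Profiles and their truncation\<close>

text \<open>A function \<open>V 0\<close> of class \<open>C\<^sup>4\<close> together with its derivatives \<open>V 1\<close>, \<dots>, \<open>V 4\<close>.\<close>

definition C4_chain :: "(nat \<Rightarrow> real \<Rightarrow> real) \<Rightarrow> bool" where
  "C4_chain V \<longleftrightarrow> (\<forall>i<4. \<forall>t. (V i has_real_derivative V (Suc i) t) (at t)) \<and> continuous_on UNIV (V 4)"

definition chain_size :: "(nat \<Rightarrow> real \<Rightarrow> real) \<Rightarrow> real \<Rightarrow> real" where
  "chain_size V t = \<bar>V 0 t\<bar> + \<bar>V 1 t\<bar> + \<bar>V 2 t\<bar> + \<bar>V 3 t\<bar> + \<bar>V 4 t\<bar>"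

lemma C4_chainD:
  assumes "C4_chain V"
  shows "(V 0 has_real_derivative V 1 t) (at t)" "(V 1 has_real_derivative V 2 t) (at t)"
    "(V 2 has_real_derivative V 3 t) (at t)" "(V 3 has_real_derivative V 4 t) (at t)"
proof -
  have "(V i has_real_derivative V (Suc i) t) (at t)" if "i < 4" for i using assms that unfolding C4_chain_def by blast
  from this[of 0] this[of 1] this[of 2] this[of 3]
  show "(V 0 has_real_derivative V 1 t) (at t)" "(V 1 has_real_derivative V 2 t) (at t)"
    "(V 2 has_real_derivative V 3 t) (at t)" "(V 3 has_real_derivative V 4 t) (at t)"
    by (simp_all add: numeral_2_eq_2 numeral_3_eq_3 eval_nat_numeral)
qed

lemma le4_cases: "i \<le> (4::nat) \<longleftrightarrow> i = 0 \<or> i = 1 \<or> i = 2 \<or> i = 3 \<or> i = 4" by auto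

lemma C4_chain_continuous:
  assumes "C4_chain V" "i \<le> 4"
  shows "continuous_on UNIV (V i)"
proof -
  have "continuous_on UNIV (V 0)" "continuous_on UNIV (V 1)" "continuous_on UNIV (V 2)" "continuous_on UNIV (V 3)"
    by (rule DERIV_continuous_on, rule C4_chainD[OF assms(1)])+
  moreover have "continuous_on UNIV (V 4)" using assms(1) by (simp add: C4_chain_def)
  ultimately show ?thesis using assms(2) unfolding le4_cases by blast
qed

lemma C4_chain_list:
  assumes "\<And>t. (v0 has_real_derivative v1 t) (at t)" "\<And>t. (v1 has_real_derivative v2 t) (at t)"
    "\<And>t. (v2 has_real_derivative v3 t) (at t)" "\<And>t. (v3 has_real_derivative v4 t) (at t)" "continuous_on UNIV v4"
  shows "C4_chain (\<lambda>i. [v0, v1, v2, v3, v4] ! i)"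
proof -
  have i4: "i < 4 \<longleftrightarrow> i = 0 \<or> i = 1 \<or> i = 2 \<or> i = (3::nat)" for i by auto
  show ?thesis unfolding C4_chain_def i4 using assms
    by (auto simp: numeral_2_eq_2 numeral_3_eq_3 eval_nat_numeral)
qed

lemma list_nth_4: "[v0, v1, v2, v3, v4] ! 0 = v0" "[v0, v1, v2, v3, v4] ! 1 = v1" "[v0, v1, v2, v3, v4] ! 2 = v2"
   "[v0, v1, v2, v3, v4] ! 3 = v3" "[v0, v1, v2, v3, v4] ! 4 = v4"
  by (simp_all add: eval_nat_numeral)

lemma positive_part_power_derivative:
  "((\<lambda>t. (max 0 (1 - t\<^sup>2)) ^ Suc (Suc n)) has_real_derivative
     real (Suc (Suc n)) * (max 0 (1 - t\<^sup>2)) ^ Suc n * (- 2 * t)) (at (t::real))"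
proof -
  have m: "((\<lambda>y. (max 0 y) ^ Suc (Suc n)) has_real_derivative real (Suc (Suc n)) * (max 0 y) ^ Suc n) (at y)" for y :: real
  proof -
    consider "0 < y" | "y < 0" | "y = 0" by linarith
    then show ?thesis
    proof cases
      case 1
      have "((\<lambda>y. y ^ Suc (Suc n)) has_real_derivative real (Suc (Suc n)) * (max 0 y) ^ Suc n) (at y)"
        using 1 DERIV_pow[of "Suc (Suc n)" y] by (simp add: max_def)
      then show ?thesis
        by (rule has_field_derivative_transform_within_open[where S = "{0<..}"]) (use 1 in \<open>auto simp: max_def\<close>)
    next
      case 2
      have "((\<lambda>_. 0) has_real_derivative real (Suc (Suc n)) * (max 0 y) ^ Suc n) (at y)" using 2 by (simp add: max_def)
      then show ?thesis
        by (rule has_field_derivative_transform_within_open[where S = "{..<0}"]) (use 2 in \<open>auto simp: max_def\<close>)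
    next
      case 3
      have "((\<lambda>h::real. ((max 0 h) ^ Suc (Suc n)) / h) \<longlongrightarrow> 0) (at 0)"
      proof (rule Lim_null_comparison[where g = "\<lambda>h. \<bar>h\<bar> ^ Suc n"])
        show "\<forall>\<^sub>F h :: real in at 0. norm ((max 0 h) ^ Suc (Suc n) / h) \<le> \<bar>h\<bar> ^ Suc n"
        proof (intro always_eventually allI)
          fix h :: real
          have pos: "0 \<le> \<bar>h\<bar> ^ Suc n" by (rule zero_le_power) simp
          show "norm ((max 0 h) ^ Suc (Suc n) / h) \<le> \<bar>h\<bar> ^ Suc n"
          proof (cases "0 < h")
            case False
            then have "norm ((max 0 h) ^ Suc (Suc n) / h) = 0" by simp
            then show ?thesis using pos by (simp only:)
          qed (simp add: max_def)
        qed
        have "((\<lambda>h. \<bar>h :: real\<bar> ^ Suc n) \<longlongrightarrow> \<bar>0\<bar> ^ Suc n) (at 0)" by (intro tendsto_intros)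
        then show "((\<lambda>h. \<bar>h :: real\<bar> ^ Suc n) \<longlongrightarrow> 0) (at 0)" by simp
      qed
      then show ?thesis using 3 by (simp add: DERIV_def)
    qed
  qed
  have i: "((\<lambda>t. 1 - t\<^sup>2) has_real_derivative - 2 * t) (at t)" by (auto intro!: derivative_eq_intros)
  show ?thesis using DERIV_chain2[OF m i] by simp
qed

lemma positive_part_power_derivative':
  assumes "2 \<le> n"
  shows "((\<lambda>t. (max 0 (1 - t\<^sup>2)) ^ n) has_real_derivative real n * (max 0 (1 - t\<^sup>2)) ^ (n - 1) * (- 2 * t)) (at (t::real))"
proof -
  obtain k where "n = Suc (Suc k)" using assms by (metis Suc_le_D numeral_2_eq_2 Suc_le_mono)
  then show ?thesis using positive_part_power_derivative[of k t] by simp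
qed

text \<open>The fifth power of the positive part of \<open>1 - t\<^sup>2\<close> has four continuous derivatives.\<close>

lemma cutoff_exists:
  obtains c :: "nat \<Rightarrow> real \<Rightarrow> real" and C where "C4_chain c" "c 0 0 = 1"
    "\<And>i t. i \<le> 4 \<Longrightarrow> 1 \<le> \<bar>t\<bar> \<Longrightarrow> c i t = 0" "\<And>i t. i \<le> 4 \<Longrightarrow> \<bar>c i t\<bar> \<le> C"
proof -
  define y where "y t = max 0 (1 - t\<^sup>2)" for t :: real
  define c0 where "c0 t = y t ^ 5" for t
  define c1 where "c1 t = - 10 * (t * y t ^ 4)" for t
  define c2 where "c2 t = - 10 * y t ^ 4 + 80 * (t\<^sup>2 * y t ^ 3)" for t
  define c3 where "c3 t = 240 * (t * y t ^ 3) - 480 * (t ^ 3 * y t ^ 2)" for t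
  define c4 where "c4 t = 240 * y t ^ 3 - 2880 * (t\<^sup>2 * y t ^ 2) + 1920 * (t ^ 4 * y t)" for t
  have dy: "((\<lambda>t. y t ^ 5) has_real_derivative - 10 * (t * y t ^ 4)) (at t)"
     "((\<lambda>t. y t ^ 4) has_real_derivative - 8 * (t * y t ^ 3)) (at t)"
     "((\<lambda>t. y t ^ 3) has_real_derivative - 6 * (t * y t ^ 2)) (at t)"
     "((\<lambda>t. y t ^ 2) has_real_derivative - 4 * (t * y t)) (at t)" for t
    using positive_part_power_derivative'[of 5 t, folded y_def] positive_part_power_derivative'[of 4 t, folded y_def]
      positive_part_power_derivative'[of 3 t, folded y_def] positive_part_power_derivative'[of 2 t, folded y_def]
    by (simp_all add: mult_ac)
  have d0: "(c0 has_real_derivative c1 t) (at t)" for t unfolding c0_def[abs_def] c1_def by (rule dy)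
  have d1: "(c1 has_real_derivative c2 t) (at t)" for t
    unfolding c1_def[abs_def] c2_def
    by (rule DERIV_cong[OF DERIV_cmult[OF DERIV_mult[OF DERIV_ident dy(2)]]]) (simp add: algebra_simps power2_eq_square)
  have dt: "((\<lambda>t. t\<^sup>2) has_real_derivative 2 * t) (at t)" "((\<lambda>t. t ^ 3) has_real_derivative 3 * t\<^sup>2) (at t)" for t :: real
    using DERIV_pow[of 2 t] DERIV_pow[of 3 t] by simp_all
  have d2: "(c2 has_real_derivative c3 t) (at t)" for t
    unfolding c2_def[abs_def] c3_def
    by (rule DERIV_cong[OF DERIV_add[OF DERIV_cmult[OF dy(2)] DERIV_cmult[OF DERIV_mult[OF dt(1) dy(3)]]]])
       (simp add: algebra_simps power2_eq_square power3_eq_cube)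
  have d3: "(c3 has_real_derivative c4 t) (at t)" for t
    unfolding c3_def[abs_def] c4_def
    by (rule DERIV_cong[OF DERIV_diff[OF DERIV_cmult[OF DERIV_mult[OF DERIV_ident dy(3)]] DERIV_cmult[OF DERIV_mult[OF dt(2) dy(4)]]]])
       (simp add: algebra_simps power2_eq_square power3_eq_cube power4_eq_xxxx)
  have yc: "continuous_on UNIV y" unfolding y_def[abs_def] by (intro continuous_intros)
  have k4: "continuous_on UNIV c4" unfolding c4_def[abs_def] by (intro continuous_intros yc)
  define c where "c = (\<lambda>i. [c0, c1, c2, c3, c4] ! i)"
  have ch: "C4_chain c" unfolding c_def by (rule C4_chain_list[OF d0 d1 d2 d3 k4])
  have z: "c i t = 0" if "i \<le> 4" "1 \<le> \<bar>t\<bar>" for i t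
  proof -
    have "1 \<le> t\<^sup>2" using that(2) by (metis abs_ge_zero one_power2 power2_abs power_mono zero_le_one)
    then have "y t = 0" by (simp add: y_def)
    then have "c0 t = 0" "c1 t = 0" "c2 t = 0" "c3 t = 0" "c4 t = 0"
      by (simp_all add: c0_def c1_def c2_def c3_def c4_def)
    then show ?thesis using that(1) unfolding le4_cases c_def by (auto simp only: list_nth_4)
  qed
  have ex: "\<exists>C. \<forall>t. \<bar>c i t\<bar> \<le> C" if i: "i \<le> 4" for i
  proof (rule continuous_compact_support(2)[where R = 1])
    show "continuous_on UNIV (c i)" by (rule C4_chain_continuous[OF ch i])
    show "c i t = 0" if "1 < norm t" for t using z[OF i, of t] that by simp
  qed
  have "0 \<le> (4::nat)" by simp
  from ex[OF this] obtain C0 where Cs0: "\<forall>t. \<bar>c 0 t\<bar> \<le> C0" by (rule exE)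
  have "1 \<le> (4::nat)" by simp
  from ex[OF this] obtain C1 where Cs1: "\<forall>t. \<bar>c 1 t\<bar> \<le> C1" by (rule exE)
  have "2 \<le> (4::nat)" by simp
  from ex[OF this] obtain C2 where Cs2: "\<forall>t. \<bar>c 2 t\<bar> \<le> C2" by (rule exE)
  have "3 \<le> (4::nat)" by simp
  from ex[OF this] obtain C3 where Cs3: "\<forall>t. \<bar>c 3 t\<bar> \<le> C3" by (rule exE)
  have "4 \<le> (4::nat)" by simp
  from ex[OF this] obtain C4 where Cs4: "\<forall>t. \<bar>c 4 t\<bar> \<le> C4" by (rule exE)
  note Cs = Cs0 Cs1 Cs2 Cs3 Cs4
  define C where "C = max C0 (max C1 (max C2 (max C3 C4)))"
  have le: "C0 \<le> C" "C1 \<le> C" "C2 \<le> C" "C3 \<le> C" "C4 \<le> C" by (auto simp: C_def)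
  have b: "\<bar>c i t\<bar> \<le> C" if "i \<le> 4" for i t
    using that unfolding le4_cases using Cs[THEN spec, of t] le by (elim disjE) auto
  have "c 0 0 = 1" by (simp add: c_def c0_def y_def)
  then show ?thesis using that[OF ch _ z b] by blast
qed

text \<open>\<open>V 0\<close> is multiplied by a cutoff at scale \<open>Suc n\<close>. By Leibniz' rule the derivatives are sums of products
  of derivatives of the cutoff and of \<open>V 0\<close>; all terms with a derivative of the cutoff tend to \<open>0\<close>.\<close>

lemma truncation_exists:
  assumes V: "C4_chain V"
  obtains W :: "nat \<Rightarrow> nat \<Rightarrow> real \<Rightarrow> real" and K where "\<And>n. C4_chain (W n)"
    "\<And>n t. real (Suc n) \<le> \<bar>t\<bar> \<Longrightarrow> W n 0 t = 0" "\<And>i t. i \<le> 4 \<Longrightarrow> (\<lambda>n. W n i t) \<longlonglongrightarrow> V i t"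
    "\<And>n i t. i \<le> 4 \<Longrightarrow> \<bar>W n i t\<bar> \<le> K * chain_size V t" "0 \<le> K"
proof -
  obtain c :: "nat \<Rightarrow> real \<Rightarrow> real" and C where c: "C4_chain c" "c 0 0 = 1"
    and cz: "\<And>i t. i \<le> 4 \<Longrightarrow> 1 \<le> \<bar>t\<bar> \<Longrightarrow> c i t = 0" and cC: "\<And>i t. i \<le> 4 \<Longrightarrow> \<bar>c i t\<bar> \<le> C"
    by (rule cutoff_exists) blast
  have C0: "0 \<le> C" using cC[of 0 0] by (auto intro: order_trans[OF abs_ge_zero])
  define R where "R n = real (Suc n)" for n
  have R: "1 \<le> R n" "0 < R n" for n by (auto simp: R_def)
  define e where "e n i t = c i (t / R n) / R n ^ i" for n i t
  have de: "((\<lambda>t. e n i t) has_real_derivative e n (Suc i) t) (at t)"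
    if h: "\<And>t. (c i has_real_derivative c (Suc i) t) (at t)" for n i t
  proof -
    have "((\<lambda>t. t / R n) has_real_derivative 1 / R n) (at t)" using R[of n] by (auto intro!: derivative_eq_intros)
    from DERIV_cdivide[OF DERIV_chain2[OF h this], of "R n ^ i"] show ?thesis
      unfolding e_def by (rule DERIV_cong) simp
  qed
  note cd = C4_chainD[OF c(1)]
  have S: "Suc 0 = 1" "Suc 1 = 2" "Suc 2 = 3" "Suc 3 = 4" by simp_all
  have de0: "((\<lambda>t. e n 0 t) has_real_derivative e n 1 t) (at t)" for n t using de[of 0, unfolded S, OF cd(1)] .
  have de1: "((\<lambda>t. e n 1 t) has_real_derivative e n 2 t) (at t)" for n t using de[of 1, unfolded S, OF cd(2)] .
  have de2: "((\<lambda>t. e n 2 t) has_real_derivative e n 3 t) (at t)" for n t using de[of 2, unfolded S, OF cd(3)] .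
  have de3: "((\<lambda>t. e n 3 t) has_real_derivative e n 4 t) (at t)" for n t using de[of 3, unfolded S, OF cd(4)] .
  have ec: "continuous_on UNIV (e n 4)" for n
  proof -
    have c4: "continuous_on UNIV (c 4)" by (rule C4_chain_continuous[OF c(1)]) simp
    have "continuous_on UNIV (\<lambda>t. t / R n)" using R(2)[of n] by (intro continuous_on_divide continuous_on_const continuous_on_id) auto
    from continuous_on_compose2[OF c4 this subset_UNIV] have "continuous_on UNIV (\<lambda>t. c 4 (t / R n))" .
    then show ?thesis unfolding e_def using R(2)[of n] by (intro continuous_on_divide continuous_on_const) auto
  qed
  have eb: "\<bar>e n i t\<bar> \<le> C" if "i \<le> 4" for n i t
  proof -
    have "1 \<le> R n ^ i" by (rule one_le_power[OF R(1)])
    then have "\<bar>e n i t\<bar> \<le> \<bar>c i (t / R n)\<bar> / 1" unfolding e_def abs_divide by (intro divide_left_mono) auto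
    then show ?thesis using cC[OF that, of "t / R n"] by simp
  qed
  have Rinv: "(\<lambda>n. 1 / R n) \<longlonglongrightarrow> 0" unfolding R_def by (rule LIMSEQ_Suc[OF lim_1_over_n])
  have el0: "(\<lambda>n. e n 0 t) \<longlonglongrightarrow> 1" for t
  proof -
    have "(\<lambda>n. t * (1 / R n)) \<longlonglongrightarrow> t * 0" by (intro tendsto_intros Rinv)
    then have "(\<lambda>n. t / R n) \<longlonglongrightarrow> 0" by simp
    from continuous_on_tendsto_compose[OF C4_chain_continuous[OF c(1), of 0] this]
    show ?thesis using c(2) by (simp add: e_def)
  qed
  have eli: "(\<lambda>n. e n i t) \<longlonglongrightarrow> 0" if i: "1 \<le> i" "i \<le> 4" for i t
  proof (rule Lim_null_comparison[where g = "\<lambda>n. C * (1 / R n)"])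
    show "\<forall>\<^sub>F n in sequentially. norm (e n i t) \<le> C * (1 / R n)"
    proof (intro always_eventually allI)
      fix n
      have "R n ^ 1 \<le> R n ^ i" using R(1) i(1) by (intro power_increasing)
      then have "R n \<le> R n ^ i" by simp
      then have "\<bar>c i (t / R n)\<bar> / R n ^ i \<le> C / R n"
        using cC[OF i(2), of "t / R n"] R[of n] C0 by (intro frac_le) auto
      then show "norm (e n i t) \<le> C * (1 / R n)" using R[of n] by (simp add: e_def abs_divide power_abs[symmetric])
    qed
    have "(\<lambda>n. C * (1 / R n)) \<longlonglongrightarrow> C * 0" by (intro tendsto_intros Rinv)
    then show "(\<lambda>n. C * (1 / R n)) \<longlonglongrightarrow> 0" by simp
  qed
  define W0 where "W0 n t = e n 0 t * V 0 t" for n t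
  define W1 where "W1 n t = e n 1 t * V 0 t + e n 0 t * V 1 t" for n t
  define W2 where "W2 n t = e n 2 t * V 0 t + 2 * (e n 1 t * V 1 t) + e n 0 t * V 2 t" for n t
  define W3 where "W3 n t = e n 3 t * V 0 t + 3 * (e n 2 t * V 1 t) + 3 * (e n 1 t * V 2 t) + e n 0 t * V 3 t" for n t
  define W4 where "W4 n t = e n 4 t * V 0 t + 4 * (e n 3 t * V 1 t) + 6 * (e n 2 t * V 2 t) + 4 * (e n 1 t * V 3 t) + e n 0 t * V 4 t" for n t
  note Vd = C4_chainD[OF V]
  have D0: "((\<lambda>t. W0 n t) has_real_derivative W1 n t) (at t)" for n t
    unfolding W0_def W1_def by (rule DERIV_cong[OF DERIV_mult[OF de0 Vd(1)]]) simp
  have D1: "((\<lambda>t. W1 n t) has_real_derivative W2 n t) (at t)" for n t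
    unfolding W1_def W2_def
    by (rule DERIV_cong[OF DERIV_add[OF DERIV_mult[OF de1 Vd(1)] DERIV_mult[OF de0 Vd(2)]]]) simp
  have D2: "((\<lambda>t. W2 n t) has_real_derivative W3 n t) (at t)" for n t
    unfolding W2_def W3_def
    by (rule DERIV_cong[OF DERIV_add[OF DERIV_add[OF DERIV_mult[OF de2 Vd(1)] DERIV_cmult[OF DERIV_mult[OF de1 Vd(2)]]] DERIV_mult[OF de0 Vd(3)]]]) simp
  have D3: "((\<lambda>t. W3 n t) has_real_derivative W4 n t) (at t)" for n t
    unfolding W3_def W4_def
    by (rule DERIV_cong[OF DERIV_add[OF DERIV_add[OF DERIV_add[OF DERIV_mult[OF de3 Vd(1)] DERIV_cmult[OF DERIV_mult[OF de2 Vd(2)]]]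
        DERIV_cmult[OF DERIV_mult[OF de1 Vd(3)]]] DERIV_mult[OF de0 Vd(4)]]]) simp
  have ecs: "continuous_on UNIV (e n 0)" "continuous_on UNIV (e n 1)" "continuous_on UNIV (e n 2)" "continuous_on UNIV (e n 3)" for n
    by (rule DERIV_continuous_on, rule de0 de1 de2 de3)+
  have Vc: "continuous_on UNIV (V i)" if "i \<le> 4" for i by (rule C4_chain_continuous[OF V that])
  have K4: "continuous_on UNIV (W4 n)" for n
    unfolding W4_def[abs_def] by (intro continuous_intros ecs ec Vc) auto
  define W where "W n = (\<lambda>i. [W0 n, W1 n, W2 n, W3 n, W4 n] ! i)" for n
  have Wi: "W n 0 = W0 n" "W n 1 = W1 n" "W n 2 = W2 n" "W n 3 = W3 n" "W n 4 = W4 n" for n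
    unfolding W_def by (rule list_nth_4)+
  show ?thesis
  proof (rule that[of W "16 * C"])
    show "C4_chain (W n)" for n unfolding W_def by (rule C4_chain_list[OF D0 D1 D2 D3 K4])
    show "W n 0 t = 0" if "real (Suc n) \<le> \<bar>t\<bar>" for n t
    proof -
      have "1 \<le> \<bar>t / R n\<bar>" using that R[of n] by (simp add: R_def le_divide_eq)
      then show ?thesis using cz[of 0 "t / R n"] by (simp add: Wi W0_def e_def)
    qed
    show "(\<lambda>n. W n i t) \<longlonglongrightarrow> V i t" if "i \<le> 4" for i t
    proof -
      have l1: "(\<lambda>n. e n 1 t) \<longlonglongrightarrow> 0" by (rule eli) simp_all
      have l2: "(\<lambda>n. e n 2 t) \<longlonglongrightarrow> 0" by (rule eli) simp_all
      have l3: "(\<lambda>n. e n 3 t) \<longlonglongrightarrow> 0" by (rule eli) simp_all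
      have l4: "(\<lambda>n. e n 4 t) \<longlonglongrightarrow> 0" by (rule eli) simp_all
      note l = el0[of t] l1 l2 l3 l4
      have "(\<lambda>n. W0 n t) \<longlonglongrightarrow> 1 * V 0 t" unfolding W0_def by (intro tendsto_intros l)
      moreover have "(\<lambda>n. W1 n t) \<longlonglongrightarrow> 0 * V 0 t + 1 * V 1 t" unfolding W1_def by (intro tendsto_intros l)
      moreover have "(\<lambda>n. W2 n t) \<longlonglongrightarrow> 0 * V 0 t + 2 * (0 * V 1 t) + 1 * V 2 t" unfolding W2_def by (intro tendsto_intros l)
      moreover have "(\<lambda>n. W3 n t) \<longlonglongrightarrow> 0 * V 0 t + 3 * (0 * V 1 t) + 3 * (0 * V 2 t) + 1 * V 3 t" unfolding W3_def by (intro tendsto_intros l)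
      moreover have "(\<lambda>n. W4 n t) \<longlonglongrightarrow> 0 * V 0 t + 4 * (0 * V 1 t) + 6 * (0 * V 2 t) + 4 * (0 * V 3 t) + 1 * V 4 t" unfolding W4_def by (intro tendsto_intros l)
      ultimately show ?thesis using that unfolding le4_cases by (elim disjE) (simp_all only: Wi, simp_all)
    qed
    \<comment> \<open>The binomial coefficients of order four add up to \<open>16\<close>.\<close>
    show "\<bar>W n i t\<bar> \<le> 16 * C * chain_size V t" if "i \<le> 4" for n i t
    proof -
      define A where "A k = C * \<bar>V k t\<bar>" for k
      have p: "e n j t * V k t \<le> A k" "- (e n j t * V k t) \<le> A k" if "j \<le> 4" for j k
      proof -
        have "\<bar>e n j t * V k t\<bar> \<le> A k"
          unfolding abs_mult A_def by (rule mult_right_mono[OF eb[OF that]]) simp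
        then show "e n j t * V k t \<le> A k" "- (e n j t * V k t) \<le> A k" by (simp_all only: abs_le_iff)
      qed
      have nn: "0 \<le> A k" for k using C0 by (simp add: A_def)
      have s: "16 * C * chain_size V t = 16 * A 0 + 16 * A 1 + 16 * A 2 + 16 * A 3 + 16 * A 4"
        by (simp add: chain_size_def A_def algebra_simps)
      note N = nn[of 0] nn[of 1] nn[of 2] nn[of 3] nn[of 4]
      have h: "(0::nat) \<le> 4" "(1::nat) \<le> 4" "(2::nat) \<le> 4" "(3::nat) \<le> 4" "(4::nat) \<le> 4" by simp_all
      have "\<bar>W0 n t\<bar> \<le> 16 * C * chain_size V t"
        unfolding W0_def s abs_le_iff using p[OF h(1), of 0] N by linarith
      moreover have "\<bar>W1 n t\<bar> \<le> 16 * C * chain_size V t"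
        unfolding W1_def s abs_le_iff using p[OF h(2), of 0] p[OF h(1), of 1] N by linarith
      moreover have "\<bar>W2 n t\<bar> \<le> 16 * C * chain_size V t"
        unfolding W2_def s abs_le_iff using p[OF h(3), of 0] p[OF h(2), of 1] p[OF h(1), of 2] N by linarith
      moreover have "\<bar>W3 n t\<bar> \<le> 16 * C * chain_size V t"
        unfolding W3_def s abs_le_iff using p[OF h(4), of 0] p[OF h(3), of 1] p[OF h(2), of 2] p[OF h(1), of 3] N by linarith
      moreover have "\<bar>W4 n t\<bar> \<le> 16 * C * chain_size V t"
        unfolding W4_def s abs_le_iff using p[OF h(5), of 0] p[OF h(4), of 1] p[OF h(3), of 2] p[OF h(2), of 3] p[OF h(1), of 4] N by linarith
      ultimately show ?thesis using that unfolding le4_cases by (elim disjE) (simp_all only: Wi)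
    qed
    show "0 \<le> 16 * C" using C0 by simp
  qed
qed

lemma rad_mult: "rad m f x * rad m' g x = rad (m + m') (\<lambda>t. f t * g t) x"
proof -
  have "norm x powr (- (m + m')) = norm x powr (- m) * norm x powr (- m')" by (simp flip: powr_add)
  then show ?thesis by (simp add: rad_def)
qed

lemma rad_power2: "(rad m f x)\<^sup>2 = rad (2 * m) (\<lambda>t. (f t)\<^sup>2) x"
  using rad_mult[of m f x m f] by (simp add: power2_eq_square)

lemma norm_powr_rad: "norm x powr (- m) * rad m' f x = rad (m + m') f x"
proof -
  have "norm x powr (- (m + m')) = norm x powr (- m) * norm x powr (- m')" by (simp flip: powr_add)
  then show ?thesis by (simp add: rad_def)
qed

lemma rad_diff: "rad m f x - rad m g x = rad m (\<lambda>t. f t - g t) x"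
  by (simp add: rad_def right_diff_distrib)

lemma rad_abs_powr: "\<bar>rad m f x\<bar> powr q = rad (m * q) (\<lambda>t. \<bar>f t\<bar> powr q) x"
  by (simp add: rad_def abs_mult powr_mult powr_powr)

text \<open>The operators on profiles which correspond to \<open>\<Delta>\<close> and \<open>\<Delta>\<^sup>2\<close> on \<open>\<bar>x\<bar> powr (- a) * W 0 t\<close>, for
  \<open>a = (DIM('a) - 4) / 2\<close> and \<open>gam = a * (a + 2)\<close>. For this value of \<open>a\<close> the odd derivatives cancel in the
  second one.\<close>

definition radial_laplace :: "real \<Rightarrow> (nat \<Rightarrow> real \<Rightarrow> real) \<Rightarrow> real \<Rightarrow> real" where
  "radial_laplace gam W t = W 2 t - 2 * W 1 t - gam * W 0 t"

definition radial_bilaplace :: "real \<Rightarrow> (nat \<Rightarrow> real \<Rightarrow> real) \<Rightarrow> real \<Rightarrow> real" where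
  "radial_bilaplace gam W t = W 4 t - (2 * gam + 4) * W 2 t + gam\<^sup>2 * W 0 t"

text \<open>For a profile with compact support the function is of class \<open>C\<^sup>4\<close> and vanishes near the origin and near infinity.
  So its Laplacian is regular enough to be a test function for every element of \<open>D22\<close>.\<close>

theorem compact_profile_pairing:
  fixes u w :: "'a::euclidean_space \<Rightarrow> real"
  assumes N: "5 \<le> DIM('a)" and a: "a = (real DIM('a) - 4) / 2" and gam: "gam = a * (a + 2)"
    and W: "C4_chain W" and z: "\<And>t. T \<le> \<bar>t\<bar> \<Longrightarrow> W 0 t = 0"
  shows "D22_rel (rad a (W 0) :: 'a \<Rightarrow> real) (rad (a + 2) (radial_laplace gam W))"
    and "D22_rel u w \<Longrightarrow> integrable lebesgue (\<lambda>x. w x * rad (a + 2) (radial_laplace gam W) x)"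
    and "D22_rel u w \<Longrightarrow> integrable lebesgue (\<lambda>x. u x * rad (a + 4) (radial_bilaplace gam W) x)"
    and "D22_rel u w \<Longrightarrow> (\<integral>x. w x * rad (a + 2) (radial_laplace gam W) x \<partial>lebesgue) =
        (\<integral>x. u x * rad (a + 4) (radial_bilaplace gam W) x \<partial>lebesgue)"
proof -
  note d = C4_chainD[OF W]
  have Na: "real DIM('a) = 2 * a + 4" using a by simp
  have c: "continuous_on UNIV (W i)" if "i \<le> 4" for i by (rule C4_chain_continuous[OF W that])
  have z0: "W 0 t = 0" if "T < \<bar>t\<bar>" for t using z[of t] that by simp
  have nxt: "f' t = 0" if "\<And>t. T < \<bar>t\<bar> \<Longrightarrow> f t = 0" "(f has_real_derivative f' t) (at t)" "T < \<bar>t\<bar>" for f f' :: "real \<Rightarrow> real" and t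
  proof -
    have "((\<lambda>_. 0) has_real_derivative 0) (at t)" by simp
    then have "(f has_real_derivative 0) (at t)"
    proof (rule has_field_derivative_transform_within_open)
      show "open {t. T < \<bar>t :: real\<bar>}" by (intro open_Collect_less continuous_intros)
    qed (use that in auto)
    then show ?thesis by (rule DERIV_unique[OF that(2)])
  qed
  have z1: "W 1 t = 0" if "T < \<bar>t\<bar>" for t by (rule nxt[of "W 0" "W 1" t, OF z0 d(1) that])
  have z2: "W 2 t = 0" if "T < \<bar>t\<bar>" for t by (rule nxt[of "W 1" "W 2" t, OF z1 d(2) that])
  have l1: "radial_laplace gam W t = W 2 t + (2 * a + 2 - real DIM('a)) * W 1 t + a * (a + 2 - real DIM('a)) * W 0 t" for t
    unfolding radial_laplace_def gam Na by (simp add: algebra_simps)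
  show "D22_rel (rad a (W 0) :: 'a \<Rightarrow> real) (rad (a + 2) (radial_laplace gam W))"
    by (rule rad_C2(2)[OF N d(1) d(2) c z l1]) auto
  define k1 where "k1 t = W 3 t - 2 * W 2 t - gam * W 1 t" for t
  define k2 where "k2 t = W 4 t - 2 * W 3 t - gam * W 2 t" for t
  have dk: "(radial_laplace gam W has_real_derivative k1 t) (at t)" "(k1 has_real_derivative k2 t) (at t)" for t
    unfolding radial_laplace_def[abs_def] k1_def[abs_def] k2_def by (intro DERIV_diff DERIV_cmult d)+
  have ck: "continuous_on UNIV k2" unfolding k2_def[abs_def] by (intro continuous_intros c) auto
  have zk: "radial_laplace gam W t = 0" if "T + 1 \<le> \<bar>t\<bar>" for t
    using z0[of t] z1[of t] z2[of t] that by (simp add: radial_laplace_def)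
  have l2: "radial_bilaplace gam W t = k2 t + (2 * (a + 2) + 2 - real DIM('a)) * k1 t + (a + 2) * (a + 2 + 2 - real DIM('a)) * radial_laplace gam W t" for t
    unfolding radial_bilaplace_def radial_laplace_def k1_def k2_def gam Na by (simp add: algebra_simps power2_eq_square)
  have "\<exists>f1 f2. C2_data (rad (a + 2) (radial_laplace gam W) :: 'a \<Rightarrow> real) f1 f2 \<and>
      (\<forall>x. (\<Sum>b\<in>Basis. f2 b x) = rad (a + 2 + 2) (radial_bilaplace gam W) x)"
    by (rule rad_C2(1)[where T = "T + 1", OF N dk ck _ l2]) (rule zk)
  then obtain f1 f2 where f: "C2_data (rad (a + 2) (radial_laplace gam W) :: 'a \<Rightarrow> real) f1 f2"
     and "\<forall>x. (\<Sum>b\<in>Basis. f2 b x) = rad (a + 2 + 2) (radial_bilaplace gam W) x"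
    by (elim exE conjE)
  then have f2: "(\<Sum>b\<in>Basis. f2 b x) = rad (a + 4) (radial_bilaplace gam W) x" for x by (simp add: add.assoc)
  have zr: "rad (a + 2) (radial_laplace gam W) x = 0" if "exp (T + 1) < norm x" for x :: 'a
    by (rule rad_C2(3)[where T = "T + 1", OF N dk ck zk l2 that])
  note P = D22_rel_pairing[where R = "exp (T + 1)", OF N _ f zr, unfolded f2]
  show "D22_rel u w \<Longrightarrow> integrable lebesgue (\<lambda>x. w x * rad (a + 2) (radial_laplace gam W) x)"
    by (rule P(1))
  show "D22_rel u w \<Longrightarrow> integrable lebesgue (\<lambda>x. u x * rad (a + 4) (radial_bilaplace gam W) x)"
    by (rule P(2))
  show "D22_rel u w \<Longrightarrow> (\<integral>x. w x * rad (a + 2) (radial_laplace gam W) x \<partial>lebesgue) =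
        (\<integral>x. u x * rad (a + 4) (radial_bilaplace gam W) x \<partial>lebesgue)"
    by (rule P(3))
qed

section \<open>The lower bound for the energy\<close>

text \<open>The Laplacian is a separate argument, as \<open>D22_lap\<close> is only determined almost everywhere.\<close>

definition energy :: "real \<Rightarrow> ('a::euclidean_space \<Rightarrow> real) \<Rightarrow> ('a \<Rightarrow> real) \<Rightarrow> real" where
  "energy lam u w = (\<integral>x. (w x)\<^sup>2 \<partial>lebesgue) - lam * (\<integral>x. norm x powr (- 4) * \<bar>u x\<bar>\<^sup>2 \<partial>lebesgue)"

lemma hardy_weight_rad: "norm x powr (- 4) * \<bar>rad a v x\<bar>\<^sup>2 = rad (2 * a + 4) (\<lambda>t. (v t)\<^sup>2) x"
  by (simp add: rad_power2 norm_powr_rad add.commute)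

lemma profile_hardy:
  fixes u w :: "'a::euclidean_space \<Rightarrow> real"
  assumes N: "5 \<le> DIM('a)" and a: "a = (real DIM('a) - 4) / 2"
    and u: "D22_rel u w" and v [measurable]: "v \<in> borel_measurable borel" and uv: "AE x in lebesgue. u x = rad a v x"
  shows "integrable lborel (\<lambda>t. (v t)\<^sup>2)"
    "(\<integral>x. norm x powr (- 4) * \<bar>u x\<bar>\<^sup>2 \<partial>lebesgue) = sphere_area TYPE('a) * (\<integral>t. (v t)\<^sup>2 \<partial>lborel)"
proof -
  have Na: "real DIM('a) = 2 * a + 4" using a by simp
  have [measurable]: "u \<in> borel_measurable lebesgue" by (rule D22_rel_measurable(1)[OF u])
  have [measurable]: "(\<lambda>x::'a. norm x powr (- 4)) \<in> borel_measurable lebesgue"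
    by (rule borel_imp_lebesgue) measurable
  have m: "(rad (real DIM('a)) (\<lambda>t. (v t)\<^sup>2) :: 'a \<Rightarrow> real) \<in> borel_measurable lebesgue"
    by (rule borel_imp_lebesgue) measurable
  have ae: "AE x in lebesgue. norm x powr (- 4) * \<bar>u x\<bar>\<^sup>2 = rad (real DIM('a)) (\<lambda>t. (v t)\<^sup>2) x"
    using uv by eventually_elim (simp only: hardy_weight_rad Na)
  have "integrable lebesgue (rad (real DIM('a)) (\<lambda>t. (v t)\<^sup>2) :: 'a \<Rightarrow> real)"
    by (rule integrable_cong_AE_imp[OF D22_Rellich(1)[OF N u a refl] m]) (use ae in \<open>auto elim: eventually_mono\<close>)
  then show "integrable lborel (\<lambda>t. (v t)\<^sup>2)" by (subst (asm) rad_integral(1)) auto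
  have "(\<integral>x. norm x powr (- 4) * \<bar>u x\<bar>\<^sup>2 \<partial>lebesgue) = (\<integral>x. rad (real DIM('a)) (\<lambda>t. (v t)\<^sup>2) x \<partial>(lebesgue :: 'a measure))"
    by (rule integral_cong_AE) (use m ae in auto)
  also have "\<dots> = sphere_area TYPE('a) * (\<integral>t. (v t)\<^sup>2 \<partial>lborel)" by (rule rad_integral(2)) auto
  finally show "(\<integral>x. norm x powr (- 4) * \<bar>u x\<bar>\<^sup>2 \<partial>lebesgue) = sphere_area TYPE('a) * (\<integral>t. (v t)\<^sup>2 \<partial>lborel)" .
qed

lemma compact_profile_integrals:
  fixes u w :: "'a::euclidean_space \<Rightarrow> real"
  assumes N: "5 \<le> DIM('a)" and a: "a = (real DIM('a) - 4) / 2" and gam: "gam = a * (a + 2)"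
    and W: "C4_chain W" and z: "\<And>t. T \<le> \<bar>t\<bar> \<Longrightarrow> W 0 t = 0"
    and u: "D22_rel u w" and v [measurable]: "v \<in> borel_measurable borel" and uv: "AE x in lebesgue. u x = rad a v x"
  shows "integrable lborel (\<lambda>t. v t * radial_bilaplace gam W t)"
    "(\<integral>x. w x * rad (a + 2) (radial_laplace gam W) x \<partial>lebesgue) = sphere_area TYPE('a) * (\<integral>t. v t * radial_bilaplace gam W t \<partial>lborel)"
proof -
  have Na: "real DIM('a) = 2 * a + 4" using a by simp
  have Wm: "W i \<in> borel_measurable borel" if "i \<le> 4" for i
    by (rule borel_measurable_continuous_onI[OF C4_chain_continuous[OF W that]])
  have [measurable]: "W 0 \<in> borel_measurable borel" "W 2 \<in> borel_measurable borel" "W 4 \<in> borel_measurable borel"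
    by (rule Wm; simp)+
  have [measurable]: "radial_bilaplace gam W \<in> borel_measurable borel"
    unfolding radial_bilaplace_def[abs_def] by measurable
  have P3: "integrable lebesgue (\<lambda>x. u x * rad (a + 4) (radial_bilaplace gam W) x)"
    by (rule compact_profile_pairing(3)[OF N a gam W _ u]) (rule z)
  have P4: "(\<integral>x. w x * rad (a + 2) (radial_laplace gam W) x \<partial>lebesgue) = (\<integral>x. u x * rad (a + 4) (radial_bilaplace gam W) x \<partial>lebesgue)"
    by (rule compact_profile_pairing(4)[OF N a gam W _ u]) (rule z)
  have e: "a + (a + 4) = real DIM('a)" using Na by simp
  have ae: "AE x in lebesgue. u x * rad (a + 4) (radial_bilaplace gam W) x = rad (real DIM('a)) (\<lambda>t. v t * radial_bilaplace gam W t) x"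
    using uv by eventually_elim (simp only: rad_mult e)
  have m: "(rad (real DIM('a)) (\<lambda>t. v t * radial_bilaplace gam W t) :: 'a \<Rightarrow> real) \<in> borel_measurable lebesgue"
    by (rule borel_imp_lebesgue) measurable
  have "integrable lebesgue (rad (real DIM('a)) (\<lambda>t. v t * radial_bilaplace gam W t) :: 'a \<Rightarrow> real)"
    by (rule integrable_cong_AE_imp[OF P3 m]) (use ae in \<open>auto elim: eventually_mono\<close>)
  then show "integrable lborel (\<lambda>t. v t * radial_bilaplace gam W t)" by (subst (asm) rad_integral(1)) auto
  have "(\<integral>x. u x * rad (a + 4) (radial_bilaplace gam W) x \<partial>lebesgue) = (\<integral>x. rad (real DIM('a)) (\<lambda>t. v t * radial_bilaplace gam W t) x \<partial>(lebesgue :: 'a measure))"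
    by (rule integral_cong_AE) (use m ae borel_measurable_integrable[OF P3] in auto)
  also have "\<dots> = sphere_area TYPE('a) * (\<integral>t. v t * radial_bilaplace gam W t \<partial>lborel)" by (rule rad_integral(2)) auto
  finally show "(\<integral>x. w x * rad (a + 2) (radial_laplace gam W) x \<partial>lebesgue) = sphere_area TYPE('a) * (\<integral>t. v t * radial_bilaplace gam W t \<partial>lborel)"
    unfolding P4 .
qed

text \<open>With \<open>\<psi> = rad a (W 0)\<close>, the Rellich inequality for \<open>u - \<psi>\<close> and \<open>lam < gam\<^sup>2\<close> show that the energy
  of \<open>u - \<psi>\<close> is nonnegative. Expanding it, the mixed term and the energy of \<open>\<psi>\<close> are integrated by parts.\<close>

lemma energy_lower_bound_compact:
  fixes u w :: "'a::euclidean_space \<Rightarrow> real"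
  assumes N: "5 \<le> DIM('a)" and a: "a = (real DIM('a) - 4) / 2" and gam: "gam = a * (a + 2)" and lam: "lam < gam\<^sup>2"
    and W: "C4_chain W" and z: "\<And>t. T \<le> \<bar>t\<bar> \<Longrightarrow> W 0 t = 0"
    and u: "D22_rel u w" and v [measurable]: "v \<in> borel_measurable borel" and uv: "AE x in lebesgue. u x = rad a v x"
  defines "q \<equiv> \<lambda>t. radial_bilaplace gam W t - lam * W 0 t"
  shows "sphere_area TYPE('a) * (2 * (\<integral>t. v t * q t \<partial>lborel) - (\<integral>t. W 0 t * q t \<partial>lborel)) \<le> energy lam u w"
proof -
  let ?A = "sphere_area TYPE('a)"
  define \<psi> where "\<psi> = (rad a (W 0) :: 'a \<Rightarrow> real)"
  define l where "l = (rad (a + 2) (radial_laplace gam W) :: 'a \<Rightarrow> real)"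
  define B where "B = radial_bilaplace gam W"
  have Wm [measurable]: "W 0 \<in> borel_measurable borel"
    by (rule borel_measurable_continuous_onI[OF C4_chain_continuous[OF W]]) simp
  have \<psi>: "D22_rel \<psi> l" unfolding \<psi>_def l_def by (rule compact_profile_pairing(1)[OF N a gam W]) (rule z)
  have \<psi>W: "AE x in lebesgue. \<psi> x = rad a (W 0) x" by (simp add: \<psi>_def)
  have D: "D22_rel (\<lambda>x. u x - \<psi> x) (\<lambda>x. w x - l x)" by (rule D22_rel_diff[OF N u \<psi>])
  have dv: "AE x in lebesgue. u x - \<psi> x = rad a (\<lambda>t. v t - W 0 t) x"
    using uv by eventually_elim (simp add: \<psi>_def rad_diff)
  have dm: "(\<lambda>t. v t - W 0 t) \<in> borel_measurable borel" by measurable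
  note hv = profile_hardy[OF N a u v uv]
  note hW = profile_hardy[OF N a \<psi> Wm \<psi>W]
  note hd = profile_hardy[OF N a D dm dv]
  have I1: "integrable lborel (\<lambda>t. v t * B t)" "(\<integral>x. w x * l x \<partial>lebesgue) = ?A * (\<integral>t. v t * B t \<partial>lborel)"
    using compact_profile_integrals[where T = T, OF N a gam W _ u v uv] z unfolding l_def[symmetric] B_def[symmetric] by blast+
  have I2: "integrable lborel (\<lambda>t. W 0 t * B t)" "(\<integral>x. l x * l x \<partial>lebesgue) = ?A * (\<integral>t. W 0 t * B t \<partial>lborel)"
    using compact_profile_integrals[where T = T, OF N a gam W _ \<psi> Wm \<psi>W] z unfolding l_def[symmetric] B_def[symmetric] by blast+
  have ivW: "integrable lborel (\<lambda>t. v t * W 0 t)"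
    by (rule L2_product_integrable) (use hv hW in auto)
  have X: "(\<integral>t. (v t - W 0 t)\<^sup>2 \<partial>lborel) = (\<integral>t. (v t)\<^sup>2 \<partial>lborel) - 2 * (\<integral>t. v t * W 0 t \<partial>lborel) + (\<integral>t. (W 0 t)\<^sup>2 \<partial>lborel)"
  proof -
    have "(\<integral>t. (v t - W 0 t)\<^sup>2 \<partial>lborel) = (\<integral>t. (v t)\<^sup>2 - 2 * (v t * W 0 t) + (W 0 t)\<^sup>2 \<partial>lborel)"
      by (simp add: power2_diff algebra_simps)
    then show ?thesis using hv(1) hW(1) ivW by simp
  qed
  have iwl: "integrable lebesgue (\<lambda>x. w x * l x)" unfolding l_def by (rule compact_profile_pairing(2)[OF N a gam W _ u]) (rule z)
  have Y: "(\<integral>x. (w x - l x)\<^sup>2 \<partial>lebesgue) = (\<integral>x. (w x)\<^sup>2 \<partial>lebesgue) - 2 * (\<integral>x. w x * l x \<partial>lebesgue) + (\<integral>x. l x * l x \<partial>lebesgue)"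
  proof -
    have "(\<integral>x. (w x - l x)\<^sup>2 \<partial>lebesgue) = (\<integral>x. (w x)\<^sup>2 - 2 * (w x * l x) + (l x)\<^sup>2 \<partial>lebesgue)"
      by (intro Bochner_Integration.integral_cong) (auto simp: power2_eq_square algebra_simps)
    then show ?thesis using D22_rel_square_integrable[OF u] D22_rel_square_integrable[OF \<psi>] iwl
      by (simp add: power2_eq_square)
  qed
  have q1: "(\<integral>t. v t * q t \<partial>lborel) = (\<integral>t. v t * B t \<partial>lborel) - lam * (\<integral>t. v t * W 0 t \<partial>lborel)"
  proof -
    have "(\<integral>t. v t * q t \<partial>lborel) = (\<integral>t. v t * B t - lam * (v t * W 0 t) \<partial>lborel)"
      by (simp add: q_def B_def algebra_simps)
    then show ?thesis using I1(1) ivW by simp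
  qed
  have q2: "(\<integral>t. W 0 t * q t \<partial>lborel) = (\<integral>t. W 0 t * B t \<partial>lborel) - lam * (\<integral>t. (W 0 t)\<^sup>2 \<partial>lborel)"
  proof -
    have "(\<integral>t. W 0 t * q t \<partial>lborel) = (\<integral>t. W 0 t * B t - lam * (W 0 t)\<^sup>2 \<partial>lborel)"
      by (simp add: q_def B_def algebra_simps power2_eq_square)
    then show ?thesis using I2(1) hW(1) by simp
  qed
  define X where "X = (\<integral>t. (v t - W 0 t)\<^sup>2 \<partial>lborel)"
  have R: "gam\<^sup>2 * (?A * X) \<le> (\<integral>x. (w x - l x)\<^sup>2 \<partial>lebesgue)"
    using D22_Rellich(2)[OF N D a gam] unfolding hd(2) X_def .
  have X0: "0 \<le> X" unfolding X_def by (rule Bochner_Integration.integral_nonneg) simp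
  have A0: "0 < ?A" by (rule sphere_area_pos)
  have "lam * (?A * X) \<le> gam\<^sup>2 * (?A * X)" using lam X0 A0 by (intro mult_right_mono) auto
  then have "lam * (?A * X) \<le> (\<integral>x. (w x)\<^sup>2 \<partial>lebesgue) - 2 * (?A * (\<integral>t. v t * B t \<partial>lborel)) + ?A * (\<integral>t. W 0 t * B t \<partial>lborel)"
    using R unfolding Y I1(2) I2(2) by linarith
  then show ?thesis
    unfolding energy_def hv(2) q1 q2 X_def X by (simp add: algebra_simps)
qed

lemma chain_size_L2_bounded:
  assumes "\<And>i. i \<le> 4 \<Longrightarrow> L2_bounded (V i)"
  shows "L2_bounded (chain_size V)"
proof -
  have ab: "L2_bounded (\<lambda>t. \<bar>f t\<bar>)" if "L2_bounded f" for f
    using that unfolding L2_bounded_def by (simp add: bounded_borel_abs)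
  show ?thesis unfolding chain_size_def[abs_def]
    by (rule L2_bounded_add)+ (rule ab, rule assms, simp)+
qed

lemma chain_size_bounds: "\<bar>V 0 t\<bar> \<le> chain_size V t" "\<bar>V 1 t\<bar> \<le> chain_size V t" "\<bar>V 2 t\<bar> \<le> chain_size V t"
   "\<bar>V 3 t\<bar> \<le> chain_size V t" "\<bar>V 4 t\<bar> \<le> chain_size V t" "0 \<le> chain_size V t"
  by (simp_all add: chain_size_def)

text \<open>Dominated convergence for the truncations of a chain uses these bounds with \<open>S\<close> a multiple of \<open>chain_size\<close>.\<close>

lemma truncated_bilaplace_bound:
  assumes b: "\<And>i. i \<le> 4 \<Longrightarrow> \<bar>W i t\<bar> \<le> S"
  shows "\<bar>radial_bilaplace gam W t - lam * W 0 t\<bar> \<le> (1 + \<bar>2 * gam + 4\<bar> + gam\<^sup>2 + \<bar>lam\<bar>) * S"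
    "\<bar>radial_laplace gam W t\<bar> \<le> (3 + \<bar>gam\<bar>) * S"
proof -
  have p: "\<bar>c * W i t\<bar> \<le> \<bar>c\<bar> * S" if "i \<le> 4" for c i
    unfolding abs_mult using b[OF that] by (rule mult_left_mono) simp
  have h: "(0::nat) \<le> 4" "(1::nat) \<le> 4" "(2::nat) \<le> 4" "(3::nat) \<le> 4" "(4::nat) \<le> 4" by simp_all
  have g: "\<bar>gam\<^sup>2 * W 0 t\<bar> \<le> gam\<^sup>2 * S" using p[OF h(1), of "gam\<^sup>2"] by simp
  have "\<bar>radial_bilaplace gam W t - lam * W 0 t\<bar> \<le> \<bar>W 4 t\<bar> + \<bar>(2 * gam + 4) * W 2 t\<bar> + \<bar>gam\<^sup>2 * W 0 t\<bar> + \<bar>lam * W 0 t\<bar>"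
    unfolding radial_bilaplace_def by linarith
  also have "\<dots> \<le> S + \<bar>2 * gam + 4\<bar> * S + gam\<^sup>2 * S + \<bar>lam\<bar> * S"
    by (intro add_mono b[OF h(5)] p[OF h(3)] g p[OF h(1)])
  finally show "\<bar>radial_bilaplace gam W t - lam * W 0 t\<bar> \<le> (1 + \<bar>2 * gam + 4\<bar> + gam\<^sup>2 + \<bar>lam\<bar>) * S"
    by (simp add: algebra_simps)
  have "\<bar>radial_laplace gam W t\<bar> \<le> \<bar>W 2 t\<bar> + \<bar>2 * W 1 t\<bar> + \<bar>gam * W 0 t\<bar>"
    unfolding radial_laplace_def by linarith
  also have "\<dots> \<le> S + \<bar>2\<bar> * S + \<bar>gam\<bar> * S"
    by (intro add_mono b[OF h(3)] p[OF h(2)] p[OF h(1)])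
  finally show "\<bar>radial_laplace gam W t\<bar> \<le> (3 + \<bar>gam\<bar>) * S" by (simp add: algebra_simps)
qed

lemma bilaplace_tendsto:
  assumes "\<And>i. i \<le> 4 \<Longrightarrow> (\<lambda>n. W n i t) \<longlonglongrightarrow> V i t"
  shows "(\<lambda>n. radial_bilaplace gam (W n) t - lam * W n 0 t) \<longlonglongrightarrow> radial_bilaplace gam V t - lam * V 0 t"
    "(\<lambda>n. radial_laplace gam (W n) t) \<longlonglongrightarrow> radial_laplace gam V t"
  unfolding radial_bilaplace_def radial_laplace_def by (intro tendsto_intros assms; simp)+

lemma chain_measurable:
  assumes W: "C4_chain W"
  shows "W 0 \<in> borel_measurable borel" "radial_bilaplace gam W \<in> borel_measurable borel" "radial_laplace gam W \<in> borel_measurable borel"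
proof -
  have Wm: "W i \<in> borel_measurable borel" if "i \<le> 4" for i
    by (rule borel_measurable_continuous_onI[OF C4_chain_continuous[OF W that]])
  have [measurable]: "W 0 \<in> borel_measurable borel" "W 1 \<in> borel_measurable borel" "W 2 \<in> borel_measurable borel" "W 4 \<in> borel_measurable borel"
    by (rule Wm; simp)+
  show "W 0 \<in> borel_measurable borel" by measurable
  show "radial_bilaplace gam W \<in> borel_measurable borel"
    unfolding radial_bilaplace_def[abs_def] by measurable
  show "radial_laplace gam W \<in> borel_measurable borel"
    unfolding radial_laplace_def[abs_def] by measurable
qed

context damped_kernel
begin

text \<open>The bound for compactly supported profiles, applied to truncations of the profile \<open>G h\<close>, for which the operator
  gives back \<open>h\<close> in the limit.\<close>

lemma energy_lower_bound_continuous: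
  fixes u w :: "'a::euclidean_space \<Rightarrow> real"
  assumes N: "5 \<le> DIM('a)" and a: "a = (real DIM('a) - 4) / 2" and gam: "gam = a * (a + 2)" and lam: "lam < gam\<^sup>2"
    and ps: "p\<^sup>2 - 2 * s = 2 * gam + 4" "s\<^sup>2 = gam\<^sup>2 - lam"
    and u: "D22_rel u w" and v [measurable]: "v \<in> borel_measurable borel" and uv: "AE x in lebesgue. u x = rad a v x"
    and h: "L2_bounded h" "continuous_on UNIV h"
  shows "sphere_area TYPE('a) * (2 * (\<integral>t. v t * h t \<partial>lborel) - J h) \<le> energy lam u w"
proof -
  let ?A = "sphere_area TYPE('a)"
  obtain V :: "nat \<Rightarrow> real \<Rightarrow> real" where V0: "V 0 = G h" and Vd: "\<forall>i<4. \<forall>t. (V i has_real_derivative V (Suc i) t) (at t)"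
    and VL: "\<forall>i\<le>4. L2_bounded (V i) \<and> continuous_on UNIV (V i)"
    and Vh: "\<forall>t. V 4 t - (p\<^sup>2 - 2 * s) * V 2 t + s\<^sup>2 * V 0 t = h t"
    using G_solves[OF h] by (elim exE conjE)
  have V: "C4_chain V" unfolding C4_chain_def using Vd VL by simp
  have hV: "radial_bilaplace gam V t - lam * V 0 t = h t" for t
    using Vh[THEN spec, of t] unfolding ps radial_bilaplace_def by (simp add: algebra_simps)
  obtain W :: "nat \<Rightarrow> nat \<Rightarrow> real \<Rightarrow> real" and K where W: "\<And>n. C4_chain (W n)"
    "\<And>n t. real (Suc n) \<le> \<bar>t\<bar> \<Longrightarrow> W n 0 t = 0" "\<And>i t. i \<le> 4 \<Longrightarrow> (\<lambda>n. W n i t) \<longlonglongrightarrow> V i t"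
    "\<And>n i t. i \<le> 4 \<Longrightarrow> \<bar>W n i t\<bar> \<le> K * chain_size V t" "0 \<le> K"
    by (rule truncation_exists[OF V]) blast
  define S where "S t = chain_size V t" for t
  have SL: "L2_bounded S" unfolding S_def[abs_def] by (rule chain_size_L2_bounded) (use VL in blast)
  have [measurable]: "S \<in> borel_measurable borel" by (rule L2_bounded_measurable[OF SL])
  have S0: "0 \<le> S t" for t by (simp add: S_def chain_size_bounds)
  define q where "q n t = radial_bilaplace gam (W n) t - lam * W n 0 t" for n t
  define C where "C = (1 + \<bar>2 * gam + 4\<bar> + gam\<^sup>2 + \<bar>lam\<bar>) * K"
  have C0: "0 \<le> C" using W(5) by (simp add: C_def)
  have qb: "\<bar>q n t\<bar> \<le> C * S t" for n t
    using truncated_bilaplace_bound(1)[of "W n" t "K * S t" gam lam] W(4) by (simp add: q_def C_def S_def mult.assoc)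
  have wb: "\<bar>W n 0 t\<bar> \<le> K * S t" for n t using W(4)[of 0] by (simp add: S_def)
  note [measurable] = chain_measurable(1)[OF W(1)] chain_measurable(2)[OF W(1)]
  have [measurable]: "q n \<in> borel_measurable borel" for n unfolding q_def[abs_def] by measurable
  have ql: "(\<lambda>n. q n t) \<longlonglongrightarrow> h t" for t unfolding q_def hV[symmetric] by (rule bilaplace_tendsto(1)) (rule W(3))
  have hm [measurable]: "h \<in> borel_measurable borel" by (rule L2_bounded_measurable[OF h(1)])
  have v2: "integrable lborel (\<lambda>t. (v t)\<^sup>2)" by (rule profile_hardy(1)[OF N a u v uv])
  have ivS: "integrable lborel (\<lambda>t. v t * S t)"
    by (rule L2_product_integrable) (use v2 SL in \<open>auto simp: L2_bounded_def\<close>)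
  have iSS: "integrable lborel (\<lambda>t. S t * S t)" using SL by (simp add: L2_bounded_def power2_eq_square)
  have l1: "(\<lambda>n. \<integral>t. v t * q n t \<partial>lborel) \<longlonglongrightarrow> (\<integral>t. v t * h t \<partial>lborel)"
  proof (rule integral_dominated_convergence)
    show "integrable lborel (\<lambda>t. C * \<bar>v t * S t\<bar>)" using ivS by simp
    show "AE t in lborel. (\<lambda>n. v t * q n t) \<longlonglongrightarrow> v t * h t" by (intro AE_I2 tendsto_intros ql)
    show "AE t in lborel. norm (v t * q n t) \<le> C * \<bar>v t * S t\<bar>" for n
    proof (rule AE_I2)
      fix t
      have "\<bar>v t\<bar> * \<bar>q n t\<bar> \<le> \<bar>v t\<bar> * (C * S t)" by (rule mult_left_mono[OF qb]) simp
      then show "norm (v t * q n t) \<le> C * \<bar>v t * S t\<bar>" using S0[of t] by (simp add: abs_mult mult_ac)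
    qed
  qed measurable
  have V0m: "V 0 \<in> borel_measurable borel" using VL by (auto intro: L2_bounded_measurable)
  have l2: "(\<lambda>n. \<integral>t. W n 0 t * q n t \<partial>lborel) \<longlonglongrightarrow> (\<integral>t. V 0 t * h t \<partial>lborel)"
  proof (rule integral_dominated_convergence)
    show "integrable lborel (\<lambda>t. (K * C) * (S t * S t))" using iSS by simp
    show "AE t in lborel. (\<lambda>n. W n 0 t * q n t) \<longlonglongrightarrow> V 0 t * h t" by (intro AE_I2 tendsto_intros ql W(3)) simp
    show "AE t in lborel. norm (W n 0 t * q n t) \<le> (K * C) * (S t * S t)" for n
    proof (rule AE_I2)
      fix t
      have "\<bar>W n 0 t\<bar> * \<bar>q n t\<bar> \<le> (K * S t) * (C * S t)"
        using W(5) S0[of t] by (intro mult_mono qb wb) auto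
      then show "norm (W n 0 t * q n t) \<le> (K * C) * (S t * S t)" by (simp add: abs_mult mult_ac)
    qed
  qed (use V0m in measurable)
  have "?A * (2 * (\<integral>t. v t * q n t \<partial>lborel) - (\<integral>t. W n 0 t * q n t \<partial>lborel)) \<le> energy lam u w" for n
    unfolding q_def by (rule energy_lower_bound_compact[OF N a gam lam W(1) _ u v uv]) (rule W(2))
  moreover have "(\<lambda>n. ?A * (2 * (\<integral>t. v t * q n t \<partial>lborel) - (\<integral>t. W n 0 t * q n t \<partial>lborel))) \<longlonglongrightarrow>
     ?A * (2 * (\<integral>t. v t * h t \<partial>lborel) - (\<integral>t. V 0 t * h t \<partial>lborel))"
    by (intro tendsto_intros l1 l2)
  ultimately have "?A * (2 * (\<integral>t. v t * h t \<partial>lborel) - (\<integral>t. V 0 t * h t \<partial>lborel)) \<le> energy lam u w"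
    by (intro LIMSEQ_le_const2) auto
  then show ?thesis by (simp add: J_eq[OF h(1)] V0 mult.commute[of "h _"])
qed

text \<open>Bounded measurable functions are limits almost everywhere of continuous ones; clipping at the height
  \<open>B\<close> and cutting off outside \<open>{-T - 1..T + 1}\<close> makes dominated convergence applicable. \<open>J\<close> is
  replaced by its bound in terms of the mass, which converges.\<close>

lemma energy_lower_bound_bounded:
  fixes u w :: "'a::euclidean_space \<Rightarrow> real"
  assumes N: "5 \<le> DIM('a)" and a: "a = (real DIM('a) - 4) / 2" and gam: "gam = a * (a + 2)" and lam: "lam < gam\<^sup>2"
    and ps: "p\<^sup>2 - 2 * s = 2 * gam + 4" "s\<^sup>2 = gam\<^sup>2 - lam"
    and u: "D22_rel u w" and v [measurable]: "v \<in> borel_measurable borel" and uv: "AE x in lebesgue. u x = rad a v x"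
    and r: "1 < r" "r \<le> 2" and M: "\<And>h. admissible r h \<Longrightarrow> J h \<le> M * power_mass r h powr (2 / r)"
    and h [measurable]: "h \<in> borel_measurable borel" and hB: "\<And>t. \<bar>h t\<bar> \<le> B" and hT: "\<And>t. T < \<bar>t\<bar> \<Longrightarrow> h t = 0" 
  shows "sphere_area TYPE('a) * (2 * (\<integral>t. v t * h t \<partial>lborel) - M * power_mass r h powr (2 / r)) \<le> energy lam u w"
proof -
  let ?A = "sphere_area TYPE('a)"
  have B0: "0 \<le> B" using hB[of 0] by (auto intro: order_trans[OF abs_ge_zero])
  have "h measurable_on UNIV"
    by (rule lebesgue_measurable_imp_measurable_on) (auto intro: borel_imp_lebesgue)
  then obtain Z g' where Z: "negligible Z" and g': "\<And>n. continuous_on UNIV (g' n)"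
    "\<And>t. t \<notin> Z \<Longrightarrow> (\<lambda>n. g' n t) \<longlonglongrightarrow> h t" unfolding measurable_on_def by auto
  define cut where "cut t = max 0 (min 1 (T + 1 - \<bar>t\<bar>))" for t
  define k where "k n t = max (- B) (min B (g' n t)) * cut t" for n t
  have cutc: "continuous_on UNIV cut" unfolding cut_def[abs_def] by (intro continuous_intros)
  have kc: "continuous_on UNIV (k n)" for n unfolding k_def[abs_def] by (intro continuous_intros g' cutc)
  have km [measurable]: "k n \<in> borel_measurable borel" for n by (rule borel_measurable_continuous_onI[OF kc])
  define I where "I = (indicator {- (T + 1)..T + 1} :: real \<Rightarrow> real)"
  have Ii: "integrable lborel I" unfolding I_def by (simp add: integrable_indicator_iff emeasure_lborel_Icc_eq)
  have kb: "\<bar>k n t\<bar> \<le> B * I t" for n t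
  proof (cases "\<bar>t\<bar> \<le> T + 1")
    case True
    have "\<bar>max (- B) (min B (g' n t))\<bar> * \<bar>cut t\<bar> \<le> B * 1"
      using B0 by (intro mult_mono) (auto simp: cut_def)
    then show ?thesis using True by (auto simp: k_def abs_mult I_def indicator_def)
  next
    case False
    then have "cut t = 0" by (simp add: cut_def)
    then show ?thesis using B0 by (simp add: k_def I_def)
  qed
  have kB: "\<bar>k n t\<bar> \<le> B" for n t
  proof -
    have "B * I t \<le> B * 1" using B0 by (intro mult_left_mono) (auto simp: I_def indicator_def)
    then show ?thesis using kb[of n t] by simp
  qed
  have klim: "AE t in lborel. (\<lambda>n. k n t) \<longlonglongrightarrow> h t"
  proof -
    have "Z \<in> null_sets lebesgue" using Z by (simp add: negligible_iff_null_sets)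
    then have "AE t in lebesgue. t \<notin> Z" by (rule AE_not_in)
    then have "AE t in lborel. t \<notin> Z" by (simp add: AE_completion_iff)
    then show ?thesis
    proof eventually_elim
      case (elim t)
      have "(\<lambda>n. k n t) \<longlonglongrightarrow> max (- B) (min B (h t)) * cut t"
        unfolding k_def by (intro tendsto_intros g' elim)
      moreover have "max (- B) (min B (h t)) = h t" using hB[of t] by (auto simp: abs_le_iff)
      moreover have "h t * cut t = h t" using hT[of t] by (cases "\<bar>t\<bar> \<le> T") (auto simp: cut_def)
      ultimately show ?case by simp
    qed
  qed
  have kp: "\<bar>k n t\<bar> powr r \<le> B powr r * I t" for n t
  proof (cases "I t = 0")
    case True
    then have "k n t = 0" using kb[of n t] by simp
    then show ?thesis using True by simp
  next
    case False
    then have "I t = 1" by (auto simp: I_def indicator_def)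
    then show ?thesis using kB[of n t] r by (auto intro: powr_mono2)
  qed
  have adm: "admissible r (k n)" for n
  proof -
    have "integrable lborel (\<lambda>t. \<bar>k n t\<bar> powr r)"
      by (rule Bochner_Integration.integrable_bound[OF integrable_mult_right[OF Ii, of "B powr r"]])
         (use kp[of n] in \<open>auto intro!: order_trans[OF _ abs_ge_self]\<close>)
    then show ?thesis using kB[of n] km[of n] unfolding admissible_def bounded_borel_def by blast
  qed
  have kL: "L2_bounded (k n)" for n by (rule admissible_L2_bounded[OF adm]) (use r in auto)
  have v2: "integrable lborel (\<lambda>t. (v t)\<^sup>2)" by (rule profile_hardy(1)[OF N a u v uv])
  have ivI: "integrable lborel (\<lambda>t. v t * I t)"
  proof (rule L2_product_integrable[OF _ _ v2])
    have "(\<lambda>t. (I t)\<^sup>2) = I" by (auto simp: I_def indicator_def)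
    then show "integrable lborel (\<lambda>t. (I t)\<^sup>2)" using Ii by simp
  qed (auto simp: I_def)
  have [measurable]: "I \<in> borel_measurable borel" by (simp add: I_def)
  have I0: "0 \<le> I t" for t by (simp add: I_def)
  have l1: "(\<lambda>n. \<integral>t. v t * k n t \<partial>lborel) \<longlonglongrightarrow> (\<integral>t. v t * h t \<partial>lborel)"
  proof (rule integral_dominated_convergence)
    show "integrable lborel (\<lambda>t. B * \<bar>v t * I t\<bar>)" using ivI by simp
    show "AE t in lborel. (\<lambda>n. v t * k n t) \<longlonglongrightarrow> v t * h t" using klim by eventually_elim (intro tendsto_intros)
    show "AE t in lborel. norm (v t * k n t) \<le> B * \<bar>v t * I t\<bar>" for n
    proof (rule AE_I2)
      fix t
      have "\<bar>v t\<bar> * \<bar>k n t\<bar> \<le> \<bar>v t\<bar> * (B * I t)" by (rule mult_left_mono[OF kb]) simp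
      then show "norm (v t * k n t) \<le> B * \<bar>v t * I t\<bar>" using I0[of t] by (simp add: abs_mult mult_ac)
    qed
  qed measurable
  have l2: "(\<lambda>n. power_mass r (k n)) \<longlonglongrightarrow> power_mass r h"
    unfolding power_mass_def
  proof (rule integral_dominated_convergence)
    show "integrable lborel (\<lambda>t. B powr r * I t)" using Ii by simp
    show "AE t in lborel. (\<lambda>n. \<bar>k n t\<bar> powr r) \<longlonglongrightarrow> \<bar>h t\<bar> powr r"
      using klim by eventually_elim (use r in \<open>auto intro!: tendsto_powr2 tendsto_rabs\<close>)
    show "AE t in lborel. norm (\<bar>k n t\<bar> powr r) \<le> B powr r * I t" for n using kp[of n] by simp
  qed measurable
  have "?A * (2 * (\<integral>t. v t * k n t \<partial>lborel) - M * power_mass r (k n) powr (2 / r)) \<le> energy lam u w" for n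
  proof -
    have "?A * (2 * (\<integral>t. v t * k n t \<partial>lborel) - M * power_mass r (k n) powr (2 / r)) \<le> ?A * (2 * (\<integral>t. v t * k n t \<partial>lborel) - J (k n))"
      using M[OF adm[of n]] sphere_area_pos[where 'a = 'a] by (intro mult_left_mono) auto
    also have "\<dots> \<le> energy lam u w"
      by (rule energy_lower_bound_continuous[OF N a gam lam ps u v uv kL kc])
    finally show ?thesis .
  qed
  moreover have "(\<lambda>n. ?A * (2 * (\<integral>t. v t * k n t \<partial>lborel) - M * power_mass r (k n) powr (2 / r))) \<longlonglongrightarrow>
     ?A * (2 * (\<integral>t. v t * h t \<partial>lborel) - M * power_mass r h powr (2 / r))"
    using r by (intro tendsto_intros tendsto_powr2 l1 l2) (auto simp: power_mass_nonneg)
  ultimately show ?thesis by (intro LIMSEQ_le_const2) auto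
qed

text \<open>The test function \<open>h\<close> is a multiple of \<open>\<bar>v\<bar> powr (q - 2) * v\<close>, restricted to the set \<open>A n\<close> where both \<open>t\<close> and
  \<open>v t\<close> are bounded by \<open>n\<close>. The bound obtained for the integral of \<open>\<bar>v\<bar> powr q\<close> over \<open>A n\<close> is independent of \<open>n\<close>, so
  monotone convergence gives both claims.\<close>

theorem energy_lower_bound:
  fixes u w :: "'a::euclidean_space \<Rightarrow> real"
  assumes N: "5 \<le> DIM('a)" and a: "a = (real DIM('a) - 4) / 2" and gam: "gam = a * (a + 2)" and lam: "lam < gam\<^sup>2"
    and ps: "p\<^sup>2 - 2 * s = 2 * gam + 4" "s\<^sup>2 = gam\<^sup>2 - lam"
    and u: "D22_rel u w" and v [measurable]: "v \<in> borel_measurable borel" and uv: "AE x in lebesgue. u x = rad a v x"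
    and q: "2 < q" and r: "r = q / (q - 1)" and M0: "0 < M"
    and M: "\<And>h. admissible r h \<Longrightarrow> J h \<le> M * power_mass r h powr (2 / r)"
  shows "integrable lborel (\<lambda>t. \<bar>v t\<bar> powr q)"
    "sphere_area TYPE('a) * ((\<integral>t. \<bar>v t\<bar> powr q \<partial>lborel) powr (2 / q) / M) \<le> energy lam u w"
proof -
  let ?A = "sphere_area TYPE('a)"
  have A0: "0 < ?A" by (rule sphere_area_pos)
  have r12: "1 < r" "r \<le> 2" "(q - 1) * r = q" "1 - 2 / r = 2 / q - 1" "2 - 2 / r = 2 / q"
    using q by (auto simp: r field_simps)
  define E where "E = energy lam u w"
  define A where "A n = {t. \<bar>t\<bar> \<le> real n \<and> \<bar>v t\<bar> \<le> real n}" for n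
  have Am [measurable]: "A n \<in> sets borel" for n unfolding A_def by measurable
  define P where "P n = (\<integral>t. indicator (A n) t * \<bar>v t\<bar> powr q \<partial>lborel)" for n
  have fin: "integrable lborel (\<lambda>t. indicator (A n) t * \<bar>v t\<bar> powr q)" for n
  proof (rule Bochner_Integration.integrable_bound[where f = "\<lambda>t. real n powr q * indicator {- real n..real n} t"])
    show "integrable lborel (\<lambda>t. real n powr q * indicat_real {- real n..real n} t)"
      by (simp add: integrable_indicator_iff emeasure_lborel_Icc_eq)
    show "AE t in lborel. norm (indicator (A n) t * \<bar>v t\<bar> powr q) \<le> norm (real n powr q * indicat_real {- real n..real n} t)"
      using q by (auto simp: A_def indicator_def abs_le_iff intro!: AE_I2 powr_mono2)
  qed measurable
  have P0: "0 \<le> P n" for n unfolding P_def by (rule Bochner_Integration.integral_nonneg) (simp add: indicator_def)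
  have E0: "0 \<le> E"
  proof -
    have "?A * (2 * (\<integral>t. v t * 0 \<partial>lborel) - M * power_mass r (\<lambda>_. 0) powr (2 / r)) \<le> energy lam u w"
      by (rule energy_lower_bound_bounded[OF N a gam lam ps u v uv r12(1,2) M, of "\<lambda>_. 0" 0 0]) auto
    then show ?thesis by (simp add: E_def power_mass_def)
  qed
  have key: "P n powr (2 / q) \<le> M * E / ?A" for n
  proof (cases "P n = 0")
    case True
    then show ?thesis using E0 A0 M0 by simp
  next
    case False
    with P0[of n] have Pp: "0 < P n" by simp
    \<comment> \<open>The value of \<open>c\<close> at which \<open>2 * c * P - M * c\<^sup>2 * P powr (2 / r)\<close> is largest.\<close>
    define c where "c = P n powr (1 - 2 / r) / M"
    have c0: "0 < c" using Pp M0 by (simp add: c_def)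
    define h where "h t = c * (indicator (A n) t * signed_power q (v t))" for t
    have [measurable]: "h \<in> borel_measurable borel" unfolding h_def[abs_def] by measurable
    have hB: "\<bar>h t\<bar> \<le> c * real n powr (q - 1)" for t
      using c0 q by (auto simp: h_def A_def indicator_def abs_mult signed_power_abs intro!: mult_left_mono powr_mono2)
    have hT: "h t = 0" if "real n < \<bar>t\<bar>" for t using that by (auto simp: h_def A_def indicator_def)
    have 1: "(\<integral>t. v t * h t \<partial>lborel) = c * P n"
    proof -
      have "v t * h t = c * (indicator (A n) t * \<bar>v t\<bar> powr q)" for t
        using signed_power_mult[OF q, of "v t"] by (simp add: h_def mult_ac)
      then show ?thesis by (simp add: P_def)
    qed
    have 2: "power_mass r h = c powr r * P n"
    proof -
      have "\<bar>h t\<bar> powr r = c powr r * (indicator (A n) t * \<bar>v t\<bar> powr q)" for t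
        using c0 r12(3) q by (auto simp: h_def indicator_def abs_mult powr_mult signed_power_abs powr_powr)
      then show ?thesis by (simp add: P_def power_mass_def)
    qed
    have "?A * (2 * (c * P n) - M * (c powr r * P n) powr (2 / r)) \<le> E"
      unfolding E_def 1[symmetric] 2[symmetric]
      by (rule energy_lower_bound_bounded[OF N a gam lam ps u v uv r12(1,2) M _ hB hT]) auto
    also have "(c powr r * P n) powr (2 / r) = c\<^sup>2 * P n powr (2 / r)"
    proof -
      have "(c powr r) powr (2 / r) = c powr 2" unfolding powr_powr using r12(1) by simp
      then show ?thesis using c0 by (simp add: powr_mult)
    qed
    also have "2 * (c * P n) - M * (c\<^sup>2 * P n powr (2 / r)) = P n powr (2 / q) / M"
    proof -
      have e1: "c * P n = P n powr (2 / q) / M"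
      proof -
        have "P n powr (1 - 2 / r) * P n powr 1 = P n powr (2 / q)" unfolding powr_add[symmetric] using r12(5) by simp
        then show ?thesis using Pp by (simp add: c_def)
      qed
      have e2: "M * (c\<^sup>2 * P n powr (2 / r)) = c * P n"
      proof -
        have "P n powr (1 - 2 / r) * P n powr (2 / r) = P n powr 1" by (simp add: powr_add[symmetric])
        then have "M * c * P n powr (2 / r) = P n" using Pp M0 by (simp add: c_def)
        then show ?thesis by (simp add: power2_eq_square mult_ac)
      qed
      show ?thesis unfolding e2 using e1 by simp
    qed
    finally show ?thesis using A0 M0 by (simp add: field_simps)
  qed
  define Bd where "Bd = (M * E / ?A) powr (q / 2)"
  have PB: "P n \<le> Bd" for n
  proof -
    have "P n = (P n powr (2 / q)) powr (q / 2)" using P0[of n] q by (simp add: powr_powr)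
    also have "\<dots> \<le> Bd" unfolding Bd_def using key q by (intro powr_mono2) auto
    finally show ?thesis .
  qed
  have inc: "incseq (\<lambda>n t. ennreal (indicator (A n) t * \<bar>v t\<bar> powr q))"
    by (auto simp: incseq_def le_fun_def A_def indicator_def intro!: ennreal_leI)
  have sup: "(SUP n. ennreal (indicator (A n) t * \<bar>v t\<bar> powr q)) = ennreal (\<bar>v t\<bar> powr q)" for t
  proof (rule antisym)
    show "(SUP n. ennreal (indicator (A n) t * \<bar>v t\<bar> powr q)) \<le> ennreal (\<bar>v t\<bar> powr q)"
      by (intro SUP_least ennreal_leI) (simp add: indicator_def)
    obtain n where n: "max \<bar>t\<bar> \<bar>v t\<bar> \<le> real n" using real_arch_simple by blast
    then have "ennreal (\<bar>v t\<bar> powr q) = ennreal (indicator (A n) t * \<bar>v t\<bar> powr q)" by (simp add: A_def)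
    then show "ennreal (\<bar>v t\<bar> powr q) \<le> (SUP n. ennreal (indicator (A n) t * \<bar>v t\<bar> powr q))" by (simp only:) (rule SUP_upper, rule UNIV_I)
  qed
  have "(\<integral>\<^sup>+t. ennreal (\<bar>v t\<bar> powr q) \<partial>lborel) = (SUP n. \<integral>\<^sup>+t. ennreal (indicator (A n) t * \<bar>v t\<bar> powr q) \<partial>lborel)"
    unfolding sup[symmetric] by (rule nn_integral_monotone_convergence_SUP[OF inc]) simp
  also have "\<dots> \<le> ennreal Bd"
  proof (rule SUP_least)
    fix n
    have "(\<integral>\<^sup>+t. ennreal (indicator (A n) t * \<bar>v t\<bar> powr q) \<partial>lborel) = ennreal (P n)"
      unfolding P_def by (rule nn_integral_eq_integral[OF fin]) (auto simp: indicator_def)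
    then show "(\<integral>\<^sup>+t. ennreal (indicator (A n) t * \<bar>v t\<bar> powr q) \<partial>lborel) \<le> ennreal Bd"
      using PB[of n] by (simp add: ennreal_leI)
  qed
  finally have nn: "(\<integral>\<^sup>+t. ennreal (\<bar>v t\<bar> powr q) \<partial>lborel) \<le> ennreal Bd" .
  have Bd0: "0 \<le> Bd" by (simp add: Bd_def)
  note fin' = nn_integral_le_imp_integrable[OF _ _ nn Bd0]
  show "integrable lborel (\<lambda>t. \<bar>v t\<bar> powr q)" by (rule fin'(1)) auto
  have "(\<integral>t. \<bar>v t\<bar> powr q \<partial>lborel) \<le> Bd" by (rule fin'(2)) auto
  then have "(\<integral>t. \<bar>v t\<bar> powr q \<partial>lborel) powr (2 / q) \<le> Bd powr (2 / q)"
    using q by (intro powr_mono2) (auto intro!: Bochner_Integration.integral_nonneg)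
  also have "Bd powr (2 / q) = M * E / ?A" unfolding Bd_def powr_powr using q M0 E0 A0 by simp
  finally show "?A * ((\<integral>t. \<bar>v t\<bar> powr q \<partial>lborel) powr (2 / q) / M) \<le> energy lam u w"
    using A0 M0 by (simp add: E_def field_simps)
qed

end

section \<open>The minimiser\<close>

lemma rad_square_integrable:
  fixes f :: "real \<Rightarrow> real"
  assumes [measurable]: "f \<in> borel_measurable borel" and f: "integrable lborel (\<lambda>t. (f t)\<^sup>2)" and m: "2 * m = real DIM('a)"
  shows "integrable lebesgue (\<lambda>x :: 'a::euclidean_space. (rad m f x)\<^sup>2)"
    "(\<integral>x. (rad m f x)\<^sup>2 \<partial>(lebesgue :: 'a measure)) = sphere_area TYPE('a) * (\<integral>t. (f t)\<^sup>2 \<partial>lborel)"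
proof -
  have f2: "(\<lambda>t. (f t)\<^sup>2) \<in> borel_measurable borel" by measurable
  have e: "(\<lambda>x :: 'a. (rad m f x)\<^sup>2) = rad (real DIM('a)) (\<lambda>t. (f t)\<^sup>2)" by (rule ext) (simp only: rad_power2 m)
  show "integrable lebesgue (\<lambda>x :: 'a. (rad m f x)\<^sup>2)" unfolding e using rad_integral(1)[OF f2, where 'a = 'a] f by simp
  show "(\<integral>x. (rad m f x)\<^sup>2 \<partial>(lebesgue :: 'a measure)) = sphere_area TYPE('a) * (\<integral>t. (f t)\<^sup>2 \<partial>lborel)"
    unfolding e by (rule rad_integral(2)[OF f2])
qed

text \<open>The weight is divided evenly: \<open>\<bar>x\<bar> powr (- 2) * u\<close> is square integrable by the Rellich inequality, and
  \<open>rad (a + 2) f\<close> because \<open>2 * (a + 2) = DIM('a)\<close>.\<close>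

lemma D22_times_rad_integrable:
  fixes u w :: "'a::euclidean_space \<Rightarrow> real"
  assumes N: "5 \<le> DIM('a)" and a: "a = (real DIM('a) - 4) / 2" and u: "D22_rel u w"
    and f [measurable]: "f \<in> borel_measurable borel" and f2: "integrable lborel (\<lambda>t. (f t)\<^sup>2)"
  shows "integrable lebesgue (\<lambda>x. u x * rad (a + 4) f x)"
proof -
  have Na: "2 * (a + 2) = real DIM('a)" using a by simp
  have [measurable]: "u \<in> borel_measurable lebesgue" by (rule D22_rel_measurable(1)[OF u])
  have [measurable]: "(\<lambda>x::'a. norm x powr (- 2)) \<in> borel_measurable lebesgue"
    by (rule borel_imp_lebesgue) measurable
  have [measurable]: "(rad (a + 2) f :: 'a \<Rightarrow> real) \<in> borel_measurable lebesgue"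
    by (rule borel_imp_lebesgue) measurable
  have "(\<lambda>x. (norm x powr (- 2) * u x)\<^sup>2) = (\<lambda>x. norm x powr (- 4) * \<bar>u x\<bar>\<^sup>2)"
    by (rule ext) (simp add: power_mult_distrib power2_eq_square flip: powr_add)
  then have 1: "integrable lebesgue (\<lambda>x. (norm x powr (- 2) * u x)\<^sup>2)" using D22_Rellich(1)[OF N u a refl] by simp
  have "integrable lebesgue (\<lambda>x. (norm x powr (- 2) * u x) * rad (a + 2) f x)"
    by (rule L2_product_integrable[OF _ _ 1 rad_square_integrable(1)[OF f f2 Na]]) measurable
  moreover have "(norm x powr (- 2) * u x) * rad (a + 2) f x = u x * rad (a + 4) f x" for x
  proof -
    have "(norm x powr (- 2) * u x) * rad (a + 2) f x = u x * (norm x powr (- 2) * rad (a + 2) f x)" by (simp add: mult_ac)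
    also have "norm x powr (- 2) * rad (a + 2) f x = rad (a + 4) f x"
      unfolding norm_powr_rad by (simp add: add.commute)
    finally show ?thesis .
  qed
  ultimately show ?thesis by simp
qed

text \<open>The results for compactly supported profiles extend to profiles with square integrable derivatives.
  Their truncations converge in the two norms that define \<open>D22\<close>, as \<open>a * crit TYPE('a)\<close> and \<open>2 * (a + 2)\<close> both equal
  \<open>DIM('a)\<close>, and all integrands are dominated by \<open>chain_size\<close>.\<close>

theorem profile_pairing:
  fixes u w :: "'a::euclidean_space \<Rightarrow> real"
  assumes N: "5 \<le> DIM('a)" and a: "a = (real DIM('a) - 4) / 2" and gam: "gam = a * (a + 2)"
    and V: "C4_chain V" and VL: "\<And>i. i \<le> 4 \<Longrightarrow> L2_bounded (V i)"
  shows "D22_rel (rad a (V 0) :: 'a \<Rightarrow> real) (rad (a + 2) (radial_laplace gam V))"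
    and "D22_rel u w \<Longrightarrow> integrable lebesgue (\<lambda>x. w x * rad (a + 2) (radial_laplace gam V) x)"
    and "D22_rel u w \<Longrightarrow> (\<integral>x. w x * rad (a + 2) (radial_laplace gam V) x \<partial>lebesgue) =
        (\<integral>x. u x * rad (a + 4) (radial_bilaplace gam V) x \<partial>lebesgue)"
proof -
  have Na: "2 * (a + 2) = real DIM('a)" using a by simp
  let ?p = "crit TYPE('a)"
  have p: "2 < ?p" by (rule crit_gt[OF N])
  have pa: "a * ?p = real DIM('a)" using N by (simp add: a crit_def)
  obtain W :: "nat \<Rightarrow> nat \<Rightarrow> real \<Rightarrow> real" and K where W: "\<And>n. C4_chain (W n)"
    "\<And>n t. real (Suc n) \<le> \<bar>t\<bar> \<Longrightarrow> W n 0 t = 0" "\<And>i t. i \<le> 4 \<Longrightarrow> (\<lambda>n. W n i t) \<longlonglongrightarrow> V i t"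
    "\<And>n i t. i \<le> 4 \<Longrightarrow> \<bar>W n i t\<bar> \<le> K * chain_size V t" "0 \<le> K"
    by (rule truncation_exists[OF V]) blast
  define S where "S t = chain_size V t" for t
  have SL: "L2_bounded S" unfolding S_def[abs_def] by (rule chain_size_L2_bounded) (use VL in blast)
  have Sm [measurable]: "S \<in> borel_measurable borel" by (rule L2_bounded_measurable[OF SL])
  have S0: "0 \<le> S t" for t by (simp add: S_def chain_size_bounds)
  have S2: "integrable lborel (\<lambda>t. (S t)\<^sup>2)" using SL by (simp add: L2_bounded_def)
  have Vs: "\<bar>V i t\<bar> \<le> S t" if "i \<le> 4" for i t
    using that unfolding le4_cases S_def by (elim disjE) (simp_all only: chain_size_bounds)
  note [measurable] = chain_measurable[OF W(1)] chain_measurable[OF V]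
  define C where "C = (3 + \<bar>gam\<bar>) * K"
  define C' where "C' = (1 + \<bar>2 * gam + 4\<bar> + gam\<^sup>2 + \<bar>0 :: real\<bar>) * K"
  have C0: "0 \<le> C" "0 \<le> C'" using W(5) by (simp_all add: C_def C'_def)
  have lb: "\<bar>radial_laplace gam (W n) t\<bar> \<le> C * S t" for n t
    using truncated_bilaplace_bound(2)[of "W n" t "K * S t" gam] W(4) by (simp add: C_def S_def mult.assoc)
  have lbV: "\<bar>radial_laplace gam V t\<bar> \<le> (3 + \<bar>gam\<bar>) * S t" for t
    by (rule truncated_bilaplace_bound(2)) (rule Vs)
  have bb: "\<bar>radial_bilaplace gam (W n) t\<bar> \<le> C' * S t" for n t
    using truncated_bilaplace_bound(1)[of "W n" t "K * S t" gam 0] W(4) by (simp add: C'_def S_def mult.assoc)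
  have ll: "(\<lambda>n. radial_laplace gam (W n) t) \<longlonglongrightarrow> radial_laplace gam V t" for t
    by (rule bilaplace_tendsto(2)) (rule W(3))
  have bl: "(\<lambda>n. radial_bilaplace gam (W n) t) \<longlonglongrightarrow> radial_bilaplace gam V t" for t
    using bilaplace_tendsto(1)[where lam = 0 and W = W and V = V and t = t and gam = gam] W(3) by simp
  have radl: "(\<lambda>n. rad m (k n) x) \<longlonglongrightarrow> rad m k' x" if "\<And>t. (\<lambda>n. k n t) \<longlonglongrightarrow> k' t" for m k k' and x :: 'a
    unfolding rad_def by (intro tendsto_intros that)
  have radb: "\<bar>y * rad m k x\<bar> \<le> c * \<bar>y * rad m S x\<bar>" if "\<And>t. \<bar>k t\<bar> \<le> c * S t" for m k c y and x :: 'a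
  proof -
    have "\<bar>y * rad m k x\<bar> = (\<bar>y\<bar> * norm x powr (- m)) * \<bar>k (- ln (norm x))\<bar>" by (simp add: rad_def abs_mult)
    also have "\<dots> \<le> (\<bar>y\<bar> * norm x powr (- m)) * (c * S (- ln (norm x)))" by (intro mult_left_mono that) simp
    also have "\<dots> = c * \<bar>y * rad m S x\<bar>" using S0 by (simp add: rad_def abs_mult)
    finally show ?thesis .
  qed
  have rm: "(rad m k :: 'a \<Rightarrow> real) \<in> borel_measurable lebesgue" if "k \<in> borel_measurable borel" for m k
    by (rule borel_imp_lebesgue[OF rad_measurable[OF that]])
  note [measurable] = rm[OF Sm] rm[OF chain_measurable(2)[OF W(1)]] rm[OF chain_measurable(3)[OF W(1)]]
      rm[OF chain_measurable(2)[OF V]] rm[OF chain_measurable(3)[OF V]] rm[OF chain_measurable(1)[OF V]]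
  show "integrable lebesgue (\<lambda>x. w x * rad (a + 2) (radial_laplace gam V) x)"
    "(\<integral>x. w x * rad (a + 2) (radial_laplace gam V) x \<partial>lebesgue) =
        (\<integral>x. u x * rad (a + 4) (radial_bilaplace gam V) x \<partial>lebesgue)" if u: "D22_rel u w"
  proof -
    note [measurable] = D22_rel_measurable[OF u]
    have iw: "integrable lebesgue (\<lambda>x. w x * rad (a + 2) S x)"
      by (rule L2_product_integrable[OF _ _ D22_rel_square_integrable[OF u] rad_square_integrable(1)[OF Sm S2 Na]]) measurable
    have iu: "integrable lebesgue (\<lambda>x. u x * rad (a + 4) S x)" by (rule D22_times_rad_integrable[OF N a u Sm S2])
    have l1: "(\<lambda>n. \<integral>x. w x * rad (a + 2) (radial_laplace gam (W n)) x \<partial>lebesgue) \<longlonglongrightarrow>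
        (\<integral>x. w x * rad (a + 2) (radial_laplace gam V) x \<partial>lebesgue)"
      and i1: "integrable lebesgue (\<lambda>x. w x * rad (a + 2) (radial_laplace gam V) x)"
    proof -
      have i: "integrable lebesgue (\<lambda>x. C * \<bar>w x * rad (a + 2) S x\<bar>)" using iw by simp
      have l: "AE x in lebesgue. (\<lambda>n. w x * rad (a + 2) (radial_laplace gam (W n)) x) \<longlonglongrightarrow> w x * rad (a + 2) (radial_laplace gam V) x"
        by (intro AE_I2 tendsto_intros radl ll)
      have b: "AE x in lebesgue. norm (w x * rad (a + 2) (radial_laplace gam (W n)) x) \<le> C * \<bar>w x * rad (a + 2) S x\<bar>" for n
        unfolding real_norm_def by (intro AE_I2 radb lb)
      show "(\<lambda>n. \<integral>x. w x * rad (a + 2) (radial_laplace gam (W n)) x \<partial>lebesgue) \<longlonglongrightarrow>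
        (\<integral>x. w x * rad (a + 2) (radial_laplace gam V) x \<partial>lebesgue)"
        by (rule integral_dominated_convergence[OF _ _ i l b]) measurable
      show "integrable lebesgue (\<lambda>x. w x * rad (a + 2) (radial_laplace gam V) x)"
        by (rule integrable_dominated_convergence[OF _ _ i l b]) measurable
    qed
    have l2: "(\<lambda>n. \<integral>x. u x * rad (a + 4) (radial_bilaplace gam (W n)) x \<partial>lebesgue) \<longlonglongrightarrow>
        (\<integral>x. u x * rad (a + 4) (radial_bilaplace gam V) x \<partial>lebesgue)"
    proof -
      have i: "integrable lebesgue (\<lambda>x. C' * \<bar>u x * rad (a + 4) S x\<bar>)" using iu by simp
      have l: "AE x in lebesgue. (\<lambda>n. u x * rad (a + 4) (radial_bilaplace gam (W n)) x) \<longlonglongrightarrow> u x * rad (a + 4) (radial_bilaplace gam V) x"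
        by (intro AE_I2 tendsto_intros radl bl)
      have b: "AE x in lebesgue. norm (u x * rad (a + 4) (radial_bilaplace gam (W n)) x) \<le> C' * \<bar>u x * rad (a + 4) S x\<bar>" for n
        unfolding real_norm_def by (intro AE_I2 radb bb)
      show ?thesis by (rule integral_dominated_convergence[OF _ _ i l b]) measurable
    qed
    have e: "(\<integral>x. w x * rad (a + 2) (radial_laplace gam (W n)) x \<partial>lebesgue) = (\<integral>x. u x * rad (a + 4) (radial_bilaplace gam (W n)) x \<partial>lebesgue)" for n
      by (rule compact_profile_pairing(4)[OF N a gam W(1) _ u]) (rule W(2))
    show "integrable lebesgue (\<lambda>x. w x * rad (a + 2) (radial_laplace gam V) x)" by (rule i1)
    show "(\<integral>x. w x * rad (a + 2) (radial_laplace gam V) x \<partial>lebesgue) = (\<integral>x. u x * rad (a + 4) (radial_bilaplace gam V) x \<partial>lebesgue)"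
      by (rule LIMSEQ_unique[OF l1 l2[folded e]])
  qed
  have Sp: "integrable lborel (\<lambda>t. \<bar>S t\<bar> powr ?p)"
    using powr_integrable_mono[of S 2 ?p] SL p unfolding L2_bounded_def by simp
  define A1 where "A1 n t = \<bar>W n 0 t - V 0 t\<bar> powr ?p" for n t
  define A2 where "A2 n t = \<bar>radial_laplace gam (W n) t - radial_laplace gam V t\<bar> powr 2" for n t
  have [measurable]: "A1 n \<in> borel_measurable borel" "A2 n \<in> borel_measurable borel" for n
    unfolding A1_def[abs_def] A2_def[abs_def] by measurable
  have A1b: "A1 n t \<le> (K + 1) powr ?p * \<bar>S t\<bar> powr ?p" for n t
  proof -
    have "\<bar>W n 0 t - V 0 t\<bar> \<le> K * S t + S t" using W(4)[of 0 n t] Vs[of 0 t] unfolding S_def[symmetric] by (simp add: abs_le_iff)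
    also have "\<dots> = (K + 1) * \<bar>S t\<bar>" using S0 by (simp add: algebra_simps)
    finally have "A1 n t \<le> ((K + 1) * \<bar>S t\<bar>) powr ?p" unfolding A1_def using p by (intro powr_mono2) auto
    then show ?thesis using W(5) by (simp add: powr_mult)
  qed
  have A2b: "A2 n t \<le> (C + (3 + \<bar>gam\<bar>))\<^sup>2 * (S t)\<^sup>2" for n t
  proof -
    have "\<bar>radial_laplace gam (W n) t - radial_laplace gam V t\<bar> \<le> C * S t + (3 + \<bar>gam\<bar>) * S t"
      by (rule order_trans[OF abs_triangle_ineq4 add_mono[OF lb lbV]])
    also have "\<dots> = (C + (3 + \<bar>gam\<bar>)) * S t" by (simp add: algebra_simps)
    finally have "\<bar>radial_laplace gam (W n) t - radial_laplace gam V t\<bar>\<^sup>2 \<le> ((C + (3 + \<bar>gam\<bar>)) * S t)\<^sup>2" by (rule power_mono) simp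
    then have "A2 n t \<le> ((C + (3 + \<bar>gam\<bar>)) * S t)\<^sup>2" unfolding A2_def abs_powr2 by (simp only: power2_abs)
    then show ?thesis by (simp add: power_mult_distrib)
  qed
  have A1i: "integrable lborel (A1 n)" and A1l: "(\<lambda>n. \<integral>t. A1 n t \<partial>lborel) \<longlonglongrightarrow> (\<integral>t. 0 \<partial>(lborel :: real measure))" for n
  proof -
    have i: "integrable lborel (\<lambda>t. (K + 1) powr ?p * \<bar>S t\<bar> powr ?p)" using Sp by simp
    have b: "AE t in lborel. norm (A1 n t) \<le> (K + 1) powr ?p * \<bar>S t\<bar> powr ?p" for n
      using A1b[of n] by (intro AE_I2) (simp add: A1_def)
    have l: "(\<lambda>n. A1 n t) \<longlonglongrightarrow> 0" for t
    proof -
      have "(\<lambda>n. \<bar>W n 0 t - V 0 t\<bar>) \<longlonglongrightarrow> \<bar>V 0 t - V 0 t\<bar>" by (intro tendsto_intros W(3)) simp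
      then have "(\<lambda>n. \<bar>W n 0 t - V 0 t\<bar>) \<longlonglongrightarrow> 0" by simp
      from tendsto_powr2[OF this tendsto_const[of ?p]] show ?thesis using p by (simp add: A1_def)
    qed
    show "integrable lborel (A1 n)"
      by (rule Bochner_Integration.integrable_bound[OF i]) (use A1b[of n] in \<open>auto simp: A1_def intro!: order_trans[OF _ abs_ge_self]\<close>)
    show "(\<lambda>n. \<integral>t. A1 n t \<partial>lborel) \<longlonglongrightarrow> (\<integral>t. 0 \<partial>(lborel :: real measure))"
      by (rule integral_dominated_convergence[OF _ _ i _ b]) (use l in auto)
  qed
  have A2i: "integrable lborel (A2 n)" and A2l: "(\<lambda>n. \<integral>t. A2 n t \<partial>lborel) \<longlonglongrightarrow> (\<integral>t. 0 \<partial>(lborel :: real measure))" for n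
  proof -
    have i: "integrable lborel (\<lambda>t. (C + (3 + \<bar>gam\<bar>))\<^sup>2 * (S t)\<^sup>2)" using S2 by simp
    have b: "AE t in lborel. norm (A2 n t) \<le> (C + (3 + \<bar>gam\<bar>))\<^sup>2 * (S t)\<^sup>2" for n
      using A2b[of n] by (intro AE_I2) (simp add: A2_def)
    have l: "(\<lambda>n. A2 n t) \<longlonglongrightarrow> 0" for t
    proof -
      have "(\<lambda>n. \<bar>radial_laplace gam (W n) t - radial_laplace gam V t\<bar>\<^sup>2) \<longlonglongrightarrow> \<bar>radial_laplace gam V t - radial_laplace gam V t\<bar>\<^sup>2" by (intro tendsto_intros ll)
      then show ?thesis by (simp add: A2_def)
    qed
    show "integrable lborel (A2 n)"
      by (rule Bochner_Integration.integrable_bound[OF i]) (use A2b[of n] in \<open>auto simp: A2_def intro!: order_trans[OF _ abs_ge_self]\<close>)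
    show "(\<lambda>n. \<integral>t. A2 n t \<partial>lborel) \<longlonglongrightarrow> (\<integral>t. 0 \<partial>(lborel :: real measure))"
      by (rule integral_dominated_convergence[OF _ _ i _ b]) (use l in auto)
  qed
  let ?A = "sphere_area TYPE('a)"
  have nn: "(\<integral>\<^sup>+x. ennreal (rad (real DIM('a)) k x) \<partial>(lebesgue :: 'a measure)) = ennreal (?A * (\<integral>t. k t \<partial>lborel))"
    if [measurable]: "k \<in> borel_measurable borel" and k: "integrable lborel k" "\<And>t. 0 \<le> k t" for k
  proof -
    have "(\<integral>\<^sup>+x. ennreal (rad (real DIM('a)) k x) \<partial>(lebesgue :: 'a measure)) = ennreal (\<integral>x. rad (real DIM('a)) k x \<partial>(lebesgue :: 'a measure))"
      by (rule nn_integral_eq_integral) (use rad_integral(1)[of k, where 'a = 'a] k in \<open>auto, auto simp: rad_def\<close>)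
    then show ?thesis by (simp add: rad_integral(2))
  qed
  show "D22_rel (rad a (V 0) :: 'a \<Rightarrow> real) (rad (a + 2) (radial_laplace gam V))"
  proof (rule D22_rel_closed[OF N])
    fix e :: real assume e: "0 < e"
    have "(\<lambda>n. ?A * (\<integral>t. A1 n t \<partial>lborel)) \<longlonglongrightarrow> ?A * (\<integral>t. 0 \<partial>(lborel :: real measure))" by (intro tendsto_intros A1l)
    then have 1: "\<forall>\<^sub>F n in sequentially. ?A * (\<integral>t. A1 n t \<partial>lborel) < e" using e by (intro order_tendstoD(2)) auto
    have "(\<lambda>n. ?A * (\<integral>t. A2 n t \<partial>lborel)) \<longlonglongrightarrow> ?A * (\<integral>t. 0 \<partial>(lborel :: real measure))" by (intro tendsto_intros A2l)
    then have 2: "\<forall>\<^sub>F n in sequentially. ?A * (\<integral>t. A2 n t \<partial>lborel) < e" using e by (intro order_tendstoD(2)) auto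
    obtain n where n: "?A * (\<integral>t. A1 n t \<partial>lborel) < e" "?A * (\<integral>t. A2 n t \<partial>lborel) < e"
      using eventually_happens'[OF sequentially_bot eventually_conj[OF 1 2]] by blast
    have d: "D22_rel (rad a (W n 0) :: 'a \<Rightarrow> real) (rad (a + 2) (radial_laplace gam (W n)))"
      by (rule compact_profile_pairing(1)[OF N a gam W(1)]) (rule W(2))
    have e1: "\<bar>rad a (W n 0) x - rad a (V 0) x\<bar> powr ?p = rad (real DIM('a)) (A1 n) x" for x :: 'a
      unfolding rad_diff rad_abs_powr pa A1_def[abs_def] ..
    have e2: "\<bar>rad (a + 2) (radial_laplace gam (W n)) x - rad (a + 2) (radial_laplace gam V) x\<bar> powr 2 = rad (real DIM('a)) (A2 n) x" for x :: 'a
      unfolding rad_diff rad_abs_powr A2_def[abs_def] using Na by (simp only: mult.commute)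
    have n1: "(\<integral>\<^sup>+x. ennreal (\<bar>rad a (W n 0) x - rad a (V 0) x\<bar> powr ?p) \<partial>(lebesgue :: 'a measure)) \<le> ennreal e"
      unfolding e1 by (subst nn) (use A1i[of n] n in \<open>auto intro!: ennreal_leI, auto simp: A1_def\<close>)
    have n2: "(\<integral>\<^sup>+x. ennreal (\<bar>rad (a + 2) (radial_laplace gam (W n)) x - rad (a + 2) (radial_laplace gam V) x\<bar> powr 2) \<partial>(lebesgue :: 'a measure)) \<le> ennreal e"
      unfolding e2 by (subst nn) (use A2i[of n] n in \<open>auto intro!: ennreal_leI, auto simp: A2_def\<close>)
    show "\<exists>u' w'. D22_rel u' w' \<and> (\<integral>\<^sup>+x. ennreal (\<bar>u' x - rad a (V 0) x\<bar> powr ?p) \<partial>(lebesgue :: 'a measure)) \<le> ennreal e \<and>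
        (\<integral>\<^sup>+x. ennreal (\<bar>w' x - rad (a + 2) (radial_laplace gam V) x\<bar> powr 2) \<partial>(lebesgue :: 'a measure)) \<le> ennreal e"
      using d n1 n2 by blast
  qed measurable
qed

lemma power_integral_profile:
  fixes u :: "'a::euclidean_space \<Rightarrow> real"
  assumes [measurable]: "u \<in> borel_measurable lebesgue" and v [measurable]: "v \<in> borel_measurable borel"
    and uv: "AE x in lebesgue. u x = rad a v x" and \<beta>: "\<beta> = real DIM('a) - q * a"
  shows "(\<integral>x. norm x powr (- \<beta>) * \<bar>u x\<bar> powr q \<partial>lebesgue) = sphere_area TYPE('a) * (\<integral>t. \<bar>v t\<bar> powr q \<partial>lborel)"
proof -
  have [measurable]: "(\<lambda>x::'a. norm x powr (- \<beta>)) \<in> borel_measurable lebesgue"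
    by (rule borel_imp_lebesgue) measurable
  have m: "(rad (real DIM('a)) (\<lambda>t. \<bar>v t\<bar> powr q) :: 'a \<Rightarrow> real) \<in> borel_measurable lebesgue"
    by (rule borel_imp_lebesgue) measurable
  have e': "\<beta> + a * q = real DIM('a)" using \<beta> by (simp add: mult.commute)
  have "(\<integral>x. norm x powr (- \<beta>) * \<bar>u x\<bar> powr q \<partial>lebesgue) = (\<integral>x. rad (real DIM('a)) (\<lambda>t. \<bar>v t\<bar> powr q) x \<partial>(lebesgue :: 'a measure))"
  proof (rule integral_cong_AE)
    show "AE x in lebesgue. norm x powr (- \<beta>) * \<bar>u x\<bar> powr q = rad (real DIM('a)) (\<lambda>t. \<bar>v t\<bar> powr q) x"
      using uv by eventually_elim (simp only: rad_abs_powr norm_powr_rad e')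
  qed (use m in auto)
  also have "\<dots> = sphere_area TYPE('a) * (\<integral>t. \<bar>v t\<bar> powr q \<partial>lborel)" by (rule rad_integral(2)) measurable
  finally show ?thesis .
qed

lemma radial_rad: "radial (rad m k)"
  unfolding radial_def rad_def by (rule exI[where x = "\<lambda>r. r powr (- m) * k (- ln r)"]) simp

lemma D22_lap_rel: "u \<in> D22 \<Longrightarrow> D22_rel u (D22_lap u)"
  unfolding D22_def D22_lap_def by (simp add: someI_ex)

context damped_kernel
begin

text \<open>Since \<open>u\<close> is not almost everywhere zero, neither is its profile, and the denominator of the quotient is positive. The
  power of the area results from its different degrees in the numerator and the denominator.\<close>

lemma rayleigh_lower_bound:
  fixes u :: "'a::euclidean_space \<Rightarrow> real"
  assumes N: "5 \<le> DIM('a)" and a: "a = (real DIM('a) - 4) / 2" and gam: "gam = a * (a + 2)" and lam: "lam < gam\<^sup>2"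
    and ps: "p\<^sup>2 - 2 * s = 2 * gam + 4" "s\<^sup>2 = gam\<^sup>2 - lam"
    and q: "2 < q" and r: "r = q / (q - 1)" and M0: "0 < M"
    and M: "\<And>h. admissible r h \<Longrightarrow> J h \<le> M * power_mass r h powr (2 / r)"
    and \<beta>: "\<beta> = real DIM('a) - q * a" and u: "u \<in> D22" "radial u" "nonzero_ae u"
  shows "sphere_area TYPE('a) powr (1 - 2 / q) / M \<le> rayleigh_quotient q \<beta> lam u"
proof -
  let ?A = "sphere_area TYPE('a)"
  have A0: "0 < ?A" by (rule sphere_area_pos)
  have D: "D22_rel u (D22_lap u)" by (rule D22_lap_rel[OF u(1)])
  have um: "u \<in> borel_measurable lebesgue" by (rule D22_rel_measurable(1)[OF D])
  obtain v where v [measurable]: "v \<in> borel_measurable borel" and uv: "AE x in lebesgue. u x = rad a v x"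
    by (rule radial_profile[OF um u(2)])
  define P where "P = (\<integral>t. \<bar>v t\<bar> powr q \<partial>lborel)"
  have i: "integrable lborel (\<lambda>t. \<bar>v t\<bar> powr q)"
    by (rule energy_lower_bound(1)[OF N a gam lam ps D v uv q r M0 M])
  have E: "?A * (P powr (2 / q) / M) \<le> energy lam u (D22_lap u)"
    unfolding P_def by (rule energy_lower_bound(2)[OF N a gam lam ps D v uv q r M0 M])
  have P0: "0 < P"
  proof (rule ccontr)
    assume "\<not> 0 < P"
    moreover have "0 \<le> P" unfolding P_def by (rule Bochner_Integration.integral_nonneg) simp
    ultimately have "P = 0" by simp
    then have "AE t in lborel. \<bar>v t\<bar> powr q = 0"
      using integral_nonneg_eq_0_iff_AE[OF i] by (simp add: P_def)
    then have "AE t in lborel. v t = 0" by eventually_elim simp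
    from polar_AE[OF this] have "AE x in (lebesgue :: 'a measure). v (- ln (norm x)) = 0" by (rule AE_completion)
    with uv have "AE x in lebesgue. u x = 0" by eventually_elim (simp add: rad_def)
    then show False using u(3) by (simp add: nonzero_ae_def)
  qed
  have A1: "?A powr (1 - 2 / q) * ?A powr (2 / q) = ?A" using A0 by (simp add: powr_add[symmetric])
  have "?A powr (1 - 2 / q) / M * (?A * P) powr (2 / q) = (?A powr (1 - 2 / q) * ?A powr (2 / q)) * (P powr (2 / q) / M)"
    using A0 P0 by (simp add: powr_mult)
  also have "\<dots> = ?A * (P powr (2 / q) / M)" unfolding A1 ..
  finally have eq: "?A powr (1 - 2 / q) / M * (?A * P) powr (2 / q) = ?A * (P powr (2 / q) / M)" .
  have "?A powr (1 - 2 / q) / M * (?A * P) powr (2 / q) \<le> energy lam u (D22_lap u)" using E unfolding eq .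
  moreover have "0 < (?A * P) powr (2 / q)" using A0 P0 by simp
  ultimately have "?A powr (1 - 2 / q) / M \<le> energy lam u (D22_lap u) / (?A * P) powr (2 / q)" by (simp add: pos_le_divide_eq)
  then show ?thesis
    unfolding rayleigh_quotient_def power_integral_profile[OF um v uv \<beta>] energy_def P_def .
qed

end

text \<open>The constants \<open>p\<close> and \<open>s\<close> match the coefficients of the operator on profiles: \<open>s\<^sup>2 = gam\<^sup>2 - lam\<close> and
  \<open>p\<^sup>2 - 2 * s = 2 * gam + 4\<close>. For the solution \<open>v = G (\<bar>v\<bar> powr (q - 2) * v)\<close> of the dual problem, pairing
  \<open>u = rad a v\<close> with itself shows that its energy equals the integral of \<open>\<bar>x\<bar> powr (- \<beta>) * \<bar>u\<bar> powr q\<close>, which gives the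
  quotient of \<open>rayleigh_lower_bound\<close>. Pairing with test functions gives the weak equation.\<close>

theorem radial_minimizer_exists:
  fixes q lam gam a \<beta> :: real
  assumes N: "5 \<le> DIM('a::euclidean_space)" and a: "a = (real DIM('a) - 4) / 2" and gam: "gam = a * (a + 2)"
    and lam: "lam < gam\<^sup>2" and q: "2 < q" and \<beta>: "\<beta> = real DIM('a) - q * a"
  shows "\<exists>u :: 'a \<Rightarrow> real. u \<in> D22 \<and> nonzero_ae u \<and> radial u \<and> weak_solution q \<beta> lam u \<and>
     rayleigh_quotient q \<beta> lam u = S_rad TYPE('a) q \<beta> lam"
proof -
  let ?A = "sphere_area TYPE('a)"
  have A0: "0 < ?A" by (rule sphere_area_pos)
  have a0: "0 < a" using N a by simp
  have g0: "0 < gam" using a0 gam by simp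
  have Na: "real DIM('a) = 2 * a + 4" using a by simp
  define s where "s = sqrt (gam\<^sup>2 - lam)"
  define p where "p = sqrt (2 * gam + 4 + 2 * s)"
  have s0: "0 < s" using lam by (simp add: s_def)
  have p0: "0 < p" using s0 g0 by (simp add: p_def)
  have ps: "p\<^sup>2 - 2 * s = 2 * gam + 4" "s\<^sup>2 = gam\<^sup>2 - lam" using s0 g0 lam by (simp_all add: p_def s_def)
  obtain g g1 where "damped_kernel p s g g1" by (rule damped_kernel_exists[OF p0 s0])
  then interpret damped_kernel p s g g1 .
  define r where "r = q / (q - 1)"
  obtain M v where M0: "0 < M" and M: "\<And>h. admissible r h \<Longrightarrow> J h \<le> M * power_mass r h powr (2 / r)"
    and vL: "L2_bounded v" and vc: "continuous_on UNIV v" and v_eq: "v = G (\<lambda>t. signed_power q (v t))"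
    and PM: "(\<integral>t. \<bar>v t\<bar> powr q \<partial>lborel) powr (1 - 2 / q) = 1 / M"
    by (rule maximizer_exists[OF q r_def]) (rule that; assumption)
  define h where "h t = signed_power q (v t)" for t
  have hL: "L2_bounded h"
    unfolding h_def[abs_def] by (rule admissible_L2_bounded[OF admissible_signed_power(1)[OF q vL]]) (use q in \<open>auto simp: field_simps\<close>)
  have hc: "continuous_on UNIV h" unfolding h_def[abs_def] by (rule signed_power_continuous[OF q vc])
  obtain V :: "nat \<Rightarrow> real \<Rightarrow> real" where V0: "V 0 = G h" and Vd: "\<forall>i<4. \<forall>t. (V i has_real_derivative V (Suc i) t) (at t)"
    and VL: "\<forall>i\<le>4. L2_bounded (V i) \<and> continuous_on UNIV (V i)"
    and Vh: "\<forall>t. V 4 t - (p\<^sup>2 - 2 * s) * V 2 t + s\<^sup>2 * V 0 t = h t"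
    using G_solves[OF hL hc] by (elim exE conjE)
  have V0v: "V 0 = v" unfolding V0 h_def[abs_def] by (rule v_eq[symmetric])
  have V: "C4_chain V" unfolding C4_chain_def using Vd VL by simp
  have VL': "L2_bounded (V i)" if "i \<le> 4" for i using VL that by blast
  have bV: "radial_bilaplace gam V t = lam * v t + h t" for t
    using Vh[THEN spec, of t] unfolding ps radial_bilaplace_def V0v by (simp add: algebra_simps)
  have vm [measurable]: "v \<in> borel_measurable borel" by (rule L2_bounded_measurable[OF vL])
  have hm [measurable]: "h \<in> borel_measurable borel" by (rule L2_bounded_measurable[OF hL])
  define u where "u = (rad a v :: 'a \<Rightarrow> real)"
  define w where "w = (rad (a + 2) (radial_laplace gam V) :: 'a \<Rightarrow> real)"
  have D: "D22_rel u w" using profile_pairing(1)[OF N a gam V VL'] unfolding u_def w_def V0v .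
  have u22: "u \<in> D22" using D by (auto simp: D22_def)
  have D': "D22_rel u (D22_lap u)" by (rule D22_lap_rel[OF u22])
  have um: "u \<in> borel_measurable lebesgue" by (rule D22_rel_measurable(1)[OF D])
  have wm [measurable]: "w \<in> borel_measurable lebesgue" by (rule D22_rel_measurable(2)[OF D])
  have lm [measurable]: "D22_lap u \<in> borel_measurable lebesgue" by (rule D22_rel_measurable(2)[OF D'])
  have lw: "AE x in lebesgue. D22_lap u x = w x" by (rule D22_rel_unique[OF N D' D])
  have uv: "AE x in lebesgue. u x = rad a v x" by (simp add: u_def)
  define P where "P = (\<integral>t. \<bar>v t\<bar> powr q \<partial>lborel)"
  have Pq: "(\<integral>x. norm x powr (- \<beta>) * \<bar>u x\<bar> powr q \<partial>lebesgue) = ?A * P"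
    unfolding P_def by (rule power_integral_profile[OF um vm uv \<beta>])
  have P0: "0 < P"
  proof -
    have "0 \<le> P" unfolding P_def by (rule Bochner_Integration.integral_nonneg) simp
    moreover have "P \<noteq> 0" using PM M0 unfolding P_def[symmetric] by auto
    ultimately show ?thesis by simp
  qed
  have nz: "nonzero_ae u"
    unfolding nonzero_ae_def
  proof
    assume "AE x in lebesgue. u x = 0"
    then have "AE x in lebesgue. u x = rad a (\<lambda>_. 0) x" by eventually_elim (simp add: rad_def)
    from power_integral_profile[OF um _ this \<beta>] have "?A * P = 0" unfolding Pq by simp
    then show False using A0 P0 by simp
  qed
  have ru: "radial u" unfolding u_def by (rule radial_rad)
  have v2: "integrable lborel (\<lambda>t. (v t)\<^sup>2)" and h2: "integrable lborel (\<lambda>t. (h t)\<^sup>2)"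
    using vL hL by (simp_all add: L2_bounded_def)
  have en: "energy lam u (D22_lap u) = ?A * P"
  proof -
    have "(\<integral>x. (D22_lap u x)\<^sup>2 \<partial>lebesgue) = (\<integral>x. w x * w x \<partial>lebesgue)"
      by (rule integral_cong_AE) (use lw in \<open>auto simp: power2_eq_square elim: eventually_mono\<close>)
    also have "\<dots> = (\<integral>x. u x * rad (a + 4) (radial_bilaplace gam V) x \<partial>lebesgue)"
      using profile_pairing(3)[OF N a gam V VL' D] unfolding w_def .
    also have "\<dots> = (\<integral>x. rad (real DIM('a)) (\<lambda>t. lam * (v t)\<^sup>2 + \<bar>v t\<bar> powr q) x \<partial>(lebesgue :: 'a measure))"
    proof (rule Bochner_Integration.integral_cong[OF refl])
      fix x :: 'a
      have e: "a + (a + 4) = real DIM('a)" using Na by simp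
      have "v t * radial_bilaplace gam V t = lam * (v t)\<^sup>2 + \<bar>v t\<bar> powr q" for t
        using signed_power_mult[OF q, of "v t"] by (simp add: bV h_def power2_eq_square algebra_simps)
      then show "u x * rad (a + 4) (radial_bilaplace gam V) x = rad (real DIM('a)) (\<lambda>t. lam * (v t)\<^sup>2 + \<bar>v t\<bar> powr q) x"
        unfolding u_def rad_mult e by simp
    qed
    also have "\<dots> = ?A * (\<integral>t. lam * (v t)\<^sup>2 + \<bar>v t\<bar> powr q \<partial>lborel)" by (rule rad_integral(2)) measurable
    also have "(\<integral>t. lam * (v t)\<^sup>2 + \<bar>v t\<bar> powr q \<partial>lborel) = lam * (\<integral>t. (v t)\<^sup>2 \<partial>lborel) + P"
      using v2 admissible_signed_power(2)[OF q vL] by (simp add: P_def)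
    finally show ?thesis
      unfolding energy_def profile_hardy(2)[OF N a D vm uv] by (simp add: algebra_simps)
  qed
  have quo: "rayleigh_quotient q \<beta> lam u = ?A powr (1 - 2 / q) / M"
  proof -
    have "rayleigh_quotient q \<beta> lam u = (?A * P) powr 1 / (?A * P) powr (2 / q)"
      unfolding rayleigh_quotient_def Pq en[unfolded energy_def] using A0 P0 by simp
    also have "\<dots> = (?A * P) powr (1 - 2 / q)" by (rule powr_diff[symmetric])
    also have "\<dots> = ?A powr (1 - 2 / q) / M" using A0 P0 PM unfolding P_def[symmetric] by (simp add: powr_mult)
    finally show ?thesis .
  qed
  have low: "?A powr (1 - 2 / q) / M \<le> rayleigh_quotient q \<beta> lam u'"
    if "u' \<in> D22" "radial u'" "nonzero_ae u'" for u' :: "'a \<Rightarrow> real"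
    by (rule rayleigh_lower_bound[OF N a gam lam ps q r_def M0 M \<beta> that])
  have S: "rayleigh_quotient q \<beta> lam u = S_rad TYPE('a) q \<beta> lam"
    unfolding S_rad_def
  proof (rule antisym)
    show "rayleigh_quotient q \<beta> lam u \<le> (INF u\<in>{u :: 'a \<Rightarrow> real. u \<in> D22 \<and> radial u \<and> nonzero_ae u}. rayleigh_quotient q \<beta> lam u)"
      by (rule cINF_greatest) (use u22 ru nz low quo in auto)
    show "(INF u\<in>{u :: 'a \<Rightarrow> real. u \<in> D22 \<and> radial u \<and> nonzero_ae u}. rayleigh_quotient q \<beta> lam u) \<le> rayleigh_quotient q \<beta> lam u"
      by (rule cINF_lower) (use u22 ru nz low in \<open>auto intro!: bdd_belowI2\<close>)
  qed
  have weak: "weak_solution q \<beta> lam u"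
    unfolding weak_solution_def
  proof (rule ballI)
    fix \<phi> :: "'a \<Rightarrow> real" assume \<phi>: "\<phi> \<in> Cc_infty"
    have D\<phi>: "D22_rel \<phi> (laplacian \<phi>)" by (rule D22_rel_Cc[OF \<phi>])
    have [measurable]: "laplacian \<phi> \<in> borel_measurable lebesgue" by (rule D22_rel_measurable(2)[OF D\<phi>])
    have ae: "AE x in lebesgue. D22_lap u x * laplacian \<phi> x = laplacian \<phi> x * w x"
      using lw by eventually_elim (simp only: mult.commute)
    have i0: "integrable lebesgue (\<lambda>x. laplacian \<phi> x * w x)"
      unfolding w_def by (rule profile_pairing(2)[OF N a gam V VL' D\<phi>])
    have iv: "integrable lebesgue (\<lambda>x. \<phi> x * rad (a + 4) v x)" by (rule D22_times_rad_integrable[OF N a D\<phi> vm v2])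
    have ih: "integrable lebesgue (\<lambda>x. \<phi> x * rad (a + 4) h x)" by (rule D22_times_rad_integrable[OF N a D\<phi> hm h2])
    have e1: "norm x powr (- 4) * u x * \<phi> x = \<phi> x * rad (a + 4) v x" for x
      unfolding u_def norm_powr_rad by (simp add: mult.commute add.commute)
    have e2: "norm x powr (- \<beta>) * \<bar>u x\<bar> powr (q - 2) * u x * \<phi> x = \<phi> x * rad (a + 4) h x" for x
    proof -
      have e: "\<beta> + (a * (q - 2) + a) = a + 4" unfolding \<beta> Na by (simp add: algebra_simps)
      have "norm x powr (- \<beta>) * (\<bar>u x\<bar> powr (q - 2) * u x) = rad (a + 4) h x"
        unfolding u_def rad_abs_powr rad_mult norm_powr_rad h_def[abs_def] signed_power_def e ..
      then show ?thesis by (simp add: mult_ac)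
    qed
    have e3: "\<phi> x * rad (a + 4) (radial_bilaplace gam V) x = lam * (\<phi> x * rad (a + 4) v x) + \<phi> x * rad (a + 4) h x" for x
      by (simp add: rad_def bV algebra_simps)
    have "(\<integral>x. D22_lap u x * laplacian \<phi> x \<partial>lebesgue) = (\<integral>x. laplacian \<phi> x * w x \<partial>lebesgue)"
      by (rule integral_cong_AE) (use ae in auto)
    also have "\<dots> = (\<integral>x. \<phi> x * rad (a + 4) (radial_bilaplace gam V) x \<partial>lebesgue)"
      unfolding w_def by (rule profile_pairing(3)[OF N a gam V VL' D\<phi>])
    also have "\<dots> = lam * (\<integral>x. \<phi> x * rad (a + 4) v x \<partial>lebesgue) + (\<integral>x. \<phi> x * rad (a + 4) h x \<partial>lebesgue)"
      unfolding e3 using iv ih by simp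
    finally have eq: "(\<integral>x. D22_lap u x * laplacian \<phi> x \<partial>lebesgue) =
       lam * (\<integral>x. \<phi> x * rad (a + 4) v x \<partial>lebesgue) + (\<integral>x. \<phi> x * rad (a + 4) h x \<partial>lebesgue)" .
    have i1: "integrable lebesgue (\<lambda>x. D22_lap u x * laplacian \<phi> x)"
      by (rule integrable_cong_AE_imp[OF i0]) (use ae in \<open>auto elim: eventually_mono\<close>)
    show "integrable lebesgue (\<lambda>x. D22_lap u x * laplacian \<phi> x) \<and>
     integrable lebesgue (\<lambda>x. norm x powr (-4) * u x * \<phi> x) \<and>
     integrable lebesgue (\<lambda>x. norm x powr (-\<beta>) * \<bar>u x\<bar> powr (q - 2) * u x * \<phi> x) \<and>
     (\<integral>x. D22_lap u x * laplacian \<phi> x \<partial>lebesgue) =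
       lam * (\<integral>x. norm x powr (-4) * u x * \<phi> x \<partial>lebesgue) +
       (\<integral>x. norm x powr (-\<beta>) * \<bar>u x\<bar> powr (q - 2) * u x * \<phi> x \<partial>lebesgue)"
      unfolding e1 e2 using i1 iv ih eq by blast
  qed
  show ?thesis using u22 nz ru weak S by blast
qed

theorem theorem1p1:
  fixes N :: nat and q lam \<beta> \<gamma> :: real
  assumes N: "N = CARD('n::finite)" "N \<ge> 5"
    and q: "q > 2"
    and gamma: "\<gamma> = real N * (real N - 4) / 4"
    and lambda: "lam < \<gamma>\<^sup>2"
    and beta: "\<beta> = real N - q * ((real N - 4) / 2)"
  shows "\<exists>u :: real ^ 'n \<Rightarrow> real.
           u \<in> D22 \<and> nonzero_ae u \<and> radial u \<and> weak_solution q \<beta> lam u \<and>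
           rayleigh_quotient q \<beta> lam u = S_rad TYPE(real ^ 'n) q \<beta> lam"
proof (rule radial_minimizer_exists)
  have D: "DIM(real ^ 'n) = N" using N by simp
  show "5 \<le> DIM(real ^ 'n)" unfolding D by (rule N)
  show "(real N - 4) / 2 = (real DIM(real ^ 'n) - 4) / 2" unfolding D ..
  show "\<gamma> = (real N - 4) / 2 * ((real N - 4) / 2 + 2)" unfolding gamma by (simp add: field_simps)
  show "\<beta> = real DIM(real ^ 'n) - q * ((real N - 4) / 2)" unfolding D by (rule beta)
qed (fact lambda q)+

end
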